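(* Let $\mathcal{M}(t)\subset\mathbb{R}^3$ be a material surface of $\dot x=v(x,t)$ over the time interval $[t_0,t_0+T]$. Also, let $\Pi(s_1)$ denote a smooth, one-parameter family of two-dimensional orientable surfaces with smooth normal vector fields $n_{\Pi(s_1)}(x)$. (i) Suppose that $\mathcal{M}(t)$ is a repelling hyperbolic LCS. Then the intersection curve $\gamma_{s_1}=\Pi(s_1)\cap\mathcal{M}(t_0)$ is a trajectory of a two-dimensional differential equation on $\Pi(s_1)$, given by $$\gamma_{s_1}'(s_2)=n_{\Pi(s_1)}(\gamma_{s_1}(s_2))\times\xi_3(\gamma_{s_1}(s_2)).$$ This trajectory must also satisfy the condition $H_{\xi_3}(\gamma_{s_1}(s_2))=0$. (ii) Suppose that $\mathcal{M}(t)$ is an attracting hyperbolic LCS. Then the intersection curve $\gamma_{s_1}=\Pi(s_1)\cap\mathcal{M}(t_0)$ is a trajectory of a two-dimensional differential equation on $\Pi(s_1)$, given by $$\gamma_{s_1}'(s_2)=n_{\Pi(s_1)}(\gamma_{s_1}(s_2))\times\xi_1(\gamma_{s_1}(s_2)).$$ This trajectory must also satisfy the condition $H_{\xi_1}(\gamma_{s_1}(s_2))=0$. (iii) Suppose that $\mathcal{M}(t)$ is a shear LCS. Then the intersection curve $\gamma_{s_1}=\Pi(s_1)\cap\mathcal{M}(t_0)$ is a trajectory of a two-dimensional differential equation on $\Pi(s_1)$, given by $$\gamma_{s_1}'(s_2)=n_{\Pi(s_1)}(\gamma_{s_1}(s_2))\times n_\pm(\gamma_{s_1}(s_2)),$$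 for some choice of the sign in $\pm$. This trajectory must also satisfy the condition $H_{n_\pm}(\gamma_{s_1}(s_2))=0$ with the same choice of the sign. If the trajectory $\gamma_{s_1}(s_2)$ is a closed orbit, then $\mathcal{M}(t)$ is an elliptic barrier.
   Context: Setting: $\dot x=v(x,t)$, $x\in D\subset\mathbb{R}^3$, $D$ compact, $t\in[t_0,t_0+T]$, $v$ smooth. The flow map is $F_{t_0}^{t}(x_0)=x(t;t_0,x_0)$, where $x(t;t_0,x_0)$ is the trajectory starting from $x_0$ at time $t_0$. The Cauchy--Green strain tensor is $C_{t_0}^{t_0+T}(x_0)=[\nabla F_{t_0}^{t_0+T}(x_0)]^*\nabla F_{t_0}^{t_0+T}(x_0)$; its eigenvalues, in increasing order, are $\lambda_1,\lambda_2,\lambda_3$, with corresponding orthonormal eigenvectors $\xi_1,\xi_2,\xi_3$. Throughout, the discussion is restricted to an open set of initial conditions $U=\{x_0\in D: 0<\lambda_1(x_0)<\lambda_2(x_0)<\lambda_3(x_0)\}$. The fields $\xi_i$ and $n_\pm$ are typically not globally orientable and are selected smoothly only locally; the differential equations are understood in piecewise oriented versions. Here $$n_{\pm}=\sqrt{\frac{\sqrt{\lambda_1}}{\sqrt{\lambda_1}+\sqrt{\lambda_3}}}\,\xi_1\pm\sqrt{\frac{\sqrt{\lambda_3}}{\sqrt{\lambda_1}+\sqrt{\lambda_3}}}\,\xi_3,$$ and $H_w(x)=\langle\nabla\times w(x),w(x)\rangle$ denotes the helicity of a three-dimensional vector field $w$. Material surface: a family $\mathcal{M}(t)=F_{t_0}^t(\mathcal{M}(t_0))$,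 $t\in[t_0,t_0+T]$, with $\mathcal{M}(t_0)$ a smooth two-dimensional surface. For a unit normal $n_0$ to $\mathcal{M}(t_0)$ at $x_0$, the unit normal to $\mathcal{M}(t_0+T)$ along the trajectory from $x_0$ is $n_{t_0+T}(x_0)=\dfrac{[\nabla F_{t_0}^{t_0+T}(x_0)]^{-*}n_0}{|[\nabla F_{t_0}^{t_0+T}(x_0)]^{-*}n_0|}$, where $A^{-*}=(A^{-1})^*$. Normal repulsion: $\rho(x_0,n_0)=\langle n_{t_0+T}(x_0),\nabla F_{t_0}^{t_0+T}(x_0)n_0\rangle$. Tangential shear: $\sigma(x_0,n_0)=|\nabla F_{t_0}^{t_0+T}(x_0)n_0-\langle n_{t_0+T}(x_0),\nabla F_{t_0}^{t_0+T}(x_0)n_0\rangle n_{t_0+T}(x_0)|$. Definitions (over $[t_0,t_0+T]$; $n_0$ denotes a unit normal to $\mathcal{M}(t_0)$ at $x_0$). $\mathcal{M}(t)$ is a - repelling hyperbolic LCS (Lagrangian Coherent Structure) if for any $x_0\in\mathcal{M}(t_0)$ and any other material surface $\hat{\mathcal{M}}(t)$ with $x_0\in\hat{\mathcal{M}}(t_0)$ and with unit normal $\hat n_0\not\parallel n_0$ at $x_0$, one has $\rho(x_0,\hat n_0)<\rho(x_0,n_0)$ and $\rho(x_0,n_0)>1$; - attracting hyperbolic LCS if for any such $x_0$ and $\hat{\mathcal{M}}$, one has $\rho(x_0,\hat n_0)>\rho(x_0,n_0)$ and $\rho(x_0,n_0)<1$; - shear LCS if for any such $x_0$ and $\hat{\mathcal{M}}$,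 one has $\sigma(x_0,\hat n_0)\le\sigma(x_0,n_0)$. Elliptic barrier (elliptic LCS): a closed shear LCS, i.e. a shear LCS distinguished by its tubular or toroidal topology (an invariant tube or invariant torus).
   Formalization: Π(s₁) and M(t₀) are assumed transversal (else n_Π×ξ may vanish on the curve); the elliptic-barrier claim assumes the slices Π(s₁)∩M(t₀) cover M(t₀), are disjoint or periodic in s₁, and are all transversal closed orbits, since one closed orbit on a flat shear LCS is not enough. *)

theory Defs
  imports "HOL-Analysis.Analysis"
begin

primrec Ck_on :: "nat \<Rightarrow> 'a set \<Rightarrow> ('a::real_normed_vector \<Rightarrow> 'b::real_normed_vector) \<Rightarrow> bool" where
  "Ck_on 0 S f \<longleftrightarrow> continuous_on S f"
| "Ck_on (Suc k) S f \<longleftrightarrow> (\<forall>x\<in>S. f differentiable (at x)) \<and>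
     (\<forall>h. Ck_on k S (\<lambda>x. frechet_derivative f (at x) h))"

definition smooth_on :: "'a set \<Rightarrow> ('a::real_normed_vector \<Rightarrow> 'b::real_normed_vector) \<Rightarrow> bool" where
  "smooth_on S f \<longleftrightarrow> open S \<and> (\<forall>k. Ck_on k S f)"

definition curl :: "(real^3 \<Rightarrow> real^3) \<Rightarrow> real^3 \<Rightarrow> real^3" where
  "curl w x = (let J = jacobian w (at x) in
     vector [J$3$2 - J$2$3, J$1$3 - J$3$1, J$2$1 - J$1$2])"

definition helicity :: "(real^3 \<Rightarrow> real^3) \<Rightarrow> real^3 \<Rightarrow> real" where
  "helicity w x = curl w x \<bullet> w x"

definition parallel :: "real^3 \<Rightarrow> real^3 \<Rightarrow> bool" where
  "parallel a b \<longleftrightarrow> cross3 a b = 0"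

subsection \<open>Surfaces\<close>

text \<open>Surfaces are embedded and without boundary: locally regular zero sets of smooth functions.\<close>

definition smooth_surface :: "(real^3) set \<Rightarrow> bool" where
  "smooth_surface S \<longleftrightarrow> (\<forall>p\<in>S. \<exists>V (g :: real^3 \<Rightarrow> real). p \<in> V \<and> smooth_on V g \<and>
     (\<forall>x\<in>V. frechet_derivative g (at x) \<noteq> (\<lambda>h. 0)) \<and> S \<inter> V = {x\<in>V. g x = 0})"

definition tangent_vectors :: "(real^3) set \<Rightarrow> real^3 \<Rightarrow> (real^3) set" where
  "tangent_vectors S p = {h. \<exists>c. c 0 = p \<and> (\<forall>\<^sub>F s in at 0. c s \<in> S) \<and>
     (c has_vector_derivative h) (at (0::real))}"

definition normal_to :: "(real^3) set \<Rightarrow> real^3 \<Rightarrow> real^3 \<Rightarrow> bool" where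
  "normal_to S p n \<longleftrightarrow> n \<noteq> 0 \<and> (\<forall>h\<in>tangent_vectors S p. n \<bullet> h = 0)"

definition unit_normal :: "(real^3) set \<Rightarrow> real^3 \<Rightarrow> real^3 \<Rightarrow> bool" where
  "unit_normal S p n \<longleftrightarrow> normal_to S p n \<and> norm n = 1"

definition transversal :: "(real^3) set \<Rightarrow> (real^3) set \<Rightarrow> bool" where
  "transversal A B \<longleftrightarrow>
     (\<forall>x\<in>A \<inter> B. \<forall>a b. normal_to A x a \<longrightarrow> normal_to B x b \<longrightarrow> \<not> parallel a b)"

definition smooth_normal_field :: "(real^3) set \<Rightarrow> (real^3 \<Rightarrow> real^3) \<Rightarrow> bool" where
  "smooth_normal_field S n \<longleftrightarrow> (\<forall>x\<in>S. normal_to S x (n x)) \<and>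
     (\<forall>x\<in>S. \<exists>V w. x \<in> V \<and> smooth_on V w \<and> (\<forall>y\<in>V \<inter> S. n y = w y))"

text \<open>A family depending smoothly on its parameter as well: the local defining functions are
  jointly smooth in the parameter and the point, and regular in the point. In particular every
  member is a smooth surface.\<close>

definition smooth_surface_family :: "real set \<Rightarrow> (real \<Rightarrow> (real^3) set) \<Rightarrow> bool" where
  "smooth_surface_family S P \<longleftrightarrow> S \<noteq> {} \<and> open S \<and> is_interval S \<and>
     (\<forall>s\<in>S. \<forall>x\<in>P s. \<exists>V (g :: real \<times> (real^3) \<Rightarrow> real).
        (s, x) \<in> V \<and> V \<subseteq> S \<times> UNIV \<and> smooth_on V g \<and>
        (\<forall>(r, y)\<in>V. frechet_derivative (\<lambda>z. g (r, z)) (at y) \<noteq> (\<lambda>h. 0)) \<and>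
        (\<forall>(r, y)\<in>V. y \<in> P r \<longleftrightarrow> g (r, y) = 0))"

subsection \<open>Flow map and Cauchy--Green strain tensor\<close>

definition trajectory ::
  "(real^3 \<Rightarrow> real \<Rightarrow> real^3) \<Rightarrow> (real^3) set \<Rightarrow> real \<Rightarrow> real \<Rightarrow> real^3 \<Rightarrow> (real \<Rightarrow> real^3) \<Rightarrow> bool" where
  "trajectory v D t0 T x0 x \<longleftrightarrow> x t0 = x0 \<and>
     (\<forall>t\<in>{t0..t0+T}. x t \<in> D \<and> (x has_vector_derivative v (x t) t) (at t within {t0..t0+T}))"

definition smooth_velocity ::
  "(real^3 \<Rightarrow> real \<Rightarrow> real^3) \<Rightarrow> (real^3) set \<Rightarrow> real \<Rightarrow> real \<Rightarrow> bool" where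
  "smooth_velocity v D t0 T \<longleftrightarrow>
     (\<exists>W. D \<times> {t0..t0+T} \<subseteq> W \<and> smooth_on W (\<lambda>(x, t). v x t))"

text \<open>The set \<open>D\<close> is not assumed to be invariant: the flow map is defined for the initial conditions
  whose trajectory exists in \<open>D\<close> over the whole time interval.\<close>

definition flow_domain ::
  "(real^3 \<Rightarrow> real \<Rightarrow> real^3) \<Rightarrow> (real^3) set \<Rightarrow> real \<Rightarrow> real \<Rightarrow> (real^3) set" where
  "flow_domain v D t0 T = {x0. \<exists>x. trajectory v D t0 T x0 x}"

definition flow_map ::
  "(real^3 \<Rightarrow> real \<Rightarrow> real^3) \<Rightarrow> (real^3) set \<Rightarrow> real \<Rightarrow> real \<Rightarrow> real \<Rightarrow> real^3 \<Rightarrow> real^3" where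
  "flow_map v D t0 T t x0 = (THE y. \<exists>x. trajectory v D t0 T x0 x \<and> x t = y)"

definition flow_gradient ::
  "(real^3 \<Rightarrow> real \<Rightarrow> real^3) \<Rightarrow> (real^3) set \<Rightarrow> real \<Rightarrow> real \<Rightarrow> real^3 \<Rightarrow> real^3^3" where
  "flow_gradient v D t0 T x0 = jacobian (flow_map v D t0 T (t0+T)) (at x0)"

definition cauchy_green ::
  "(real^3 \<Rightarrow> real \<Rightarrow> real^3) \<Rightarrow> (real^3) set \<Rightarrow> real \<Rightarrow> real \<Rightarrow> real^3 \<Rightarrow> real^3^3" where
  "cauchy_green v D t0 T x0 = transpose (flow_gradient v D t0 T x0) ** flow_gradient v D t0 T x0"

definition eigenvalues :: "real^3^3 \<Rightarrow> real set" where
  "eigenvalues A = {l. \<exists>x. x \<noteq> 0 \<and> A *v x = l *\<^sub>R x}"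

definition lambda1 ::
  "(real^3 \<Rightarrow> real \<Rightarrow> real^3) \<Rightarrow> (real^3) set \<Rightarrow> real \<Rightarrow> real \<Rightarrow> real^3 \<Rightarrow> real" where
  "lambda1 v D t0 T x0 = Min (eigenvalues (cauchy_green v D t0 T x0))"

definition lambda3 ::
  "(real^3 \<Rightarrow> real \<Rightarrow> real^3) \<Rightarrow> (real^3) set \<Rightarrow> real \<Rightarrow> real \<Rightarrow> real^3 \<Rightarrow> real" where
  "lambda3 v D t0 T x0 = Max (eigenvalues (cauchy_green v D t0 T x0))"

text \<open>The interior is taken because the two-sided gradient of the flow map is needed.\<close>

definition simple_spectrum_set ::
  "(real^3 \<Rightarrow> real \<Rightarrow> real^3) \<Rightarrow> (real^3) set \<Rightarrow> real \<Rightarrow> real \<Rightarrow> (real^3) set" where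
  "simple_spectrum_set v D t0 T = {x0 \<in> interior (flow_domain v D t0 T).
     \<exists>l1 l2 l3. 0 < l1 \<and> l1 < l2 \<and> l2 < l3 \<and>
       eigenvalues (cauchy_green v D t0 T x0) = {l1, l2, l3}}"

text \<open>The unit eigenvectors \<open>\<xi>\<^sub>1\<close>, \<open>\<xi>\<^sub>3\<close> are determined only up to sign, so they are relations.\<close>

definition is_xi1 ::
  "(real^3 \<Rightarrow> real \<Rightarrow> real^3) \<Rightarrow> (real^3) set \<Rightarrow> real \<Rightarrow> real \<Rightarrow> real^3 \<Rightarrow> real^3 \<Rightarrow> bool" where
  "is_xi1 v D t0 T x e \<longleftrightarrow>
     norm e = 1 \<and> cauchy_green v D t0 T x *v e = lambda1 v D t0 T x *\<^sub>R e"

definition is_xi3 ::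
  "(real^3 \<Rightarrow> real \<Rightarrow> real^3) \<Rightarrow> (real^3) set \<Rightarrow> real \<Rightarrow> real \<Rightarrow> real^3 \<Rightarrow> real^3 \<Rightarrow> bool" where
  "is_xi3 v D t0 T x e \<longleftrightarrow>
     norm e = 1 \<and> cauchy_green v D t0 T x *v e = lambda3 v D t0 T x *\<^sub>R e"

text \<open>\<open>n_pm \<dots> \<epsilon> x e1 e3\<close> with \<open>\<epsilon> \<in> {1, -1}\<close> is \<open>n\<^sub>\<plusminus>(x)\<close> for the orientations \<open>e1\<close>, \<open>e3\<close> of
  \<open>\<xi>\<^sub>1(x)\<close>, \<open>\<xi>\<^sub>3(x)\<close>.\<close>

definition n_pm ::
  "(real^3 \<Rightarrow> real \<Rightarrow> real^3) \<Rightarrow> (real^3) set \<Rightarrow> real \<Rightarrow> real \<Rightarrow>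
   real \<Rightarrow> real^3 \<Rightarrow> real^3 \<Rightarrow> real^3 \<Rightarrow> real^3" where
  "n_pm v D t0 T \<epsilon> x e1 e3 =
     (let a = sqrt (lambda1 v D t0 T x); b = sqrt (lambda3 v D t0 T x) in
        sqrt (a / (a + b)) *\<^sub>R e1 + \<epsilon> *\<^sub>R (sqrt (b / (a + b)) *\<^sub>R e3))"

definition is_n_pm ::
  "(real^3 \<Rightarrow> real \<Rightarrow> real^3) \<Rightarrow> (real^3) set \<Rightarrow> real \<Rightarrow> real \<Rightarrow> real^3 \<Rightarrow> real^3 \<Rightarrow> bool" where
  "is_n_pm v D t0 T x n \<longleftrightarrow> (\<exists>\<epsilon>\<in>{1, -1}. \<exists>e1 e3.
     is_xi1 v D t0 T x e1 \<and> is_xi3 v D t0 T x e3 \<and> n = n_pm v D t0 T \<epsilon> x e1 e3)"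

subsection \<open>Lagrangian coherent structures\<close>

definition material_surface ::
  "(real^3 \<Rightarrow> real \<Rightarrow> real^3) \<Rightarrow> (real^3) set \<Rightarrow> real \<Rightarrow> real \<Rightarrow> (real \<Rightarrow> (real^3) set) \<Rightarrow> bool" where
  "material_surface v D t0 T M \<longleftrightarrow> smooth_surface (M t0) \<and> M t0 \<subseteq> flow_domain v D t0 T \<and>
     (\<forall>t\<in>{t0..t0+T}. M t = flow_map v D t0 T t ` M t0)"

definition advected_normal ::
  "(real^3 \<Rightarrow> real \<Rightarrow> real^3) \<Rightarrow> (real^3) set \<Rightarrow> real \<Rightarrow> real \<Rightarrow> real^3 \<Rightarrow> real^3 \<Rightarrow> real^3" where
  "advected_normal v D t0 T x0 n0 =
     (let m = transpose (matrix_inv (flow_gradient v D t0 T x0)) *v n0 in m /\<^sub>R norm m)"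

definition repulsion ::
  "(real^3 \<Rightarrow> real \<Rightarrow> real^3) \<Rightarrow> (real^3) set \<Rightarrow> real \<Rightarrow> real \<Rightarrow> real^3 \<Rightarrow> real^3 \<Rightarrow> real" where
  "repulsion v D t0 T x0 n0 =
     advected_normal v D t0 T x0 n0 \<bullet> (flow_gradient v D t0 T x0 *v n0)"

definition shear ::
  "(real^3 \<Rightarrow> real \<Rightarrow> real^3) \<Rightarrow> (real^3) set \<Rightarrow> real \<Rightarrow> real \<Rightarrow> real^3 \<Rightarrow> real^3 \<Rightarrow> real" where
  "shear v D t0 T x0 n0 =
     norm (flow_gradient v D t0 T x0 *v n0 -
           (advected_normal v D t0 T x0 n0 \<bullet> (flow_gradient v D t0 T x0 *v n0)) *\<^sub>R
             advected_normal v D t0 T x0 n0)"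

definition repelling_LCS ::
  "(real^3 \<Rightarrow> real \<Rightarrow> real^3) \<Rightarrow> (real^3) set \<Rightarrow> real \<Rightarrow> real \<Rightarrow> (real \<Rightarrow> (real^3) set) \<Rightarrow> bool" where
  "repelling_LCS v D t0 T M \<longleftrightarrow> material_surface v D t0 T M \<and>
     (\<forall>x0\<in>M t0. \<forall>n0. unit_normal (M t0) x0 n0 \<longrightarrow>
        repulsion v D t0 T x0 n0 > 1 \<and>
        (\<forall>M' n'. material_surface v D t0 T M' \<longrightarrow> x0 \<in> M' t0 \<longrightarrow>
           unit_normal (M' t0) x0 n' \<longrightarrow> \<not> parallel n' n0 \<longrightarrow>
           repulsion v D t0 T x0 n' < repulsion v D t0 T x0 n0))"

definition attracting_LCS ::
  "(real^3 \<Rightarrow> real \<Rightarrow> real^3) \<Rightarrow> (real^3) set \<Rightarrow> real \<Rightarrow> real \<Rightarrow> (real \<Rightarrow> (real^3) set) \<Rightarrow> bool" where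
  "attracting_LCS v D t0 T M \<longleftrightarrow> material_surface v D t0 T M \<and>
     (\<forall>x0\<in>M t0. \<forall>n0. unit_normal (M t0) x0 n0 \<longrightarrow>
        repulsion v D t0 T x0 n0 < 1 \<and>
        (\<forall>M' n'. material_surface v D t0 T M' \<longrightarrow> x0 \<in> M' t0 \<longrightarrow>
           unit_normal (M' t0) x0 n' \<longrightarrow> \<not> parallel n' n0 \<longrightarrow>
           repulsion v D t0 T x0 n' > repulsion v D t0 T x0 n0))"

definition shear_LCS ::
  "(real^3 \<Rightarrow> real \<Rightarrow> real^3) \<Rightarrow> (real^3) set \<Rightarrow> real \<Rightarrow> real \<Rightarrow> (real \<Rightarrow> (real^3) set) \<Rightarrow> bool" where
  "shear_LCS v D t0 T M \<longleftrightarrow> material_surface v D t0 T M \<and>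
     (\<forall>x0\<in>M t0. \<forall>n0. unit_normal (M t0) x0 n0 \<longrightarrow>
        (\<forall>M' n'. material_surface v D t0 T M' \<longrightarrow> x0 \<in> M' t0 \<longrightarrow>
           unit_normal (M' t0) x0 n' \<longrightarrow> \<not> parallel n' n0 \<longrightarrow>
           shear v D t0 T x0 n' \<le> shear v D t0 T x0 n0))"

text \<open>The flow maps are diffeomorphisms onto their images, so the topology of \<open>M t\<close> is that of
  \<open>M t0\<close>: an open tube or a torus.\<close>

definition elliptic_barrier ::
  "(real^3 \<Rightarrow> real \<Rightarrow> real^3) \<Rightarrow> (real^3) set \<Rightarrow> real \<Rightarrow> real \<Rightarrow> (real \<Rightarrow> (real^3) set) \<Rightarrow> bool" where
  "elliptic_barrier v D t0 T M \<longleftrightarrow> shear_LCS v D t0 T M \<and>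
     (M t0 homeomorphic (sphere (0::real^2) 1 \<times> (UNIV :: real set)) \<or>
      M t0 homeomorphic (sphere (0::real^2) 1 \<times> sphere (0::real^2) 1))"

subsection \<open>Trajectories of \<open>\<gamma>' = n(\<gamma>) \<times> X(\<gamma>)\<close> for a locally orientable field \<open>X\<close>\<close>

text \<open>The field is given as the relation \<open>X x e\<close> (\<open>e\<close> is an admissible value at \<open>x\<close>); a trajectory
  comes with a continuous choice \<open>N\<close> of values along it.\<close>

definition oriented_trajectory ::
  "(real^3 \<Rightarrow> real^3 \<Rightarrow> bool) \<Rightarrow> (real^3 \<Rightarrow> real^3) \<Rightarrow> real set \<Rightarrow>
   (real \<Rightarrow> real^3) \<Rightarrow> (real \<Rightarrow> real^3) \<Rightarrow> bool" where
  "oriented_trajectory X n J \<gamma> N \<longleftrightarrow> open J \<and> is_interval J \<and> continuous_on J N \<and>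
     (\<forall>s\<in>J. X (\<gamma> s) (N s) \<and> (\<gamma> has_vector_derivative cross3 (n (\<gamma> s)) (N s)) (at s))"

definition closed_orbit ::
  "(real^3 \<Rightarrow> real^3 \<Rightarrow> bool) \<Rightarrow> (real^3 \<Rightarrow> real^3) \<Rightarrow> (real \<Rightarrow> real^3) \<Rightarrow> bool" where
  "closed_orbit X n \<gamma> \<longleftrightarrow> (\<exists>N. oriented_trajectory X n UNIV \<gamma> N) \<and>
     (\<exists>s. \<gamma> s \<noteq> \<gamma> 0) \<and> (\<exists>p>0. \<forall>s. \<gamma> (s + p) = \<gamma> s)"

definition smooth_selection ::
  "(real^3 \<Rightarrow> real^3 \<Rightarrow> bool) \<Rightarrow> (real^3) set \<Rightarrow> (real^3 \<Rightarrow> real^3) \<Rightarrow> bool" where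
  "smooth_selection X V w \<longleftrightarrow> smooth_on V w \<and> (\<forall>x\<in>V. X x (w x))"

text \<open>The family meets \<open>K\<close> in a one-parameter family of slices that cover \<open>K\<close>, different parameters
  giving disjoint slices; the parameter runs through an interval or, for a periodic family, through
  the circle \<open>\<real> / p\<int>\<close>.\<close>

definition slices :: "real set \<Rightarrow> (real \<Rightarrow> (real^3) set) \<Rightarrow> (real^3) set \<Rightarrow> bool" where
  "slices S P K \<longleftrightarrow> K \<subseteq> (\<Union>s\<in>S. P s) \<and>
     ((\<forall>s\<in>S. \<forall>r\<in>S. s \<noteq> r \<longrightarrow> P s \<inter> P r \<inter> K = {}) \<or>
      (S = UNIV \<and> (\<exists>p>0. (\<forall>s. P (s + p) = P s) \<and>
         (\<forall>s r. P s \<inter> P r \<inter> K \<noteq> {} \<longrightarrow> (\<exists>k::int. r = s + of_int k * p)))))"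

end

theory Submission
  imports Defs
begin

text \<open>
  In an eigenframe of the Cauchy--Green tensor, repulsion and shear of a unit normal \<open>n\<close> are explicit
  functions of the squared components of \<open>n\<close>, and every unit vector at an interior point is the normal of
  some competing material surface. Extremality therefore forces the normal of an LCS to be \<open>\<xi>\<^sub>3\<close>,
  \<open>\<xi>\<^sub>1\<close> or \<open>n\<^sub>\<plusminus>\<close>, and a curve in \<open>\<Pi>(s) \<inter> M\<close> is tangent to the cross product of the two
  normals. Helicity vanishes by Frobenius' theorem: a field that is normal to \<open>M\<close> along \<open>M\<close> is there a multiple
  of the gradient of a local defining function.

  For the elliptic part, the slices are the leaves of a foliation of \<open>M\<close> by circles. Their length is a
  continuous function of the parameter, so a continuous section gives a parametrization \<open>f (t, s)\<close> of
  \<open>M\<close> that is 1-periodic in \<open>t\<close>. Over an interval of parameters \<open>M\<close> is then a cylinder. Over a circle of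
  parameters \<open>M\<close> is a torus or a Klein bottle; it is compact, hence two-sided in \<open>\<real>\<^sup>3\<close>, and the resulting normal
  together with the direction of increasing parameter orients the leaves consistently, which excludes the
  Klein bottle.
\<close>

subsection \<open>Charts and normals of surfaces\<close>

text \<open>The eigenvector fields, the normal of \<open>M\<close> and the direction of a leaf are
  each determined only up to sign. Along a single curve the sign is fixed by requiring that the
  cross product with the normal of the slice point along the curve; a change of time then gives the
  trajectory. Over a family of leaves no such choice is given, since the closed orbits on different
  slices come with unrelated directions and periods. They enter through their images, and the motion
  is rebuilt by arclength from the sets \<open>M \<inter> P s\<close>, on pairs of a point and a
  unit tangent so that both directions are present. Such a motion is unique because a leaf is
  locally a single arc. The delicate point is the length of the leaves: nearby leaves could close up
  several times while one leaf is traversed once. A lower bound for return times, uniform near a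
  parameter, leaves finitely many multiples to exclude. After one period of the parameter a section
  ends on the initial leaf, but possibly at another point; once orientations agree, the gap is a
  time shift along that leaf, and spreading it linearly over the period closes the section.\<close>

lemma local_diffeo:
  fixes F :: "'a::euclidean_space \<Rightarrow> 'a" and F' :: "'a \<Rightarrow> 'a \<Rightarrow> 'a"
  assumes U: "open U" "x0 \<in> U"
    and der: "\<forall>x\<in>U. (F has_derivative F' x) (at x)"
    and cont: "\<forall>h\<in>Basis. continuous_on U (\<lambda>x. F' x h)"
    and inj: "\<forall>h. F' x0 h = 0 \<longrightarrow> h = 0"
  shows "\<exists>U' V G G'. open U' \<and> U' \<subseteq> U \<and> x0 \<in> U' \<and> open V \<and> F x0 \<in> V \<and>
    homeomorphism U' V F G \<and> (\<forall>y\<in>V. (G has_derivative G' y) (at y)) \<and>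
    (\<forall>y\<in>V. \<forall>h. F' (G y) (G' y h) = h)"
proof -
  have bl: "bounded_linear (F' x)" if "x \<in> U" for x
    using der that by (blast intro: has_derivative_bounded_linear)
  define f' where "f' = (\<lambda>x. Blinfun (F' x))"
  have f': "blinfun_apply (f' x) = F' x" if "x \<in> U" for x
    unfolding f'_def using bl[OF that] by (rule bounded_linear_Blinfun_apply)
  \<comment> \<open>In finite dimension, continuity of the derivative in operator norm amounts to
    continuity of its value at each basis vector.\<close>
  have c: "continuous_on U f'"
    by (rule continuous_on_blinfun_componentwise) (use cont f' in \<open>simp cong: continuous_on_cong\<close>)
  have lin: "linear (F' x0)" using bl[OF U(2)] by (rule bounded_linear.linear)
  have "inj (F' x0)" using inj by (simp add: linear_injective_0[OF lin])
  then obtain g where g: "linear g" "g \<circ> F' x0 = id"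
    using linear_injective_left_inverse[OF lin] by blast
  have invf: "Blinfun g o\<^sub>L f' x0 = id_blinfun"
    using g by (intro blinfun_eqI)
      (auto simp: f'[OF U(2)] bounded_linear_Blinfun_apply linear_conv_bounded_linear fun_eq_iff)
  obtain U' V G G' where *: "open U'" "U' \<subseteq> U" "x0 \<in> U'" "open V" "F x0 \<in> V"
    "homeomorphism U' V F G"
    "\<And>y. y \<in> V \<Longrightarrow> (G has_derivative G' y) (at y)"
    "\<And>y. y \<in> V \<Longrightarrow> G' y = inv (blinfun_apply (f' (G y)))"
    "\<And>y. y \<in> V \<Longrightarrow> bij (blinfun_apply (f' (G y)))"
    using inverse_function_theorem[OF U(1) _ c U(2) invf, of F] der f' by (metis (full_types))
  have GU: "G y \<in> U" if "y \<in> V" for y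
    using *(2,6) that by (auto simp: homeomorphism_def)
  \<comment> \<open>The derivative of the inverse is recorded only through this identity; its
    components are read off from it later, without computing an inverse matrix.\<close>
  have "F' (G y) (G' y h) = h" if y: "y \<in> V" for y h
  proof -
    note e = f'[OF GU[OF y]]
    have "bij (F' (G y))" using *(9)[OF y] e by simp
    then show ?thesis using *(8)[OF y] e by (simp add: bij_is_surj surj_f_inv_f)
  qed
  then show ?thesis using *(1-7) by (intro exI[of _ U'] exI[of _ V] exI[of _ G] exI[of _ G']) simp
qed

definition grad :: "('a::euclidean_space \<Rightarrow> real) \<Rightarrow> 'a \<Rightarrow> 'a" where
  "grad g x = (\<Sum>b\<in>Basis. frechet_derivative g (at x) b *\<^sub>R b)"

lemma grad_has_derivative:
  assumes "g differentiable (at x)"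
  shows "(g has_derivative (\<lambda>h. grad g x \<bullet> h)) (at x)"
proof -
  have d: "(g has_derivative frechet_derivative g (at x)) (at x)"
    using assms by (simp add: frechet_derivative_works)
  have l: "linear (frechet_derivative g (at x))"
    using d has_derivative_linear by blast
  have "frechet_derivative g (at x) h = grad g x \<bullet> h" for h
  proof -
    have "frechet_derivative g (at x) h = frechet_derivative g (at x) (\<Sum>b\<in>Basis. (h \<bullet> b) *\<^sub>R b)"
      by (simp add: euclidean_representation)
    also have "\<dots> = (\<Sum>b\<in>Basis. (h \<bullet> b) * frechet_derivative g (at x) b)"
      by (simp add: linear_sum[OF l] linear_cmul[OF l])
    also have "\<dots> = grad g x \<bullet> h"
      by (simp add: grad_def inner_sum_left inner_commute[of h] mult.commute)
    finally show ?thesis .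
  qed
  then have "frechet_derivative g (at x) = (\<lambda>h. grad g x \<bullet> h)" by (rule ext)
  then show ?thesis using d by simp
qed

lemma grad_unique:
  assumes "(g has_derivative (\<lambda>h. v \<bullet> h)) (at x)"
  shows "grad g x = v"
proof -
  have "(\<lambda>h. grad g x \<bullet> h) = (\<lambda>h. v \<bullet> h)"
    using assms grad_has_derivative has_derivative_unique differentiableI by blast
  then have "\<And>h. grad g x \<bullet> h = v \<bullet> h" by metis
  then show ?thesis by (metis vector_eq_rdot)
qed

lemma smooth_on_C1:
  fixes g :: "'a::euclidean_space \<Rightarrow> real"
  assumes "smooth_on V g"
  shows "open V" "\<And>x. x \<in> V \<Longrightarrow> (g has_derivative (\<lambda>h. grad g x \<bullet> h)) (at x)"
    "continuous_on V g" "continuous_on V (grad g)" "\<And>x. x \<in> V \<Longrightarrow> grad g differentiable (at x)"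
proof -
  have 1: "Ck_on (Suc 0) V g" and 2: "Ck_on (Suc (Suc 0)) V g" and "open V"
    using assms unfolding smooth_on_def by blast+
  then show "open V" by simp
  show "\<And>x. x \<in> V \<Longrightarrow> (g has_derivative (\<lambda>h. grad g x \<bullet> h)) (at x)"
    using 1 by (simp add: grad_has_derivative)
  show "continuous_on V g" using assms unfolding smooth_on_def by (metis Ck_on.simps(1))
  have "continuous_on V (\<lambda>x. \<Sum>b\<in>Basis. frechet_derivative g (at x) b *\<^sub>R b)"
    using 1 by (intro continuous_intros) auto
  then show "continuous_on V (grad g)" by (simp add: grad_def[abs_def])
  show "grad g differentiable (at x)" if "x \<in> V" for x
    unfolding grad_def[abs_def] using 2 that
    by (intro differentiable_sum differentiable_scaleR) auto
qed

lemma frechet_derivative_grad: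
  "g differentiable (at x) \<Longrightarrow> frechet_derivative g (at x) = (\<lambda>h. grad g x \<bullet> h)"
  using frechet_derivative_at[OF grad_has_derivative, of g x] by simp

lemma frechet_derivative_nz:
  assumes "g differentiable (at x)"
  shows "frechet_derivative g (at x) \<noteq> (\<lambda>h. 0) \<longleftrightarrow> grad g x \<noteq> 0"
  unfolding frechet_derivative_grad[OF assms] by (auto simp: fun_eq_iff inner_eq_zero_iff)

definition defining :: "(real^3) set \<Rightarrow> (real^3) set \<Rightarrow> (real^3 \<Rightarrow> real) \<Rightarrow> bool" where
  "defining S V g \<longleftrightarrow> smooth_on V g \<and> (\<forall>x\<in>V. grad g x \<noteq> 0) \<and> S \<inter> V = {x\<in>V. g x = 0}"

lemma smooth_surface_defining:
  assumes "smooth_surface S" "p \<in> S"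
  shows "\<exists>V g. p \<in> V \<and> defining S V g"
  using bspec[OF assms(1)[unfolded smooth_surface_def] assms(2)]
proof (elim exE conjE)
  fix V and g :: "real^3 \<Rightarrow> real"
  assume g: "p \<in> V" "smooth_on V g" "\<forall>x\<in>V. frechet_derivative g (at x) \<noteq> (\<lambda>h. 0)"
      "S \<inter> V = {x\<in>V. g x = 0}"
  have "grad g x \<noteq> 0" if "x \<in> V" for x
    using frechet_derivative_nz[of g x] g(3) that smooth_on_C1(2)[OF g(2) that]
    by (auto simp: differentiable_def)
  then have "defining S V g" using g by (simp add: defining_def)
  with g(1) show ?thesis by blast
qed

text \<open>Expansion of \<open>h\<close> in the reciprocal basis \<open>cross3 b c\<close>,
  \<open>cross3 c a\<close>, \<open>cross3 a b\<close>, whose coefficients are the three inner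
  products. It serves below as injectivity of chart derivatives and to identify vectors by three
  components.\<close>

lemma triple_eq_0:
  fixes h :: "real^3"
  assumes "a \<bullet> cross3 b c \<noteq> 0" "a \<bullet> h = 0" "b \<bullet> h = 0" "c \<bullet> h = 0"
  shows "h = 0"
proof -
  have "(a \<bullet> cross3 b c) *\<^sub>R h
      = (a \<bullet> h) *\<^sub>R cross3 b c + (b \<bullet> h) *\<^sub>R cross3 c a + (c \<bullet> h) *\<^sub>R cross3 a b"
    using exhaust_3 by (force simp add: cross3_simps)
  then show ?thesis using assms by simp
qed

lemma cross3_self_left: "cross3 b (cross3 a b) = (b \<bullet> b) *\<^sub>R a - (a \<bullet> b) *\<^sub>R b"
  using exhaust_3 by (force simp add: cross3_simps)

text \<open>A unit vector \<open>k\<close> orthogonal to \<open>G\<close> together with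
  \<open>cross3 G k\<close>. The exact value \<open>cross3 k1 k2 = G\<close>, rather than mere
  independence, turns the pairing of a curl with \<open>G\<close> into a difference of two
  directional derivatives.\<close>

lemma frame_exists:
  fixes G :: "real^3" assumes "G \<noteq> 0"
  obtains k1 k2 where "G \<bullet> k1 = 0" "G \<bullet> k2 = 0" "cross3 k1 k2 = G" "G \<bullet> cross3 k1 k2 \<noteq> 0"
proof -
  obtain y :: "real^3" where y: "y \<noteq> 0" "orthogonal G y"
    using orthogonal_to_vector_exists[of G] by (auto simp: DIM_real)
  define k where "k = y /\<^sub>R norm y"
  have k: "k \<bullet> k = 1" "G \<bullet> k = 0" 
    using y by (simp_all add: k_def orthogonal_def dot_square_norm power2_eq_square)
  have "cross3 k (cross3 G k) = G" by (simp add: cross3_self_left k)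
  then show ?thesis using that[of k "cross3 G k"] k assms by (simp add: dot_cross_self)
qed

lemma parallelD:
  assumes "parallel a b" "b \<noteq> 0" shows "a = ((a \<bullet> b) / (b \<bullet> b)) *\<^sub>R b"
proof -
  have "(b \<bullet> b) *\<^sub>R a = (a \<bullet> b) *\<^sub>R b"
    using assms(1) cross3_self_left[of b a] by (simp add: parallel_def)
  then have "(1 / (b \<bullet> b)) *\<^sub>R ((b \<bullet> b) *\<^sub>R a) = (1 / (b \<bullet> b)) *\<^sub>R ((a \<bullet> b) *\<^sub>R b)" by simp
  then show ?thesis using assms(2) by simp
qed

text \<open>The defining function itself is the first coordinate, so the surface becomes the plane
  where that coordinate vanishes and its two sides become half-spaces. The other coordinates are
  linear and centred at \<open>p\<close>.\<close>

definition chart3 :: "(real^3 \<Rightarrow> real) \<Rightarrow> real^3 \<Rightarrow> real^3 \<Rightarrow> real^3 \<Rightarrow> real^3 \<Rightarrow> real^3" where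
  "chart3 g k1 k2 p x = g x *\<^sub>R axis 1 1 + (k1 \<bullet> (x - p)) *\<^sub>R axis 2 1 + (k2 \<bullet> (x - p)) *\<^sub>R axis 3 1"

lemma axis_comb_nth:
  fixes a b c :: real
  shows "(a *\<^sub>R axis 1 1 + b *\<^sub>R axis 2 1 + c *\<^sub>R axis 3 1 :: real^3) $ 1 = a"
    "(a *\<^sub>R axis 1 1 + b *\<^sub>R axis 2 1 + c *\<^sub>R axis 3 1 :: real^3) $ 2 = b"
    "(a *\<^sub>R axis 1 1 + b *\<^sub>R axis 2 1 + c *\<^sub>R axis 3 1 :: real^3) $ 3 = c"
  by (simp_all add: axis_def)

lemma axis_comb_eq_iff:
  fixes a b c :: real
  shows "(a *\<^sub>R axis 1 1 + b *\<^sub>R axis 2 1 + c *\<^sub>R axis 3 1 :: real^3) =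
      a' *\<^sub>R axis 1 1 + b' *\<^sub>R axis 2 1 + c' *\<^sub>R axis 3 1 \<longleftrightarrow> a = a' \<and> b = b' \<and> c = c'"
  unfolding vec_eq_iff forall_3 axis_comb_nth by simp

lemma axis_comb_eq_0:
  fixes a b c :: real
  shows "(a *\<^sub>R axis 1 1 + b *\<^sub>R axis 2 1 + c *\<^sub>R axis 3 1 :: real^3) = 0 \<longleftrightarrow> a = 0 \<and> b = 0 \<and> c = 0"
  using axis_comb_eq_iff[of a b c 0 0 0] by simp

lemma chart3_nth [simp]:
  "chart3 g k1 k2 p x $ 1 = g x" "chart3 g k1 k2 p x $ 2 = k1 \<bullet> (x - p)"
  "chart3 g k1 k2 p x $ 3 = k2 \<bullet> (x - p)"
  unfolding chart3_def by (rule axis_comb_nth)+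

lemma shrink_homeomorphism:
  assumes "homeomorphism U V F G" "open U" "open V'" "V' \<subseteq> V"
  shows "open (G ` V')" "homeomorphism (G ` V') V' F G" "G ` V' \<subseteq> U"
proof -
  show sub: "G ` V' \<subseteq> U" using assms(1,4) by (auto simp: homeomorphism_def)
  have "G ` V' = U \<inter> F -` V'"
    using assms(1,4) by (force simp: homeomorphism_def)
  moreover have "open (U \<inter> F -` V')"
    using assms by (intro continuous_open_preimage) (auto simp: homeomorphism_def)
  ultimately show "open (G ` V')" by simp
  show "homeomorphism (G ` V') V' F G"
  proof (rule homeomorphism_of_subsets[OF assms(1) sub])
    show "F ` G ` V' = V'"
      using assms(1,4) by (auto simp: homeomorphism_def subset_iff image_image)
  qed (use assms(4) in auto)
qed

text \<open>Inverse function theorem for \<open>chart3\<close>. The image is shrunk to a ball about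
  the image 0 of \<open>p\<close>, so that its two halves, one for each side of the surface, are
  convex.\<close>

lemma surface_chart:
  assumes def: "defining S V g" and p: "p \<in> S" "p \<in> V" and ind: "grad g p \<bullet> cross3 k1 k2 \<noteq> 0"
  shows "\<exists>U r G G'. open U \<and> p \<in> U \<and> U \<subseteq> V \<and> 0 < r \<and>
    homeomorphism U (ball 0 r) (chart3 g k1 k2 p) G \<and>
    (\<forall>y\<in>ball 0 r. (G has_derivative G' y) (at y) \<and>
      (\<forall>h. grad g (G y) \<bullet> G' y h = h $ 1 \<and> k1 \<bullet> G' y h = h $ 2 \<and> k2 \<bullet> G' y h = h $ 3))"
proof -
  let ?F = "chart3 g k1 k2 p"
  let ?F' = "\<lambda>x h. (grad g x \<bullet> h) *\<^sub>R axis 1 1 + (k1 \<bullet> h) *\<^sub>R axis 2 1 + (k2 \<bullet> h) *\<^sub>R axis 3 1 :: real^3"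
  have sm: "smooth_on V g" using def by (simp add: defining_def)
  note C1 = smooth_on_C1[OF sm]
  have d: "\<forall>x\<in>V. (?F has_derivative ?F' x) (at x)"
    unfolding chart3_def[abs_def] by (intro ballI) (rule derivative_eq_intros C1(2) refl | assumption | simp)+
  have c: "\<forall>h\<in>Basis. continuous_on V (\<lambda>x. ?F' x h)"
    by (intro ballI continuous_intros C1(4))
  have inj: "\<forall>h. ?F' p h = 0 \<longrightarrow> h = 0"
    using triple_eq_0[OF ind] by (simp add: axis_comb_eq_0)
  have Fp: "?F p = 0" using def p by (auto simp: chart3_def defining_def)
  obtain U' V' G G' where *: "open U'" "U' \<subseteq> V" "p \<in> U'" "open V'" "?F p \<in> V'"
    "homeomorphism U' V' ?F G" "\<forall>y\<in>V'. (G has_derivative G' y) (at y)"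
    "\<forall>y\<in>V'. \<forall>h. ?F' (G y) (G' y h) = h"
    using local_diffeo[of V p ?F ?F', OF C1(1) p(2) d c inj] by (elim exE conjE) (rule that)
  obtain r where r: "r > 0" "ball 0 r \<subseteq> V'" using *(4,5) Fp by (metis open_contains_ball)
  note sh = shrink_homeomorphism[OF *(6,1) open_ball r(2)]
  have "p = G (?F p)" using *(3,6) by (simp add: homeomorphism_def)
  then have "p \<in> G ` ball 0 r" using Fp r by auto
  moreover have "grad g (G y) \<bullet> G' y h = h $ 1" "k1 \<bullet> G' y h = h $ 2" "k2 \<bullet> G' y h = h $ 3" 
    if "y \<in> ball 0 r" for y h
    using arg_cong[OF *(8)[rule_format, of y h], of "\<lambda>v. v $ 1"] arg_cong[OF *(8)[rule_format, of y h], of "\<lambda>v. v $ 2"]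
      arg_cong[OF *(8)[rule_format, of y h], of "\<lambda>v. v $ 3"] that r(2) unfolding axis_comb_nth by auto
  moreover have "G ` ball 0 r \<subseteq> V" using *(2) sh(3) by simp
  moreover have "\<And>y. y \<in> ball 0 r \<Longrightarrow> (G has_derivative G' y) (at y)" using *(7) r(2) by (meson subsetD)
  ultimately show ?thesis
    using sh(1,2) r(1) by (intro exI[of _ "G ` ball 0 r"] exI[of _ r] exI[of _ G] exI[of _ G']) auto
qed

text \<open>Differentiating \<open>g (c s) = 0\<close> gives one inclusion. For the other, a
  straight line in the plane of the chart is pulled back to a curve in the surface with the
  prescribed velocity.\<close>

lemma tangent_vectors_eq:
  assumes def: "defining S V g" and p: "p \<in> S" "p \<in> V"
  shows "tangent_vectors S p = {h. grad g p \<bullet> h = 0}"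
proof (intro equalityI subsetI CollectI)
  have sm: "smooth_on V g" using def by (simp add: defining_def)
  note C1 = smooth_on_C1[OF sm]
  fix h
  {
    assume "h \<in> tangent_vectors S p"
    then obtain c where c: "c 0 = p" "\<forall>\<^sub>F s in at 0. c s \<in> S" "(c has_vector_derivative h) (at (0::real))"
      unfolding tangent_vectors_def by auto
    have "isCont c 0" using c(3) has_vector_derivative_continuous by blast
    then have "\<forall>\<^sub>F s in at 0. c s \<in> V"
      using C1(1) p(2) c(1) by (metis continuous_within topological_tendstoD)
    with c(2) have ev: "\<forall>\<^sub>F s in at 0. g (c s) = 0"
      by eventually_elim (use def in \<open>auto simp: defining_def\<close>)
    have "((g \<circ> c) has_derivative (\<lambda>s. grad g p \<bullet> (s *\<^sub>R h))) (at 0)"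
      using diff_chain_at[of c "\<lambda>s. s *\<^sub>R h" 0 g "(\<bullet>) (grad g p)"] C1(2)[OF p(2)] c
      by (simp add: has_vector_derivative_def o_def)
    moreover have "((g \<circ> c) has_derivative (\<lambda>s. 0)) (at 0)"
    proof (rule has_derivative_transform_eventually[of "\<lambda>s. 0"])
      show "\<forall>\<^sub>F x' in at 0. 0 = (g \<circ> c) x'" using ev by eventually_elim simp
      show "0 = (g \<circ> c) 0" using c(1) p def by (auto simp: defining_def)
    qed auto
    ultimately have "(\<lambda>s. grad g p \<bullet> (s *\<^sub>R h)) = (\<lambda>s::real. 0)" by (rule has_derivative_unique)
    from fun_cong[OF this, of 1] show "grad g p \<bullet> h = 0" by simp
  next
    assume "h \<in> {h. grad g p \<bullet> h = 0}"
    then have h: "grad g p \<bullet> h = 0" by simp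
    have "grad g p \<noteq> 0" using def p by (simp add: defining_def)
    then obtain k1 k2 where "grad g p \<bullet> cross3 k1 k2 \<noteq> 0" by (rule frame_exists)
    note ind = this
    obtain U r G G' where ch: "open U" "p \<in> U" "U \<subseteq> V" "0 < r"
      "homeomorphism U (ball 0 r) (chart3 g k1 k2 p) G"
      "\<forall>y\<in>ball 0 r. (G has_derivative G' y) (at y) \<and>
      (\<forall>h. grad g (G y) \<bullet> G' y h = h $ 1 \<and> k1 \<bullet> G' y h = h $ 2 \<and> k2 \<bullet> G' y h = h $ 3)"
      using surface_chart[OF def p ind] by (elim exE conjE) (rule that)
    have F0: "chart3 g k1 k2 p p = 0" using def p by (auto simp: chart3_def defining_def)
    have Gp: "G 0 = p" using ch(2,5) F0 by (metis homeomorphism_def)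
    \<comment> \<open>The first coordinate 0 keeps the pulled-back line in the surface; the other
      two are chosen so that its velocity has the same components as \<open>h\<close> against
      \<open>grad g p\<close>, \<open>k1\<close> and \<open>k2\<close>.\<close>
    define v where "v = (0 *\<^sub>R axis 1 1 + (k1 \<bullet> h) *\<^sub>R axis 2 1 + (k2 \<bullet> h) *\<^sub>R axis 3 1 :: real^3)"
    have v: "v $ 1 = 0" "v $ 2 = k1 \<bullet> h" "v $ 3 = k2 \<bullet> h" unfolding v_def axis_comb_nth by auto
    have "G' 0 v - h = 0"
      using ch(6)[rule_format, of 0] ch(4) h by (intro triple_eq_0[OF ind]) (simp_all add: Gp v inner_diff_right)
    then have G'v: "G' 0 v = h" by simp
    define c where "c = (\<lambda>s::real. G (s *\<^sub>R v))"
    have dG: "(G has_derivative G' 0) (at 0)" using ch(4,6) by simp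
    have "(c has_derivative (\<lambda>s. G' 0 (s *\<^sub>R v))) (at 0)"
      using diff_chain_at[of "\<lambda>s. s *\<^sub>R v" "\<lambda>s. s *\<^sub>R v" "0::real" G "G' 0"] dG
      using has_derivative_scaleR_left[OF has_derivative_ident, of v] by (simp add: c_def o_def)
    moreover have "G' 0 (s *\<^sub>R v) = s *\<^sub>R h" for s
      using linear_scale[OF has_derivative_linear[OF dG]] G'v by simp
    ultimately have "(c has_vector_derivative h) (at 0)" by (simp add: has_vector_derivative_def)
    moreover have "((\<lambda>s. s *\<^sub>R v) \<longlongrightarrow> 0 *\<^sub>R v) (at (0::real))" by (intro tendsto_intros)
    then have "\<forall>\<^sub>F s in at (0::real). s *\<^sub>R v \<in> ball 0 r"
      using ch(4) by (intro topological_tendstoD) auto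
    then have "\<forall>\<^sub>F s in at 0. c s \<in> S"
    proof eventually_elim
      case (elim s)
      then have "c s \<in> U" "chart3 g k1 k2 p (c s) = s *\<^sub>R v"
        using ch(5) by (auto simp: c_def homeomorphism_def)
      then have "g (c s) = (s *\<^sub>R v) $ 1" by (metis chart3_nth(1))
      then show ?case using \<open>c s \<in> U\<close> ch(3) def v by (auto simp: defining_def)
    qed
    moreover have "c 0 = p" by (simp add: c_def Gp)
    ultimately show "h \<in> tangent_vectors S p" unfolding tangent_vectors_def by blast
  }
qed

lemma normal_to_iff:
  assumes "defining S V g" "p \<in> S" "p \<in> V"
  shows "normal_to S p n \<longleftrightarrow> n \<noteq> 0 \<and> parallel n (grad g p)"
proof -
  let ?G = "grad g p"
  have nz: "?G \<noteq> 0" using assms by (simp add: defining_def)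
  have "parallel n ?G" if "\<And>h. ?G \<bullet> h = 0 \<Longrightarrow> n \<bullet> h = 0"
  proof -
    \<comment> \<open>Up to the factor \<open>?G \<bullet> ?G\<close> this is the tangential part of
      \<open>n\<close>. Its pairing with \<open>n\<close> is the squared length of
      \<open>cross3 n ?G\<close>.\<close>
    let ?c = "cross3 ?G (cross3 n ?G)"
    have "n \<bullet> ?c = 0" by (rule that) (simp add: dot_cross_self)
    moreover have "n \<bullet> ?c = cross3 n ?G \<bullet> cross3 n ?G" by (simp add: cross3_simps)
    ultimately show ?thesis by (simp add: parallel_def)
  qed
  moreover have "n \<bullet> h = 0" if "parallel n ?G" "?G \<bullet> h = 0" for h
    using parallelD[OF that(1) nz] that(2) by (metis inner_scaleR_left mult_zero_right)
  ultimately show ?thesis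
    unfolding normal_to_def tangent_vectors_eq[OF assms] by auto
qed

lemma unit_normal_iff:
  assumes "defining S V g" "p \<in> S" "p \<in> V"
  shows "unit_normal S p n \<longleftrightarrow> n = grad g p /\<^sub>R norm (grad g p) \<or> n = - (grad g p /\<^sub>R norm (grad g p))"
    (is "_ \<longleftrightarrow> n = ?u \<or> n = - ?u")
proof -
  have nz: "grad g p \<noteq> 0" using assms by (simp add: defining_def)
  have u: "norm ?u = 1" using nz by simp
  have "n = ?u \<or> n = - ?u" if "parallel n (grad g p)" "norm n = 1"
  proof -
    define k where "k = (n \<bullet> grad g p) / (grad g p \<bullet> grad g p)"
    have k: "n = k *\<^sub>R grad g p" unfolding k_def by (rule parallelD[OF that(1) nz])
    then have "n = (k * norm (grad g p)) *\<^sub>R ?u" using nz by simp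
    moreover from this have "\<bar>k * norm (grad g p)\<bar> = 1" using that(2) u
      by (metis norm_scaleR mult.right_neutral)
    ultimately show ?thesis by (metis abs_eq_iff' scaleR_minus1_left scaleR_one abs_1)
  qed
  moreover have "parallel ?u (grad g p)" "parallel (- ?u) (grad g p)"
    by (simp_all add: parallel_def cross_mult_left)
  ultimately show ?thesis
    unfolding unit_normal_def normal_to_iff[OF assms] using u nz by (metis norm_minus_cancel norm_zero zero_neq_one)
qed

subsection \<open>Smooth families of surfaces\<close>

definition xgrad :: "(real \<times> (real^3) \<Rightarrow> real) \<Rightarrow> real \<times> (real^3) \<Rightarrow> real^3" where
  "xgrad g z = snd (grad g z)"

definition family_defining ::
  "real set \<Rightarrow> (real \<Rightarrow> (real^3) set) \<Rightarrow> (real \<times> (real^3)) set \<Rightarrow> (real \<times> (real^3) \<Rightarrow> real) \<Rightarrow> bool" where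
  "family_defining S P V g \<longleftrightarrow> smooth_on V g \<and> V \<subseteq> S \<times> UNIV \<and>
     (\<forall>z\<in>V. xgrad g z \<noteq> 0) \<and> (\<forall>z\<in>V. snd z \<in> P (fst z) \<longleftrightarrow> g z = 0)"

lemma slice_has_derivative:
  assumes "smooth_on V g" "(r, y) \<in> V"
  shows "((\<lambda>z. g (r, z)) has_derivative (\<lambda>h. xgrad g (r, y) \<bullet> h)) (at y)"
proof -
  have "((\<lambda>z. (r, z)) has_derivative (\<lambda>h. (0, h))) (at y)"
    by (auto intro!: derivative_eq_intros)
  from diff_chain_at[OF this smooth_on_C1(2)[OF assms]] show ?thesis
    by (simp add: o_def xgrad_def inner_prod_def)
qed

lemma smooth_surface_family_defining:
  assumes "smooth_surface_family S P" "s \<in> S" "x \<in> P s"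
  shows "\<exists>V g. (s, x) \<in> V \<and> family_defining S P V g"
proof -
  have "\<exists>V (g :: real \<times> (real^3) \<Rightarrow> real).
        (s, x) \<in> V \<and> V \<subseteq> S \<times> UNIV \<and> smooth_on V g \<and>
        (\<forall>(r, y)\<in>V. frechet_derivative (\<lambda>z. g (r, z)) (at y) \<noteq> (\<lambda>h. 0)) \<and>
        (\<forall>(r, y)\<in>V. y \<in> P r \<longleftrightarrow> g (r, y) = 0)"
    using assms unfolding smooth_surface_family_def by simp
  then show ?thesis
  proof (elim exE conjE)
    fix V and g :: "real \<times> (real^3) \<Rightarrow> real"
    assume g: "(s, x) \<in> V" "V \<subseteq> S \<times> UNIV" "smooth_on V g"
        "\<forall>(r, y)\<in>V. frechet_derivative (\<lambda>z. g (r, z)) (at y) \<noteq> (\<lambda>h. 0)"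
        "\<forall>(r, y)\<in>V. y \<in> P r \<longleftrightarrow> g (r, y) = 0"
    have "xgrad g (r, y) \<noteq> 0" if ry: "(r, y) \<in> V" for r y
    proof
      assume 0: "xgrad g (r, y) = 0"
      have "frechet_derivative (\<lambda>z. g (r, z)) (at y) = (\<lambda>h. 0)"
        using frechet_derivative_at[OF slice_has_derivative[OF g(3) ry]] 0 by (simp add: fun_eq_iff)
      with g(4) ry show False by auto
    qed
    then have "family_defining S P V g" using g by (auto simp: family_defining_def)
    with g(1) show ?thesis by blast
  qed
qed

text \<open>Both surfaces are level sets, so the cross product of their gradients spans the tangent
  line of the intersection wherever they are transversal. It is not normalized.\<close>

definition leaf_dir :: "(real^3 \<Rightarrow> real) \<Rightarrow> (real \<times> (real^3) \<Rightarrow> real) \<Rightarrow> real \<times> (real^3) \<Rightarrow> real^3" where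
  "leaf_dir g1 g2 z = cross3 (grad g1 (snd z)) (xgrad g2 z)"

lemma continuous_on_xgrad: "smooth_on V g \<Longrightarrow> continuous_on V (xgrad g)"
  unfolding xgrad_def[abs_def] using smooth_on_C1(4)[of V g] by (intro continuous_intros)

lemma continuous_on_leaf_dir:
  assumes "smooth_on V1 g1" "smooth_on V2 g2" "W \<subseteq> V2" "snd ` W \<subseteq> V1"
  shows "continuous_on W (leaf_dir g1 g2)"
  unfolding leaf_dir_def[abs_def]
proof (intro continuous_on_cross)
  show "continuous_on W (\<lambda>x. grad g1 (snd x))"
    using smooth_on_C1(4)[OF assms(1)] assms(4)
    by (intro continuous_on_compose2[of V1 "grad g1" W snd]) (auto intro!: continuous_intros)
  show "continuous_on W (xgrad g2)"
    using continuous_on_xgrad[OF assms(2)] assms(3) continuous_on_subset by blast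
qed

lemma cross3_cycle: "a \<bullet> cross3 b c = c \<bullet> cross3 a b" "a \<bullet> cross3 b c = b \<bullet> cross3 c a"
  by (simp_all add: cross3_simps)

text \<open>Implicit function theorem with a parameter, applied to the map sending
  \<open>(s, x)\<close> to \<open>s\<close>, \<open>g1 x\<close>, \<open>g2 (s, x)\<close> and
  \<open>\<tau> \<bullet> (x - x0)\<close>. Near \<open>x0\<close> every leaf is a graph over the
  direction \<tau> of the leaf through \<open>x0\<close>: \<open>\<psi> (s, w)\<close> is the point
  of leaf \<open>s\<close> at height \<open>w\<close>.\<close>

lemma slice_chart:
  assumes M: "defining M V1 g1" "x0 \<in> M" "x0 \<in> V1"
    and F: "family_defining S P V2 g2" "x0 \<in> P s0" "(s0, x0) \<in> V2"
    and tr: "\<not> parallel (grad g1 x0) (xgrad g2 (s0, x0))"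
    and \<tau>: "\<tau> = leaf_dir g1 g2 (s0, x0)"
  shows "\<exists>\<epsilon> W \<psi>. 0 < \<epsilon> \<and> open W \<and> (s0, x0) \<in> W \<and> W \<subseteq> V2 \<and> snd ` W \<subseteq> V1 \<and>
    (\<forall>z\<in>W. \<tau> \<bullet> leaf_dir g1 g2 z > 0) \<and>
    (\<forall>s w. \<bar>s - s0\<bar> < \<epsilon> \<and> \<bar>w\<bar> < \<epsilon> \<longrightarrow> (s, \<psi> (s, w)) \<in> W \<and> \<psi> (s, w) \<in> M \<inter> P s \<and>
       \<tau> \<bullet> (\<psi> (s, w) - x0) = w \<and>
       ((\<lambda>w. \<psi> (s, w)) has_vector_derivative
          leaf_dir g1 g2 (s, \<psi> (s, w)) /\<^sub>R (\<tau> \<bullet> leaf_dir g1 g2 (s, \<psi> (s, w)))) (at w)) \<and>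
    (\<forall>s x. (s, x) \<in> W \<and> x \<in> M \<inter> P s \<longrightarrow>
       \<bar>s - s0\<bar> < \<epsilon> \<and> \<bar>\<tau> \<bullet> (x - x0)\<bar> < \<epsilon> \<and> \<psi> (s, \<tau> \<bullet> (x - x0)) = x) \<and>
    continuous_on {z. \<bar>fst z - s0\<bar> < \<epsilon> \<and> \<bar>snd z\<bar> < \<epsilon>} \<psi>"
proof -
  have sm: "smooth_on V1 g1" "smooth_on V2 g2" using M F by (auto simp: defining_def family_defining_def)
  note C1 = smooth_on_C1[OF sm(1)] and C2 = smooth_on_C1[OF sm(2)]
  have \<tau>nz: "\<tau> \<noteq> 0" using tr by (simp add: \<tau> leaf_dir_def parallel_def)
  define U0 where "U0 = V2 \<inter> snd -` V1"
  have oU0: "open U0" unfolding U0_def using C1(1) C2(1) by (auto intro!: open_Int open_vimage_snd)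
  have cl: "continuous_on U0 (leaf_dir g1 g2)"
    by (rule continuous_on_leaf_dir[OF sm]) (auto simp: U0_def)
  \<comment> \<open>Where the leaf direction makes an acute angle with \<tau>, the two gradients and
    \<tau> are independent, and the height along \<tau> increases along the leaf.\<close>
  define U where "U = U0 \<inter> (\<lambda>z. \<tau> \<bullet> leaf_dir g1 g2 z) -` {0<..}"
  have oU: "open U" unfolding U_def
    by (intro continuous_open_preimage oU0 continuous_intros cl)
  have x0U: "(s0, x0) \<in> U" using M F \<tau>nz \<tau> by (auto simp: U_def U0_def)
  let ?F = "\<lambda>z. (fst z, g1 (snd z) *\<^sub>R axis 1 1 + g2 z *\<^sub>R axis 2 1 + (\<tau> \<bullet> (snd z - x0)) *\<^sub>R axis 3 1 :: real^3)"
  let ?F' = "\<lambda>z h. (fst h, (grad g1 (snd z) \<bullet> snd h) *\<^sub>R axis 1 1 + (grad g2 z \<bullet> h) *\<^sub>R axis 2 1 + (\<tau> \<bullet> snd h) *\<^sub>R axis 3 1 :: real^3)"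
  have d: "\<forall>z\<in>U. (?F has_derivative ?F' z) (at z)"
  proof
    fix z assume "z \<in> U"
    then have z: "snd z \<in> V1" "z \<in> V2" by (auto simp: U_def U0_def)
    have "((\<lambda>z. g1 (snd z)) has_derivative (\<lambda>h. grad g1 (snd z) \<bullet> snd h)) (at z)"
      using diff_chain_at[of snd snd z g1, OF _ C1(2)[OF z(1)]] 
      by (simp add: o_def has_derivative_snd[OF has_derivative_ident])
    then show "(?F has_derivative ?F' z) (at z)"
      by (auto intro!: derivative_eq_intros C2(2)[OF z(2)])
  qed
  have c: "\<forall>h\<in>Basis. continuous_on U (\<lambda>z. ?F' z h)"
  proof
    fix h
    have "continuous_on U (\<lambda>z. grad g1 (snd z))"
      by (rule continuous_on_compose2[OF C1(4)]) (auto intro!: continuous_intros simp: U_def U0_def)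
    moreover have "continuous_on U (grad g2)"
      by (rule continuous_on_subset[OF C2(4)]) (auto simp: U_def U0_def)
    ultimately show "continuous_on U (\<lambda>z. ?F' z h)" by (intro continuous_intros)
  qed
  have ind: "grad g1 (snd z) \<bullet> cross3 (xgrad g2 z) \<tau> > 0" if "z \<in> U" for z
    using that cross3_cycle(1)[of "grad g1 (snd z)" "xgrad g2 z" \<tau>] by (simp add: U_def leaf_dir_def)
  have inj: "\<forall>h. ?F' (s0, x0) h = 0 \<longrightarrow> h = 0"
  proof (intro allI impI)
    fix h assume h: "?F' (s0, x0) h = 0"
    then have "fst h = 0" by (simp add: zero_prod_def)
    then have g: "grad g2 (s0, x0) \<bullet> h = xgrad g2 (s0, x0) \<bullet> snd h" by (simp add: inner_prod_def xgrad_def)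
    have "snd h = 0"
      using h ind[OF x0U] unfolding g
      by (intro triple_eq_0[of "grad g1 x0" "xgrad g2 (s0, x0)" \<tau>]) (auto simp: zero_prod_def axis_comb_eq_0)
    with \<open>fst h = 0\<close> show "h = 0" by (simp add: prod_eq_iff)
  qed
  have F0: "?F (s0, x0) = (s0, 0)" proof -
    have "g1 x0 = 0" using M by (auto simp: defining_def)
    moreover have "g2 (s0, x0) = 0" using F by (auto simp: family_defining_def dest!: bspec[of V2 _ "(s0, x0)"])
    ultimately show ?thesis by simp
  qed
  obtain U' V' G G' where *: "open U'" "U' \<subseteq> U" "(s0, x0) \<in> U'" "open V'" "?F (s0, x0) \<in> V'"
    "homeomorphism U' V' ?F G" "\<forall>y\<in>V'. (G has_derivative G' y) (at y)"
    "\<forall>y\<in>V'. \<forall>h. ?F' (G y) (G' y h) = h"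
    using local_diffeo[of U "(s0, x0)" ?F ?F', OF oU x0U d c inj] by (elim exE conjE) (rule that)
  obtain e where e: "e > 0" "ball (s0, 0) e \<subseteq> V'" using *(4,5) F0 by (metis open_contains_ball)
  \<comment> \<open>Three space coordinates below \<epsilon> bound the norm by three times
    \<epsilon>, and the parameter contributes one more \<epsilon>, so that the box \<open>R\<close>
    fits into the ball of radius \<open>e\<close>.\<close>
  define \<epsilon> where "\<epsilon> = e / 4"
  have \<epsilon>: "\<epsilon> > 0" using e by (simp add: \<epsilon>_def)
  define R where "R = {z :: real \<times> (real^3). \<bar>fst z - s0\<bar> < \<epsilon> \<and> (\<forall>i. \<bar>snd z $ i\<bar> < \<epsilon>)}"
  have "open {z :: real \<times> (real^3). \<bar>snd z $ i\<bar> < \<epsilon>}" for i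
    by (intro open_Collect_less continuous_on_rabs continuous_on_component continuous_on_snd
        continuous_on_id continuous_on_const)
  then have oR: "open R" unfolding R_def Collect_conj_eq Collect_all_eq
    by (intro open_Int open_INT open_Collect_less continuous_intros) auto
  have RV: "R \<subseteq> V'"
  proof
    fix z assume z: "z \<in> R"
    have "norm (snd z) \<le> (\<Sum>i\<in>UNIV. \<bar>snd z $ i\<bar>)" by (rule norm_le_l1_cart)
    also have "\<dots> < 3 * \<epsilon>"
    proof -
      have "\<bar>snd z $ 1\<bar> < \<epsilon>" "\<bar>snd z $ 2\<bar> < \<epsilon>" "\<bar>snd z $ 3\<bar> < \<epsilon>" using z by (auto simp: R_def)
      then show ?thesis unfolding sum_3 by linarith
    qed
    finally have "dist (s0, 0) z < e"
      using z dist_triangle[of "(s0, 0)" z "(fst z, 0)"]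
      by (cases z) (auto simp: R_def \<epsilon>_def dist_Pair_Pair dist_real_def abs_minus_commute)
    then show "z \<in> V'" using e(2) by auto
  qed
  note sh = shrink_homeomorphism[OF *(6,1) oR RV]
  define W where "W = G ` R"
  define \<psi> where "\<psi> = (\<lambda>z. snd (G (fst z, snd z *\<^sub>R axis 3 1)))"
  have FG: "?F (G y) = y" if "y \<in> R" for y using *(6) that RV by (auto simp: homeomorphism_def)
  have inR: "(s, w *\<^sub>R axis 3 1) \<in> R" if "\<bar>s - s0\<bar> < \<epsilon>" "\<bar>w\<bar> < \<epsilon>" for s w
    using that \<epsilon> by (auto simp: R_def axis_def)
  have G\<psi>: "G (s, w *\<^sub>R axis 3 1) = (s, \<psi> (s, w))" if "\<bar>s - s0\<bar> < \<epsilon>" "\<bar>w\<bar> < \<epsilon>" for s w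
    using FG[OF inR[OF that]] by (auto simp: \<psi>_def prod_eq_iff)
  have WU: "W \<subseteq> U" using sh(3) *(2) by (auto simp: W_def)
  have x0W: "(s0, x0) \<in> W"
  proof -
    have "G (?F (s0, x0)) = (s0, x0)" by (rule homeomorphism_apply1[OF *(6,3)])
    moreover have "?F (s0, x0) \<in> R" unfolding F0 using \<epsilon> by (simp add: R_def)
    ultimately show ?thesis unfolding W_def by (metis imageI)
  qed
  have fwd: "(s, \<psi> (s, w)) \<in> W \<and> \<psi> (s, w) \<in> M \<inter> P s \<and> \<tau> \<bullet> (\<psi> (s, w) - x0) = w \<and>
       ((\<lambda>w. \<psi> (s, w)) has_vector_derivative
          leaf_dir g1 g2 (s, \<psi> (s, w)) /\<^sub>R (\<tau> \<bullet> leaf_dir g1 g2 (s, \<psi> (s, w)))) (at w)"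
    if sw: "\<bar>s - s0\<bar> < \<epsilon>" "\<bar>w\<bar> < \<epsilon>" for s w
  proof -
    let ?z = "(s, \<psi> (s, w))" and ?y = "(s, w *\<^sub>R axis 3 1) :: real \<times> (real^3)"
    have zW: "?z \<in> W" using inR[OF sw] G\<psi>[OF sw] by (force simp: W_def)
    then have zU: "?z \<in> U" using WU by auto
    have "?F ?z = (s, 0 *\<^sub>R axis 1 1 + 0 *\<^sub>R axis 2 1 + w *\<^sub>R axis 3 1)"
      using FG[OF inR[OF sw]] unfolding G\<psi>[OF sw] by simp
    then have v: "g1 (\<psi> (s, w)) = 0" "g2 ?z = 0" "\<tau> \<bullet> (\<psi> (s, w) - x0) = w"
      unfolding prod_eq_iff fst_conv snd_conv axis_comb_eq_iff by auto
    have mem: "\<psi> (s, w) \<in> M \<inter> P s"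
      using v zU M(1) F(1) unfolding U_def U0_def defining_def family_defining_def by auto
    define h where "h = G' ?y (0, axis 3 1)"
    have "?y \<in> V'" using inR[OF sw] RV by auto
    note dG = *(7)[rule_format, OF this] and FG' = *(8)[rule_format, OF this, of "(0, axis 3 1)"]
    have "?F' ?z h = (0, 0 *\<^sub>R axis 1 1 + 0 *\<^sub>R axis 2 1 + 1 *\<^sub>R axis 3 1)"
      using FG' unfolding G\<psi>[OF sw] h_def by simp
    then have h: "fst h = 0" "grad g1 (\<psi> (s, w)) \<bullet> snd h = 0" "grad g2 ?z \<bullet> h = 0" "\<tau> \<bullet> snd h = 1"
      unfolding prod_eq_iff fst_conv snd_conv axis_comb_eq_iff by auto
    then have h3: "xgrad g2 ?z \<bullet> snd h = 0" by (simp add: inner_prod_def xgrad_def)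
    let ?l = "leaf_dir g1 g2 ?z"
    have pos: "\<tau> \<bullet> ?l > 0" using zU by (simp add: U_def)
    \<comment> \<open>The velocity of the leaf and the rescaled \<open>leaf_dir\<close> are both
      orthogonal to the two gradients and have the same component 1 along \<tau>.\<close>
    have "snd h - ?l /\<^sub>R (\<tau> \<bullet> ?l) = 0"
      using ind[OF zU] h h3 pos
      by (intro triple_eq_0[of "grad g1 (\<psi> (s, w))" "xgrad g2 ?z" \<tau>])
         (auto simp: inner_diff_right leaf_dir_def dot_cross_self)
    then have sh': "snd h = ?l /\<^sub>R (\<tau> \<bullet> ?l)" by simp
    have "((\<lambda>w. (s, w *\<^sub>R axis 3 1)) has_derivative (\<lambda>t. (0, t *\<^sub>R axis 3 1 :: real^3))) (at w)"
      by (auto intro!: derivative_eq_intros)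
    from diff_chain_at[OF this dG]
    have "((\<lambda>w. G (s, w *\<^sub>R axis 3 1)) has_derivative (\<lambda>t. G' ?y (0, t *\<^sub>R axis 3 1))) (at w)"
      by (simp add: o_def)
    moreover have "G' ?y (0, t *\<^sub>R axis 3 1) = t *\<^sub>R h" for t
      unfolding h_def using linear_scale[OF has_derivative_linear[OF dG], of t "(0, axis 3 1)"] by simp
    ultimately have "((\<lambda>w. G (s, w *\<^sub>R axis 3 1)) has_derivative (\<lambda>t. t *\<^sub>R h)) (at w)" by simp
    then have "((\<lambda>w. snd (G (s, w *\<^sub>R axis 3 1))) has_derivative (\<lambda>t. snd (t *\<^sub>R h))) (at w)"
      by (rule has_derivative_snd)
    moreover have "(\<lambda>w. \<psi> (s, w)) = (\<lambda>w. snd (G (s, w *\<^sub>R axis 3 1)))" by (simp add: \<psi>_def)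
    ultimately have "((\<lambda>w. \<psi> (s, w)) has_vector_derivative ?l /\<^sub>R (\<tau> \<bullet> ?l)) (at w)"
      using sh' by (simp add: has_vector_derivative_def)
    then show ?thesis using zW mem v(3) by blast
  qed
  have bwd: "\<bar>s - s0\<bar> < \<epsilon> \<and> \<bar>\<tau> \<bullet> (x - x0)\<bar> < \<epsilon> \<and> \<psi> (s, \<tau> \<bullet> (x - x0)) = x"
    if z: "(s, x) \<in> W" "x \<in> M \<inter> P s" for s x
  proof -
    have zU: "(s, x) \<in> U" using WU z by auto
    have "g1 x = 0" "g2 (s, x) = 0"
      using zU z M(1) F(1) unfolding U_def U0_def defining_def family_defining_def by auto
    then have Fz: "?F (s, x) = (s, (\<tau> \<bullet> (x - x0)) *\<^sub>R axis 3 1)" by simp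
    obtain y where y: "y \<in> R" "(s, x) = G y" using z(1) by (auto simp: W_def)
    then have yF: "y = (s, (\<tau> \<bullet> (x - x0)) *\<^sub>R axis 3 1)" using FG[OF y(1)] Fz by simp
    then have "\<bar>s - s0\<bar> < \<epsilon>" "\<bar>((\<tau> \<bullet> (x - x0)) *\<^sub>R axis 3 1 :: real^3) $ 3\<bar> < \<epsilon>" 
      using y(1) unfolding R_def yF by (simp_all only: mem_Collect_eq fst_conv snd_conv)
    then have b: "\<bar>s - s0\<bar> < \<epsilon>" "\<bar>\<tau> \<bullet> (x - x0)\<bar> < \<epsilon>" by (auto simp: axis_def)
    show ?thesis using G\<psi>[OF b] b y(2) yF by simp
  qed
  have cont: "continuous_on {z. \<bar>fst z - s0\<bar> < \<epsilon> \<and> \<bar>snd z\<bar> < \<epsilon>} \<psi>"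
    unfolding \<psi>_def
  proof (intro continuous_on_snd)
    have "continuous_on R G" using sh(2) by (simp add: homeomorphism_def)
    then show "continuous_on {z. \<bar>fst z - s0\<bar> < \<epsilon> \<and> \<bar>snd z\<bar> < \<epsilon>} (\<lambda>z. G (fst z, snd z *\<^sub>R axis 3 1))"
      by (rule continuous_on_compose2) (auto intro!: continuous_intros inR)
  qed
  have "W \<subseteq> V2" "snd ` W \<subseteq> V1" "\<forall>z\<in>W. \<tau> \<bullet> leaf_dir g1 g2 z > 0"
    using WU by (auto simp: U_def U0_def)
  moreover have "open W" using sh(1) by (simp add: W_def)
  ultimately show ?thesis
    by (intro exI[of _ \<epsilon>] exI[of _ W] exI[of _ \<psi>] conjI)
      (rule x0W \<epsilon> cont | assumption | (intro allI impI, elim conjE, rule fwd bwd, assumption, assumption))+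
qed

subsection \<open>Extremal normals of repulsion and shear\<close>

definition eigenframe ::
  "real^3^3 \<Rightarrow> real \<Rightarrow> real \<Rightarrow> real \<Rightarrow> real^3 \<Rightarrow> real^3 \<Rightarrow> real^3 \<Rightarrow> bool" where
  "eigenframe F l1 l2 l3 e1 e2 e3 \<longleftrightarrow> 0 < l1 \<and> l1 < l2 \<and> l2 < l3 \<and>
     e1 \<bullet> e1 = 1 \<and> e2 \<bullet> e2 = 1 \<and> e3 \<bullet> e3 = 1 \<and> e1 \<bullet> e2 = 0 \<and> e1 \<bullet> e3 = 0 \<and> e2 \<bullet> e3 = 0 \<and>
     (transpose F ** F) *v e1 = l1 *\<^sub>R e1 \<and> (transpose F ** F) *v e2 = l2 *\<^sub>R e2 \<and>
     (transpose F ** F) *v e3 = l3 *\<^sub>R e3"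

lemma inner_transpose_mult: "x \<bullet> (transpose F *v z) = (F *v x) \<bullet> (z :: real^'n)" for F :: "real^'m^'n"
  by (metis dot_lmul_matrix inner_commute transpose_matrix_vector)

lemma inner_gram: "x \<bullet> ((transpose F ** F) *v y) = (F *v x) \<bullet> (F *v y)" for F :: "real^'m^'n"
  by (metis inner_transpose_mult matrix_vector_mul_assoc)

lemma eigenvectors_orthogonal:
  fixes F :: "real^'m^'n"
  assumes "(transpose F ** F) *v x = a *\<^sub>R x" "(transpose F ** F) *v y = b *\<^sub>R y" "a \<noteq> b"
  shows "x \<bullet> y = 0"
proof -
  have "b * (x \<bullet> y) = a * (x \<bullet> y)"
    using inner_gram[of x F y] inner_gram[of y F x] assms by (simp add: inner_commute)
  then show ?thesis using assms(3) by simp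
qed

text \<open>Eigenvectors of the symmetric matrix \<open>transpose F ** F\<close> for distinct
  eigenvalues are orthogonal, so one normalized eigenvector for each eigenvalue already forms the
  frame.\<close>

lemma eigenframe_exists:
  assumes "eigenvalues (transpose F ** F) = {l1, l2, l3}" "0 < l1" "l1 < l2" "l2 < l3"
  shows "\<exists>e1 e2 e3. eigenframe F l1 l2 l3 e1 e2 e3"
proof -
  have unit: "\<exists>e. e \<bullet> e = 1 \<and> (transpose F ** F) *v e = l *\<^sub>R e" if "l \<in> eigenvalues (transpose F ** F)" for l
  proof -
    have "\<exists>x. x \<noteq> 0 \<and> (transpose F ** F) *v x = l *\<^sub>R x"
      using that by (simp only: eigenvalues_def mem_Collect_eq)
    then obtain x where x: "x \<noteq> 0" "(transpose F ** F) *v x = l *\<^sub>R x" by metis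
    have "norm (x /\<^sub>R norm x) = 1" using x(1) by simp
    then have "(x /\<^sub>R norm x) \<bullet> (x /\<^sub>R norm x) = 1" by (simp only: norm_eq_1)
    moreover have "(transpose F ** F) *v (x /\<^sub>R norm x) = l *\<^sub>R (x /\<^sub>R norm x)"
      by (simp only: matrix_vector_mult_scaleR x(2) scaleR_scaleR mult.commute)
    ultimately show ?thesis by blast
  qed
  have l: "l1 \<in> eigenvalues (transpose F ** F)" "l2 \<in> eigenvalues (transpose F ** F)" 
    "l3 \<in> eigenvalues (transpose F ** F)" using assms(1) by auto
  obtain e1 e2 e3 where e: "e1 \<bullet> e1 = 1" "(transpose F ** F) *v e1 = l1 *\<^sub>R e1"
     "e2 \<bullet> e2 = 1" "(transpose F ** F) *v e2 = l2 *\<^sub>R e2"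
     "e3 \<bullet> e3 = 1" "(transpose F ** F) *v e3 = l3 *\<^sub>R e3"
    using unit[OF l(1)] unit[OF l(2)] unit[OF l(3)] by blast
  then show ?thesis
    using assms(2-4) eigenvectors_orthogonal[OF e(2,4)] eigenvectors_orthogonal[OF e(2,6)]
      eigenvectors_orthogonal[OF e(4,6)]
    unfolding eigenframe_def by (intro exI[of _ e1] exI[of _ e2] exI[of _ e3]) auto
qed

lemma orthonormal_expand:
  fixes e1 e2 e3 n :: "real^3"
  assumes "e1 \<bullet> e1 = 1" "e2 \<bullet> e2 = 1" "e3 \<bullet> e3 = 1" "e1 \<bullet> e2 = 0" "e1 \<bullet> e3 = 0" "e2 \<bullet> e3 = 0"
  shows "n = (n \<bullet> e1) *\<^sub>R e1 + (n \<bullet> e2) *\<^sub>R e2 + (n \<bullet> e3) *\<^sub>R e3"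
proof -
  have "cross3 e2 e3 \<bullet> cross3 e2 e3 = 1" by (simp add: dot_cross assms inner_commute)
  moreover have "e1 \<noteq> 0" using assms by auto
  ultimately have ind: "e1 \<bullet> cross3 e2 e3 \<noteq> 0"
    using triple_eq_0[of "cross3 e2 e3" e2 e3 e1] assms by (auto simp: inner_commute)
  have "n - ((n \<bullet> e1) *\<^sub>R e1 + (n \<bullet> e2) *\<^sub>R e2 + (n \<bullet> e3) *\<^sub>R e3) = 0"
    by (rule triple_eq_0[OF ind]) (use assms in \<open>simp_all add: inner_diff_right inner_add_right inner_commute\<close>)
  then show ?thesis by simp
qed

context
  fixes F :: "real^3^3" and l1 l2 l3 :: real and e1 e2 e3 :: "real^3"
  assumes ef: "eigenframe F l1 l2 l3 e1 e2 e3"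
begin

lemma frame_expand: "n = (n \<bullet> e1) *\<^sub>R e1 + (n \<bullet> e2) *\<^sub>R e2 + (n \<bullet> e3) *\<^sub>R e3"
  using ef by (intro orthonormal_expand) (auto simp: eigenframe_def)

lemma gram_expand:
  "(transpose F ** F) *v n = (l1 * (n \<bullet> e1)) *\<^sub>R e1 + (l2 * (n \<bullet> e2)) *\<^sub>R e2 + (l3 * (n \<bullet> e3)) *\<^sub>R e3"
proof -
  have "(transpose F ** F) *v n
    = (transpose F ** F) *v ((n \<bullet> e1) *\<^sub>R e1 + (n \<bullet> e2) *\<^sub>R e2 + (n \<bullet> e3) *\<^sub>R e3)"
    using frame_expand[of n] by simp
  also have "\<dots> = (l1 * (n \<bullet> e1)) *\<^sub>R e1 + (l2 * (n \<bullet> e2)) *\<^sub>R e2 + (l3 * (n \<bullet> e3)) *\<^sub>R e3"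
    using ef unfolding eigenframe_def
    by (simp add: matrix_vector_right_distrib matrix_vector_mult_scaleR mult.commute)
  finally show ?thesis .
qed

lemma frame_inner: "x \<bullet> y = (x \<bullet> e1) * (y \<bullet> e1) + (x \<bullet> e2) * (y \<bullet> e2) + (x \<bullet> e3) * (y \<bullet> e3)"
  by (subst frame_expand[of y]) (simp add: inner_add_right mult.commute)

lemma gram_quadratic:
  "(F *v n) \<bullet> (F *v n) = l1 * (n \<bullet> e1)\<^sup>2 + l2 * (n \<bullet> e2)\<^sup>2 + l3 * (n \<bullet> e3)\<^sup>2"
  by (simp add: gram_expand inner_add_right power2_eq_square mult.assoc flip: inner_gram)

lemma frame_invertible: "invertible F"
proof -
  have "x = 0" if "F *v x = 0" for x
  proof -
    have "l1 * (x \<bullet> e1)\<^sup>2 + l2 * (x \<bullet> e2)\<^sup>2 + l3 * (x \<bullet> e3)\<^sup>2 = 0"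
      using gram_quadratic[of x] that by simp
    moreover have "0 < l1" "0 < l2" "0 < l3" using ef by (auto simp: eigenframe_def)
    ultimately have "x \<bullet> e1 = 0 \<and> x \<bullet> e2 = 0 \<and> x \<bullet> e3 = 0"
      by (smt (verit) mult_nonneg_nonneg mult_pos_pos zero_le_power2 zero_less_power2)
    then show ?thesis using frame_expand[of x] by simp
  qed
  then show ?thesis by (simp add: invertible_left_inverse matrix_left_invertible_ker)
qed

text \<open>The quadratic form of the inverse Cauchy-Green tensor, written in its
  eigenframe.\<close>

definition "inverse_form n = (n \<bullet> e1)\<^sup>2 / l1 + (n \<bullet> e2)\<^sup>2 / l2 + (n \<bullet> e3)\<^sup>2 / l3"

lemma inverse_transpose_norm:
  defines "m \<equiv> \<lambda>n. transpose (matrix_inv F) *v n"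
  shows "m n \<bullet> m n = inverse_form n" "m n \<bullet> (F *v n) = n \<bullet> n"
proof -
  have pos: "0 < l1" "0 < l2" "0 < l3" using ef by (auto simp: eigenframe_def)
  have inv: "matrix_inv F ** F = mat 1" "F ** matrix_inv F = mat 1"
    using someI_ex[OF frame_invertible[unfolded invertible_def]] unfolding matrix_inv_def by blast+
  show "m n \<bullet> (F *v n) = n \<bullet> n"
    unfolding m_def by (metis inner_commute inner_transpose_mult inv(1) matrix_vector_mul_assoc matrix_vector_mul_lid)
  \<comment> \<open>The inverse Cauchy-Green tensor applied to \<open>n\<close>. Then
    \<open>F *v y\<close> is the inverse transpose of \<open>F\<close> applied to \<open>n\<close>,
    so the squared norm sought is the Cauchy-Green form at \<open>y\<close>.\<close>
  define y where "y = ((n \<bullet> e1) / l1) *\<^sub>R e1 + ((n \<bullet> e2) / l2) *\<^sub>R e2 + ((n \<bullet> e3) / l3) *\<^sub>R e3"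
  have on: "e1 \<bullet> e1 = 1" "e2 \<bullet> e2 = 1" "e3 \<bullet> e3 = 1" "e1 \<bullet> e2 = 0" "e1 \<bullet> e3 = 0" "e2 \<bullet> e3 = 0"
    "e2 \<bullet> e1 = 0" "e3 \<bullet> e1 = 0" "e3 \<bullet> e2 = 0"
    using ef by (auto simp: eigenframe_def inner_commute)
  have ye: "y \<bullet> e1 = (n \<bullet> e1) / l1" "y \<bullet> e2 = (n \<bullet> e2) / l2" "y \<bullet> e3 = (n \<bullet> e3) / l3"
    unfolding y_def by (simp_all add: inner_add_left on)
  have "(transpose F ** F) *v y = n"
    unfolding gram_expand ye using pos frame_expand[of n] by simp
  then have Fy: "transpose F *v (F *v y) = n" by (simp add: matrix_vector_mul_assoc)
  have "transpose (matrix_inv F) ** transpose F = mat 1"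
    using inv(2) by (metis matrix_transpose_mul transpose_mat)
  then have "m n = F *v y"
    unfolding m_def by (metis Fy matrix_vector_mul_assoc matrix_vector_mul_lid)
  then show "m n \<bullet> m n = inverse_form n"
    using gram_quadratic[of y] pos unfolding ye inverse_form_def by (simp add: power2_eq_square)
qed

text \<open>The squared components of a unit vector sum to 1, so the form is a weighted mean of the
  reciprocals of the three eigenvalues.\<close>

lemma inverse_form_pos:
  assumes "n \<bullet> n = 1" shows "1 / l3 \<le> inverse_form n" "inverse_form n \<le> 1 / l1" "0 < inverse_form n"
proof -
  have pos: "0 < l1" "0 < l2" "0 < l3" "l1 \<le> l2" "l2 \<le> l3" using ef by (auto simp: eigenframe_def)
  have n: "1 = (n \<bullet> e1)\<^sup>2 + (n \<bullet> e2)\<^sup>2 + (n \<bullet> e3)\<^sup>2"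
    using frame_inner[of n n] assms by (simp add: power2_eq_square)
  have "1 / l3 = (n \<bullet> e1)\<^sup>2 / l3 + (n \<bullet> e2)\<^sup>2 / l3 + (n \<bullet> e3)\<^sup>2 / l3"
    unfolding add_divide_distrib[symmetric] using n by simp
  also have "\<dots> \<le> inverse_form n" unfolding inverse_form_def using pos by (intro add_mono divide_left_mono) auto
  finally show 1: "1 / l3 \<le> inverse_form n" .
  have "inverse_form n \<le> (n \<bullet> e1)\<^sup>2 / l1 + (n \<bullet> e2)\<^sup>2 / l1 + (n \<bullet> e3)\<^sup>2 / l1"
    unfolding inverse_form_def using pos by (intro add_mono divide_left_mono) auto
  also have "\<dots> = 1 / l1" unfolding add_divide_distrib[symmetric] using n by simp
  finally show "inverse_form n \<le> 1 / l1" .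
  have "0 < 1 / l3" using pos by simp
  with 1 show "0 < inverse_form n" by linarith
qed

lemma inverse_form_frame: "inverse_form e1 = 1 / l1" "inverse_form e3 = 1 / l3"
  using ef unfolding inverse_form_def eigenframe_def by (auto simp: inner_commute)

text \<open>Pythagoras: the squared length of \<open>F *v n\<close> minus the square of its
  component along the advected normal.\<close>

definition "shear_form n = (n \<bullet> e1)\<^sup>2 * l1 + (n \<bullet> e2)\<^sup>2 * l2 + (n \<bullet> e3)\<^sup>2 * l3 - 1 / inverse_form n"

text \<open>The unnormalized advected normal \<open>m\<close> satisfies
  \<open>m \<bullet> (F *v n) = 1\<close> because the inverse transpose cancels \<open>F\<close> in
  the inner product. Hence the repulsion is the reciprocal of the norm of \<open>m\<close>, and the
  shear is the length of what remains after an orthogonal projection.\<close>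

lemma repulsion_shear_formula:
  assumes "n \<bullet> n = 1"
  defines "m \<equiv> transpose (matrix_inv F) *v n"
  shows "(m /\<^sub>R norm m) \<bullet> (F *v n) = 1 / sqrt (inverse_form n)"
    "(norm (F *v n - ((m /\<^sub>R norm m) \<bullet> (F *v n)) *\<^sub>R (m /\<^sub>R norm m)))\<^sup>2 = shear_form n"
proof -
  have m: "m \<bullet> m = inverse_form n" "m \<bullet> (F *v n) = 1"
    using inverse_transpose_norm[of n] assms by auto
  have nm: "norm m = sqrt (inverse_form n)" using m(1) by (simp add: norm_eq_sqrt_inner)
  have q: "0 < inverse_form n" using inverse_form_pos(3)[OF assms(1)] .
  show r: "(m /\<^sub>R norm m) \<bullet> (F *v n) = 1 / sqrt (inverse_form n)"
    using m(2) by (simp add: nm divide_inverse)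
  let ?u = "m /\<^sub>R norm m"
  have uu: "?u \<bullet> ?u = 1" 
  proof -
    have "norm m > 0" unfolding nm using q by simp
    then have "norm ?u = 1" by simp
    then show ?thesis by (simp only: norm_eq_1)
  qed
  have "(norm (F *v n - (?u \<bullet> (F *v n)) *\<^sub>R ?u))\<^sup>2 = (F *v n) \<bullet> (F *v n) - (?u \<bullet> (F *v n))\<^sup>2"
    unfolding power2_norm_eq_inner inner_diff_left inner_diff_right using uu
    by (simp add: inner_commute power2_eq_square)
  also have "\<dots> = shear_form n"
    unfolding r gram_quadratic shear_form_def using q by (simp add: power_divide mult.commute)
  finally show "(norm (F *v n - (?u \<bullet> (F *v n)) *\<^sub>R ?u))\<^sup>2 = shear_form n" .
qed

text \<open>With \<open>A\<close> the Cauchy-Green form at \<open>n\<close> and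
  \<open>B = l1 + l3 - A\<close>, the inverse form is \<open>B / (l1 * l3)\<close> minus a
  nonnegative multiple of the squared \<open>e2\<close> component. The squared shear is therefore at
  most \<open>l1 + l3 - (B + l1 * l3 / B)\<close>, which the inequality of arithmetic and geometric
  means bounds by the stated value. Equality removes the \<open>e2\<close> component and fixes
  \<open>B\<close>, hence the two other weights.\<close>

lemma shear_extremal:
  assumes n: "n \<bullet> n = 1" and ge: "shear_form n \<ge> (sqrt l3 - sqrt l1)\<^sup>2"
  shows "(n \<bullet> e2) = 0" "(n \<bullet> e1)\<^sup>2 = sqrt l1 / (sqrt l1 + sqrt l3)" "(n \<bullet> e3)\<^sup>2 = sqrt l3 / (sqrt l1 + sqrt l3)"
proof -
  define s1 s3 p1 p2 p3 where "s1 = sqrt l1" and "s3 = sqrt l3"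
    and "p1 = (n \<bullet> e1)\<^sup>2" and "p2 = (n \<bullet> e2)\<^sup>2" and "p3 = (n \<bullet> e3)\<^sup>2"
  have pos: "0 < l1" "0 < l2" "0 < l3" "l1 < l2" "l2 < l3" using ef by (auto simp: eigenframe_def)
  have s: "0 < s1" "0 < s3" "s1 < s3" "l1 = s1\<^sup>2" "l3 = s3\<^sup>2" using pos by (simp_all add: s1_def s3_def)
  have p: "0 \<le> p1" "0 \<le> p2" "0 \<le> p3" "p1 + p2 + p3 = 1"
    using frame_inner[of n n] n by (simp_all add: p1_def p2_def p3_def power2_eq_square)
  define A B q where "A = p1 * l1 + p2 * l2 + p3 * l3" and "B = l1 + l3 - A" and "q = inverse_form n"
  have qpos: "q > 0" unfolding q_def by (rule inverse_form_pos(3)[OF n])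
  \<comment> \<open>The amount by which a unit of \<open>e2\<close> weight lowers the inverse form
    below the affine function of \<open>B\<close> valid in the plane of \<open>e1\<close> and
    \<open>e3\<close>. It is positive because \<open>l2\<close> lies strictly between the extreme
    eigenvalues.\<close>
  define \<delta> where "\<delta> = (l2 - l1) * (l3 - l2) / (l1 * l2 * l3)"
  have \<delta>: "\<delta> > 0" using pos by (simp add: \<delta>_def)
  have q: "q = p1 / l1 + p2 / l2 + p3 / l3" by (simp add: q_def inverse_form_def p1_def p2_def p3_def)
  have p1: "p1 = 1 - p2 - p3" using p(4) by simp
  have qB: "q = B / (l1 * l3) - p2 * \<delta>"
    unfolding q B_def A_def \<delta>_def p1 using pos by (simp add: field_simps)
  have Bpos: "B > 0"
  proof -
    have "B / (l1 * l3) > 0" using qB qpos \<delta> p(2) by (smt (verit) mult_nonneg_nonneg)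
    then show ?thesis using pos by (simp add: zero_less_divide_iff mult_less_0_iff)
  qed
  have g: "(s3 - s1)\<^sup>2 \<le> A - 1 / q"
    using ge unfolding shear_form_def s1_def s3_def A_def q_def p1_def p2_def p3_def .
  have "q \<le> B / (l1 * l3)" using qB p(2) \<delta> by simp
  then have "l1 * l3 / B \<le> 1 / q"
    using qpos Bpos pos by (simp add: field_simps)
  with g have "(s3 - s1)\<^sup>2 \<le> l1 + l3 - B - l1 * l3 / B" by (simp add: B_def)
  then have "B + l1 * l3 / B \<le> 2 * s1 * s3" by (simp add: s(4,5) power2_eq_square algebra_simps)
  then have "B * B + l1 * l3 \<le> 2 * s1 * s3 * B" using Bpos by (simp add: field_simps)
  \<comment> \<open>The equality case of the inequality of means.\<close>
  then have "(B - s1 * s3)\<^sup>2 \<le> 0" by (simp add: s(4,5) power2_eq_square algebra_simps)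
  then have B: "B = s1 * s3" by simp
  \<comment> \<open>The same inequality once more, now with \<open>B\<close> known and the term
    \<open>p2 * \<delta>\<close> retained; the previous round had estimated it away.\<close>
  have "(s3 - s1)\<^sup>2 \<le> l1 + l3 - B - 1 / q" using g by (simp add: B_def)
  then have "1 / q \<le> s1 * s3" unfolding B by (simp add: s(4,5) power2_eq_square algebra_simps)
  then have "1 / (s1 * s3) \<le> q" using qpos s(1,2) by (simp add: field_simps)
  moreover have "B / (l1 * l3) = 1 / (s1 * s3)" unfolding B s(4,5) using s(1,2) by (simp add: field_simps power2_eq_square)
  ultimately have "p2 * \<delta> \<le> 0" using qB by simp
  then have p2: "p2 = 0" using \<delta> p(2) by (simp add: mult_le_0_iff)
  then show "n \<bullet> e2 = 0" by (simp add: p2_def)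
  have "p3 = 1 - p1" using p(4) p2 by simp
  with B have "p1 * (l1 - l3) = l1 - s1 * s3" unfolding B_def A_def p2 by (simp add: algebra_simps)
  then have "p1 * (s1 + s3) * (s1 - s3) = s1 * (s1 - s3)" by (simp add: s(4,5) power2_eq_square algebra_simps)
  then have "p1 * (s1 + s3) = s1" using s(3) by simp
  then have p1': "p1 = s1 / (s1 + s3)" using s(1,2) by (simp add: field_simps)
  then show "(n \<bullet> e1)\<^sup>2 = sqrt l1 / (sqrt l1 + sqrt l3)" by (simp add: p1_def s1_def s3_def)
  have "p3 = s3 / (s1 + s3)" using \<open>p3 = 1 - p1\<close> p1' s(1,2) by (simp add: field_simps)
  then show "(n \<bullet> e3)\<^sup>2 = sqrt l3 / (sqrt l1 + sqrt l3)" by (simp add: p3_def s1_def s3_def)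
qed

text \<open>The bound of \<open>shear_extremal\<close> is attained, which supplies the competitor
  for a shear LCS. The value comes from factoring the sum of cubes of \<open>s1\<close> and
  \<open>s3\<close> by \<open>s1 + s3\<close>.\<close>

lemma shear_n_plus:
  defines "n \<equiv> sqrt (sqrt l1 / (sqrt l1 + sqrt l3)) *\<^sub>R e1 + sqrt (sqrt l3 / (sqrt l1 + sqrt l3)) *\<^sub>R e3"
  shows "n \<bullet> n = 1" "shear_form n = (sqrt l3 - sqrt l1)\<^sup>2"
proof -
  define s1 s3 where "s1 = sqrt l1" and "s3 = sqrt l3"
  have pos: "0 < l1" "0 < l2" "0 < l3" "l1 < l2" "l2 < l3" using ef by (auto simp: eigenframe_def)
  have s: "0 < s1" "0 < s3" "l1 = s1\<^sup>2" "l3 = s3\<^sup>2" using pos by (simp_all add: s1_def s3_def)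
  have on: "e1 \<bullet> e1 = 1" "e2 \<bullet> e2 = 1" "e3 \<bullet> e3 = 1" "e1 \<bullet> e2 = 0" "e1 \<bullet> e3 = 0" "e2 \<bullet> e3 = 0"
    "e2 \<bullet> e1 = 0" "e3 \<bullet> e1 = 0" "e3 \<bullet> e2 = 0"
    using ef by (auto simp: eigenframe_def inner_commute)
  have ne: "(n \<bullet> e1)\<^sup>2 = s1 / (s1 + s3)" "n \<bullet> e2 = 0" "(n \<bullet> e3)\<^sup>2 = s3 / (s1 + s3)"
    using s(1,2) by (simp_all add: n_def inner_add_left on flip: s1_def s3_def)
  show "n \<bullet> n = 1"
    using frame_inner[of n n] ne s(1,2) by (simp add: power2_eq_square add_divide_distrib[symmetric])
  have q: "inverse_form n = 1 / (s1 * s3)"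
  proof -
    have "s1 / (s1 + s3) / s1\<^sup>2 = s3 / ((s1 + s3) * (s1 * s3))" "s3 / (s1 + s3) / s3\<^sup>2 = s1 / ((s1 + s3) * (s1 * s3))"
      using s(1,2) by (simp_all add: power2_eq_square)
    then have "s1 / (s1 + s3) / s1\<^sup>2 + s3 / (s1 + s3) / s3\<^sup>2 = (s1 + s3) / ((s1 + s3) * (s1 * s3))"
      by (simp add: add_divide_distrib)
    also have "\<dots> = 1 / (s1 * s3)" using s(1,2) by simp
    finally show ?thesis unfolding inverse_form_def ne unfolding s(3,4) by simp
  qed
  have ss: "s1 + s3 \<noteq> 0" using s(1,2) by simp
  have "shear_form n = (s1 * s1\<^sup>2 + s3 * s3\<^sup>2) / (s1 + s3) - s1 * s3"
    unfolding shear_form_def q ne using s by (simp add: add_divide_distrib)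
  also have "s1 * s1\<^sup>2 + s3 * s3\<^sup>2 = (s1 + s3) * (s1\<^sup>2 - s1 * s3 + s3\<^sup>2)"
    by (simp add: power2_eq_square algebra_simps)
  also have "\<dots> / (s1 + s3) - s1 * s3 = (s3 - s1)\<^sup>2" 
    unfolding nonzero_mult_div_cancel_left[OF ss] by (simp add: power2_eq_square algebra_simps)
  finally show "shear_form n = (sqrt l3 - sqrt l1)\<^sup>2" by (simp add: s1_def s3_def)
qed

end

section \<open>Competing material surfaces and the normals of an LCS\<close>

lemma Ck_on_affine: "Ck_on k V (\<lambda>x. f x + c)" if "bounded_linear f"
proof (cases k)
  case 0
  then show ?thesis using that by (simp add: continuous_on_add linear_continuous_on)
next
  case (Suc j)
  have d: "((\<lambda>x. f x + c) has_derivative f) (at x)" for x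
    using bounded_linear_imp_has_derivative[OF that] by (auto intro!: derivative_eq_intros)
  have fd: "frechet_derivative (\<lambda>x. f x + c) (at x) = f" for x
    using frechet_derivative_at[OF d] by simp
  have const: "Ck_on j V (\<lambda>x. a)" for a :: 'b and j
    by (induction j arbitrary: a) (auto simp: frechet_derivative_const)
  show ?thesis unfolding Suc Ck_on.simps fd using d const by (auto simp: differentiable_def)
qed

text \<open>A flat disk orthogonal to \<open>n\<close>, small enough to lie in the flow domain and
  carried along by the flow map. This is how a comparison of surfaces becomes an optimization over
  all unit vectors.\<close>

lemma competitor_exists:
  assumes x: "x \<in> interior (flow_domain v D t0 T)" and n: "norm n = 1"
  shows "\<exists>M. material_surface v D t0 T M \<and> x \<in> M t0 \<and> unit_normal (M t0) x n"
proof -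
  obtain r where r: "r > 0" "ball x r \<subseteq> flow_domain v D t0 T"
    using x by (meson mem_interior)
  define M0 where "M0 = {y \<in> ball x r. n \<bullet> y - n \<bullet> x = 0}"
  let ?g = "\<lambda>y. n \<bullet> y - n \<bullet> x"
  have sm: "smooth_on (ball x r) ?g"
    unfolding smooth_on_def using Ck_on_affine[OF bounded_linear_inner_right[of n], of _ _ "- (n \<bullet> x)"] by simp
  have "(?g has_derivative (\<lambda>h. n \<bullet> h)) (at y)" for y by (auto intro!: derivative_eq_intros)
  then have gr: "grad ?g y = n" for y by (rule grad_unique)
  have n0: "n \<noteq> 0" using n by auto
  have def: "defining M0 (ball x r) ?g"
    unfolding defining_def using sm n0 by (auto simp: gr M0_def)
  have fr: "frechet_derivative ?g (at y) \<noteq> (\<lambda>h. 0)" for y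
    using frechet_derivative_nz[of ?g y] gr[of y] n0 by (simp add: bounded_linear_imp_differentiable bounded_linear_inner_right)
  have surf: "smooth_surface M0"
    unfolding smooth_surface_def
  proof
    fix p assume "p \<in> M0"
    then show "\<exists>V g. p \<in> V \<and> smooth_on V g \<and> (\<forall>x\<in>V. frechet_derivative g (at x) \<noteq> (\<lambda>h. 0)) \<and>
        M0 \<inter> V = {x \<in> V. g x = (0::real)}"
      using sm fr by (intro exI[of _ "ball x r"] exI[of _ ?g]) (auto simp: M0_def)
  qed
  have xM: "x \<in> M0" using r by (simp add: M0_def)
  have un: "unit_normal M0 x n"
    using unit_normal_iff[OF def xM, of n] r n by (simp add: gr)
  \<comment> \<open>The initial surface is the disk itself; it agrees with its image under the flow
    map at the initial time because that map is the identity on it.\<close>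
  define M where "M = (\<lambda>t. if t = t0 then M0 else flow_map v D t0 T t ` M0)"
  have id: "flow_map v D t0 T t0 y = y" if "y \<in> M0" for y
  proof -
    have "\<exists>z. trajectory v D t0 T y z" using that r(2) by (auto simp: M0_def flow_domain_def)
    moreover have "z t0 = y" if "trajectory v D t0 T y z" for z using that by (simp add: trajectory_def)
    ultimately show ?thesis unfolding flow_map_def by (intro the_equality) blast+
  qed
  have "flow_map v D t0 T t0 ` M0 = M0" using id by (auto simp: image_iff)
  then have "material_surface v D t0 T M"
    unfolding material_surface_def using surf r(2) by (auto simp: M_def M0_def)
  moreover have "M t0 = M0" by (simp add: M_def)
  ultimately show ?thesis using xM un by auto
qed

lemma parallel_unit:
  assumes "parallel a b" "norm a = 1" "norm b = 1" shows "a = b \<or> a = - b"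
proof -
  have bb: "b \<bullet> b = 1" "b \<noteq> 0" using assms(3) by (auto simp: dot_square_norm)
  have ab: "a = (a \<bullet> b) *\<^sub>R b" using parallelD[OF assms(1) bb(2)] bb(1) by simp
  then have "\<bar>a \<bullet> b\<bar> = 1" using assms(2,3) by (metis norm_scaleR mult.right_neutral)
  then show ?thesis using ab by (metis abs_eq_iff' scaleR_minus1_left scaleR_one abs_1)
qed

definition eframe where
  "eframe v D t0 T x l1 l2 l3 e1 e2 e3 \<longleftrightarrow> eigenframe (flow_gradient v D t0 T x) l1 l2 l3 e1 e2 e3 \<and>
     lambda1 v D t0 T x = l1 \<and> lambda3 v D t0 T x = l3"

lemma eframe_exists:
  assumes "x \<in> simple_spectrum_set v D t0 T"
  shows "\<exists>l1 l2 l3 e1 e2 e3. eframe v D t0 T x l1 l2 l3 e1 e2 e3"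
proof -
  obtain l1 l2 l3 where l: "0 < l1" "l1 < l2" "l2 < l3"
     "eigenvalues (cauchy_green v D t0 T x) = {l1, l2, l3}"
    using assms unfolding simple_spectrum_set_def by blast
  obtain e1 e2 e3 where e: "eigenframe (flow_gradient v D t0 T x) l1 l2 l3 e1 e2 e3"
    using eigenframe_exists[OF l(4)[unfolded cauchy_green_def] l(1-3)] by blast
  have "lambda1 v D t0 T x = l1" "lambda3 v D t0 T x = l3"
    unfolding lambda1_def lambda3_def l(4) using l(1-3) by simp_all
  with e show ?thesis unfolding eframe_def by blast
qed

text \<open>A unit eigenvector for an extreme eigenvalue is orthogonal to the two other frame
  vectors, so only its sign is free.\<close>

lemma eframe_is_xi:
  assumes "eframe v D t0 T x l1 l2 l3 e1 e2 e3"
  shows "is_xi1 v D t0 T x e \<longleftrightarrow> e = e1 \<or> e = - e1" "is_xi3 v D t0 T x e \<longleftrightarrow> e = e3 \<or> e = - e3"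
proof -
  let ?F = "flow_gradient v D t0 T x"
  have ef: "eigenframe ?F l1 l2 l3 e1 e2 e3" and l: "lambda1 v D t0 T x = l1" "lambda3 v D t0 T x = l3"
    using assms by (auto simp: eframe_def)
  note E = ef[unfolded eigenframe_def]
  have n: "norm e1 = 1" "norm e3 = 1" using E by (simp_all add: norm_eq_1)
  have sc: "e = e' \<or> e = - e'" if "e = (e \<bullet> e') *\<^sub>R e'" "norm e = 1" "norm e' = 1" for e' :: "real^3"
    using that parallel_unit[of e e'] by (metis cross_mult_left cross_refl parallel_def scaleR_zero_right)
  have 1: "e = e1 \<or> e = - e1" if "norm e = 1" "(transpose ?F ** ?F) *v e = l1 *\<^sub>R e"
    using eigenvectors_orthogonal[OF that(2), of e2 l2] eigenvectors_orthogonal[OF that(2), of e3 l3] E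
      frame_expand[OF ef, of e] that(1) n by (intro sc) auto
  have 3: "e = e3 \<or> e = - e3" if "norm e = 1" "(transpose ?F ** ?F) *v e = l3 *\<^sub>R e"
    using eigenvectors_orthogonal[OF that(2), of e2 l2] eigenvectors_orthogonal[OF that(2), of e1 l1] E
      frame_expand[OF ef, of e] that(1) n by (intro sc) auto
  have neg: "(transpose ?F ** ?F) *v (- w) = - ((transpose ?F ** ?F) *v w)" for w
    by (metis matrix_vector_mult_scaleR scaleR_minus1_left)
  show "is_xi1 v D t0 T x e \<longleftrightarrow> e = e1 \<or> e = - e1"
    using 1 E n unfolding is_xi1_def cauchy_green_def l by (auto simp: neg)
  show "is_xi3 v D t0 T x e \<longleftrightarrow> e = e3 \<or> e = - e3"
    using 3 E n unfolding is_xi3_def cauchy_green_def l by (auto simp: neg)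
qed

lemma repulsion_eq:
  assumes "eframe v D t0 T x l1 l2 l3 e1 e2 e3" "norm n = 1"
  shows "repulsion v D t0 T x n = 1 / sqrt (inverse_form l1 l2 l3 e1 e2 e3 n)"
    "(shear v D t0 T x n)\<^sup>2 = shear_form l1 l2 l3 e1 e2 e3 n"
  using repulsion_shear_formula[of "flow_gradient v D t0 T x" l1 l2 l3 e1 e2 e3 n] assms
  by (auto simp: eframe_def norm_eq_1 repulsion_def shear_def advected_normal_def Let_def)

text \<open>The inverse form is smallest at \<open>e3\<close>, so no unit vector has larger
  repulsion than \<open>e3\<close>. A disk with normal \<open>e3\<close> would violate the strict
  inequality in the definition if \<open>n\<close> were not parallel to it.\<close>

lemma repelling_normal:
  assumes M: "repelling_LCS v D t0 T M" "x \<in> M t0" "unit_normal (M t0) x n"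
    and x: "x \<in> simple_spectrum_set v D t0 T"
  shows "is_xi3 v D t0 T x n"
proof -
  obtain l1 l2 l3 e1 e2 e3 where ef: "eframe v D t0 T x l1 l2 l3 e1 e2 e3" using eframe_exists[OF x] by blast
  then have ef': "eigenframe (flow_gradient v D t0 T x) l1 l2 l3 e1 e2 e3" by (simp add: eframe_def)
  have nn: "norm n = 1" using M(3) by (simp add: unit_normal_def)
  have ne: "norm e3 = 1" using ef' by (simp add: eigenframe_def norm_eq_1)
  have l: "0 < l3" using ef' by (auto simp: eigenframe_def)
  have "x \<in> interior (flow_domain v D t0 T)" using x by (simp add: simple_spectrum_set_def)
  then obtain M' where M': "material_surface v D t0 T M'" "x \<in> M' t0" "unit_normal (M' t0) x e3"
    using competitor_exists ne by blast
  have "parallel e3 n"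
  proof (rule ccontr)
    assume "\<not> parallel e3 n"
    then have "repulsion v D t0 T x e3 < repulsion v D t0 T x n"
      using M M' unfolding repelling_LCS_def by blast
    then have "1 / sqrt (1 / l3) < 1 / sqrt (inverse_form l1 l2 l3 e1 e2 e3 n)"
      unfolding repulsion_eq(1)[OF ef ne] repulsion_eq(1)[OF ef nn] inverse_form_frame[OF ef'] .
    moreover have "sqrt (1 / l3) \<le> sqrt (inverse_form l1 l2 l3 e1 e2 e3 n)"
      using inverse_form_pos(1)[OF ef'] nn by (simp add: norm_eq_1)
    ultimately show False using l by (smt (verit) divide_pos_pos frac_le real_sqrt_gt_zero)
  qed
  then show ?thesis using parallel_unit[OF _ ne nn] eframe_is_xi(2)[OF ef] by force
qed

text \<open>The mirror image of the repelling case: the inverse form is largest at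
  \<open>e1\<close>, hence the repulsion smallest.\<close>

lemma attracting_normal:
  assumes M: "attracting_LCS v D t0 T M" "x \<in> M t0" "unit_normal (M t0) x n"
    and x: "x \<in> simple_spectrum_set v D t0 T"
  shows "is_xi1 v D t0 T x n"
proof -
  obtain l1 l2 l3 e1 e2 e3 where ef: "eframe v D t0 T x l1 l2 l3 e1 e2 e3" using eframe_exists[OF x] by blast
  then have ef': "eigenframe (flow_gradient v D t0 T x) l1 l2 l3 e1 e2 e3" by (simp add: eframe_def)
  have nn: "norm n = 1" using M(3) by (simp add: unit_normal_def)
  have ne: "norm e1 = 1" using ef' by (simp add: eigenframe_def norm_eq_1)
  have l: "0 < l1" using ef' by (auto simp: eigenframe_def)
  have "x \<in> interior (flow_domain v D t0 T)" using x by (simp add: simple_spectrum_set_def)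
  then obtain M' where M': "material_surface v D t0 T M'" "x \<in> M' t0" "unit_normal (M' t0) x e1"
    using competitor_exists ne by blast
  have "parallel e1 n"
  proof (rule ccontr)
    assume "\<not> parallel e1 n"
    then have "repulsion v D t0 T x e1 > repulsion v D t0 T x n"
      using M M' unfolding attracting_LCS_def by blast
    then have "1 / sqrt (1 / l1) > 1 / sqrt (inverse_form l1 l2 l3 e1 e2 e3 n)"
      unfolding repulsion_eq(1)[OF ef ne] repulsion_eq(1)[OF ef nn] inverse_form_frame[OF ef'] .
    moreover have "sqrt (1 / l1) \<ge> sqrt (inverse_form l1 l2 l3 e1 e2 e3 n)" "inverse_form l1 l2 l3 e1 e2 e3 n > 0"
      using inverse_form_pos(2,3)[OF ef'] nn by (simp_all add: norm_eq_1)
    ultimately show False using l by (smt (verit) divide_pos_pos frac_le real_sqrt_gt_zero)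
  qed
  then show ?thesis using parallel_unit[OF _ ne nn] eframe_is_xi(1)[OF ef] by force
qed

text \<open>Maximizers of the shear are not unique even up to sign, and the definition compares
  weakly. A disk whose normal is one maximizer only shows that \<open>n\<close> attains the maximum;
  the equality case in \<open>shear_extremal\<close> then determines the squared components of
  \<open>n\<close>.\<close>

lemma shear_normal:
  assumes M: "shear_LCS v D t0 T M" "x \<in> M t0" "unit_normal (M t0) x n"
    and x: "x \<in> simple_spectrum_set v D t0 T"
  shows "is_n_pm v D t0 T x n"
proof -
  obtain l1 l2 l3 e1 e2 e3 where ef: "eframe v D t0 T x l1 l2 l3 e1 e2 e3" using eframe_exists[OF x] by blast
  then have ef': "eigenframe (flow_gradient v D t0 T x) l1 l2 l3 e1 e2 e3" 
    and lam: "lambda1 v D t0 T x = l1" "lambda3 v D t0 T x = l3" by (simp_all add: eframe_def)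
  have nn: "norm n = 1" using M(3) by (simp add: unit_normal_def)
  define a c where "a = sqrt (sqrt l1 / (sqrt l1 + sqrt l3))" and "c = sqrt (sqrt l3 / (sqrt l1 + sqrt l3))"
  define m where "m = a *\<^sub>R e1 + c *\<^sub>R e3"
  have mm: "norm m = 1" "shear_form l1 l2 l3 e1 e2 e3 m = (sqrt l3 - sqrt l1)\<^sup>2"
    unfolding m_def a_def c_def using shear_n_plus[OF ef'] by (simp_all add: norm_eq_1)
  \<comment> \<open>All four sign patterns are covered with the sign parameter 1, since signs can be
    absorbed into the orientations of the two eigenvectors.\<close>
  have pm: "is_n_pm v D t0 T x (\<alpha> *\<^sub>R (a *\<^sub>R e1) + \<gamma> *\<^sub>R (c *\<^sub>R e3))"
    if "\<alpha> \<in> {1, -1}" "\<gamma> \<in> {1, -1}" for \<alpha> \<gamma> :: real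
    unfolding is_n_pm_def
  proof (intro bexI[of _ 1] exI conjI)
    show "is_xi1 v D t0 T x (\<alpha> *\<^sub>R e1)" "is_xi3 v D t0 T x (\<gamma> *\<^sub>R e3)"
      using that eframe_is_xi[OF ef] by auto
    show "\<alpha> *\<^sub>R (a *\<^sub>R e1) + \<gamma> *\<^sub>R (c *\<^sub>R e3) = n_pm v D t0 T 1 x (\<alpha> *\<^sub>R e1) (\<gamma> *\<^sub>R e3)"
      by (simp add: n_pm_def lam a_def c_def mult.commute Let_def)
  qed simp
  have l: "0 < l1" "0 < l3" using ef' by (auto simp: eigenframe_def)
  have "x \<in> interior (flow_domain v D t0 T)" using x by (simp add: simple_spectrum_set_def)
  then obtain M' where M': "material_surface v D t0 T M'" "x \<in> M' t0" "unit_normal (M' t0) x m"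
    using competitor_exists mm(1) by blast
  show ?thesis
  proof (cases "parallel m n")
    case True
    then have "n = m \<or> n = - m" using parallel_unit[OF True mm(1) nn] by auto
    then show ?thesis using pm[of 1 1] pm[of "-1" "-1"] by (auto simp: m_def)
  next
    case False
    then have "shear v D t0 T x m \<le> shear v D t0 T x n"
      using M M' unfolding shear_LCS_def by blast
    moreover have "0 \<le> shear v D t0 T x m" by (simp add: shear_def)
    ultimately have "(shear v D t0 T x m)\<^sup>2 \<le> (shear v D t0 T x n)\<^sup>2" by (simp add: power_mono)
    then have ge: "shear_form l1 l2 l3 e1 e2 e3 n \<ge> (sqrt l3 - sqrt l1)\<^sup>2"
      unfolding repulsion_eq(2)[OF ef mm(1)] repulsion_eq(2)[OF ef nn] mm(2) .
    have ex: "n \<bullet> e2 = 0" "(n \<bullet> e1)\<^sup>2 = a\<^sup>2" "(n \<bullet> e3)\<^sup>2 = c\<^sup>2"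
      using shear_extremal[OF ef' _ ge] nn l by (simp_all add: norm_eq_1 a_def c_def)
    have "\<exists>\<alpha>\<in>{1, -1}. n \<bullet> e1 = \<alpha> * a" "\<exists>\<gamma>\<in>{1, -1}. n \<bullet> e3 = \<gamma> * c"
      using ex(2,3) by (auto simp: power2_eq_iff)
    then obtain \<alpha> \<gamma> :: real where "\<alpha> \<in> {1, -1}" "\<gamma> \<in> {1, -1}" "n \<bullet> e1 = \<alpha> * a" "n \<bullet> e3 = \<gamma> * c"
      by blast
    then show ?thesis using frame_expand[OF ef', of n] ex(1) pm[of \<alpha> \<gamma>] by simp
  qed
qed

subsection \<open>Helicity of normal fields\<close>

text \<open>The mean value theorem along \<open>t *\<^sub>R a\<close>, applied to the difference of
  \<open>g\<close> at points shifted by \<open>t *\<^sub>R b\<close>, produces an increment of the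
  gradient. Linearizing the gradient at \<open>p\<close> gives \<open>t *\<^sub>R A b\<close> with
  one error at each of two points, whence the factor 2.\<close>

lemma second_difference_estimate:
  fixes g :: "'a::euclidean_space \<Rightarrow> real"
  assumes dg: "\<And>x. x \<in> ball p d \<Longrightarrow> (g has_derivative (\<lambda>h. G x \<bullet> h)) (at x)"
    and A: "linear A" and e: "e > 0"
    and est: "\<And>y. y \<in> ball p d \<Longrightarrow> norm (G y - G p - A (y - p)) \<le> e * norm (y - p)"
    and t: "t > 0" "t * (norm a + norm b) < d"
  shows "\<bar>g (p + t *\<^sub>R a + t *\<^sub>R b) - g (p + t *\<^sub>R a) - g (p + t *\<^sub>R b) + g p - t\<^sup>2 * (A b \<bullet> a)\<bar>
      \<le> 2 * e * t\<^sup>2 * (norm a + norm b)\<^sup>2"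
proof -
  let ?m = "norm a + norm b"
  have sm: "norm (s *\<^sub>R (t *\<^sub>R a) + r *\<^sub>R (t *\<^sub>R b)) \<le> t * ?m" if "0 \<le> s" "s \<le> 1" "0 \<le> r" "r \<le> 1" for s r
  proof -
    have "norm (s *\<^sub>R (t *\<^sub>R a) + r *\<^sub>R (t *\<^sub>R b)) \<le> s * (t * norm a) + r * (t * norm b)"
      using norm_triangle_ineq[of "s *\<^sub>R (t *\<^sub>R a)" "r *\<^sub>R (t *\<^sub>R b)"] t that by simp
    also have "\<dots> \<le> 1 * (t * norm a) + 1 * (t * norm b)"
      using t that by (intro add_mono mult_right_mono) auto
    finally show ?thesis by (simp add: algebra_simps)
  qed
  have inb: "p + (s *\<^sub>R (t *\<^sub>R a) + r *\<^sub>R (t *\<^sub>R b)) \<in> ball p d" if "0 \<le> s" "s \<le> 1" "0 \<le> r" "r \<le> 1" for s r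
  proof -
    have "dist p (p + v) = norm v" for v by (simp add: dist_norm)
    then show ?thesis using sm[OF that] t unfolding mem_ball by (metis le_less_trans)
  qed
  define k where "k = (\<lambda>s. g (p + (s *\<^sub>R (t *\<^sub>R a) + 1 *\<^sub>R (t *\<^sub>R b))) - g (p + (s *\<^sub>R (t *\<^sub>R a) + 0 *\<^sub>R (t *\<^sub>R b))))"
  define k' where "k' = (\<lambda>s. G (p + (s *\<^sub>R (t *\<^sub>R a) + 1 *\<^sub>R (t *\<^sub>R b))) \<bullet> (t *\<^sub>R a) - G (p + (s *\<^sub>R (t *\<^sub>R a) + 0 *\<^sub>R (t *\<^sub>R b))) \<bullet> (t *\<^sub>R a))"
  have part: "((\<lambda>s. g (p + (s *\<^sub>R (t *\<^sub>R a) + r *\<^sub>R (t *\<^sub>R b)))) has_real_derivative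
      G (p + (s *\<^sub>R (t *\<^sub>R a) + r *\<^sub>R (t *\<^sub>R b))) \<bullet> (t *\<^sub>R a)) (at s)"
    if "0 \<le> s" "s \<le> 1" "0 \<le> r" "r \<le> 1" for s r
  proof -
    have "((\<lambda>s. p + (s *\<^sub>R (t *\<^sub>R a) + r *\<^sub>R (t *\<^sub>R b))) has_derivative (\<lambda>h. h *\<^sub>R (t *\<^sub>R a))) (at s)"
      by (auto intro!: derivative_eq_intros)
    from diff_chain_at[OF this dg[OF inb[OF that]]] show ?thesis
      unfolding has_field_derivative_def by (rule has_derivative_eq_rhs[THEN back_subst[of "\<lambda>f. (f has_derivative _) _"]]) (auto simp: o_def fun_eq_iff)
  qed
  have dk: "(k has_real_derivative k' x) (at x)" if "0 \<le> x" "x \<le> 1" for x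
    unfolding k_def k'_def using that by (intro DERIV_diff part) auto
  have "\<exists>z>0. z < 1 \<and> k 1 - k 0 = (1 - 0) * k' z"
    by (rule MVT2) (use dk in auto)
  then obtain z where z: "0 < z" "z < 1" "k 1 - k 0 = k' z" by auto
  let ?y1 = "p + (z *\<^sub>R (t *\<^sub>R a) + 1 *\<^sub>R (t *\<^sub>R b))" and ?y0 = "p + (z *\<^sub>R (t *\<^sub>R a) + 0 *\<^sub>R (t *\<^sub>R b))"
  define r1 r0 where "r1 = G ?y1 - G p - A (?y1 - p)" and "r0 = G ?y0 - G p - A (?y0 - p)"
  have "norm r1 \<le> e * norm (?y1 - p)" "norm r0 \<le> e * norm (?y0 - p)"
    unfolding r1_def r0_def using z by (intro est inb; simp)+
  moreover have "norm (?y1 - p) \<le> t * ?m" "norm (?y0 - p) \<le> t * ?m"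
    using sm[of z 1] sm[of z 0] z by simp_all
  ultimately have r: "norm r1 \<le> e * (t * ?m)" "norm r0 \<le> e * (t * ?m)"
    using e by (meson mult_left_mono order_trans less_imp_le)+
  have "A (?y1 - p) - A (?y0 - p) = t *\<^sub>R A b"
    by (simp add: linear_add[OF A] linear_cmul[OF A])
  then have "G ?y1 - G ?y0 = t *\<^sub>R A b + (r1 - r0)" by (simp add: r1_def r0_def algebra_simps)
  moreover have "k' z = (G ?y1 - G ?y0) \<bullet> (t *\<^sub>R a)" by (simp only: k'_def inner_diff_left)
  ultimately have "k' z = (t *\<^sub>R A b + (r1 - r0)) \<bullet> (t *\<^sub>R a)" by (simp only:)
  then have "k' z = t\<^sup>2 * (A b \<bullet> a) + (r1 - r0) \<bullet> (t *\<^sub>R a)"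
    by (simp only: inner_add_left inner_scaleR_left inner_scaleR_right power2_eq_square mult.assoc distrib_left)
  moreover have "\<bar>(r1 - r0) \<bullet> (t *\<^sub>R a)\<bar> \<le> 2 * e * t\<^sup>2 * ?m\<^sup>2"
  proof -
    have "\<bar>(r1 - r0) \<bullet> (t *\<^sub>R a)\<bar> \<le> norm (r1 - r0) * norm (t *\<^sub>R a)" by (rule Cauchy_Schwarz_ineq2)
    also have "\<dots> \<le> (2 * (e * (t * ?m))) * (t * ?m)"
    proof (rule mult_mono)
      show "norm (r1 - r0) \<le> 2 * (e * (t * ?m))" using r norm_triangle_ineq4[of r1 r0] by linarith
      show "norm (t *\<^sub>R a) \<le> t * ?m" using t by simp
    qed (use e t in auto)
    finally show ?thesis by (simp add: power2_eq_square algebra_simps)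
  qed
  ultimately show ?thesis using z(3) unfolding k_def by (simp add: algebra_simps)
qed

text \<open>The second difference is symmetric in \<open>a\<close> and \<open>b\<close>, while its
  leading term is the squared step times \<open>A b \<bullet> a\<close> in one order and times
  \<open>A a \<bullet> b\<close> in the other. Dividing by the squared step leaves an arbitrarily
  small discrepancy.\<close>

lemma second_derivative_symmetric:
  fixes g :: "'a::euclidean_space \<Rightarrow> real"
  assumes V: "open V" "p \<in> V" and dg: "\<And>x. x \<in> V \<Longrightarrow> (g has_derivative (\<lambda>h. G x \<bullet> h)) (at x)"
    and A: "(G has_derivative A) (at p)"
  shows "A a \<bullet> b = A b \<bullet> a"
proof -
  let ?m = "norm a + norm b"
  have lin: "linear A" using A has_derivative_linear by blast
  have le: "\<bar>A b \<bullet> a - A a \<bullet> b\<bar> \<le> 4 * e * ?m\<^sup>2" if e: "e > 0" for e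
  proof -
    obtain d1 where d1: "d1 > 0" "\<And>y. norm (y - p) < d1 \<Longrightarrow> norm (G y - G p - A (y - p)) \<le> e * norm (y - p)"
      using A e unfolding has_derivative_at_alt by blast
    obtain d2 where d2: "d2 > 0" "ball p d2 \<subseteq> V" using V by (meson open_contains_ball)
    define d where "d = min d1 d2"
    have d: "d > 0" "ball p d \<subseteq> V" using d1 d2 by (auto simp: d_def)
    have est: "norm (G y - G p - A (y - p)) \<le> e * norm (y - p)" if "y \<in> ball p d" for y
      by (rule d1(2)) (use that in \<open>simp add: d_def dist_norm norm_minus_commute\<close>)
    \<comment> \<open>Any positive \<open>t\<close> with \<open>t * ?m < d\<close> would do; the
      added 1 covers the case that both vectors vanish.\<close>
    define t where "t = d / (?m + 1)"
    have m0: "0 \<le> ?m" by simp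
    then have m1: "?m + 1 > 0" by linarith
    then have t: "t > 0" using d by (simp add: t_def)
    have "t * ?m = d * (?m / (?m + 1))" by (simp add: t_def)
    also have "\<dots> < d * 1" using m1 d by (intro mult_strict_left_mono) (simp_all add: divide_less_eq)
    finally have tm: "t * ?m < d" by simp
    have t': "t * (norm b + norm a) < d" using tm by (simp add: add.commute)
    have dg': "\<And>x. x \<in> ball p d \<Longrightarrow> (g has_derivative (\<lambda>h. G x \<bullet> h)) (at x)" using dg d by blast
    note 1 = second_difference_estimate[OF dg' lin e est t tm]
    note 2 = second_difference_estimate[OF dg' lin e est t t']
    have ab: "p + t *\<^sub>R b + t *\<^sub>R a = p + t *\<^sub>R a + t *\<^sub>R b" "norm b + norm a = ?m" by simp_all
    have "\<bar>t\<^sup>2 * (A b \<bullet> a) - t\<^sup>2 * (A a \<bullet> b)\<bar> \<le> 2 * (2 * e * t\<^sup>2 * ?m\<^sup>2)"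
      using 1 2[unfolded ab] by linarith
    then have "t\<^sup>2 * \<bar>A b \<bullet> a - A a \<bullet> b\<bar> \<le> t\<^sup>2 * (4 * e * ?m\<^sup>2)"
      unfolding right_diff_distrib[symmetric] abs_mult by (simp add: algebra_simps)
    then show ?thesis using t by simp
  qed
  have "\<bar>A b \<bullet> a - A a \<bullet> b\<bar> \<le> 0"
  proof (rule field_le_epsilon)
    fix e :: real assume e: "e > 0"
    have p: "4 * (?m\<^sup>2 + 1) > 0" by (simp add: add_nonneg_pos)
    have "\<bar>A b \<bullet> a - A a \<bullet> b\<bar> \<le> 4 * (e / (4 * (?m\<^sup>2 + 1))) * ?m\<^sup>2"
      by (rule le) (use e p in simp)
    also have "\<dots> = e * (?m\<^sup>2 / (?m\<^sup>2 + 1))"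
      unfolding times_divide_eq_right mult_divide_mult_cancel_left_if by simp
    also have "\<dots> \<le> e * 1" using e p by (intro mult_left_mono) (auto simp: divide_le_eq_1)
    finally show "\<bar>A b \<bullet> a - A a \<bullet> b\<bar> \<le> 0 + e" by simp
  qed
  then show ?thesis by simp
qed

text \<open>The curl is the axial vector of the antisymmetric part of the Jacobian, and this pairing
  is how that part acts on two vectors.\<close>

lemma curl_inner_cross:
  assumes "(w has_derivative D) (at p)"
  shows "curl w p \<bullet> cross3 a b = D a \<bullet> b - D b \<bullet> a"
proof -
  define J where "J = jacobian w (at p)"
  have fd: "frechet_derivative w (at p) = D" using frechet_derivative_at[OF assms] by simp
  have "D = (\<lambda>h. J *v h)"
    unfolding J_def jacobian_def fd using has_derivative_linear[OF assms] by simp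
  then have D: "D h = J *v h" for h by simp
  show ?thesis
    unfolding curl_def J_def[symmetric] D Let_def
    by (simp add: cross3_simps matrix_vector_mult_def sum_3 forall_3)
qed

text \<open>Frobenius: on tangent vectors the antisymmetric part of the derivative of \<open>w = \<kappa> grad g\<close>
  reduces to the Hessian of \<open>g\<close>, which is symmetric.\<close>

lemma helicity_normal_field:
  assumes M: "defining M U g" "p \<in> M" "p \<in> U"
    and w: "w differentiable (at p)" and V: "open V" "p \<in> V"
    and par: "\<And>x. x \<in> M \<inter> V \<inter> U \<Longrightarrow> parallel (w x) (grad g x)"
  shows "helicity w p = 0"
proof -
  have sm: "smooth_on U g" using M by (simp add: defining_def)
  note C1 = smooth_on_C1[OF sm]
  let ?G = "grad g"
  obtain D where D: "(w has_derivative D) (at p)" using w unfolding differentiable_def by blast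
  obtain A where A: "(?G has_derivative A) (at p)" using C1(5)[OF M(3)] unfolding differentiable_def by blast
  have nz: "?G x \<noteq> 0" if "x \<in> U" for x using M that by (simp add: defining_def)
  \<comment> \<open>Written as a quotient of inner products, the factor makes sense on a whole
    neighbourhood and is differentiable at \<open>p\<close>. The identity
    \<open>w = \<kappa> grad g\<close> holds only on the surface, so the derivatives can be compared
    along tangent vectors alone.\<close>
  define \<kappa> where "\<kappa> = (\<lambda>x. (w x \<bullet> ?G x) / (?G x \<bullet> ?G x))"
  have w\<kappa>: "w x = \<kappa> x *\<^sub>R ?G x" if "x \<in> M \<inter> V \<inter> U" for x
    unfolding \<kappa>_def using parallelD[OF par[OF that]] nz that by auto
  have "\<exists>K. (\<kappa> has_derivative K) (at p)"
    unfolding \<kappa>_def using nz[OF M(3)] 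
      has_derivative_divide[OF has_derivative_inner[OF D A] has_derivative_inner[OF A A]] by auto
  then obtain K where K: "(\<kappa> has_derivative K) (at p)" by blast
  have Dt: "D a = \<kappa> p *\<^sub>R A a + K a *\<^sub>R ?G p" if a: "?G p \<bullet> a = 0" for a
  proof -
    have "a \<in> tangent_vectors M p" using tangent_vectors_eq[OF M] a by simp
    then obtain c where c: "c 0 = p" "\<forall>\<^sub>F s in at 0. c s \<in> M" "(c has_derivative (\<lambda>s. s *\<^sub>R a)) (at (0::real))"
      unfolding tangent_vectors_def has_vector_derivative_def by auto
    have "isCont c 0" using c(3) has_derivative_continuous by blast
    then have "\<forall>\<^sub>F s in at 0. c s \<in> V \<inter> U"
      using C1(1) V M(3) c(1) by (metis IntI continuous_within open_Int topological_tendstoD)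
    with c(2) have ev: "\<forall>\<^sub>F s in at 0. (w \<circ> c) s = \<kappa> (c s) *\<^sub>R ?G (c s)"
      by eventually_elim (use w\<kappa> in auto)
    have "((w \<circ> c) has_derivative (\<lambda>s. D (s *\<^sub>R a))) (at 0)"
      using diff_chain_at[OF c(3), of w D] D c(1) by (simp add: o_def)
    moreover have "((\<lambda>s. \<kappa> (c s) *\<^sub>R ?G (c s)) has_derivative (\<lambda>s. \<kappa> p *\<^sub>R A (s *\<^sub>R a) + K (s *\<^sub>R a) *\<^sub>R ?G p)) (at 0)"
      using has_derivative_scaleR[OF diff_chain_at[OF c(3), of \<kappa> K] diff_chain_at[OF c(3), of ?G A]] A K c(1)
      by (simp add: o_def)
    then have "((w \<circ> c) has_derivative (\<lambda>s. \<kappa> p *\<^sub>R A (s *\<^sub>R a) + K (s *\<^sub>R a) *\<^sub>R ?G p)) (at 0)"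
    proof (rule has_derivative_transform_eventually)
      show "\<forall>\<^sub>F s in at 0. \<kappa> (c s) *\<^sub>R ?G (c s) = (w \<circ> c) s" using ev by eventually_elim simp
      show "\<kappa> (c 0) *\<^sub>R ?G (c 0) = (w \<circ> c) 0" using w\<kappa>[of p] M V c(1) by simp
    qed simp
    ultimately have "(\<lambda>s. D (s *\<^sub>R a)) = (\<lambda>s. \<kappa> p *\<^sub>R A (s *\<^sub>R a) + K (s *\<^sub>R a) *\<^sub>R ?G p)"
      by (rule has_derivative_unique)
    from fun_cong[OF this, of 1] show ?thesis by simp
  qed
  obtain k1 k2 where k: "?G p \<bullet> k1 = 0" "?G p \<bullet> k2 = 0" "cross3 k1 k2 = ?G p"
    using frame_exists[OF nz[OF M(3)]] by metis
  have "curl w p \<bullet> ?G p = D k1 \<bullet> k2 - D k2 \<bullet> k1" using curl_inner_cross[OF D, of k1 k2] k(3) by simp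
  \<comment> \<open>The terms containing the derivative of \<kappa> are multiples of
    \<open>?G p\<close> and vanish against the tangent vectors \<open>k1\<close> and
    \<open>k2\<close>.\<close>
  also have "\<dots> = \<kappa> p * (A k1 \<bullet> k2 - A k2 \<bullet> k1)"
    unfolding Dt[OF k(1)] Dt[OF k(2)] using k by (simp add: inner_add_left right_diff_distrib)
  also have "A k1 \<bullet> k2 = A k2 \<bullet> k1"
    by (rule second_derivative_symmetric[OF C1(1) M(3) C1(2) A])
  finally have "curl w p \<bullet> ?G p = 0" by simp
  then show ?thesis unfolding helicity_def using w\<kappa>[of p] M V by simp
qed

subsection \<open>Families of curves and their unit-speed flow\<close>

text \<open>The leaf \<open>X s\<close> inside \<open>W\<close> is parametrized by arclength through \<open>\<beta> s\<close>, with unit tangent \<open>T s\<close> and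
  inverse \<open>a s\<close>, all jointly continuous in the parameter \<open>s\<close>.\<close>

definition leaf_box ::
  "(real \<Rightarrow> 'a::euclidean_space set) \<Rightarrow> real \<Rightarrow> 'a \<Rightarrow> real \<Rightarrow> (real \<times> 'a) set \<Rightarrow>
   (real \<Rightarrow> real \<Rightarrow> 'a) \<Rightarrow> (real \<Rightarrow> real \<Rightarrow> 'a) \<Rightarrow> (real \<Rightarrow> 'a \<Rightarrow> real) \<Rightarrow> bool" where
  "leaf_box X s0 x0 \<epsilon> W \<beta> T a \<longleftrightarrow> 0 < \<epsilon> \<and> open W \<and> (s0, x0) \<in> W \<and> a s0 x0 = 0 \<and>
     (\<forall>s u. \<bar>s - s0\<bar> < \<epsilon> \<and> \<bar>u\<bar> < \<epsilon> \<longrightarrow> \<beta> s u \<in> X s \<and> (s, \<beta> s u) \<in> W \<and> a s (\<beta> s u) = u \<and>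
        norm (T s u) = 1 \<and> (\<beta> s has_vector_derivative T s u) (at u)) \<and>
     (\<forall>s x. (s, x) \<in> W \<and> x \<in> X s \<longrightarrow> \<bar>s - s0\<bar> < \<epsilon> \<and> \<bar>a s x\<bar> < \<epsilon> \<and> \<beta> s (a s x) = x \<and>
        a s differentiable (at x)) \<and>
     continuous_on {z. \<bar>fst z - s0\<bar> < \<epsilon> \<and> \<bar>snd z\<bar> < \<epsilon>} (\<lambda>z. \<beta> (fst z) (snd z)) \<and>
     continuous_on {z. \<bar>fst z - s0\<bar> < \<epsilon> \<and> \<bar>snd z\<bar> < \<epsilon>} (\<lambda>z. T (fst z) (snd z)) \<and>
     continuous_on {z \<in> W. snd z \<in> X (fst z)} (\<lambda>z. a (fst z) (snd z))"

lemma leaf_boxD: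
  assumes "leaf_box X s0 x0 \<epsilon> W \<beta> T a"
  shows "0 < \<epsilon>" "open W" "(s0, x0) \<in> W" "a s0 x0 = 0"
    "\<And>s u. \<bar>s - s0\<bar> < \<epsilon> \<Longrightarrow> \<bar>u\<bar> < \<epsilon> \<Longrightarrow> \<beta> s u \<in> X s"
    "\<And>s u. \<bar>s - s0\<bar> < \<epsilon> \<Longrightarrow> \<bar>u\<bar> < \<epsilon> \<Longrightarrow> (s, \<beta> s u) \<in> W"
    "\<And>s u. \<bar>s - s0\<bar> < \<epsilon> \<Longrightarrow> \<bar>u\<bar> < \<epsilon> \<Longrightarrow> a s (\<beta> s u) = u"
    "\<And>s u. \<bar>s - s0\<bar> < \<epsilon> \<Longrightarrow> \<bar>u\<bar> < \<epsilon> \<Longrightarrow> norm (T s u) = 1"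
    "\<And>s u. \<bar>s - s0\<bar> < \<epsilon> \<Longrightarrow> \<bar>u\<bar> < \<epsilon> \<Longrightarrow> (\<beta> s has_vector_derivative T s u) (at u)"
    "\<And>s x. (s, x) \<in> W \<Longrightarrow> x \<in> X s \<Longrightarrow> \<bar>s - s0\<bar> < \<epsilon>"
    "\<And>s x. (s, x) \<in> W \<Longrightarrow> x \<in> X s \<Longrightarrow> \<bar>a s x\<bar> < \<epsilon>"
    "\<And>s x. (s, x) \<in> W \<Longrightarrow> x \<in> X s \<Longrightarrow> \<beta> s (a s x) = x"
    "\<And>s x. (s, x) \<in> W \<Longrightarrow> x \<in> X s \<Longrightarrow> a s differentiable (at x)"
    "continuous_on {z. \<bar>fst z - s0\<bar> < \<epsilon> \<and> \<bar>snd z\<bar> < \<epsilon>} (\<lambda>z. \<beta> (fst z) (snd z))"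
    "continuous_on {z. \<bar>fst z - s0\<bar> < \<epsilon> \<and> \<bar>snd z\<bar> < \<epsilon>} (\<lambda>z. T (fst z) (snd z))"
    "continuous_on {z \<in> W. snd z \<in> X (fst z)} (\<lambda>z. a (fst z) (snd z))"
  using assms unfolding leaf_box_def by blast+

definition unit_curve ::
  "('a::real_normed_vector) set \<Rightarrow> real set \<Rightarrow> (real \<Rightarrow> 'a) \<Rightarrow> (real \<Rightarrow> 'a) \<Rightarrow> bool" where
  "unit_curve X J y \<sigma> \<longleftrightarrow> open J \<and> is_interval J \<and> continuous_on J \<sigma> \<and>
     (\<forall>t\<in>J. y t \<in> X \<and> norm (\<sigma> t) = 1 \<and> (y has_vector_derivative \<sigma> t) (at t))"

lemma unit_curveD:
  assumes "unit_curve X J y \<sigma>"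
  shows "open J" "is_interval J" "connected J" "continuous_on J \<sigma>" "continuous_on J y"
    "\<And>t. t \<in> J \<Longrightarrow> y t \<in> X" "\<And>t. t \<in> J \<Longrightarrow> norm (\<sigma> t) = 1"
    "\<And>t. t \<in> J \<Longrightarrow> (y has_vector_derivative \<sigma> t) (at t)"
  using assms unfolding unit_curve_def
  by (auto simp: is_interval_connected intro!: continuous_at_imp_continuous_on has_vector_derivative_continuous)

lemma unit_curve_subset:
  "unit_curve X J y \<sigma> \<Longrightarrow> J' \<subseteq> J \<Longrightarrow> open J' \<Longrightarrow> is_interval J' \<Longrightarrow> unit_curve X J' y \<sigma>"
  unfolding unit_curve_def by (auto intro: continuous_on_subset)

lemma is_interval_affine_vimage:
  fixes J :: "real set"
  assumes "is_interval J"
  shows "is_interval {r. t + c * r \<in> J}"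
proof -
  have "convex ((\<lambda>r. t + c * r) -` J)"
  proof -
    have "{r. t + c * r \<in> J} = (*) c -` ((+) (-t) ` J)"
      by (auto simp: image_iff) (metis add.commute add_diff_cancel_left' diff_conv_add_uminus)
    moreover have "convex ((*) c -` ((+) (-t) ` J))"
      using assms by (intro convex_linear_vimage convex_translation) (auto simp: is_interval_convex_1 linear_times)
    ultimately show ?thesis by (simp add: vimage_def)
  qed
  then show ?thesis by (simp add: is_interval_convex_1 vimage_def)
qed

lemma unit_curve_affine:
  assumes y: "unit_curve X J y \<sigma>" and c: "c \<in> {1, -1 :: real}"
  shows "unit_curve X {r. t + c * r \<in> J} (\<lambda>r. y (t + c * r)) (\<lambda>r. c *\<^sub>R \<sigma> (t + c * r))"
  unfolding unit_curve_def
proof (intro conjI ballI)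
  note D = unit_curveD[OF y]
  show "open {r. t + c * r \<in> J}"
  proof -
    have "continuous_on UNIV (\<lambda>r. t + c * r)" by (intro continuous_intros)
    from open_vimage[OF D(1) this] show ?thesis by (simp add: vimage_def)
  qed
  show "is_interval {r. t + c * r \<in> J}" by (rule is_interval_affine_vimage[OF D(2)])
  have "continuous_on {r. t + c * r \<in> J} (\<lambda>r. \<sigma> (t + c * r))"
    by (rule continuous_on_compose2[OF D(4)]) (auto intro!: continuous_intros)
  then show "continuous_on {r. t + c * r \<in> J} (\<lambda>r. c *\<^sub>R \<sigma> (t + c * r))"
    by (intro continuous_intros)
  fix r assume r: "r \<in> {r. t + c * r \<in> J}"
  show "y (t + c * r) \<in> X" "norm (c *\<^sub>R \<sigma> (t + c * r)) = 1" using r D c by auto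
  have "((\<lambda>r. t + c * r) has_vector_derivative c) (at r)"
    by (auto intro!: derivative_eq_intros)
  from vector_diff_chain_at[OF this D(8)] show "((\<lambda>r. y (t + c * r)) has_vector_derivative c *\<^sub>R \<sigma> (t + c * r)) (at r)"
    using r by (simp add: o_def)
qed

text \<open>Continuation principle for locally constant properties. Uniqueness and completeness of
  unit-speed curves, continuity of their flow, transitivity on a leaf and uniqueness of side
  functions all rest on it.\<close>

lemma connected_propagate:
  assumes "connected I" "t0 \<in> I" "t \<in> I" "Q t0"
    and loc: "\<And>t. t \<in> I \<Longrightarrow> \<exists>U. open U \<and> t \<in> U \<and> (\<forall>t'\<in>U \<inter> I. Q t' \<longleftrightarrow> Q t)"
  shows "Q t"
proof -
  have "(\<lambda>x y. Q x \<longleftrightarrow> Q y) t0 t"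
  proof (rule connected_equivalence_relation[OF assms(1-3)])
    fix t assume t: "t \<in> I"
    obtain U where U: "open U" "t \<in> U" "\<forall>t'\<in>U \<inter> I. Q t' \<longleftrightarrow> Q t" using loc[OF t] by blast
    have "openin (top_of_set I) (I \<inter> U)" using U(1) by (rule openin_open_Int)
    moreover have "t \<in> I \<inter> U" using t U(2) by blast
    moreover have "\<forall>x\<in>I \<inter> U. Q t \<longleftrightarrow> Q x" using U(3) by blast
    ultimately show "\<exists>T. openin (top_of_set I) T \<and> t \<in> T \<and> (\<forall>x\<in>T. Q t \<longleftrightarrow> Q x)" by blast
  qed blast+
  with assms(4) show ?thesis by simp
qed

lemma unit_curve_near:
  assumes y: "unit_curve X J y \<sigma>" and W: "open W" "(s, y t) \<in> W" and t: "t \<in> J"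
  shows "\<exists>\<delta>>0. ball t \<delta> \<subseteq> J \<and> (\<forall>t'\<in>ball t \<delta>. (s, y t') \<in> W)"
proof -
  have "continuous_on J (\<lambda>t. (s, y t))" using unit_curveD(5)[OF y] by (intro continuous_intros)
  then have "open (J \<inter> (\<lambda>t. (s, y t)) -` W)"
    using unit_curveD(1)[OF y] W(1) by (intro continuous_open_preimage)
  moreover have "t \<in> J \<inter> (\<lambda>t. (s, y t)) -` W" using W t by simp
  ultimately obtain \<delta> where "\<delta> > 0" "ball t \<delta> \<subseteq> J \<inter> (\<lambda>t. (s, y t)) -` W" by (meson open_contains_ball)
  then show ?thesis by (intro exI[of _ \<delta>]) auto
qed

lemma box_unit_curve:
  assumes B: "leaf_box X s0 x0 \<epsilon> W \<beta> T a" and s: "\<bar>s - s0\<bar> < \<epsilon>"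
  shows "unit_curve (X s) {-\<epsilon><..<\<epsilon>} (\<beta> s) (T s)"
  unfolding unit_curve_def
proof (intro conjI ballI)
  have "continuous_on {-\<epsilon><..<\<epsilon>} (\<lambda>u. (\<lambda>z. T (fst z) (snd z)) (s, u))"
    by (rule continuous_on_compose2[OF leaf_boxD(15)[OF B]]) (use s in \<open>auto intro!: continuous_intros\<close>)
  then show "continuous_on {-\<epsilon><..<\<epsilon>} (T s)" by simp
qed (use leaf_boxD[OF B] s in \<open>auto simp: is_interval_oo\<close>)

text \<open>Inside a box the leaf is one arc with arclength coordinate \<open>a s\<close>. Along a
  curve of unit speed this coordinate has derivative 1 or -1; the derivative is continuous because
  the velocity is, hence constant, and the curve runs along \<beta> in one of two
  directions.\<close>

lemma unit_curve_in_box: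
  assumes B: "leaf_box X s0 x0 \<epsilon> W \<beta> T a"
    and y: "unit_curve (X s) J y \<sigma>" and W: "\<And>t. t \<in> J \<Longrightarrow> (s, y t) \<in> W" and t1: "t1 \<in> J"
  shows "\<exists>c\<in>{1,-1}. \<forall>t\<in>J. y t = \<beta> s (a s (y t1) + c * (t - t1)) \<and>
     \<sigma> t = c *\<^sub>R T s (a s (y t1) + c * (t - t1))"
proof -
  note D = unit_curveD[OF y] and BD = leaf_boxD[OF B]
  have s: "\<bar>s - s0\<bar> < \<epsilon>" using BD(10)[OF W D(6)] t1 by blast
  note C = unit_curveD[OF box_unit_curve[OF B s]]
  define p where "p = (\<lambda>t. a s (y t))"
  have p: "\<bar>p t\<bar> < \<epsilon>" "\<beta> s (p t) = y t" if "t \<in> J" for t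
    using BD(11,12)[OF W D(6)] that by (auto simp: p_def)
  have p\<epsilon>: "p t \<in> {-\<epsilon><..<\<epsilon>}" if "t \<in> J" for t
    using p(1)[OF that] by auto
  have "\<exists>p'. (p has_real_derivative p') (at t) \<and> \<sigma> t = p' *\<^sub>R T s (p t)" if t: "t \<in> J" for t
  proof -
    obtain A where A: "(a s has_derivative A) (at (y t))"
      using BD(13)[OF W[OF t] D(6)[OF t]] unfolding differentiable_def by blast
    have "(p has_derivative (\<lambda>h. A (h *\<^sub>R \<sigma> t))) (at t)"
      using diff_chain_at[OF D(8)[OF t, unfolded has_vector_derivative_def] A] by (simp add: o_def p_def)
    moreover have "A (h *\<^sub>R \<sigma> t) = A (\<sigma> t) * h" for h
      using linear_scale[OF has_derivative_linear[OF A]] by simp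
    ultimately have pd: "(p has_real_derivative A (\<sigma> t)) (at t)"
      by (simp add: has_field_derivative_def)
    then have "(p has_vector_derivative A (\<sigma> t)) (at t)"
      by (simp add: has_real_derivative_iff_has_vector_derivative)
    from vector_diff_chain_at[OF this, of "\<beta> s" "T s (p t)"]
    have "((\<beta> s \<circ> p) has_vector_derivative A (\<sigma> t) *\<^sub>R T s (p t)) (at t)"
      using C(8)[OF p\<epsilon>[OF t]] by blast
    then have "(y has_vector_derivative A (\<sigma> t) *\<^sub>R T s (p t)) (at t)"
      by (rule has_vector_derivative_transform_within_open[OF _ D(1) t]) (simp add: p(2))
    with D(8)[OF t] have "\<sigma> t = A (\<sigma> t) *\<^sub>R T s (p t)" by (rule vector_derivative_unique_at)
    with pd show ?thesis by blast
  qed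
  then obtain p' where p': "\<And>t. t \<in> J \<Longrightarrow> (p has_real_derivative p' t) (at t)"
      "\<And>t. t \<in> J \<Longrightarrow> \<sigma> t = p' t *\<^sub>R T s (p t)" by metis
  have contp: "continuous_on J p"
    using p'(1) by (auto intro!: continuous_at_imp_continuous_on DERIV_isCont)
  have nT: "norm (T s (p t)) = 1" if "t \<in> J" for t using C(7)[OF p\<epsilon>[OF that]] .
  have p'1: "p' t \<in> {1, -1}" if "t \<in> J" for t
  proof -
    have "\<bar>p' t\<bar> = 1" using D(7)[OF that] nT[OF that] p'(2)[OF that] by simp
    then show ?thesis by auto
  qed
  have "p' t = \<sigma> t \<bullet> T s (p t)" if "t \<in> J" for t
    using nT[OF that] p'(2)[OF that] by (simp add: norm_eq_1)
  moreover have "continuous_on J (\<lambda>t. \<sigma> t \<bullet> T s (p t))"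
    by (intro continuous_intros D(4) continuous_on_compose2[OF C(4) contp]) (use p\<epsilon> in blast)
  ultimately have "continuous_on J p'" by (simp cong: continuous_on_cong)
  moreover have "finite (p' ` J)" by (rule finite_subset[of _ "{1, -1}"]) (use p'1 in auto)
  ultimately have "p' constant_on J" by (rule continuous_finite_range_constant[OF D(3)])
  then obtain c where c: "\<And>t. t \<in> J \<Longrightarrow> p' t = c" unfolding constant_on_def by blast
  have c1: "c \<in> {1, -1}" using p'1[OF t1] c[OF t1] by simp
  have "\<exists>k. \<forall>t\<in>J. p t - c * t = k"
  proof (rule has_field_derivative_zero_constant)
    show "convex J" using D(2) by (simp add: is_interval_convex_1)
    fix t assume t: "t \<in> J"
    show "((\<lambda>t. p t - c * t) has_real_derivative 0) (at t within J)"
      using has_field_derivative_at_within[OF p'(1)[OF t]] c[OF t] by (auto intro!: derivative_eq_intros)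
  qed
  then obtain k where k: "\<And>t. t \<in> J \<Longrightarrow> p t - c * t = k" by blast
  have pt: "p t = a s (y t1) + c * (t - t1)" if "t \<in> J" for t
    using k[OF that] k[OF t1] by (simp add: p_def algebra_simps)
  show ?thesis
    by (rule bexI[OF _ c1]) (use pt p(2) p'(2) c in \<open>auto simp flip: pt\<close>)
qed

lemma unit_curve_affine_box:
  assumes B: "leaf_box X s0 x0 \<epsilon> W \<beta> T a" and x: "(s, x) \<in> W" "x \<in> X s" and c: "c \<in> {1, -1}"
  shows "unit_curve (X s) {t. \<bar>a s x + c * t\<bar> < \<epsilon>} (\<lambda>t. \<beta> s (a s x + c * t)) (\<lambda>t. c *\<^sub>R T s (a s x + c * t))"
proof -
  have "\<bar>s - s0\<bar> < \<epsilon>" using leaf_boxD(10)[OF B] x by blast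
  note A = unit_curve_affine[OF box_unit_curve[OF B this] c, of "a s x"]
  have "{t. a s x + c * t \<in> {-\<epsilon><..<\<epsilon>}} = {t. \<bar>a s x + c * t\<bar> < \<epsilon>}" by auto
  with A show ?thesis by simp
qed

section \<open>The flow on unit tangent states of the leaves\<close>

locale leaf_space =
  fixes X :: "real \<Rightarrow> 'a::euclidean_space set"
  assumes box_exists: "x \<in> X s \<Longrightarrow> \<exists>\<epsilon> W \<beta> T a. leaf_box X s x \<epsilon> W \<beta> T a"
begin

text \<open>Agreement of position and velocity is locally constant in time. Where both agree, the
  curves run in a common box, in which only a sign is free and the velocity fixes it. Where they
  differ, continuity keeps them different.\<close>

lemma unit_curve_unique:
  assumes y1: "unit_curve (X s) J1 y1 \<sigma>1" and y2: "unit_curve (X s) J2 y2 \<sigma>2"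
    and t0: "t0 \<in> J1" "t0 \<in> J2" "y1 t0 = y2 t0" "\<sigma>1 t0 = \<sigma>2 t0" and t: "t \<in> J1" "t \<in> J2"
  shows "y1 t = y2 t \<and> \<sigma>1 t = \<sigma>2 t"
proof (rule connected_propagate[where I = "J1 \<inter> J2" and ?t0.0 = t0])
  note D1 = unit_curveD[OF y1] and D2 = unit_curveD[OF y2]
  show "connected (J1 \<inter> J2)" using D1(2) D2(2) by (metis is_interval_Int is_interval_connected)
  fix t assume t: "t \<in> J1 \<inter> J2"
  show "\<exists>U. open U \<and> t \<in> U \<and> (\<forall>t'\<in>U \<inter> (J1 \<inter> J2).
      (y1 t' = y2 t' \<and> \<sigma>1 t' = \<sigma>2 t') = (y1 t = y2 t \<and> \<sigma>1 t = \<sigma>2 t))"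
  proof (cases "y1 t = y2 t \<and> \<sigma>1 t = \<sigma>2 t")
    case True
    obtain \<epsilon> W \<beta> T a where B: "leaf_box X s (y1 t) \<epsilon> W \<beta> T a" using box_exists D1(6) t by blast
    obtain \<delta>1 where \<delta>1: "\<delta>1 > 0" "ball t \<delta>1 \<subseteq> J1" "\<forall>t'\<in>ball t \<delta>1. (s, y1 t') \<in> W"
      using unit_curve_near[OF y1 leaf_boxD(2)[OF B], of s t] leaf_boxD(3)[OF B] t by blast
    obtain \<delta>2 where \<delta>2: "\<delta>2 > 0" "ball t \<delta>2 \<subseteq> J2" "\<forall>t'\<in>ball t \<delta>2. (s, y2 t') \<in> W"
      using unit_curve_near[OF y2 leaf_boxD(2)[OF B], of s t] leaf_boxD(3)[OF B] t True by auto
    define U where "U = ball t (min \<delta>1 \<delta>2)"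
    have U: "open U" "is_interval U" "t \<in> U" "U \<subseteq> J1" "U \<subseteq> J2"
      using \<delta>1 \<delta>2 by (auto simp: U_def is_interval_ball_real)
    have "\<exists>c\<in>{1,-1}. \<forall>t'\<in>U. y1 t' = \<beta> s (a s (y1 t) + c * (t' - t)) \<and>
     \<sigma>1 t' = c *\<^sub>R T s (a s (y1 t) + c * (t' - t))"
      by (rule unit_curve_in_box[OF B unit_curve_subset[OF y1 U(4,1,2)] _ U(3)])
         (use \<delta>1(3) in \<open>auto simp: U_def\<close>)
    then obtain c1 where c1: "c1 \<in> {1,-1}" "\<forall>t'\<in>U. y1 t' = \<beta> s (a s (y1 t) + c1 * (t' - t)) \<and>
     \<sigma>1 t' = c1 *\<^sub>R T s (a s (y1 t) + c1 * (t' - t))" by blast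
    have "\<exists>c\<in>{1,-1}. \<forall>t'\<in>U. y2 t' = \<beta> s (a s (y2 t) + c * (t' - t)) \<and>
     \<sigma>2 t' = c *\<^sub>R T s (a s (y2 t) + c * (t' - t))"
      by (rule unit_curve_in_box[OF B unit_curve_subset[OF y2 U(5,1,2)] _ U(3)])
         (use \<delta>2(3) in \<open>auto simp: U_def\<close>)
    then obtain c2 where c2: "c2 \<in> {1,-1}" "\<forall>t'\<in>U. y2 t' = \<beta> s (a s (y2 t) + c2 * (t' - t)) \<and>
     \<sigma>2 t' = c2 *\<^sub>R T s (a s (y2 t) + c2 * (t' - t))" by blast
    have "c1 *\<^sub>R T s (a s (y1 t)) = c2 *\<^sub>R T s (a s (y1 t))"
      using c1(2) c2(2) U(3) True by (metis cancel_comm_monoid_add_class.diff_cancel mult_zero_right add.right_neutral)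
    moreover have "T s (a s (y1 t)) \<noteq> 0"
      using leaf_boxD(8)[OF B, of s "a s (y1 t)"] leaf_boxD(1,4)[OF B] by force
    ultimately have "c1 = c2" by simp
    then have "\<forall>t'\<in>U. y1 t' = y2 t' \<and> \<sigma>1 t' = \<sigma>2 t'" using c1(2) c2(2) True by simp
    then show ?thesis using U(1,3) True by blast
  next
    case False
    let ?f = "\<lambda>t. (y1 t - y2 t, \<sigma>1 t - \<sigma>2 t)"
    have "continuous_on (J1 \<inter> J2) ?f"
      using D1(4,5) D2(4,5) by (intro continuous_intros; blast intro: continuous_on_subset)
    then have "open ((J1 \<inter> J2) \<inter> ?f -` (- {0}))"
      using D1(1) D2(1) by (intro continuous_open_preimage) auto
    then show ?thesis using False t
      by (intro exI[of _ "(J1 \<inter> J2) \<inter> ?f -` (- {0})"]) (auto simp: zero_prod_def)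
  qed
qed (use t t0 in auto)

text \<open>States are unit tangent vectors of leaves, so that both orientations of a leaf are treated at once;
  \<open>flow s z t\<close> is the state reached from \<open>z\<close> along \<open>X s\<close> at time \<open>t\<close>, with a junk value outside
  \<open>flow_dom s z\<close>.\<close>

definition states :: "(real \<times> 'a \<times> 'a) set" where
  "states = {(s, z). \<exists>J y \<sigma>. unit_curve (X s) J y \<sigma> \<and> 0 \<in> J \<and> z = (y 0, \<sigma> 0)}"

definition flow_dom :: "real \<Rightarrow> 'a \<times> 'a \<Rightarrow> real set" where
  "flow_dom s z = \<Union>{J. \<exists>y \<sigma>. unit_curve (X s) J y \<sigma> \<and> 0 \<in> J \<and> z = (y 0, \<sigma> 0)}"

definition flow :: "real \<Rightarrow> 'a \<times> 'a \<Rightarrow> real \<Rightarrow> 'a \<times> 'a" where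
  "flow s z t = (SOME w. \<exists>J y \<sigma>. unit_curve (X s) J y \<sigma> \<and> 0 \<in> J \<and> z = (y 0, \<sigma> 0) \<and> t \<in> J \<and> w = (y t, \<sigma> t))"

lemma flow_eqI:
  assumes y: "unit_curve (X s) J y \<sigma>" "0 \<in> J" "z = (y 0, \<sigma> 0)" "t \<in> J"
  shows "t \<in> flow_dom s z" "flow s z t = (y t, \<sigma> t)"
proof -
  show "t \<in> flow_dom s z" using y unfolding flow_dom_def by blast
  let ?P = "\<lambda>w. \<exists>J y \<sigma>. unit_curve (X s) J y \<sigma> \<and> 0 \<in> J \<and> z = (y 0, \<sigma> 0) \<and> t \<in> J \<and> w = (y t, \<sigma> t)"
  have "?P (y t, \<sigma> t)" using y by blast
  then have "?P (flow s z t)" unfolding flow_def by (rule someI)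
  then obtain J' y' \<sigma>' where y': "unit_curve (X s) J' y' \<sigma>'" "0 \<in> J'" "z = (y' 0, \<sigma>' 0)" "t \<in> J'"
    "flow s z t = (y' t, \<sigma>' t)" by blast
  then show "flow s z t = (y t, \<sigma> t)"
    using unit_curve_unique[OF y(1) y'(1) y(2) y'(2) _ _ y(4) y'(4)] y(3) by auto
qed

text \<open>All unit curves starting at \<open>z\<close> have domains containing 0 and agree on
  overlaps by uniqueness, so their union is the maximal one.\<close>

lemma flow_unit_curve:
  assumes z: "(s, z) \<in> states"
  shows "unit_curve (X s) (flow_dom s z) (\<lambda>t. fst (flow s z t)) (\<lambda>t. snd (flow s z t))"
    "0 \<in> flow_dom s z" "flow s z 0 = z"
proof -
  obtain J0 y0 \<sigma>0 where 0: "unit_curve (X s) J0 y0 \<sigma>0" "0 \<in> J0" "z = (y0 0, \<sigma>0 0)"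
    using z unfolding states_def by blast
  show "0 \<in> flow_dom s z" "flow s z 0 = z" using flow_eqI[OF 0 0(2)] 0(3) by auto
  have ex: "\<exists>J y \<sigma>. unit_curve (X s) J y \<sigma> \<and> J \<subseteq> flow_dom s z \<and> t \<in> J \<and> (\<forall>r\<in>J. flow s z r = (y r, \<sigma> r))"
    if t: "t \<in> flow_dom s z" for t
  proof -
    obtain J y \<sigma> where J: "unit_curve (X s) J y \<sigma>" "0 \<in> J" "z = (y 0, \<sigma> 0)" "t \<in> J"
      using t unfolding flow_dom_def by blast
    then show ?thesis using flow_eqI[OF J(1-3)] by blast
  qed
  have op: "open (flow_dom s z)"
    unfolding flow_dom_def by (rule open_Union) (auto simp: unit_curve_def)
  have conn: "connected (flow_dom s z)"
    unfolding flow_dom_def using unit_curveD(3) by (intro connected_Union) blast+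
  show "unit_curve (X s) (flow_dom s z) (\<lambda>t. fst (flow s z t)) (\<lambda>t. snd (flow s z t))"
    unfolding unit_curve_def
  proof (intro conjI ballI op)
    show "is_interval (flow_dom s z)" using conn by (simp add: is_interval_connected_1)
    show "continuous_on (flow_dom s z) (\<lambda>t. snd (flow s z t))"
    proof (intro continuous_at_imp_continuous_on ballI)
      fix t assume "t \<in> flow_dom s z"
      then obtain J y \<sigma> where J: "unit_curve (X s) J y \<sigma>" "t \<in> J" "\<forall>r\<in>J. flow s z r = (y r, \<sigma> r)"
        using ex by blast
      have "continuous_on J (\<lambda>t. snd (flow s z t))"
        using unit_curveD(4)[OF J(1)] J(3) by (simp cong: continuous_on_cong)
      then show "isCont (\<lambda>t. snd (flow s z t)) t"
        using unit_curveD(1)[OF J(1)] J(2) by (simp add: continuous_on_eq_continuous_at)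
    qed
    fix t assume "t \<in> flow_dom s z"
    then obtain J y \<sigma> where J: "unit_curve (X s) J y \<sigma>" "t \<in> J" "\<forall>r\<in>J. flow s z r = (y r, \<sigma> r)"
      using ex by blast
    note D = unit_curveD[OF J(1)]
    show "fst (flow s z t) \<in> X s" "norm (snd (flow s z t)) = 1" using J D by auto
    show "((\<lambda>t. fst (flow s z t)) has_vector_derivative snd (flow s z t)) (at t)"
      using has_vector_derivative_transform_within_open[OF D(8)[OF J(2)] D(1) J(2), of "\<lambda>t. fst (flow s z t)"] J(2,3)
      by simp
  qed
qed

lemma state_shift:
  assumes "unit_curve (X s) J y \<sigma>" "t \<in> J"
  shows "(s, y t, \<sigma> t) \<in> states"
proof -
  have A: "unit_curve (X s) {r. t + 1 * r \<in> J} (\<lambda>r. y (t + 1 * r)) (\<lambda>r. 1 *\<^sub>R \<sigma> (t + 1 * r))"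
    by (rule unit_curve_affine[OF assms(1)]) simp
  have "0 \<in> {r. t + 1 * r \<in> J}" "(y t, \<sigma> t) = (y (t + 1 * 0), 1 *\<^sub>R \<sigma> (t + 1 * 0))"
    using assms(2) by simp_all
  with A show ?thesis unfolding states_def by blast
qed

lemma flow_shift1:
  assumes z: "(s, z) \<in> states" "t \<in> flow_dom s z" "t + r \<in> flow_dom s z"
  shows "(s, flow s z t) \<in> states" "r \<in> flow_dom s (flow s z t)" "flow s (flow s z t) r = flow s z (t + r)"
proof -
  note F = flow_unit_curve[OF z(1)]
  show "(s, flow s z t) \<in> states" using state_shift[OF F(1) z(2)] by simp
  note A = unit_curve_affine[OF F(1), of 1 t, simplified]
  show "r \<in> flow_dom s (flow s z t)" "flow s (flow s z t) r = flow s z (t + r)"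
    using flow_eqI[OF A, of "flow s z t" r] z by auto
qed

lemma flow_shift:
  assumes z: "(s, z) \<in> states" "t \<in> flow_dom s z"
  shows "(s, flow s z t) \<in> states" "r \<in> flow_dom s (flow s z t) \<longleftrightarrow> t + r \<in> flow_dom s z"
proof -
  have 0: "t + 0 \<in> flow_dom s z" "t + (- t) \<in> flow_dom s z" using z flow_unit_curve(2)[OF z(1)] by auto
  show w: "(s, flow s z t) \<in> states" by (rule flow_shift1(1)[OF z 0(1)])
  note m = flow_shift1(2,3)[OF z 0(2)]
  have "t + r \<in> flow_dom s z" if "r \<in> flow_dom s (flow s z t)"
    using flow_shift1(2)[OF w m(1), of "t + r"] that m(2) flow_unit_curve(3)[OF z(1)] by simp
  then show "r \<in> flow_dom s (flow s z t) \<longleftrightarrow> t + r \<in> flow_dom s z" using flow_shift1(2)[OF z] by blast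
qed

lemma flow_flip1:
  assumes z: "(s, x, \<tau>) \<in> states"
  shows "(s, x, - \<tau>) \<in> states"
    "- t \<in> flow_dom s (x, \<tau>) \<Longrightarrow> t \<in> flow_dom s (x, - \<tau>)"
    "- t \<in> flow_dom s (x, \<tau>) \<Longrightarrow> flow s (x, - \<tau>) t = (fst (flow s (x, \<tau>) (- t)), - snd (flow s (x, \<tau>) (- t)))"
proof -
  note F = flow_unit_curve[OF z]
  note A = unit_curve_affine[OF F(1), of "-1" 0, simplified]
  have "(x, - \<tau>) = (fst (flow s (x, \<tau>) (- 0)), - snd (flow s (x, \<tau>) (- 0)))" using F(3) by simp
  note E = flow_eqI[OF A _ this]
  show "(s, x, - \<tau>) \<in> states" unfolding states_def using A F(2,3) by force
  show "- t \<in> flow_dom s (x, \<tau>) \<Longrightarrow> t \<in> flow_dom s (x, - \<tau>)"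
    "- t \<in> flow_dom s (x, \<tau>) \<Longrightarrow> flow s (x, - \<tau>) t = (fst (flow s (x, \<tau>) (- t)), - snd (flow s (x, \<tau>) (- t)))"
    using E F(2) by auto
qed

lemma state_in_box:
  assumes B: "leaf_box X s0 x0 \<epsilon> W \<beta> T a" and z: "(s, x, \<tau>) \<in> states" "(s, x) \<in> W"
  shows "\<exists>c\<in>{1,-1}. \<tau> = c *\<^sub>R T s (a s x)"
proof -
  obtain J y \<sigma> where J: "unit_curve (X s) J y \<sigma>" "0 \<in> J" "(x, \<tau>) = (y 0, \<sigma> 0)"
    using z(1) unfolding states_def by blast
  obtain \<delta> where \<delta>: "\<delta> > 0" "ball 0 \<delta> \<subseteq> J" "\<forall>t'\<in>ball 0 \<delta>. (s, y t') \<in> W"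
    using unit_curve_near[OF J(1) leaf_boxD(2)[OF B], of s 0] z(2) J by auto
  have "\<exists>c\<in>{1,-1}. \<forall>t\<in>ball 0 \<delta>. y t = \<beta> s (a s (y 0) + c * (t - 0)) \<and>
     \<sigma> t = c *\<^sub>R T s (a s (y 0) + c * (t - 0))"
    by (rule unit_curve_in_box[OF B unit_curve_subset[OF J(1) \<delta>(2)]]) (use \<delta> in \<open>auto simp: is_interval_ball_real\<close>)
  then obtain c where c: "c \<in> {1,-1}" "\<forall>t\<in>ball 0 \<delta>. \<sigma> t = c *\<^sub>R T s (a s (y 0) + c * (t - 0))" by blast
  have "\<tau> = c *\<^sub>R T s (a s x)" using c(2)[rule_format, of 0] \<delta>(1) J(3) by simp
  with c(1) show ?thesis by blast
qed

lemma state_space: "(s, x, \<tau>) \<in> states \<Longrightarrow> x \<in> X s"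
  unfolding states_def using unit_curveD(6) by blast

lemma state_norm: "(s, x, \<tau>) \<in> states \<Longrightarrow> norm \<tau> = 1"
  unfolding states_def using unit_curveD(7) by blast

lemma flow_in_box:
  assumes B: "leaf_box X s0 x0 \<epsilon> W \<beta> T a" and x: "(s, x) \<in> W" "x \<in> X s" and c: "c \<in> {1, -1}"
  shows "(s, x, c *\<^sub>R T s (a s x)) \<in> states"
    "\<bar>a s x + c * t\<bar> < \<epsilon> \<Longrightarrow> t \<in> flow_dom s (x, c *\<^sub>R T s (a s x))"
    "\<bar>a s x + c * t\<bar> < \<epsilon> \<Longrightarrow> flow s (x, c *\<^sub>R T s (a s x)) t = (\<beta> s (a s x + c * t), c *\<^sub>R T s (a s x + c * t))"
proof -
  note U = unit_curve_affine_box[OF B x c]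
  have "\<bar>a s x\<bar> < \<epsilon>" "\<beta> s (a s x) = x" using leaf_boxD(11,12)[OF B x] by auto
  then have 0: "0 \<in> {t. \<bar>a s x + c * t\<bar> < \<epsilon>}" "(x, c *\<^sub>R T s (a s x)) = (\<beta> s (a s x + c * 0), c *\<^sub>R T s (a s x + c * 0))"
    by auto
  show "(s, x, c *\<^sub>R T s (a s x)) \<in> states" unfolding states_def using U 0 by blast
  show "\<bar>a s x + c * t\<bar> < \<epsilon> \<Longrightarrow> t \<in> flow_dom s (x, c *\<^sub>R T s (a s x))"
    "\<bar>a s x + c * t\<bar> < \<epsilon> \<Longrightarrow> flow s (x, c *\<^sub>R T s (a s x)) t = (\<beta> s (a s x + c * t), c *\<^sub>R T s (a s x + c * t))"
    using flow_eqI[OF U 0] by auto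
qed

lemma state_exists: "x \<in> X s \<Longrightarrow> \<exists>\<tau>. (s, x, \<tau>) \<in> states"
  using box_exists[of x s] flow_in_box(1)[where c = 1 and x = x and s = s] leaf_boxD(3) by blast

text \<open>The leaf meets a box in a single arc of length twice \<epsilon>, so an orbit that visits
  the box reaches every leaf point of it. The bound on the time needed is what forces compact leaves
  to close up.\<close>

lemma flow_covers_box:
  assumes B: "leaf_box X s0 x0 \<epsilon> W \<beta> T a" and z: "(s, z) \<in> states" "t \<in> flow_dom s z"
    and W: "(s, fst (flow s z t)) \<in> W" and x: "(s, x) \<in> W" "x \<in> X s"
  shows "\<exists>r\<in>flow_dom s z. \<bar>r - t\<bar> < 2 * \<epsilon> \<and> fst (flow s z r) = x"
proof -
  define x1 \<tau>1 where "x1 = fst (flow s z t)" and "\<tau>1 = snd (flow s z t)"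
  have st: "(s, x1, \<tau>1) \<in> states" using flow_shift(1)[OF z] by (simp add: x1_def \<tau>1_def)
  have x1: "(s, x1) \<in> W" "x1 \<in> X s" using W state_space[OF st] by (auto simp: x1_def)
  obtain c where c: "c \<in> {1,-1}" "\<tau>1 = c *\<^sub>R T s (a s x1)"
    using state_in_box[OF B st x1(1)] by blast
  define r where "r = c * (a s x - a s x1)"
  have "a s x1 + c * r = a s x" using c(1) by (auto simp: r_def)
  then have "r \<in> flow_dom s (x1, \<tau>1)" "fst (flow s (x1, \<tau>1) r) = x"
    using flow_in_box(2,3)[OF B x1 c(1), of r] leaf_boxD(11,12)[OF B x] c(2) by auto
  moreover have "(x1, \<tau>1) = flow s z t" by (simp add: x1_def \<tau>1_def)
  moreover have "\<bar>r\<bar> < 2 * \<epsilon>"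
    using c(1) leaf_boxD(11)[OF B x] leaf_boxD(11)[OF B x1] unfolding r_def by auto
  ultimately show ?thesis
    using flow_shift(2)[OF z, of r] flow_shift1(3)[OF z, of r] by (intro bexI[of _ "t + r"]) auto
qed

text \<open>Within a box either every point of the leaf is reached by the orbit or none is. Being
  reached is thus locally constant along the leaf.\<close>

lemma flow_image_component:
  assumes \<Gamma>: "\<Gamma> \<in> components (X s)" and z: "(s, x, \<tau>) \<in> states" "x \<in> \<Gamma>"
  shows "(\<lambda>t. fst (flow s (x, \<tau>) t)) ` flow_dom s (x, \<tau>) = \<Gamma>" (is "?I = \<Gamma>")
proof
  note F = flow_unit_curve[OF z(1)] and D = unit_curveD[OF flow_unit_curve(1)[OF z(1)]]
  have x: "x \<in> ?I" using F by force
  show "?I \<subseteq> \<Gamma>"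
  proof (rule components_maximal[OF \<Gamma>])
    show "connected ?I" by (rule connected_continuous_image[OF D(5,3)])
    show "?I \<subseteq> X s" using D(6) by auto
    show "\<Gamma> \<inter> ?I \<noteq> {}" using x z(2) by blast
  qed
  have conn: "connected \<Gamma>" and sub: "\<Gamma> \<subseteq> X s" using in_components_connected[OF \<Gamma>] in_components_subset[OF \<Gamma>] by auto
  show "\<Gamma> \<subseteq> ?I"
  proof
    fix y assume "y \<in> \<Gamma>"
    show "y \<in> ?I"
    proof (rule connected_propagate[where Q = "\<lambda>y. y \<in> ?I", OF conn z(2) \<open>y \<in> \<Gamma>\<close> x])
      fix y assume y: "y \<in> \<Gamma>"
      then obtain \<epsilon> W \<beta> T a where B: "leaf_box X s y \<epsilon> W \<beta> T a" using box_exists sub by blast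
      let ?U = "{v. (s, v) \<in> W}"
      have "continuous_on UNIV (\<lambda>v :: 'a. (s, v))" by (intro continuous_intros)
      from open_vimage[OF leaf_boxD(2)[OF B] this] have "open ?U" by (simp add: vimage_def)
      moreover have "y' \<in> ?I \<longleftrightarrow> y \<in> ?I" if "y' \<in> ?U \<inter> \<Gamma>" for y'
      proof -
        have Wy: "(s, y) \<in> W" "y \<in> X s" "(s, y') \<in> W" "y' \<in> X s"
          using that y sub leaf_boxD(3)[OF B] by auto
        show ?thesis
          using flow_covers_box[OF B z(1) _ _ Wy(1,2)] flow_covers_box[OF B z(1) _ _ Wy(3,4)] Wy(1,3)
          by blast
      qed
      ultimately show "\<exists>U. open U \<and> y \<in> U \<and> (\<forall>y'\<in>U \<inter> \<Gamma>. (y' \<in> ?I) = (y \<in> ?I))"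
        using leaf_boxD(3)[OF B] by (intro exI[of _ ?U]) auto
    qed
  qed
qed

end

lemma compact_uniform_bound:
  fixes Q :: "'a::metric_space \<Rightarrow> real \<Rightarrow> bool"
  assumes K: "compact K"
    and loc: "\<And>x. x \<in> K \<Longrightarrow> \<exists>U e. open U \<and> x \<in> U \<and> 0 < e \<and> (\<forall>y\<in>U \<inter> K. Q y e)"
    and mono: "\<And>y e e'. Q y e \<Longrightarrow> 0 < e' \<Longrightarrow> e' \<le> e \<Longrightarrow> Q y e'"
  shows "\<exists>e>0. \<forall>y\<in>K. Q y e"
proof -
  obtain U e where U: "\<And>x. x \<in> K \<Longrightarrow> open (U x)" "\<And>x. x \<in> K \<Longrightarrow> x \<in> U x"
    "\<And>x. x \<in> K \<Longrightarrow> 0 < (e x :: real)" "\<And>x y. x \<in> K \<Longrightarrow> y \<in> U x \<inter> K \<Longrightarrow> Q y (e x)"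
    using loc by metis
  obtain C where C: "C \<subseteq> K" "finite C" "K \<subseteq> (\<Union>c\<in>C. U c)"
    using compactE_image[OF K, of K U] U(1,2) by (metis UN_iff subsetI)
  \<comment> \<open>The additional 1 gives the minimum a value when the finite cover is
    empty.\<close>
  define m where "m = Min (insert 1 (e ` C))"
  have m: "m > 0" "\<And>c. c \<in> C \<Longrightarrow> m \<le> e c"
    unfolding m_def using C U(3) by (auto simp: Min_gr_iff subset_iff)
  have "Q y m" if y: "y \<in> K" for y
  proof -
    obtain c where c: "c \<in> C" "y \<in> U c" using C(3) y by blast
    then show ?thesis using mono[OF U(4)[of c y] m(1) m(2)] C(1) y by blast
  qed
  with m(1) show ?thesis by blast
qed

context leaf_space
begin

text \<open>A point whose arclength coordinate is below half the box size can still move half the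
  box size in both directions. Compactness makes this time uniform over the leaf.\<close>

lemma flow_dom_uniform:
  assumes "compact (X s)"
  shows "\<exists>e>0. \<forall>x\<in>X s. \<forall>\<tau>. (s, x, \<tau>) \<in> states \<longrightarrow> {-e<..<e} \<subseteq> flow_dom s (x, \<tau>)"
proof (rule compact_uniform_bound[OF assms])
  fix x assume x: "x \<in> X s"
  obtain \<epsilon> W \<beta> T a where B: "leaf_box X s x \<epsilon> W \<beta> T a" using box_exists x by blast
  note BD = leaf_boxD[OF B]
  have "isCont (a s) x" using BD(13)[OF BD(3) x] differentiable_imp_continuous_within by blast
  then have "\<forall>\<^sub>F y in nhds x. a s y \<in> {-\<epsilon>/2<..<\<epsilon>/2}"
    unfolding continuous_within using BD(1,4) tendsto_at_iff_tendsto_nhds[of "a s" x]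
    by (intro topological_tendstoD[of "a s" "a s x"]) auto
  then obtain U1 where U1: "open U1" "x \<in> U1" "\<forall>y\<in>U1. a s y \<in> {-\<epsilon>/2<..<\<epsilon>/2}"
    unfolding eventually_nhds by blast
  have "continuous_on UNIV (\<lambda>v :: 'a. (s, v))" by (intro continuous_intros)
  from open_vimage[OF BD(2) this] have U2: "open {v. (s, v) \<in> W}" by (simp add: vimage_def)
  have "{-(\<epsilon>/2)<..<\<epsilon>/2} \<subseteq> flow_dom s (y, \<tau>)"
    if y: "y \<in> U1 \<inter> {v. (s, v) \<in> W} \<inter> X s" and st: "(s, y, \<tau>) \<in> states" for y \<tau>
  proof
    fix t assume t: "t \<in> {-(\<epsilon>/2)<..<\<epsilon>/2}"
    have y': "(s, y) \<in> W" "y \<in> X s" using y by auto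
    obtain c where c: "c \<in> {1,-1}" "\<tau> = c *\<^sub>R T s (a s y)" using state_in_box[OF B st y'(1)] by blast
    have "\<bar>a s y\<bar> < \<epsilon> / 2" "\<bar>t\<bar> < \<epsilon> / 2" using y U1(3) t by auto
    then have "\<bar>a s y + c * t\<bar> < \<epsilon>" using c(1) by auto
    then show "t \<in> flow_dom s (y, \<tau>)" using flow_in_box(2)[OF B y' c(1)] c(2) by simp
  qed
  then show "\<exists>U e. open U \<and> x \<in> U \<and> 0 < e \<and>
      (\<forall>y\<in>U \<inter> X s. \<forall>\<tau>. (s, y, \<tau>) \<in> states \<longrightarrow> {-e<..<e} \<subseteq> flow_dom s (y, \<tau>))"
    using U1(1,2) U2 BD(1,3) by (intro exI[of _ "U1 \<inter> {v. (s, v) \<in> W}"] exI[of _ "\<epsilon>/2"]) auto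
next
  fix y and e e' :: real
  assume *: "\<forall>\<tau>. (s, y, \<tau>) \<in> states \<longrightarrow> {-e<..<e} \<subseteq> flow_dom s (y, \<tau>)" and e: "0 < e'" "e' \<le> e"
  have "{-e'<..<e'} \<subseteq> {-e<..<e}" using e by auto
  with * show "\<forall>\<tau>. (s, y, \<tau>) \<in> states \<longrightarrow> {-e'<..<e'} \<subseteq> flow_dom s (y, \<tau>)" by blast
qed

text \<open>With a uniform time step, membership in the domain of the flow passes between any two
  times closer than that step, in either direction.\<close>

lemma flow_complete:
  assumes K: "compact (X s)" and z: "(s, z) \<in> states"
  shows "t \<in> flow_dom s z"
proof -
  obtain e where e: "e > 0" "\<And>x \<tau>. (s, x, \<tau>) \<in> states \<Longrightarrow> {-e<..<e} \<subseteq> flow_dom s (x, \<tau>)"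
    using flow_dom_uniform[OF K] state_space by blast
  have step: "t' \<in> flow_dom s z" if "t \<in> flow_dom s z" "\<bar>t' - t\<bar> < e" for t t'
  proof -
    have "(s, flow s z t) \<in> states" by (rule flow_shift(1)[OF z that(1)])
    moreover have "t' - t \<in> {-e<..<e}" using that(2) by auto
    ultimately have "t' - t \<in> flow_dom s (flow s z t)"
      using e(2)[of "fst (flow s z t)" "snd (flow s z t)"] by auto
    then show ?thesis using flow_shift(2)[OF z that(1)] by simp
  qed
  show ?thesis
  proof (rule connected_propagate[where I = UNIV and ?t0.0 = 0 and Q = "\<lambda>t. t \<in> flow_dom s z"])
    show "0 \<in> flow_dom s z" by (rule flow_unit_curve(2)[OF z])
    fix t :: real
    have "(t' \<in> flow_dom s z) = (t \<in> flow_dom s z)" if "t' \<in> ball t e" for t'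
    proof -
      have "\<bar>t' - t\<bar> < e" "\<bar>t - t'\<bar> < e" using that by (auto simp: dist_real_def)
      then show ?thesis using step by blast
    qed
    note near = this
    show "\<exists>U. open U \<and> t \<in> U \<and> (\<forall>t'\<in>U \<inter> UNIV. (t' \<in> flow_dom s z) = (t \<in> flow_dom s z))"
    proof (intro exI[of _ "ball t e"] conjI ballI)
      show "t \<in> ball t e" using e(1) by simp
      fix t' assume "t' \<in> ball t e \<inter> UNIV"
      then show "(t' \<in> flow_dom s z) = (t \<in> flow_dom s z)" using near by blast
    qed simp
  qed auto
qed

end

section \<open>Compact connected leaves: recurrence and length\<close>

locale circle_leaves = leaf_space X for X :: "real \<Rightarrow> 'a::euclidean_space set" +
  assumes compact_leaf: "compact (X s)" and connected_leaf: "connected (X s)"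
begin

lemma flow_state: "(s, z) \<in> states \<Longrightarrow> (s, flow s z t) \<in> states"
  using flow_shift(1) flow_complete[OF compact_leaf] by blast

lemma flow_add: "(s, z) \<in> states \<Longrightarrow> flow s (flow s z t) r = flow s z (t + r)"
  using flow_shift1(3) flow_complete[OF compact_leaf] by blast

lemma flow_0: "(s, z) \<in> states \<Longrightarrow> flow s z 0 = z"
  using flow_unit_curve(3) by blast

lemma flow_neg: "(s, x, \<tau>) \<in> states \<Longrightarrow>
    flow s (x, - \<tau>) t = (fst (flow s (x, \<tau>) (- t)), - snd (flow s (x, \<tau>) (- t)))"
  using flow_flip1(3) flow_complete[OF compact_leaf] by blast

lemma flow_transitive:
  assumes "(s, z) \<in> states" "y \<in> X s"
  shows "\<exists>t. fst (flow s z t) = y"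
proof -
  obtain x \<tau> where z: "z = (x, \<tau>)" by (cases z)
  have "X s \<in> components (X s)" using connected_leaf assms(2)
    by (metis components_eq_sing_iff empty_iff insertI1)
  then have "(\<lambda>t. fst (flow s (x, \<tau>) t)) ` flow_dom s (x, \<tau>) = X s"
    using flow_image_component[of "X s" s x \<tau>] assms z state_space by simp
  then have "y \<in> (\<lambda>t. fst (flow s z t)) ` flow_dom s z" using assms(2) z by simp
  then show ?thesis by blast
qed

text \<open>If the reversed initial state were reached at time \<open>t\<close>, the state at time
  \<open>t / 2\<close> would be its own reversal, and a unit tangent would equal its
  negative.\<close>

lemma flow_no_flip:
  assumes "(s, x, \<tau>) \<in> states" shows "flow s (x, \<tau>) t \<noteq> (x, - \<tau>)"
proof
  assume *: "flow s (x, \<tau>) t = (x, - \<tau>)"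
  define w where "w = flow s (x, \<tau>) (t / 2)"
  have "w = flow s (flow s (x, \<tau>) t) (- (t / 2))" unfolding w_def flow_add[OF assms] by simp
  also have "\<dots> = (fst w, - snd w)" unfolding * flow_neg[OF assms] w_def by simp
  finally have "snd w = - snd w" by (metis snd_conv)
  then have "snd w = 0" by (metis eq_neg_iff_add_eq_0 scaleR_2 scaleR_eq_0_iff zero_neq_numeral)
  moreover have "norm (snd w) = 1" using state_norm[of s "fst w" "snd w"] flow_state[OF assms] by (simp add: w_def)
  ultimately show False by simp
qed

lemma state_same_point:
  assumes "(s, x, \<tau>) \<in> states" "(s, x, \<tau>') \<in> states"
  shows "\<tau>' = \<tau> \<or> \<tau>' = - \<tau>"
proof -
  obtain \<epsilon> W \<beta> T a where B: "leaf_box X s x \<epsilon> W \<beta> T a" using box_exists state_space[OF assms(1)] by blast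
  show ?thesis using state_in_box[OF B assms(1) leaf_boxD(3)[OF B]] state_in_box[OF B assms(2) leaf_boxD(3)[OF B]]
    by auto
qed

text \<open>In a box the flow is an explicit expression in \<beta>, \<open>T\<close> and the
  coordinate \<open>a\<close>, all jointly continuous. The set \<open>V\<close> keeps the coordinate
  small enough to stay in the box for a time \<open>\<epsilon>/2\<close>, and keeps the tangent on
  the same side as the initial one.\<close>

lemma flow_continuous_local:
  assumes z0: "(s0, z0) \<in> states"
  shows "\<exists>e>0. \<exists>V. open V \<and> (s0, z0) \<in> V \<and>
    continuous_on ({-e<..<e} \<times> (states \<inter> V)) (\<lambda>p. flow (fst (snd p)) (snd (snd p)) (fst p))"
proof -
  obtain x0 \<tau>0 where zz: "z0 = (x0, \<tau>0)" by (cases z0)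
  then have st0: "(s0, x0, \<tau>0) \<in> states" using z0 by simp
  obtain \<epsilon> W \<beta> T a where B: "leaf_box X s0 x0 \<epsilon> W \<beta> T a" using box_exists state_space[OF st0] by blast
  note BD = leaf_boxD[OF B]
  obtain c0 where c0: "c0 \<in> {1,-1}" "\<tau>0 = c0 *\<^sub>R T s0 (a s0 x0)" using state_in_box[OF B st0 BD(3)] by blast
  define D where "D = {\<zeta>\<in>states. (fst \<zeta>, fst (snd \<zeta>)) \<in> W}"
  have xD: "(fst \<zeta>, fst (snd \<zeta>)) \<in> W" "fst (snd \<zeta>) \<in> X (fst \<zeta>)" if "\<zeta> \<in> D" for \<zeta>
    using that state_space[of "fst \<zeta>" "fst (snd \<zeta>)" "snd (snd \<zeta>)"] by (auto simp: D_def)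
  have aD: "\<bar>fst \<zeta> - s0\<bar> < \<epsilon>" "\<bar>a (fst \<zeta>) (fst (snd \<zeta>))\<bar> < \<epsilon>" if "\<zeta> \<in> D" for \<zeta>
    using BD(10,11)[OF xD[OF that]] .
  have ca: "continuous_on D (\<lambda>\<zeta>. a (fst \<zeta>) (fst (snd \<zeta>)))"
  proof -
    have "continuous_on D (\<lambda>\<zeta>. (\<lambda>z. a (fst z) (snd z)) (fst \<zeta>, fst (snd \<zeta>)))"
      by (rule continuous_on_compose2[OF BD(16)], intro continuous_intros, rule image_subsetI, simp add: xD)
    then show ?thesis by simp
  qed
  have cT: "continuous_on D (\<lambda>\<zeta>. T (fst \<zeta>) (a (fst \<zeta>) (fst (snd \<zeta>))))"
  proof -
    have "continuous_on D (\<lambda>\<zeta>. (\<lambda>z. T (fst z) (snd z)) (fst \<zeta>, a (fst \<zeta>) (fst (snd \<zeta>))))"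
      by (rule continuous_on_compose2[OF BD(15)], intro continuous_intros ca, rule image_subsetI, simp add: aD)
    then show ?thesis by simp
  qed
  \<comment> \<open>Positivity of the second component expresses that the tangent has the sign
    \<open>c0\<close> relative to \<open>T\<close>; as a condition on a continuous function it is
    relatively open among the states.\<close>
  define f where "f = (\<lambda>\<zeta>. (a (fst \<zeta>) (fst (snd \<zeta>)), c0 * (snd (snd \<zeta>) \<bullet> T (fst \<zeta>) (a (fst \<zeta>) (fst (snd \<zeta>))))))"
  have cf: "continuous_on D f" unfolding f_def by (intro continuous_intros ca cT)
  have "continuous_on UNIV (\<lambda>\<zeta> :: real \<times> 'a \<times> 'a. (fst \<zeta>, fst (snd \<zeta>)))" by (intro continuous_intros)
  from open_vimage[OF BD(2) this] have oW: "open {\<zeta> :: real \<times> 'a \<times> 'a. (fst \<zeta>, fst (snd \<zeta>)) \<in> W}" by (simp add: vimage_def)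
  have Deq: "D = states \<inter> {\<zeta>. (fst \<zeta>, fst (snd \<zeta>)) \<in> W}" by (auto simp: D_def)
  have oD: "openin (top_of_set states) D" unfolding Deq by (rule openin_open_Int[OF oW])
  have "openin (top_of_set D) (D \<inter> f -` ({-\<epsilon>/2<..<\<epsilon>/2} \<times> {0<..}))"
    by (intro continuous_openin_preimage_gen[OF cf] open_Times open_greaterThanLessThan open_greaterThan)
  then have "openin (top_of_set states) (D \<inter> f -` ({-\<epsilon>/2<..<\<epsilon>/2} \<times> {0<..}))" using oD openin_trans by blast
  then obtain V where V: "open V" "D \<inter> f -` ({-\<epsilon>/2<..<\<epsilon>/2} \<times> {0<..}) = states \<inter> V" using openin_open[THEN iffD1] by metis
  have nT: "T s u \<bullet> T s u = 1" if "\<bar>s - s0\<bar> < \<epsilon>" "\<bar>u\<bar> < \<epsilon>" for s u using BD(8)[OF that] by (simp add: norm_eq_1)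
  have "(s0, z0) \<in> D" using st0 BD(3) by (simp add: D_def zz)
  moreover have "f (s0, z0) \<in> {-\<epsilon>/2<..<\<epsilon>/2} \<times> {0<..}"
    using BD(1,4) c0 nT[of s0 0] by (auto simp: f_def zz)
  ultimately have z0V: "(s0, z0) \<in> V" using V(2) by blast
  have form: "flow (fst \<zeta>) (snd \<zeta>) t =
      (\<beta> (fst \<zeta>) (fst (f \<zeta>) + c0 * t), c0 *\<^sub>R T (fst \<zeta>) (fst (f \<zeta>) + c0 * t)) \<and> \<bar>fst (f \<zeta>) + c0 * t\<bar> < \<epsilon>"
    if \<zeta>: "\<zeta> \<in> states \<inter> V" and t: "t \<in> {-(\<epsilon>/2)<..<\<epsilon>/2}" for \<zeta> t
  proof -
    obtain s x \<tau> where \<zeta>e: "\<zeta> = (s, x, \<tau>)" by (metis prod.collapse)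
    have N: "\<zeta> \<in> D" "f \<zeta> \<in> {-\<epsilon>/2<..<\<epsilon>/2} \<times> {0<..}" using V(2) \<zeta> by blast+
    note x = xD[OF N(1), unfolded \<zeta>e fst_conv snd_conv] and ax = aD[OF N(1), unfolded \<zeta>e fst_conv snd_conv]
    have st: "(s, x, \<tau>) \<in> states" using \<zeta> \<zeta>e by simp
    obtain c where c: "c \<in> {1,-1}" "\<tau> = c *\<^sub>R T s (a s x)" using state_in_box[OF B st x(1)] by blast
    have "c0 * (\<tau> \<bullet> T s (a s x)) > 0" using N(2) by (simp add: f_def \<zeta>e)
    then have "c0 * c > 0" using c(2) nT[OF ax] by simp
    then have cc: "c = c0" using c(1) c0(1) by auto
    have "\<bar>a s x\<bar> < \<epsilon> / 2" "\<bar>t\<bar> < \<epsilon> / 2" using N(2) t by (auto simp: f_def \<zeta>e)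
    then have b: "\<bar>a s x + c0 * t\<bar> < \<epsilon>" using c0(1) by auto
    then show ?thesis using flow_in_box(3)[OF B x c0(1), of t] c(2) cc by (simp add: \<zeta>e f_def)
  qed
  let ?R = "{-(\<epsilon>/2)<..<\<epsilon>/2} \<times> (states \<inter> V)"
  have cf': "continuous_on ?R (\<lambda>p. fst (f (snd p)) + c0 * fst p)"
  proof (intro continuous_intros)
    have "states \<inter> V \<subseteq> D" using V(2) by blast
    then show "continuous_on ?R (\<lambda>p. f (snd p))"
      by (intro continuous_on_compose2[OF cf]) (auto intro!: continuous_intros)
  qed
  have bd: "\<bar>fst (snd p) - s0\<bar> < \<epsilon>" "\<bar>fst (f (snd p)) + c0 * fst p\<bar> < \<epsilon>" if "p \<in> ?R" for p
  proof -
    have p: "snd p \<in> states \<inter> V" "fst p \<in> {-(\<epsilon>/2)<..<\<epsilon>/2}" using that by auto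
    then show "\<bar>fst (f (snd p)) + c0 * fst p\<bar> < \<epsilon>" using form by blast
    have "snd p \<in> D" using p V(2) by blast
    then show "\<bar>fst (snd p) - s0\<bar> < \<epsilon>" by (rule aD)
  qed
  have "continuous_on ?R (\<lambda>p. (\<lambda>z. \<beta> (fst z) (snd z)) (fst (snd p), fst (f (snd p)) + c0 * fst p))"
    by (rule continuous_on_compose2[OF BD(14)]) (use bd in \<open>auto intro!: continuous_intros cf'\<close>)
  moreover have "continuous_on ?R (\<lambda>p. (\<lambda>z. T (fst z) (snd z)) (fst (snd p), fst (f (snd p)) + c0 * fst p))"
    by (rule continuous_on_compose2[OF BD(15)]) (use bd in \<open>auto intro!: continuous_intros cf'\<close>)
  ultimately have "continuous_on ?R (\<lambda>p. (\<beta> (fst (snd p)) (fst (f (snd p)) + c0 * fst p),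
      c0 *\<^sub>R T (fst (snd p)) (fst (f (snd p)) + c0 * fst p)))"
    by (simp only: fst_conv snd_conv) (intro continuous_intros)
  moreover have "flow (fst (snd p)) (snd (snd p)) (fst p) = (\<beta> (fst (snd p)) (fst (f (snd p)) + c0 * fst p),
      c0 *\<^sub>R T (fst (snd p)) (fst (f (snd p)) + c0 * fst p))" if "p \<in> ?R" for p
    using form[of "snd p" "fst p"] that by (simp add: mem_Times_iff)
  ultimately have "continuous_on ?R (\<lambda>p. flow (fst (snd p)) (snd (snd p)) (fst p))"
    by (simp cong: continuous_on_cong)
  then show ?thesis using V(1) z0V BD(1) by (intro exI[of _ "\<epsilon>/2"] exI[of _ V] conjI) auto
qed

text \<open>Continuity at a time spreads along the orbit: if it holds at \<open>t\<close>, the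
  perturbed states at time \<open>t\<close> again converge, and local continuity applies to them.
  The argument works forwards and backwards, so the times at which continuity holds are all or
  none.\<close>

lemma flow_sequential:
  assumes \<zeta>: "\<And>n. (s n, z n) \<in> states" "(s0, z0) \<in> states" "s \<longlonglongrightarrow> s0" "z \<longlonglongrightarrow> z0" and t: "t \<longlonglongrightarrow> t0"
  shows "(\<lambda>n. flow (s n) (z n) (t n)) \<longlonglongrightarrow> flow s0 z0 t0"
proof -
  define A where "A = (\<lambda>t0. \<forall>t. t \<longlonglongrightarrow> t0 \<longrightarrow> (\<lambda>n. flow (s n) (z n) (t n)) \<longlonglongrightarrow> flow s0 z0 t0)"
  have local: "(\<lambda>n. flow (s n) (w n) (t n)) \<longlonglongrightarrow> flow s0 w0 r"
    if V: "open V" "continuous_on ({-e<..<e} \<times> (states \<inter> V)) (\<lambda>p. flow (fst (snd p)) (snd (snd p)) (fst p))"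
    and w: "\<And>n. (s n, w n) \<in> states" "(s0, w0) \<in> states \<inter> V" "w \<longlonglongrightarrow> w0" "t \<longlonglongrightarrow> r" "\<bar>r\<bar> < e"
    for V e w w0 t r
  proof -
    have lim: "(\<lambda>n. (t n, s n, w n)) \<longlonglongrightarrow> (r, s0, w0)" by (intro tendsto_intros w \<zeta>)
    have "open ({-e<..<e} \<times> V)" using V(1) by (simp add: open_Times)
    moreover have "(r, s0, w0) \<in> {-e<..<e} \<times> V" using w(2,5) by auto
    ultimately have "\<forall>\<^sub>F n in sequentially. (t n, s n, w n) \<in> {-e<..<e} \<times> V"
      using lim by (rule topological_tendstoD[rotated])
    then have "\<forall>\<^sub>F n in sequentially. (t n, s n, w n) \<in> {-e<..<e} \<times> (states \<inter> V)"
      by eventually_elim (use w(1) in auto)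
    moreover have "(r, s0, w0) \<in> {-e<..<e} \<times> (states \<inter> V)" using w(2,5) by auto
    ultimately show ?thesis using continuous_on_tendsto_compose[OF V(2) lim] by simp
  qed
  have "A t0"
  proof (rule connected_propagate[where I = UNIV and ?t0.0 = 0 and Q = A])
    obtain e V where eV: "e > 0" "open V" "(s0, z0) \<in> V"
       "continuous_on ({-e<..<e} \<times> (states \<inter> V)) (\<lambda>p. flow (fst (snd p)) (snd (snd p)) (fst p))"
      using flow_continuous_local[OF \<zeta>(2)] by blast
    show "A 0" unfolding A_def
      using local[OF eV(2,4) \<zeta>(1) _ \<zeta>(4)] eV(1,3) \<zeta>(2) by simp
    fix t1 :: real
    define w1 where "w1 = flow s0 z0 t1"
    have w1: "(s0, w1) \<in> states" unfolding w1_def by (rule flow_state[OF \<zeta>(2)])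
    obtain e V where eV: "e > 0" "open V" "(s0, w1) \<in> V"
       "continuous_on ({-e<..<e} \<times> (states \<inter> V)) (\<lambda>p. flow (fst (snd p)) (snd (snd p)) (fst p))"
      using flow_continuous_local[OF w1] by blast
    note U = unit_curveD[OF flow_unit_curve(1)[OF \<zeta>(2)]]
    have "continuous_on (flow_dom s0 z0) (\<lambda>t. (s0, fst (flow s0 z0 t), snd (flow s0 z0 t)))"
      by (intro continuous_intros U(4,5))
    moreover have "flow_dom s0 z0 = UNIV" using flow_complete[OF compact_leaf \<zeta>(2)] by blast
    ultimately have "continuous_on UNIV (\<lambda>t. (s0, flow s0 z0 t))" by simp
    from open_vimage[OF eV(2) this] have oV: "open {t. (s0, flow s0 z0 t) \<in> V}" by (simp add: vimage_def)
    define N where "N = {t. (s0, flow s0 z0 t) \<in> V} \<inter> ball t1 e"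
    have step: "A t'" if "A t" "(s0, flow s0 z0 t) \<in> V" "\<bar>t' - t\<bar> < e" for t t'
      unfolding A_def
    proof (intro allI impI)
      fix q assume q: "q \<longlonglongrightarrow> t'"
      have w: "(\<lambda>n. flow (s n) (z n) t) \<longlonglongrightarrow> flow s0 z0 t"
        using that(1) unfolding A_def by (rule spec[of _ "\<lambda>n. t", THEN mp]) simp
      have qt: "(\<lambda>n. q n - t) \<longlonglongrightarrow> t' - t" by (intro tendsto_intros q)
      have "(\<lambda>n. flow (s n) (flow (s n) (z n) t) (q n - t)) \<longlonglongrightarrow> flow s0 (flow s0 z0 t) (t' - t)"
        by (rule local[OF eV(2,4) flow_state[OF \<zeta>(1)] _ w qt that(3)]) (use that(2) flow_state[OF \<zeta>(2)] in auto)
      then show "(\<lambda>n. flow (s n) (z n) (q n)) \<longlonglongrightarrow> flow s0 z0 t'"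
        by (simp add: flow_add[OF \<zeta>(1)] flow_add[OF \<zeta>(2)])
    qed
    have "A t' \<longleftrightarrow> A t1" if "t' \<in> N" for t'
    proof -
      have "\<bar>t' - t1\<bar> < e" "\<bar>t1 - t'\<bar> < e" "(s0, flow s0 z0 t') \<in> V" "(s0, flow s0 z0 t1) \<in> V"
        using that eV(3) by (auto simp: N_def dist_real_def w1_def)
      then show ?thesis using step by blast
    qed
    moreover have "open N" "t1 \<in> N" using oV eV(1,3) by (auto simp: N_def w1_def)
    ultimately show "\<exists>U. open U \<and> t1 \<in> U \<and> (\<forall>t'\<in>U \<inter> UNIV. A t' = A t1)" by blast
  qed auto
  then show ?thesis using t unfolding A_def by blast
qed

lemma continuous_on_flow:
  fixes I :: "'b::metric_space set"
  assumes "continuous_on I \<sigma>" "continuous_on I r" "continuous_on I q" "\<And>i. i \<in> I \<Longrightarrow> (q i, \<sigma> i) \<in> states"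
  shows "continuous_on I (\<lambda>i. flow (q i) (\<sigma> i) (r i))"
  unfolding continuous_on_sequentially o_def
proof (intro allI ballI impI)
  fix i x assume i: "x \<in> I" "(\<forall>n. i n \<in> I) \<and> i \<longlonglongrightarrow> x"
  then show "(\<lambda>n. flow (q (i n)) (\<sigma> (i n)) (r (i n))) \<longlonglongrightarrow> flow (q x) (\<sigma> x) (r x)"
    using assms by (intro flow_sequential) (auto simp: continuous_on_sequentially o_def)
qed

text \<open>For times below \<epsilon> the arclength coordinate of the box still tells the points
  apart. The bound does not depend on \<open>s\<close>, so it also rules out arbitrarily short
  leaves near a given parameter.\<close>

lemma flow_return_lower_bound:
  assumes B: "leaf_box X s0 x0 \<epsilon> W \<beta> T a" and s: "\<bar>s - s0\<bar> < \<epsilon>" and t: "0 < t" "t < \<epsilon>"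
  shows "flow s (\<beta> s 0, T s 0) t \<noteq> (\<beta> s 0, T s 0)"
proof -
  note BD = leaf_boxD[OF B]
  have 0: "a s (\<beta> s 0) = 0" "(s, \<beta> s 0) \<in> W" "\<beta> s 0 \<in> X s" using BD(1,5-7) s by auto
  have "flow s (\<beta> s 0, T s 0) t = (\<beta> s t, T s t)"
    using flow_in_box(3)[OF B 0(2,3), of 1 t] 0(1) t by simp
  moreover have "a s (\<beta> s t) = t" using BD(7) s t by simp
  ultimately show ?thesis using 0(1) t by auto
qed

lemma box_state:
  assumes B: "leaf_box X s0 x0 \<epsilon> W \<beta> T a" and s: "\<bar>s - s0\<bar> < \<epsilon>"
  shows "(s, \<beta> s 0, T s 0) \<in> states"
proof -
  note BD = leaf_boxD[OF B]
  have 0: "a s (\<beta> s 0) = 0" "(s, \<beta> s 0) \<in> W" "\<beta> s 0 \<in> X s" using BD(1,5-7) s by auto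
  show ?thesis using flow_in_box(1)[OF B 0(2,3), of 1] 0(1) by simp
qed

lemma flow_cases_same_leaf:
  assumes z: "(s, x, \<tau>) \<in> states" and w: "(s, y, \<rho>) \<in> states"
  shows "\<exists>r. flow s (x, \<tau>) r = (y, \<rho>) \<or> flow s (x, \<tau>) r = (y, - \<rho>)"
proof -
  obtain r where r: "fst (flow s (x, \<tau>) r) = y" using flow_transitive[OF z state_space[OF w]] by blast
  have "(s, y, snd (flow s (x, \<tau>) r)) \<in> states" using flow_state[OF z, of r] r by (metis prod.collapse)
  from state_same_point[OF w this] show ?thesis using r by (metis prod.collapse)
qed

text \<open>Any two states on a leaf are related by the flow, up to reversal. A return time passes
  along the flow because times add commutatively, and to the reversed state by running time
  backwards.\<close>

lemma period_independent:
  assumes z: "(s, z) \<in> states" and w: "(s, w) \<in> states" and t: "flow s z t = z"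
  shows "flow s w t = w"
proof -
  obtain x \<tau> y \<rho> where zw: "z = (x, \<tau>)" "w = (y, \<rho>)" by (metis prod.collapse)
  have z': "(s, x, \<tau>) \<in> states" and w': "(s, y, \<rho>) \<in> states" using z w zw by auto
  have inv: "flow s (flow s z r) t = flow s z r" for r
    using flow_add[OF z, of r t] flow_add[OF z, of t r] t by (simp add: add.commute)
  obtain r where "flow s z r = (y, \<rho>) \<or> flow s z r = (y, - \<rho>)"
    using flow_cases_same_leaf[OF z' w'] zw by blast
  then show ?thesis
  proof
    assume "flow s z r = (y, \<rho>)" then show ?thesis using inv[of r] zw by simp
  next
    assume r: "flow s z r = (y, - \<rho>)"
    then have st: "(s, y, - \<rho>) \<in> states" using flow_state[OF z, of r] by simp
    have "flow s (y, - \<rho>) t = (y, - \<rho>)" using inv[of r] r by simp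
    then have "flow s (y, - \<rho>) (- t) = (y, - \<rho>)"
      using flow_add[OF st, of t "- t"] flow_0[OF st] by simp
    then show ?thesis using flow_neg[OF st, of t] zw by simp
  qed
qed

text \<open>Through a point of a leaf there are two states, each the reversal of the other. By
  \<open>flow_no_flip\<close> an orbit never meets both, so a return to the point is a return to the
  state.\<close>

lemma flow_same_point:
  assumes z: "(s, x, \<tau>) \<in> states" and eq: "fst (flow s (x, \<tau>) t) = fst (flow s (x, \<tau>) t')"
  shows "flow s (x, \<tau>) (t - t') = (x, \<tau>)"
proof -
  define w w' where "w = flow s (x, \<tau>) t" and "w' = flow s (x, \<tau>) t'"
  have st: "(s, w) \<in> states" "(s, w') \<in> states" unfolding w_def w'_def by (rule flow_state[OF z])+
  have st': "(s, fst w', snd w') \<in> states" "(s, fst w', snd w) \<in> states" using st eq by (auto simp: w_def w'_def) (metis prod.collapse)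
  have fl: "flow s w' (t - t') = w" unfolding w_def w'_def flow_add[OF z] by simp
  have "snd w = snd w' \<or> snd w = - snd w'" by (rule state_same_point[OF st'])
  moreover have "w \<noteq> (fst w', - snd w')" using flow_no_flip[OF st'(1), of "t - t'"] fl by simp
  ultimately have "w = w'" using eq by (metis prod.collapse w_def w'_def)
  then have "flow s w' (t - t') = w'" using fl by simp
  then show ?thesis by (rule period_independent[OF st(2) z])
qed

text \<open>Without a return the orbit is injective. By compactness it comes close to some
  \<open>q\<close> at arbitrarily late times; but every leaf point in a box around \<open>q\<close>
  is visited within twice \<epsilon> of the time at which the orbit passes \<open>q\<close>, which
  contradicts injectivity.\<close>

lemma period_exists:
  assumes z: "(s, z) \<in> states" shows "\<exists>t>0. flow s z t = z"
proof (rule ccontr)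
  assume no: "\<not> (\<exists>t>0. flow s z t = z)"
  obtain x \<tau> where zx: "z = (x, \<tau>)" by (cases z)
  define g where "g = (\<lambda>t. fst (flow s z t))"
  have inj: "t = t'" if "g t = g t'" for t t'
  proof (rule ccontr)
    assume "t \<noteq> t'"
    then have "t - t' > 0 \<or> t' - t > 0" by auto
    moreover have "flow s z (t - t') = z" "flow s z (t' - t) = z"
      using flow_same_point[of s x \<tau> t t'] flow_same_point[of s x \<tau> t' t] that z zx by (auto simp: g_def)
    ultimately show False using no by blast
  qed
  have "\<forall>n. g (real n) \<in> X s"
    using state_space flow_state[OF z] by (metis g_def prod.collapse)
  then obtain q \<phi> where q: "q \<in> X s" "strict_mono \<phi>" "((\<lambda>n. g (real n)) \<circ> \<phi>) \<longlonglongrightarrow> q"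
    using compact_leaf[of s, unfolded compact_def, rule_format, of "\<lambda>n. g (real n)"] by blast
  obtain \<epsilon> W \<beta> T a where B: "leaf_box X s q \<epsilon> W \<beta> T a" using box_exists q(1) by blast
  note BD = leaf_boxD[OF B]
  obtain tq where tq: "g tq = q" using flow_transitive[OF z q(1)] by (auto simp: g_def)
  have "(\<lambda>n. (s, g (real (\<phi> n)))) \<longlonglongrightarrow> (s, q)" using q(3) by (intro tendsto_intros) (simp add: o_def)
  then have "\<forall>\<^sub>F n in sequentially. (s, g (real (\<phi> n))) \<in> W" using BD(2,3) by (rule topological_tendstoD)
  then have "\<forall>\<^sub>F n in sequentially. (s, g (real (\<phi> n))) \<in> W \<and> n > nat \<lceil>tq + 2 * \<epsilon>\<rceil>"
    using eventually_gt_at_top by (rule eventually_conj)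
  then obtain n where n: "(s, g (real (\<phi> n))) \<in> W" "n > nat \<lceil>tq + 2 * \<epsilon>\<rceil>"
    using eventually_happens by fastforce
  have W: "(s, fst (flow s z tq)) \<in> W" using tq BD(3) by (simp add: g_def)
  have "g (real (\<phi> n)) \<in> X s" using \<open>\<forall>n. g (real n) \<in> X s\<close> by blast
  then obtain r where r: "\<bar>r - tq\<bar> < 2 * \<epsilon>" "g r = g (real (\<phi> n))"
    using flow_covers_box[OF B z flow_complete[OF compact_leaf z] W n(1)] by (auto simp: g_def)
  have "r = real (\<phi> n)" by (rule inj[OF r(2)])
  moreover have "real (\<phi> n) \<ge> real n" using seq_suble[OF q(2), of n] by simp
  moreover have "real n > tq + 2 * \<epsilon>" using n(2) by linarith
  ultimately show False using r(1) by linarith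
qed

text \<open>The condition ranges over all states of the leaf, so that the length depends on
  \<open>s\<close> alone. By \<open>period_independent\<close> a single state decides it.\<close>

definition period :: "real \<Rightarrow> real" where
  "period s = Inf {t. 0 < t \<and> (\<forall>z. (s, z) \<in> states \<longrightarrow> flow s z t = z)}"

text \<open>Positive return times are bounded below by the size of a box and form a closed set, so
  their infimum is attained. A return time that is not a multiple would leave a smaller positive
  remainder.\<close>

lemma period:
  assumes z: "(s, z) \<in> states"
  shows "0 < period s" "flow s z t = z \<longleftrightarrow> (\<exists>k::int. t = of_int k * period s)"
proof -
  obtain x \<tau> where zx: "z = (x, \<tau>)" by (cases z)
  have x: "x \<in> X s" using state_space z zx by blast
  obtain \<epsilon> W \<beta> T a where B: "leaf_box X s x \<epsilon> W \<beta> T a" using box_exists x by blast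
  note BD = leaf_boxD[OF B]
  have st: "(s, \<beta> s 0, T s 0) \<in> states" using box_state[OF B, of s] BD(1) by simp
  let ?P = "{t. \<epsilon> \<le> t \<and> flow s z t = z}"
  have lb: "\<epsilon> \<le> t" if t: "flow s z t = z" "t > 0" for t
    using flow_return_lower_bound[OF B, of s t] period_independent[OF z st t(1)] t(2) BD(1) by (metis abs_zero diff_self not_le)
  have Peq: "{t. 0 < t \<and> (\<forall>z. (s, z) \<in> states \<longrightarrow> flow s z t = z)} = ?P"
  proof (intro Collect_cong iffI conjI allI impI)
    fix t assume t: "0 < t \<and> (\<forall>z. (s, z) \<in> states \<longrightarrow> flow s z t = z)"
    then show "flow s z t = z" using z by blast
    then show "\<epsilon> \<le> t" using lb t by blast
  next
    fix t assume t: "\<epsilon> \<le> t \<and> flow s z t = z"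
    then show "0 < t" using BD(1) by linarith
    fix w assume "(s, w) \<in> states"
    then show "flow s w t = w" using period_independent[OF z] t by blast
  qed
  have L: "period s = Inf ?P" unfolding period_def Peq ..
  have "closed ?P"
  proof -
    have "continuous_on UNIV (\<lambda>t. flow s z t)"
      by (rule continuous_on_flow) (auto intro!: continuous_intros z)
    then have "closed {t. flow s z t = z}" by (intro closed_Collect_eq continuous_on_const)
    then have "closed ({\<epsilon>..} \<inter> {t. flow s z t = z})" by (intro closed_Int closed_atLeast)
    then show ?thesis by (simp add: Collect_conj_eq atLeast_def)
  qed
  moreover have "?P \<noteq> {}" using period_exists[OF z] lb by auto
  moreover have bb: "bdd_below ?P" by (rule bdd_belowI[of _ \<epsilon>]) simp
  ultimately have LP: "period s \<in> ?P" unfolding L by (intro closed_contains_Inf)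
  then show pos: "0 < period s" using BD(1) by auto
  have mult: "flow s z (of_nat k * period s) = z" for k :: nat
  proof (induction k)
    case (Suc k)
    have "flow s z (of_nat (Suc k) * period s) = flow s (flow s z (of_nat k * period s)) (period s)"
      unfolding flow_add[OF z] by (simp add: algebra_simps)
    then show ?case using Suc LP by simp
  qed (simp add: flow_0[OF z])
  have neg: "flow s z (- t) = z" if "flow s z t = z" for t
    using flow_add[OF z, of t "- t"] flow_0[OF z] that by simp
  have imult: "flow s z (of_int k * period s) = z" for k :: int
  proof (cases "k \<ge> 0")
    case True then show ?thesis using mult[of "nat k"] by simp
  next
    case False then show ?thesis using neg[OF mult[of "nat (- k)"]] by simp
  qed
  show "flow s z t = z \<longleftrightarrow> (\<exists>k::int. t = of_int k * period s)"
  proof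
    assume t: "flow s z t = z"
    define k where "k = \<lfloor>t / period s\<rfloor>"
    define r where "r = t - of_int k * period s"
    have "of_int k \<le> t / period s" "t / period s < of_int k + 1" by (auto simp: k_def)
    then have r: "0 \<le> r" "r < period s" using pos by (auto simp: r_def field_simps)
    have "flow s z r = flow s (flow s z t) (of_int (- k) * period s)"
      unfolding flow_add[OF z] r_def by simp
    then have rr: "flow s z r = z" using t imult[of "- k"] by simp
    have "r = 0"
    proof (rule ccontr)
      assume "r \<noteq> 0"
      then have "r \<in> ?P" using lb[OF rr] rr r by simp
      then have "period s \<le> r" unfolding L using bb by (rule cInf_lower)
      with r show False by simp
    qed
    then show "\<exists>k::int. t = of_int k * period s" by (auto simp: r_def)
  qed (use imult in auto)
qed

lemma flow_eq_iff:
  assumes z: "(s, z) \<in> states"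
  shows "fst (flow s z t) = fst (flow s z t') \<longleftrightarrow> (\<exists>k::int. t - t' = of_int k * period s)"
proof -
  obtain x \<tau> where zx: "z = (x, \<tau>)" by (cases z)
  have "flow s z t = flow s z t'" if "flow s z (t - t') = z"
    using flow_add[OF z, of "t - t'" t'] that by simp
  then have "fst (flow s z t) = fst (flow s z t') \<longleftrightarrow> flow s z (t - t') = z"
    using flow_same_point[of s x \<tau> t t'] z zx by auto
  then show ?thesis using period(2)[OF z] by simp
qed

text \<open>After time \<open>L\<close>, the length at \<open>s0\<close>, an orbit on a nearby leaf
  is almost back, and the box coordinate \<open>u s\<close> of its position turns this into an exact
  return at time \<open>L - u s\<close>. That time is a multiple of the length of leaf
  \<open>s\<close>. The lower bound on lengths limits the multiples, and each multiple above 1 is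
  excluded near \<open>s0\<close> by continuity, so the length equals
  \<open>L - u s\<close>.\<close>

lemma period_continuous:
  assumes z: "(s0, z) \<in> states" shows "isCont period s0"
proof -
  obtain x0 \<tau> where zx: "z = (x0, \<tau>)" by (cases z)
  have x: "x0 \<in> X s0" using state_space z zx by blast
  obtain \<epsilon> W \<beta> T a where B: "leaf_box X s0 x0 \<epsilon> W \<beta> T a" using box_exists x by blast
  note BD = leaf_boxD[OF B]
  have \<beta>0: "\<beta> s0 0 = x0" using BD(12)[OF BD(3) x] BD(4) by simp
  let ?I = "ball s0 \<epsilon>"
  have I: "\<bar>s - s0\<bar> < \<epsilon>" if "s \<in> ?I" for s using that by (simp add: dist_real_def abs_minus_commute)
  define \<sigma> where "\<sigma> = (\<lambda>s. (\<beta> s 0, T s 0))"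
  have st: "(s, \<sigma> s) \<in> states" if "s \<in> ?I" for s using box_state[OF B I[OF that]] by (simp add: \<sigma>_def)
  have "continuous_on ?I (\<lambda>s. ((\<lambda>z. \<beta> (fst z) (snd z)) (s, 0), (\<lambda>z. T (fst z) (snd z)) (s, 0)))"
    by (intro continuous_on_Pair continuous_on_compose2[OF BD(14)] continuous_on_compose2[OF BD(15)] continuous_intros)
       (use I BD(1) in auto)
  then have c\<sigma>: "continuous_on ?I \<sigma>" by (simp add: \<sigma>_def)
  have s0I: "s0 \<in> ?I" "open ?I" using BD(1) by auto
  have evI: "\<forall>\<^sub>F s in nhds s0. s \<in> ?I" by (rule eventually_nhds_in_open[OF s0I(2,1)])
  define L where "L = period s0"
  have Lpos: "0 < L" unfolding L_def by (rule period(1)[OF z])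
  have flowc: "continuous_on ?I (\<lambda>s. flow s (\<sigma> s) (r s))" if "continuous_on ?I r" for r
    by (rule continuous_on_flow) (auto intro!: continuous_intros c\<sigma> that st)
  define F where "F = (\<lambda>s. flow s (\<sigma> s) L)"
  have cF: "continuous_on ?I F" unfolding F_def by (intro flowc continuous_intros)
  have F0: "F s0 = (x0, T s0 0)"
  proof -
    have "flow s0 (\<sigma> s0) (of_int 1 * L) = \<sigma> s0" unfolding L_def using period(2)[OF st[OF s0I(1)]] by blast
    then show ?thesis by (simp add: F_def \<sigma>_def \<beta>0)
  qed
  have FX: "fst (F s) \<in> X s" if "s \<in> ?I" for s
    using flow_state[OF st[OF that], of L] state_space unfolding F_def by (metis prod.collapse)
  let ?D = "?I \<inter> (\<lambda>s. (s, fst (F s))) -` W"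
  have oD: "open ?D" by (intro continuous_open_preimage continuous_intros cF s0I BD(2))
  have s0D: "s0 \<in> ?D" using s0I F0 BD(3) by simp
  define u where "u = (\<lambda>s. a s (fst (F s)))"
  have "continuous_on ?D (\<lambda>s. (\<lambda>z. a (fst z) (snd z)) (s, fst (F s)))"
    by (rule continuous_on_compose2[OF BD(16)])
       (use FX in \<open>auto intro!: continuous_intros continuous_on_subset[OF cF]\<close>)
  then have cu: "continuous_on ?D u" by (simp add: u_def)
  have u0: "u s0 = 0" using F0 BD(4) by (simp add: u_def)
  have ub: "\<bar>u s\<bar> < \<epsilon>" if "s \<in> ?D" for s using BD(11)[of s "fst (F s)"] FX that by (auto simp: u_def)
  have "continuous_on ?D (\<lambda>s. (\<lambda>z. T (fst z) (snd z)) (s, u s))"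
    by (rule continuous_on_compose2[OF BD(15)]) (use I ub in \<open>auto intro!: continuous_intros cu\<close>)
  then have cTu: "continuous_on ?D (\<lambda>s. snd (F s) \<bullet> T s (u s))"
    by (intro continuous_intros continuous_on_subset[OF cF]) auto
  have uc: "isCont u s0" using cu oD s0D continuous_on_eq_continuous_at by blast
  have "isCont (\<lambda>s. snd (F s) \<bullet> T s (u s)) s0" using cTu oD s0D continuous_on_eq_continuous_at by blast
  moreover have "snd (F s0) \<bullet> T s0 (u s0) = 1" using F0 u0 BD(8)[of s0 0] BD(1) by (simp add: norm_eq_1)
  ultimately have ev1: "\<forall>\<^sub>F s in nhds s0. snd (F s) \<bullet> T s (u s) > 0"
    by (metis isCont_def order_tendstoD(1) tendsto_at_iff_tendsto_nhds zero_less_one)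
  have evD: "\<forall>\<^sub>F s in nhds s0. s \<in> ?D" using oD s0D by (rule eventually_nhds_in_open)
  \<comment> \<open>At time \<open>L\<close> the orbit is at box coordinate \<open>u s\<close> with
    tangent \<open>T\<close>. The base state reaches the same state at time \<open>u s\<close>, and
    cancelling this time gives the return.\<close>
  have ret: "flow s (\<sigma> s) (L - u s) = \<sigma> s" if s: "s \<in> ?D" "snd (F s) \<bullet> T s (u s) > 0" for s
  proof -
    have sI: "s \<in> ?I" and W: "(s, fst (F s)) \<in> W" using s by auto
    have stF: "(s, fst (F s), snd (F s)) \<in> states" using flow_state[OF st[OF sI], of L] by (simp add: F_def)
    obtain c where c: "c \<in> {1,-1}" "snd (F s) = c *\<^sub>R T s (u s)" using state_in_box[OF B stF W] unfolding u_def by blast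
    have "c > 0" using s(2) c(2) BD(8)[OF I[OF sI] ub[OF s(1)]] by (simp add: norm_eq_1)
    then have "snd (F s) = T s (u s)" using c by auto
    moreover have "fst (F s) = \<beta> s (u s)" using BD(12)[OF W FX[OF sI]] by (simp add: u_def)
    moreover have b0: "a s (\<beta> s 0) = 0" "(s, \<beta> s 0) \<in> W" "\<beta> s 0 \<in> X s" using BD(1,5-7) I[OF sI] by auto
    moreover have "flow s (\<sigma> s) (u s) = (\<beta> s (u s), T s (u s))"
      using flow_in_box(3)[OF B b0(2,3), of 1 "u s"] b0(1) ub[OF s(1)] by (simp add: \<sigma>_def)
    ultimately have "flow s (\<sigma> s) L = flow s (\<sigma> s) (u s)" by (simp add: F_def prod_eq_iff)
    then have "flow s (flow s (\<sigma> s) L) (- u s) = flow s (flow s (\<sigma> s) (u s)) (- u s)" by simp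
    then show ?thesis using flow_0[OF st[OF sI]] unfolding flow_add[OF st[OF sI]] by simp
  qed
  \<comment> \<open>If \<open>L - u s\<close> is \<open>k\<close> times a length of at least
    \<epsilon>, then \<open>u s > -1\<close> gives
    \<open>k * \<epsilon> \<le> L + 1\<close>.\<close>
  define K where "K = nat \<lceil>(L + 1) / \<epsilon>\<rceil>"
  have evk: "\<forall>\<^sub>F s in nhds s0. flow s (\<sigma> s) ((L - u s) / real k) \<noteq> \<sigma> s" if k: "k \<in> {2..K}" for k
  proof -
    let ?f = "\<lambda>s. flow s (\<sigma> s) ((L - u s) / real k)" 
    have "continuous_on ?D ?f"
      by (rule continuous_on_flow) (use st k in \<open>auto intro!: continuous_intros cu continuous_on_subset[OF c\<sigma>]\<close>)
    then have "continuous_on ?D (\<lambda>s. ?f s - \<sigma> s)"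
      by (intro continuous_intros continuous_on_subset[OF c\<sigma>]) auto
    then have "isCont (\<lambda>s. ?f s - \<sigma> s) s0" using oD s0D continuous_on_eq_continuous_at by blast
    moreover have "?f s0 - \<sigma> s0 \<noteq> 0"
    proof
      assume "?f s0 - \<sigma> s0 = 0"
      then have "flow s0 (\<sigma> s0) (L / real k) = \<sigma> s0" using u0 by simp
      \<comment> \<open>At \<open>s0\<close> itself a return at a proper fraction of
        \<open>L\<close> would have to be a multiple of \<open>L\<close>.\<close>
      then obtain j :: int where j: "L / real k = of_int j * L" unfolding L_def using period(2)[OF st[OF s0I(1)]] by blast
      have "of_int (j * int k) * L = of_int 1 * L" using j k by (simp add: field_simps)
      then have "of_int (j * int k) = (of_int 1 :: real)" using Lpos by simp
      then have "j * int k = 1" using of_int_eq_iff by blast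
      then have "int k dvd 1" by (metis dvd_triv_right)
      then show False using k by simp
    qed
    moreover have "((\<lambda>s. ?f s - \<sigma> s) \<longlongrightarrow> ?f s0 - \<sigma> s0) (nhds s0)"
      if "isCont (\<lambda>s. ?f s - \<sigma> s) s0"
      using that tendsto_at_iff_tendsto_nhds[of "\<lambda>s. ?f s - \<sigma> s" s0] by (simp add: isCont_def)
    ultimately have "\<forall>\<^sub>F s in nhds s0. ?f s - \<sigma> s \<noteq> 0"
      using tendsto_imp_eventually_ne[of "\<lambda>s. ?f s - \<sigma> s" "?f s0 - \<sigma> s0" "nhds s0" 0] by blast
    then show ?thesis by eventually_elim simp
  qed
  then have evK: "\<forall>\<^sub>F s in nhds s0. \<forall>k\<in>{2..K}. flow s (\<sigma> s) ((L - u s) / real k) \<noteq> \<sigma> s"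
    by (intro eventually_ball_finite) auto
  have ut: "(u \<longlongrightarrow> 0) (nhds s0)" using uc u0 by (metis isCont_def tendsto_at_iff_tendsto_nhds)
  then have evu: "\<forall>\<^sub>F s in nhds s0. u s < L" "\<forall>\<^sub>F s in nhds s0. u s > -1"
    using Lpos by (auto intro: order_tendstoD)
  have evP: "\<forall>\<^sub>F s in nhds s0. period s = L - u s"
    using evD ev1 evK evu
  proof eventually_elim
    case (elim s)
    have sI: "s \<in> ?I" using elim by blast
    note P = period[OF st[OF sI]]
    obtain k :: int where k: "L - u s = of_int k * period s" using ret[OF elim(1,2)] P(2) by blast
    have "of_int k * period s > 0" using elim(4) k by simp
    then have k0: "k > 0" using P(1) by (simp add: zero_less_mult_iff)
    have "flow s (\<sigma> s) (of_int 1 * period s) = \<sigma> s" using P(2) by blast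
    then have "\<epsilon> \<le> period s"
      using flow_return_lower_bound[OF B I[OF sI] P(1)] by (force simp: \<sigma>_def)
    then have "of_int k * \<epsilon> \<le> of_int k * period s" using k0 by (intro mult_left_mono) auto
    then have "of_int k * \<epsilon> \<le> L + 1" using k elim(5) by linarith
    then have "of_int k \<le> (L + 1) / \<epsilon>" using BD(1) by (simp add: field_simps)
    then have "nat k \<le> K" unfolding K_def by linarith
    have "k = 1"
    proof (rule ccontr)
      assume "k \<noteq> 1"
      then have "nat k \<in> {2..K}" using k0 \<open>nat k \<le> K\<close> by auto
      then have "flow s (\<sigma> s) ((L - u s) / real (nat k)) \<noteq> \<sigma> s" using elim(3) by blast
      moreover have "(L - u s) / real (nat k) = period s" using k k0 by simp
      ultimately show False using P(2) by (metis mult_1 of_int_1)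
    qed
    then show ?case using k by simp
  qed
  have "((\<lambda>s. L - u s) \<longlongrightarrow> L - 0) (nhds s0)" by (intro tendsto_intros ut)
  then have "(period \<longlongrightarrow> L) (nhds s0)"
    using evP by (simp add: tendsto_cong)
  then show ?thesis unfolding L_def isCont_def by (simp add: tendsto_at_iff_tendsto_nhds)
qed

section \<open>Continuous sections of the states\<close>

definition state_section :: "real set \<Rightarrow> (real \<Rightarrow> 'a \<times> 'a) \<Rightarrow> bool" where
  "state_section I \<sigma> \<longleftrightarrow> continuous_on I \<sigma> \<and> (\<forall>s\<in>I. (s, \<sigma> s) \<in> states)"

text \<open>The central section of a box is moved by a constant time so as to pass through the
  prescribed state; if that state has the other direction, the reversed section is moved back
  instead. The radius depends on neither the state nor the parameter at which it is prescribed, as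
  bisection requires.\<close>

lemma section_local:
  assumes x0: "x0 \<in> X s0"
  shows "\<exists>e>0. \<forall>I c z. I \<subseteq> ball s0 e \<longrightarrow> c \<in> I \<longrightarrow> (c, z) \<in> states \<longrightarrow> (\<exists>\<sigma>. state_section I \<sigma> \<and> \<sigma> c = z)"
proof -
  obtain \<epsilon> W \<beta> T a where B: "leaf_box X s0 x0 \<epsilon> W \<beta> T a" using box_exists x0 by blast
  note BD = leaf_boxD[OF B]
  have "\<exists>\<sigma>. state_section I \<sigma> \<and> \<sigma> c = z" if I: "I \<subseteq> ball s0 \<epsilon>" "c \<in> I" "(c, z) \<in> states" for I c z
  proof -
    obtain x \<tau> where z: "z = (x, \<tau>)" by (cases z)
    have Is: "\<bar>s - s0\<bar> < \<epsilon>" if "s \<in> I" for s using that I(1) by (auto simp: dist_real_def abs_minus_commute)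
    have "continuous_on I (\<lambda>s. (\<lambda>z. \<beta> (fst z) (snd z)) (s, 0))" "continuous_on I (\<lambda>s. (\<lambda>z. T (fst z) (snd z)) (s, 0))"
      by (intro continuous_on_compose2[OF BD(14)] continuous_on_compose2[OF BD(15)] continuous_intros; use Is BD(1) in auto)+
    then have c: "continuous_on I (\<lambda>s. \<beta> s 0)" "continuous_on I (\<lambda>s. T s 0)" by simp_all
    have st: "(s, \<beta> s 0, T s 0) \<in> states" if "s \<in> I" for s by (rule box_state[OF B Is[OF that]])
    then have st': "(s, \<beta> s 0, - T s 0) \<in> states" if "s \<in> I" for s using flow_flip1(1) that by blast
    have gen: "\<exists>\<sigma>. state_section I \<sigma> \<and> \<sigma> c = z"
      if \<rho>: "continuous_on I \<rho>" "\<And>s. s \<in> I \<Longrightarrow> (s, \<rho> s) \<in> states" "flow c (\<rho> c) r = z" for \<rho> r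
      using that flow_state
      by (intro exI[of _ "\<lambda>s. flow s (\<rho> s) r"]) (auto simp: state_section_def intro!: continuous_on_flow continuous_intros)
    obtain r where "flow c (\<beta> c 0, T c 0) r = z \<or> flow c (\<beta> c 0, T c 0) r = (x, - \<tau>)"
      using flow_cases_same_leaf[OF st[OF I(2)] I(3)[unfolded z]] z by blast
    then show ?thesis
    proof
      assume "flow c (\<beta> c 0, T c 0) r = z"
      then show ?thesis by (intro gen[of "\<lambda>s. (\<beta> s 0, T s 0)" r] continuous_on_Pair c st)
    next
      assume "flow c (\<beta> c 0, T c 0) r = (x, - \<tau>)"
      then have "flow c (\<beta> c 0, - T c 0) (- r) = z" using flow_neg[OF st[OF I(2)], of "- r"] z by simp
      then show ?thesis by (intro gen[of "\<lambda>s. (\<beta> s 0, - T s 0)" "- r"] continuous_on_Pair continuous_on_minus c st')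
    qed
  qed
  then show ?thesis using BD(1) by blast
qed

lemma section_glue:
  assumes "state_section {a..b} \<sigma>1" "state_section {b..c} \<sigma>2" "\<sigma>1 b = \<sigma>2 b" "a \<le> b" "b \<le> c"
  shows "state_section {a..c} (\<lambda>s. if s \<le> b then \<sigma>1 s else \<sigma>2 s)"
proof -
  have eq: "{a..c} = {a..b} \<union> {b..c}" using assms(4,5) by auto
  have "continuous_on ({a..b} \<union> {b..c}) (\<lambda>s. if s \<le> b then \<sigma>1 s else \<sigma>2 s)"
    using assms by (intro continuous_on_If) (auto simp: state_section_def)
  then show ?thesis unfolding state_section_def eq using assms by (auto simp: state_section_def)
qed

text \<open>Bolzano bisection. The property allows any prescribed state at any point of the
  interval, which makes it stable under concatenation: a section on the half containing that point
  is continued on the other half from its value at the common endpoint.\<close>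

lemma section_exists:
  assumes ne: "\<And>s. s \<in> {A..B} \<Longrightarrow> X s \<noteq> {}" and AB: "A \<le> B" and c: "c \<in> {A..B}" "(c, z) \<in> states"
  shows "\<exists>\<sigma>. state_section {A..B} \<sigma> \<and> \<sigma> c = z"
proof -
  define P where "P = (\<lambda>a b. \<forall>c z. c \<in> {a..b} \<longrightarrow> (c, z) \<in> states \<longrightarrow> (\<exists>\<sigma>. state_section {a..b} \<sigma> \<and> \<sigma> c = z))"
  have PD: "\<exists>\<sigma>. state_section {a..b} \<sigma> \<and> \<sigma> c = z" if "P a b" "c \<in> {a..b}" "(c, z) \<in> states" for a b c z
    using that unfolding P_def by blast
  have "P A B" using AB
  proof (induction rule: Bolzano)
    case (trans a b c)
    show ?case unfolding P_def
    proof (intro allI impI)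
      fix d z assume d: "d \<in> {a..c}" "(d, z) \<in> states"
      show "\<exists>\<sigma>. state_section {a..c} \<sigma> \<and> \<sigma> d = z"
      proof (cases "d \<le> b")
        case True
        obtain \<sigma>1 where 1: "state_section {a..b} \<sigma>1" "\<sigma>1 d = z"
          using PD[OF trans(1), of d z] d True by (metis atLeastAtMost_iff)
        have "(b, \<sigma>1 b) \<in> states" using 1(1) trans(3) unfolding state_section_def by auto
        then obtain \<sigma>2 where 2: "state_section {b..c} \<sigma>2" "\<sigma>2 b = \<sigma>1 b"
          using PD[OF trans(2), of b "\<sigma>1 b"] trans(4) by (metis atLeastAtMost_iff order_refl)
        show ?thesis using section_glue[OF 1(1) 2(1)] 1(2) 2(2) trans(3,4) True by (intro exI[of _ "\<lambda>s. if s \<le> b then \<sigma>1 s else \<sigma>2 s"]) auto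
      next
        case False
        obtain \<sigma>2 where 2: "state_section {b..c} \<sigma>2" "\<sigma>2 d = z"
          using PD[OF trans(2), of d z] d False by (metis atLeastAtMost_iff linear)
        have "(b, \<sigma>2 b) \<in> states" using 2(1) trans(4) unfolding state_section_def by auto
        then obtain \<sigma>1 where 1: "state_section {a..b} \<sigma>1" "\<sigma>1 b = \<sigma>2 b"
          using PD[OF trans(1), of b "\<sigma>2 b"] trans(3) by (metis atLeastAtMost_iff order_refl)
        show ?thesis using section_glue[OF 1(1) 2(1)] 1(2) 2(2) trans(3,4) False by (intro exI[of _ "\<lambda>s. if s \<le> b then \<sigma>1 s else \<sigma>2 s"]) auto
      qed
    qed
  next
    case (local x)
    then obtain x0 where "x0 \<in> X x" using ne[of x] by auto
    from section_local[OF this] obtain e where e: "e > 0"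
      "\<And>I c z. I \<subseteq> ball x e \<Longrightarrow> c \<in> I \<Longrightarrow> (c, z) \<in> states \<Longrightarrow> \<exists>\<sigma>. state_section I \<sigma> \<and> \<sigma> c = z" by blast
    have "P a b" if "a \<le> x" "x \<le> b" "b - a < e" for a b
    proof -
      have "{a..b} \<subseteq> ball x e" using that by (auto simp: dist_real_def)
      then show ?thesis unfolding P_def using e(2) by blast
    qed
    then show ?case using e(1) by blast
  qed
  then show ?thesis using c unfolding P_def by blast
qed

lemma section_extend:
  assumes ne: "\<And>s. s \<in> {A..B} \<Longrightarrow> X s \<noteq> {}" and \<sigma>: "state_section {a..b} \<sigma>" and ab: "A \<le> a" "a \<le> b" "b \<le> B"
  shows "\<exists>\<rho>. state_section {A..B} \<rho> \<and> (\<forall>s\<in>{a..b}. \<rho> s = \<sigma> s)"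
proof -
  have st: "(a, \<sigma> a) \<in> states" "(b, \<sigma> b) \<in> states" using \<sigma> ab unfolding state_section_def by auto
  obtain \<sigma>1 where 1: "state_section {A..a} \<sigma>1" "\<sigma>1 a = \<sigma> a"
    using section_exists[of A a a "\<sigma> a"] ne ab st by auto
  obtain \<sigma>2 where 2: "state_section {b..B} \<sigma>2" "\<sigma>2 b = \<sigma> b"
    using section_exists[of b B b "\<sigma> b"] ne ab st by auto
  let ?\<rho> = "\<lambda>s. if s \<le> a then \<sigma>1 s else \<sigma> s"
  have "state_section {A..b} ?\<rho>" by (rule section_glue[OF 1(1) \<sigma> 1(2) ab(1,2)])
  from section_glue[OF this 2(1)] have "state_section {A..B} (\<lambda>s. if s \<le> b then ?\<rho> s else \<sigma>2 s)"
    using 2(2) 1(2) ab by (cases "a = b") auto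
  then show ?thesis using 1(2) by (intro exI[of _ "\<lambda>s. if s \<le> b then ?\<rho> s else \<sigma>2 s"]) auto
qed

lemma leaf_parametrization:
  assumes \<sigma>: "state_section I \<sigma>"
  defines "f \<equiv> \<lambda>p. fst (flow (snd p) (\<sigma> (snd p)) (fst p * period (snd p)))"
  shows "continuous_on (UNIV \<times> I) f"
    "\<And>s. s \<in> I \<Longrightarrow> (\<lambda>t. f (t, s)) ` UNIV = X s"
    "\<And>s t t'. s \<in> I \<Longrightarrow> f (t, s) = f (t', s) \<longleftrightarrow> t - t' \<in> \<int>"
proof -
  have st: "(s, \<sigma> s) \<in> states" if "s \<in> I" for s using \<sigma> that by (simp add: state_section_def)
  have cp: "continuous_on I period"
    using period_continuous[OF st] by (auto intro: continuous_at_imp_continuous_on)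
  have cs: "continuous_on I \<sigma>" using \<sigma> by (simp add: state_section_def)
  show "continuous_on (UNIV \<times> I) f"
    unfolding f_def using st
    by (intro continuous_on_fst continuous_on_flow continuous_intros continuous_on_compose2[OF cp continuous_on_snd]
         continuous_on_compose2[OF cs continuous_on_snd]) auto
  show "(\<lambda>t. f (t, s)) ` UNIV = X s" if s: "s \<in> I" for s
  proof (intro equalityI subsetI)
    fix y assume "y \<in> (\<lambda>t. f (t, s)) ` UNIV"
    then show "y \<in> X s" using flow_state[OF st[OF s]] state_space by (auto simp: f_def) (metis prod.collapse)
  next
    fix y assume "y \<in> X s"
    then obtain r where "fst (flow s (\<sigma> s) r) = y" using flow_transitive[OF st[OF s]] by blast
    then have "f (r / period s, s) = y" using period(1)[OF st[OF s]] by (simp add: f_def)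
    then show "y \<in> (\<lambda>t. f (t, s)) ` UNIV" by blast
  qed
  show "f (t, s) = f (t', s) \<longleftrightarrow> t - t' \<in> \<int>" if s: "s \<in> I" for s t t'
  proof -
    have "f (t, s) = f (t', s) \<longleftrightarrow> (\<exists>k::int. (t - t') * period s = of_int k * period s)"
      unfolding f_def using flow_eq_iff[OF st[OF s]] by (simp add: left_diff_distrib)
    also have "\<dots> \<longleftrightarrow> t - t' \<in> \<int>" using period(1)[OF st[OF s]] by (auto simp: Ints_def)
    finally show ?thesis .
  qed
qed

end

subsection \<open>Intersections of a surface with a family\<close>

text \<open>\<open>A s w\<close> integrates the speed from 0 to \<open>w\<close>. The map sending
  \<open>(s, w)\<close> to \<open>(s, A s w)\<close> is continuous and injective, so invariance of
  domain yields an inverse that is continuous in both variables, from mere continuity in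
  \<open>s\<close>.\<close>

lemma arclength_reparametrization:
  fixes l :: "real \<times> real \<Rightarrow> real"
  assumes e0: "0 < e0"
    and cont: "continuous_on {z. \<bar>fst z - s0\<bar> < e0 \<and> \<bar>snd z\<bar> < e0} l"
    and pos: "\<forall>s w. \<bar>s - s0\<bar> < e0 \<and> \<bar>w\<bar> < e0 \<longrightarrow> 0 < l (s, w)"
  shows "\<exists>r \<epsilon> A \<omega>. 0 < \<epsilon> \<and> \<epsilon> \<le> r \<and> r < e0 \<and>
    (\<forall>s w. \<bar>s - s0\<bar> < r \<and> \<bar>w\<bar> < r \<longrightarrow> (A s has_real_derivative l (s, w)) (at w)) \<and>
    continuous_on {z. \<bar>fst z - s0\<bar> < r \<and> \<bar>snd z\<bar> < r} (\<lambda>z. A (fst z) (snd z)) \<and>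
    (\<forall>s w w'. \<bar>s - s0\<bar> < r \<and> \<bar>w\<bar> < r \<and> \<bar>w'\<bar> < r \<and> A s w = A s w' \<longrightarrow> w = w') \<and>
    A s0 0 = 0 \<and>
    (\<forall>s u. \<bar>s - s0\<bar> < \<epsilon> \<and> \<bar>u\<bar> < \<epsilon> \<longrightarrow> \<bar>\<omega> s u\<bar> < r \<and> A s (\<omega> s u) = u) \<and>
    continuous_on {z. \<bar>fst z - s0\<bar> < \<epsilon> \<and> \<bar>snd z\<bar> < \<epsilon>} (\<lambda>z. \<omega> (fst z) (snd z))"
proof -
  \<comment> \<open>Half the radius keeps the closed interval of integration inside the domain of
    \<open>l\<close>.\<close>
  define r where "r = e0 / 2"
  have r: "0 < r" "r < e0" using e0 by (auto simp: r_def)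
  let ?R = "{z :: real \<times> real. \<bar>fst z - s0\<bar> < r \<and> \<bar>snd z\<bar> < r}"
  have cl: "continuous_on I (\<lambda>i. l (p i, q i))"
    if "continuous_on I p" "continuous_on I q" "\<And>i. i \<in> I \<Longrightarrow> \<bar>p i - s0\<bar> < e0 \<and> \<bar>q i\<bar> < e0" for I :: "'c::topological_space set" and p q
    using that by (intro continuous_on_compose2[OF cont, of I "\<lambda>i. (p i, q i)"] continuous_on_Pair) auto
  define B where "B = (\<lambda>s w. integral {-r..w} (\<lambda>u. l (s, u)))"
  define A where "A = (\<lambda>s w. B s w - B s 0)"
  \<comment> \<open>Clamping the integrand at \<open>w\<close> trades the moving endpoint for a
    fixed interval; the constant excess over the rest of the interval is subtracted. Joint
    continuity then follows from continuity of parameter integrals.\<close>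
  have Beq: "B s w = integral (cbox (-r) r) (\<lambda>u. l (s, min u w)) - (r - w) * l (s, w)"
    if sw: "\<bar>s - s0\<bar> < r" "\<bar>w\<bar> < r" for s w
  proof -
    have "continuous_on {-r..r} (\<lambda>u. l (s, min u w))"
      by (rule cl) (use sw r in \<open>auto intro!: continuous_intros\<close>)
    then have "integral {-r..w} (\<lambda>u. l (s, min u w)) + integral {w..r} (\<lambda>u. l (s, min u w)) = integral {-r..r} (\<lambda>u. l (s, min u w))"
      using sw by (intro Henstock_Kurzweil_Integration.integral_combine integrable_continuous_interval) auto
    moreover have "integral {-r..w} (\<lambda>u. l (s, min u w)) = B s w"
      unfolding B_def by (rule integral_cong) (auto simp: min_def)
    moreover have "integral {w..r} (\<lambda>u. l (s, min u w)) = integral {w..r} (\<lambda>u. l (s, w))"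
      by (rule integral_cong) (auto simp: min_def)
    moreover have "integral {w..r} (\<lambda>u. l (s, w)) = (r - w) * l (s, w)" using sw by simp
    ultimately show ?thesis unfolding cbox_interval by linarith
  qed
  have "continuous_on ?R (\<lambda>z. integral (cbox (-r) r) (\<lambda>u. l (fst z, min u (snd z))))"
    by (rule integral_continuous_on_param)
       (unfold case_prod_beta, rule cl, use r in \<open>auto intro!: continuous_intros\<close>)
  moreover have "continuous_on ?R (\<lambda>z. (r - snd z) * l (fst z, snd z))"
    by (intro continuous_intros cl) (use r in auto)
  ultimately have "continuous_on ?R (\<lambda>z. integral (cbox (-r) r) (\<lambda>u. l (fst z, min u (snd z))) - (r - snd z) * l (fst z, snd z))"
    by (rule continuous_on_diff)
  then have cB: "continuous_on ?R (\<lambda>z. B (fst z) (snd z))"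
    by (rule continuous_on_eq) (simp add: Beq)
  have "continuous_on ?R (\<lambda>z. (\<lambda>z. B (fst z) (snd z)) (fst z, 0))"
    by (rule continuous_on_compose2[OF cB]) (use r in \<open>auto intro!: continuous_intros\<close>)
  then have cA: "continuous_on ?R (\<lambda>z. A (fst z) (snd z))" unfolding A_def using cB by (auto intro!: continuous_intros)
  have dA: "(A s has_real_derivative l (s, w)) (at w)" if sw: "\<bar>s - s0\<bar> < r" "\<bar>w\<bar> < r" for s w
  proof -
    have c: "continuous_on {-r..r} (\<lambda>u. l (s, u))" by (rule cl) (use sw r in \<open>auto intro!: continuous_intros\<close>)
    have w: "w \<in> {-r..r}" "-r < w" "w < r" using sw by auto
    have "((\<lambda>w. integral {-r..w} (\<lambda>u. l (s, u))) has_vector_derivative l (s, w)) (at w within {-r..r})"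
      by (rule integral_has_vector_derivative[OF c w(1)])
    then have "(B s has_vector_derivative l (s, w)) (at w)"
      using at_within_Icc_at[OF w(2,3)] by (simp add: B_def[abs_def])
    then have "(B s has_real_derivative l (s, w)) (at w)"
      by (simp add: has_real_derivative_iff_has_vector_derivative)
    then show ?thesis unfolding A_def[abs_def] by (auto intro!: derivative_eq_intros)
  qed
  have mono: "A s w < A s w'" if "\<bar>s - s0\<bar> < r" "\<bar>w\<bar> < r" "\<bar>w'\<bar> < r" "w < w'" for s w w'
  proof (rule DERIV_pos_imp_increasing[OF that(4)])
    fix x assume "w \<le> x" "x \<le> w'"
    then have x: "\<bar>x\<bar> < r" using that by auto
    then show "\<exists>y. (A s has_real_derivative y) (at x) \<and> 0 < y"
      using dA[OF that(1) x] pos[rule_format, of s x] that(1) x r by auto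
  qed
  have inj: "w = w'" if "\<bar>s - s0\<bar> < r" "\<bar>w\<bar> < r" "\<bar>w'\<bar> < r" "A s w = A s w'" for s w w'
    using mono[OF that(1-3)] mono[OF that(1,3,2)] that(4) by (metis less_irrefl linorder_neqE_linordered_idom)
  have oR: "open ?R" unfolding Collect_conj_eq by (intro open_Int open_Collect_less continuous_intros)
  let ?\<Phi> = "\<lambda>z. (fst z, A (fst z) (snd z))"
  have c\<Phi>: "continuous_on ?R ?\<Phi>" by (intro continuous_intros cA)
  have i\<Phi>: "inj_on ?\<Phi> ?R" using inj by (auto simp: inj_on_def)
  obtain g where g: "homeomorphism ?R (?\<Phi> ` ?R) ?\<Phi> g"
    using invariance_of_domain_homeomorphism[OF oR c\<Phi> _ i\<Phi>] by auto
  have o\<Phi>: "open (?\<Phi> ` ?R)" by (rule invariance_of_domain[OF c\<Phi> oR i\<Phi>])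
  have "(s0, 0) \<in> ?\<Phi> ` ?R" using r by (intro image_eqI[of _ _ "(s0, 0)"]) (auto simp: A_def)
  then obtain d where d: "d > 0" "ball (s0, 0) d \<subseteq> ?\<Phi> ` ?R" using o\<Phi> by (meson open_contains_ball)
  define \<epsilon> where "\<epsilon> = min r (d / 2)"
  have \<epsilon>: "0 < \<epsilon>" "\<epsilon> \<le> r" using r d by (auto simp: \<epsilon>_def)
  have sub: "(s, u) \<in> ?\<Phi> ` ?R" if "\<bar>s - s0\<bar> < \<epsilon>" "\<bar>u\<bar> < \<epsilon>" for s u
  proof -
    have "dist (s0, 0) (s, u) \<le> \<bar>s - s0\<bar> + \<bar>u\<bar>"
      unfolding dist_Pair_Pair dist_real_def using sqrt_sum_squares_le_sum_abs[of "s0 - s" "0 - u"]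
      by (simp add: abs_minus_commute)
    also have "\<dots> < d" using that by (auto simp: \<epsilon>_def)
    finally show ?thesis using d(2) by auto
  qed
  define \<omega> where "\<omega> = (\<lambda>s u. snd (g (s, u)))"
  have \<omega>: "\<bar>\<omega> s u\<bar> < r \<and> A s (\<omega> s u) = u" if su: "\<bar>s - s0\<bar> < \<epsilon>" "\<bar>u\<bar> < \<epsilon>" for s u
  proof -
    have "g (s, u) \<in> ?R" "?\<Phi> (g (s, u)) = (s, u)" using g sub[OF su] unfolding homeomorphism_def by blast+
    then show ?thesis by (auto simp: \<omega>_def)
  qed
  have "continuous_on {z. \<bar>fst z - s0\<bar> < \<epsilon> \<and> \<bar>snd z\<bar> < \<epsilon>} (\<lambda>z. g (fst z, snd z))"
    by (rule continuous_on_compose2[of "?\<Phi> ` ?R" g])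
       (use g sub in \<open>auto simp: homeomorphism_def simp del: image_iff intro!: continuous_intros\<close>)
  then have c\<omega>: "continuous_on {z. \<bar>fst z - s0\<bar> < \<epsilon> \<and> \<bar>snd z\<bar> < \<epsilon>} (\<lambda>z. \<omega> (fst z) (snd z))"
    unfolding \<omega>_def by (intro continuous_intros)
  have A0: "A s0 0 = 0" by (simp add: A_def)
  have "\<forall>s w. \<bar>s - s0\<bar> < r \<and> \<bar>w\<bar> < r \<longrightarrow> (A s has_real_derivative l (s, w)) (at w)"
    using dA by simp
  moreover have "\<forall>s w w'. \<bar>s - s0\<bar> < r \<and> \<bar>w\<bar> < r \<and> \<bar>w'\<bar> < r \<and> A s w = A s w' \<longrightarrow> w = w'"
    by (intro allI impI, elim conjE) (rule inj)
  moreover have "\<forall>s u. \<bar>s - s0\<bar> < \<epsilon> \<and> \<bar>u\<bar> < \<epsilon> \<longrightarrow> \<bar>\<omega> s u\<bar> < r \<and> A s (\<omega> s u) = u"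
    using \<omega> by simp
  ultimately show ?thesis
    by (intro exI[of _ r] exI[of _ \<epsilon>] exI[of _ A] exI[of _ \<omega>] conjI) (rule \<epsilon> r cA c\<omega> A0 | assumption)+
qed

text \<open>The graph parametrization from \<open>slice_chart\<close> is reparametrized by
  arclength. That \<open>T\<close> is the normalized \<open>leaf_dir\<close> is part of the
  conclusion because the orientation of the leaves is later compared with the gradients of the two
  surfaces.\<close>

lemma leaf_box_of_slice:
  assumes M: "defining M V1 g1" "x0 \<in> M" "x0 \<in> V1"
    and F: "family_defining S P V2 g2" "x0 \<in> P s0" "(s0, x0) \<in> V2"
    and tr: "\<not> parallel (grad g1 x0) (xgrad g2 (s0, x0))"
  shows "\<exists>\<epsilon> W \<beta> T a. leaf_box (\<lambda>s. if s \<in> S then M \<inter> P s else {}) s0 x0 \<epsilon> W \<beta> T a \<and>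
     W \<subseteq> V2 \<and> snd ` W \<subseteq> V1 \<and>
     (\<forall>s u. \<bar>s - s0\<bar> < \<epsilon> \<and> \<bar>u\<bar> < \<epsilon> \<longrightarrow> leaf_dir g1 g2 (s, \<beta> s u) \<noteq> 0 \<and>
        T s u = leaf_dir g1 g2 (s, \<beta> s u) /\<^sub>R norm (leaf_dir g1 g2 (s, \<beta> s u)))"
proof -
  let ?X = "\<lambda>s. if s \<in> S then M \<inter> P s else {}"
  let ?l = "leaf_dir g1 g2"
  define \<tau> where "\<tau> = ?l (s0, x0)"
  obtain e0 W0 \<psi> where C: "0 < e0" "open W0" "(s0, x0) \<in> W0" "W0 \<subseteq> V2" "snd ` W0 \<subseteq> V1"
    and C0: "\<forall>z\<in>W0. \<tau> \<bullet> ?l z > 0"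
    and C1: "\<forall>s w. \<bar>s - s0\<bar> < e0 \<and> \<bar>w\<bar> < e0 \<longrightarrow> (s, \<psi> (s, w)) \<in> W0 \<and> \<psi> (s, w) \<in> M \<inter> P s \<and>
       \<tau> \<bullet> (\<psi> (s, w) - x0) = w \<and>
       ((\<lambda>w. \<psi> (s, w)) has_vector_derivative ?l (s, \<psi> (s, w)) /\<^sub>R (\<tau> \<bullet> ?l (s, \<psi> (s, w)))) (at w)"
    and C2: "\<forall>s x. (s, x) \<in> W0 \<and> x \<in> M \<inter> P s \<longrightarrow>
       \<bar>s - s0\<bar> < e0 \<and> \<bar>\<tau> \<bullet> (x - x0)\<bar> < e0 \<and> \<psi> (s, \<tau> \<bullet> (x - x0)) = x"
    and C3: "continuous_on {z. \<bar>fst z - s0\<bar> < e0 \<and> \<bar>snd z\<bar> < e0} \<psi>"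
    using slice_chart[OF M F tr \<tau>_def] by (elim exE conjE) (rule that)
  have sm: "smooth_on V1 g1" "smooth_on V2 g2" using M F by (auto simp: defining_def family_defining_def)
  have clW: "continuous_on W0 ?l" by (rule continuous_on_leaf_dir[OF sm C(4,5)])
  let ?R0 = "{z :: real \<times> real. \<bar>fst z - s0\<bar> < e0 \<and> \<bar>snd z\<bar> < e0}"
  \<comment> \<open>The speed of the graph parametrization: its velocity is the leaf direction
    scaled to have component 1 along \<tau>.\<close>
  define L where "L = (\<lambda>z. norm (?l (fst z, \<psi> z)) / (\<tau> \<bullet> ?l (fst z, \<psi> z)))"
  have in0: "(fst z, \<psi> z) \<in> W0" if "z \<in> ?R0" for z using C1[rule_format, of "fst z" "snd z"] that by simp
  have cl: "continuous_on ?R0 (\<lambda>z. ?l (fst z, \<psi> z))"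
    by (rule continuous_on_compose2[OF clW]) (use in0 in \<open>auto intro!: continuous_intros C3\<close>)
  have lpos: "\<tau> \<bullet> ?l (fst z, \<psi> z) > 0" if "z \<in> ?R0" for z using in0[OF that] C0 by blast
  have cL: "continuous_on ?R0 L" unfolding L_def using lpos by (intro continuous_intros cl) force
  have Lpos: "0 < L (s, w)" if "\<bar>s - s0\<bar> < e0" "\<bar>w\<bar> < e0" for s w
  proof -
    have "\<tau> \<bullet> ?l (s, \<psi> (s, w)) > 0" using lpos[of "(s, w)"] that by simp
    moreover from this have "?l (s, \<psi> (s, w)) \<noteq> 0" by force
    ultimately show ?thesis by (simp add: L_def)
  qed
  then have Lpos': "\<forall>s w. \<bar>s - s0\<bar> < e0 \<and> \<bar>w\<bar> < e0 \<longrightarrow> 0 < L (s, w)" by blast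
  obtain r \<epsilon> A \<omega> where r: "0 < \<epsilon>" "\<epsilon> \<le> r" "r < e0"
    and dA: "\<forall>s w. \<bar>s - s0\<bar> < r \<and> \<bar>w\<bar> < r \<longrightarrow> (A s has_real_derivative L (s, w)) (at w)"
    and cA: "continuous_on {z. \<bar>fst z - s0\<bar> < r \<and> \<bar>snd z\<bar> < r} (\<lambda>z. A (fst z) (snd z))"
    and inj: "\<forall>s w w'. \<bar>s - s0\<bar> < r \<and> \<bar>w\<bar> < r \<and> \<bar>w'\<bar> < r \<and> A s w = A s w' \<longrightarrow> w = w'"
    and A0: "A s0 0 = 0"
    and \<omega>: "\<forall>s u. \<bar>s - s0\<bar> < \<epsilon> \<and> \<bar>u\<bar> < \<epsilon> \<longrightarrow> \<bar>\<omega> s u\<bar> < r \<and> A s (\<omega> s u) = u"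
    and c\<omega>: "continuous_on {z. \<bar>fst z - s0\<bar> < \<epsilon> \<and> \<bar>snd z\<bar> < \<epsilon>} (\<lambda>z. \<omega> (fst z) (snd z))"
    using arclength_reparametrization[OF C(1) cL Lpos'] by (elim exE conjE) (rule that)
  define \<beta> where "\<beta> = (\<lambda>s u. \<psi> (s, \<omega> s u))"
  define T where "T = (\<lambda>s u. ?l (s, \<beta> s u) /\<^sub>R norm (?l (s, \<beta> s u)))"
  define a where "a = (\<lambda>s x. A s (\<tau> \<bullet> (x - x0)))"
  let ?Q = "{z :: real \<times> (real^3). \<bar>fst z - s0\<bar> < \<epsilon> \<and> \<bar>\<tau> \<bullet> (snd z - x0)\<bar> < r}"
  define W where "W = W0 \<inter> (?Q \<inter> (\<lambda>z. a (fst z) (snd z)) -` {-\<epsilon><..<\<epsilon>})"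
  have oQ: "open ?Q" unfolding Collect_conj_eq by (intro open_Int open_Collect_less continuous_intros)
  have caQ: "continuous_on ?Q (\<lambda>z. a (fst z) (snd z))"
  proof -
    have "continuous_on ?Q (\<lambda>z. (\<lambda>z. A (fst z) (snd z)) (fst z, \<tau> \<bullet> (snd z - x0)))"
      by (rule continuous_on_compose2[OF cA]) (use r in \<open>auto intro!: continuous_intros\<close>)
    then show ?thesis by (simp add: a_def)
  qed
  have oW: "open W" unfolding W_def by (intro open_Int C(2) continuous_open_preimage[OF caQ oQ]) auto
  let ?R = "{z :: real \<times> real. \<bar>fst z - s0\<bar> < \<epsilon> \<and> \<bar>snd z\<bar> < \<epsilon>}"
  have R0: "\<bar>s - s0\<bar> < e0" "\<bar>\<omega> s u\<bar> < e0" "\<bar>\<omega> s u\<bar> < r" "A s (\<omega> s u) = u" if "\<bar>s - s0\<bar> < \<epsilon>" "\<bar>u\<bar> < \<epsilon>" for s u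
    using \<omega>[rule_format, of s u] that r by auto
  have c\<beta>: "continuous_on ?R (\<lambda>z. \<beta> (fst z) (snd z))" unfolding \<beta>_def
    by (rule continuous_on_compose2[OF C3]) (use R0 in \<open>auto intro!: continuous_intros c\<omega>\<close>)
  have \<beta>W0: "(s, \<beta> s u) \<in> W0" if "\<bar>s - s0\<bar> < \<epsilon>" "\<bar>u\<bar> < \<epsilon>" for s u
    using in0[of "(s, \<omega> s u)"] R0[OF that] by (simp add: \<beta>_def)
  have lnz: "?l (s, \<beta> s u) \<noteq> 0" if "\<bar>s - s0\<bar> < \<epsilon>" "\<bar>u\<bar> < \<epsilon>" for s u
    using C0 \<beta>W0[OF that] by force
  have "continuous_on ?R (\<lambda>z. ?l (fst z, \<beta> (fst z) (snd z)))"
    by (rule continuous_on_compose2[OF clW]) (use \<beta>W0 in \<open>auto intro!: continuous_intros c\<beta>\<close>)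
  then have cT: "continuous_on ?R (\<lambda>z. T (fst z) (snd z))" unfolding T_def
    using lnz by (intro continuous_intros) auto
  have fwd: "\<beta> s u \<in> ?X s \<and> (s, \<beta> s u) \<in> W \<and> a s (\<beta> s u) = u \<and> norm (T s u) = 1 \<and>
      (\<beta> s has_vector_derivative T s u) (at u)" if su: "\<bar>s - s0\<bar> < \<epsilon>" "\<bar>u\<bar> < \<epsilon>" for s u
  proof -
    note R = R0[OF su] and \<psi> = C1[rule_format, OF conjI[OF R0(1,2)[OF su]], folded \<beta>_def]
    have \<beta>m: "\<beta> s u \<in> M \<inter> P s" "\<tau> \<bullet> (\<beta> s u - x0) = \<omega> s u"
      using C1[rule_format, OF conjI[OF R(1,2)]] by (auto simp: \<beta>_def)
    have sS: "s \<in> S" using \<beta>W0[OF su] C(4) F(1) unfolding family_defining_def by auto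
    have au: "a s (\<beta> s u) = u" unfolding a_def \<beta>m(2) by (rule R(4))
    have W: "(s, \<beta> s u) \<in> W" using \<beta>W0[OF su] su \<beta>m(2) au R(3) by (auto simp: W_def)
    let ?v = "?l (s, \<beta> s u)"
    have vpos: "\<tau> \<bullet> ?v > 0" using C0 \<beta>W0[OF su] by blast
    have "isCont (\<omega> s) u"
    proof -
      have "continuous_on {-\<epsilon><..<\<epsilon>} (\<lambda>u. (\<lambda>z. \<omega> (fst z) (snd z)) (s, u))"
        by (rule continuous_on_compose2[OF c\<omega>]) (use su in \<open>auto intro!: continuous_intros\<close>)
      then have "continuous_on {-\<epsilon><..<\<epsilon>} (\<omega> s)" by simp
      moreover have "u \<in> {-\<epsilon><..<\<epsilon>}" using su by auto
      ultimately show ?thesis using continuous_on_eq_continuous_at open_greaterThanLessThan by blast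
    qed
    moreover have "(A s has_real_derivative L (s, \<omega> s u)) (at (\<omega> s u))" using dA R(3) su r by auto
    moreover have "L (s, \<omega> s u) > 0" by (rule Lpos[OF R(1,2)])
    \<comment> \<open>Differentiating the inverse of arclength gives the reciprocal of the speed,
      which normalizes the velocity in the chain rule below.\<close>
    ultimately have "(\<omega> s has_real_derivative inverse (L (s, \<omega> s u))) (at u)"
      using su R0(4) by (intro DERIV_inverse_function[where a = "-\<epsilon>" and b = \<epsilon> and f = "A s"]) auto
    then have "(\<omega> s has_vector_derivative inverse (L (s, \<omega> s u))) (at u)"
      by (simp add: has_real_derivative_iff_has_vector_derivative)
    moreover have "((\<lambda>w. \<psi> (s, w)) has_vector_derivative ?v /\<^sub>R (\<tau> \<bullet> ?v)) (at (\<omega> s u))"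
      using C1[rule_format, OF conjI[OF R(1,2)]] by (simp add: \<beta>_def)
    ultimately have "((\<lambda>w. \<psi> (s, w)) \<circ> \<omega> s has_vector_derivative inverse (L (s, \<omega> s u)) *\<^sub>R (?v /\<^sub>R (\<tau> \<bullet> ?v))) (at u)"
      by (rule vector_diff_chain_at)
    moreover have "inverse (L (s, \<omega> s u)) *\<^sub>R (?v /\<^sub>R (\<tau> \<bullet> ?v)) = T s u"
      using vpos by (simp add: L_def T_def \<beta>_def inverse_eq_divide)
    ultimately have "(\<beta> s has_vector_derivative T s u) (at u)" by (simp add: o_def \<beta>_def[abs_def])
    then show ?thesis using \<beta>m(1) sS au W lnz[OF su] by (simp add: T_def)
  qed
  have bwd: "\<bar>s - s0\<bar> < \<epsilon> \<and> \<bar>a s x\<bar> < \<epsilon> \<and> \<beta> s (a s x) = x \<and> a s differentiable (at x)"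
    if sx: "(s, x) \<in> W" "x \<in> ?X s" for s x
  proof -
    have b: "\<bar>s - s0\<bar> < \<epsilon>" "\<bar>a s x\<bar> < \<epsilon>" "\<bar>\<tau> \<bullet> (x - x0)\<bar> < r" "(s, x) \<in> W0" using sx(1) by (auto simp: W_def)
    have x: "\<psi> (s, \<tau> \<bullet> (x - x0)) = x" using C2 b(4) sx(2) by (auto split: if_splits)
    have "\<omega> s (a s x) = \<tau> \<bullet> (x - x0)"
      using inj[rule_format, of s "\<omega> s (a s x)" "\<tau> \<bullet> (x - x0)"] R0(3,4)[OF b(1,2)] b r by (simp add: a_def)
    then have "\<beta> s (a s x) = x" using x by (simp add: \<beta>_def)
    moreover have "a s differentiable (at x)"
    proof -
      have d: "(A s has_derivative (*) (L (s, \<tau> \<bullet> (x - x0)))) (at (\<tau> \<bullet> (x - x0)))"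
        using dA b r by (auto simp: has_field_derivative_def)
      have "((\<lambda>x. \<tau> \<bullet> (x - x0)) has_derivative (\<lambda>h. \<tau> \<bullet> h)) (at x)"
        by (auto intro!: derivative_eq_intros)
      from diff_chain_at[OF this d] show ?thesis unfolding differentiable_def a_def[abs_def] o_def by blast
    qed
    ultimately show ?thesis using b by blast
  qed
  have x0W: "(s0, x0) \<in> W" using C(3) r A0 by (simp add: W_def a_def)
  have ca: "continuous_on {z \<in> W. snd z \<in> ?X (fst z)} (\<lambda>z. a (fst z) (snd z))"
    by (rule continuous_on_subset[OF caQ]) (auto simp: W_def)
  have a0: "a s0 x0 = 0" using A0 by (simp add: a_def)
  have box: "leaf_box ?X s0 x0 \<epsilon> W \<beta> T a"
    unfolding leaf_box_def
    by (intro conjI allI impI r(1) oW x0W a0 c\<beta> cT ca; (elim conjE)?; (drule (1) fwd bwd)?; blast)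
  have "W \<subseteq> V2" "snd ` W \<subseteq> V1" using C(4,5) by (auto simp: W_def)
  then show ?thesis using box lnz T_def by (intro exI[of _ \<epsilon>] exI[of _ W] exI[of _ \<beta>] exI[of _ T] exI[of _ a]) auto
qed

section \<open>Single slices as leaf spaces\<close>

lemma Ck_on_cong:
  assumes "open V" "\<And>x. x \<in> V \<Longrightarrow> f x = g x" "Ck_on k V f"
  shows "Ck_on k V g"
  using assms(2,3)
proof (induction k arbitrary: f g)
  case 0
  then show ?case by (simp cong: continuous_on_cong)
next
  case (Suc k)
  have d: "(g has_derivative frechet_derivative f (at x)) (at x)" if x: "x \<in> V" for x
  proof (rule has_derivative_transform_within_open[OF _ assms(1) x])
    show "(f has_derivative frechet_derivative f (at x)) (at x)"
      using Suc.prems(2) x by (simp add: frechet_derivative_works)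
  qed (use Suc.prems(1) in auto)
  have eq: "frechet_derivative f (at x) h = frechet_derivative g (at x) h" if "x \<in> V" for x h
    using frechet_derivative_at[OF d[OF that]] by simp
  have "Ck_on k V (\<lambda>x. frechet_derivative g (at x) h)" for h
    by (rule Suc.IH[of "\<lambda>x. frechet_derivative f (at x) h", OF eq]) (use Suc.prems(2) in simp_all)
  then show ?case using d by (auto simp: differentiable_def)
qed

lemma Ck_on_slice:
  fixes g :: "'a::euclidean_space \<times> 'b::euclidean_space \<Rightarrow> 'c::real_normed_vector"
  assumes V: "open V" and g: "Ck_on k V g"
  shows "Ck_on k {y. (r, y) \<in> V} (\<lambda>y. g (r, y))"
  using g
proof (induction k arbitrary: g)
  case 0
  then show ?case by (auto intro!: continuous_on_compose2[of V g] continuous_intros)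
next
  case (Suc k)
  have "continuous_on UNIV (\<lambda>y :: 'b. (r, y))" by (intro continuous_intros)
  from open_vimage[OF V this] have oV: "open {y. (r, y) \<in> V}" by (simp add: vimage_def)
  have d: "((\<lambda>y. g (r, y)) has_derivative (\<lambda>h. frechet_derivative g (at (r, y)) (0, h))) (at y)"
    if "(r, y) \<in> V" for y
  proof -
    have "(g has_derivative frechet_derivative g (at (r, y))) (at (r, y))"
      using Suc.prems that by (simp add: frechet_derivative_works)
    moreover have "((\<lambda>z. (r, z)) has_derivative (\<lambda>h. (0, h))) (at y)"
      by (auto intro!: derivative_eq_intros)
    ultimately show ?thesis using diff_chain_at[of "\<lambda>z. (r, z)" "\<lambda>h. (0, h)" y g] by (simp add: o_def)
  qed
  have "Ck_on k {y. (r, y) \<in> V} (\<lambda>x. frechet_derivative (\<lambda>y. g (r, y)) (at x) h)" for h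
  proof (rule Ck_on_cong[OF oV])
    show "Ck_on k {y. (r, y) \<in> V} (\<lambda>y. frechet_derivative g (at (r, y)) (0, h))"
      using Suc.prems by (intro Suc.IH) simp
    fix x assume "x \<in> {y. (r, y) \<in> V}"
    then show "frechet_derivative g (at (r, x)) (0, h) = frechet_derivative (\<lambda>y. g (r, y)) (at x) h"
      using frechet_derivative_at[OF d, of x] by (simp add: fun_eq_iff)
  qed
  then show ?case using d by (auto simp: differentiable_def)
qed

lemma family_member_defining:
  assumes F: "family_defining S P V g"
  shows "defining (P s) {y. (s, y) \<in> V} (\<lambda>y. g (s, y))"
    "(s, y) \<in> V \<Longrightarrow> grad (\<lambda>y. g (s, y)) y = xgrad g (s, y)"
proof -
  have sm: "smooth_on V g" using F by (simp add: family_defining_def)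
  show gr: "(s, y) \<in> V \<Longrightarrow> grad (\<lambda>y. g (s, y)) y = xgrad g (s, y)" for y
    by (rule grad_unique[OF slice_has_derivative[OF sm]])
  have oV: "open V" using sm by (simp add: smooth_on_def)
  have "continuous_on UNIV (\<lambda>y :: real^3. (s, y))" by (intro continuous_intros)
  from open_vimage[OF oV this] have "open {y. (s, y) \<in> V}" by (simp add: vimage_def)
  then have "smooth_on {y. (s, y) \<in> V} (\<lambda>y. g (s, y))"
    using sm by (auto simp: smooth_on_def intro: Ck_on_slice[OF oV])
  then show "defining (P s) {y. (s, y) \<in> V} (\<lambda>y. g (s, y))"
    using F gr by (auto simp: defining_def family_defining_def)
qed

lemma transversal_grad:
  assumes "transversal A B" "defining A V g" "defining B U h" "x \<in> A" "x \<in> B" "x \<in> V" "x \<in> U"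
  shows "\<not> parallel (grad h x) (grad g x)"
proof -
  have "normal_to A x (grad g x)" "normal_to B x (grad h x)"
    unfolding normal_to_iff[OF assms(2,4,6)] normal_to_iff[OF assms(3,5,7)]
    using assms by (auto simp: parallel_def defining_def)
  then have "\<not> parallel (grad g x) (grad h x)" using assms(1,4,5) unfolding transversal_def by blast
  then show ?thesis unfolding parallel_def by (metis cross_skew neg_equal_0_iff_equal)
qed

lemma slice_box_exists:
  assumes M: "smooth_surface M" and F: "smooth_surface_family S P" and s: "s \<in> S"
    and tr: "transversal (P s) M" and x: "x \<in> M" "x \<in> P s"
  shows "\<exists>\<epsilon> W \<beta> T a. leaf_box (\<lambda>s. if s \<in> S then M \<inter> P s else {}) s x \<epsilon> W \<beta> T a"
proof -
  obtain V1 g1 where g1: "x \<in> V1" "defining M V1 g1" using smooth_surface_defining[OF M x(1)] by metis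
  obtain V2 g2 where g2: "(s, x) \<in> V2" "family_defining S P V2 g2"
    using smooth_surface_family_defining[OF F s x(2)] by metis
  have "\<not> parallel (grad g1 x) (xgrad g2 (s, x))"
    using transversal_grad[OF tr family_member_defining(1)[OF g2(2)] g1(2) x(2,1)] g1(1) g2(1)
      family_member_defining(2)[OF g2(2,1)] by simp
  from leaf_box_of_slice[OF g1(2) x(1) g1(1) g2(2) x(2) g2(1) this] show ?thesis
  proof (elim exE conjE)
    fix \<epsilon> W \<beta> T a
    assume "leaf_box (\<lambda>s. if s \<in> S then M \<inter> P s else {}) s x \<epsilon> W \<beta> T a"
    then show ?thesis by (intro exI)
  qed
qed

text \<open>Freezing the parameter turns one slice into a constant family. The flow is thereby
  available on a single slice under transversality of that slice alone.\<close>

lemma leaf_box_const: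
  assumes B: "leaf_box X s x \<epsilon> W \<beta> T a"
  shows "leaf_box (\<lambda>_. X s) r x \<epsilon> {z. \<bar>fst z - r\<bar> < \<epsilon> \<and> (s, snd z) \<in> W} (\<lambda>_. \<beta> s) (\<lambda>_. T s) (\<lambda>_. a s)"
proof -
  note BD = leaf_boxD[OF B]
  have s: "\<bar>s - s\<bar> < \<epsilon>" using BD(1) by simp
  have "continuous_on UNIV (\<lambda>z :: real \<times> 'a. (s, snd z))" by (intro continuous_intros)
  from open_vimage[OF BD(2) this] have oW: "open {z :: real \<times> 'a. (s, snd z) \<in> W}" by (simp add: vimage_def)
  have "open ({z :: real \<times> 'a. \<bar>fst z - r\<bar> < \<epsilon>} \<inter> {z. (s, snd z) \<in> W})"
    by (intro open_Int oW open_Collect_less continuous_intros)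
  then have "open {z :: real \<times> 'a. \<bar>fst z - r\<bar> < \<epsilon> \<and> (s, snd z) \<in> W}"
    by (simp add: Collect_conj_eq)
  moreover have "continuous_on {z. \<bar>fst z - r\<bar> < \<epsilon> \<and> \<bar>snd z\<bar> < \<epsilon>} (\<lambda>z. (\<lambda>z. \<beta> (fst z) (snd z)) (s, snd z))"
    "continuous_on {z. \<bar>fst z - r\<bar> < \<epsilon> \<and> \<bar>snd z\<bar> < \<epsilon>} (\<lambda>z. (\<lambda>z. T (fst z) (snd z)) (s, snd z))"
    by (intro continuous_on_compose2[OF BD(14)] continuous_on_compose2[OF BD(15)] continuous_intros; use s in force)+
  moreover have "continuous_on {z \<in> {z. \<bar>fst z - r\<bar> < \<epsilon> \<and> (s, snd z) \<in> W}. snd z \<in> X s} (\<lambda>z. (\<lambda>z. a (fst z) (snd z)) (s, snd z))"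
    by (intro continuous_on_compose2[OF BD(16)] continuous_intros) force
  ultimately show ?thesis
    unfolding leaf_box_def using BD(1,3,4) BD(5-9)[OF s] BD(11-13)[of s] by simp
qed

lemma slice_leaf_space:
  assumes M: "smooth_surface M" and F: "smooth_surface_family S P" and s: "s \<in> S"
    and tr: "transversal (P s) M"
  shows "leaf_space (\<lambda>_ :: real. P s \<inter> M)"
proof
  fix x r assume "x \<in> P s \<inter> M"
  then have x: "x \<in> M" "x \<in> P s" by auto
  obtain \<epsilon> W \<beta> T a where "leaf_box (\<lambda>s. if s \<in> S then M \<inter> P s else {}) s x \<epsilon> W \<beta> T a"
    using slice_box_exists[OF M F s tr x] by (elim exE) (rule that)
  note B = leaf_box_const[OF this, of r]
  have eq: "(if s \<in> S then M \<inter> P s else {}) = P s \<inter> M" using s by auto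
  show "\<exists>\<epsilon> W \<beta> T a. leaf_box (\<lambda>_. P s \<inter> M) r x \<epsilon> W \<beta> T a"
    using B unfolding eq by (intro exI)
qed

lemma unit_curve_tangent:
  assumes y: "unit_curve X J y \<sigma>" and X: "X \<subseteq> S" and t: "t \<in> J"
  shows "\<sigma> t \<in> tangent_vectors S (y t)"
proof -
  let ?c = "\<lambda>r. y (t + 1 * r)"
  have A: "unit_curve X {r. t + 1 * r \<in> J} ?c (\<lambda>r. 1 *\<^sub>R \<sigma> (t + 1 * r))"
    by (rule unit_curve_affine[OF y]) simp
  note D = unit_curveD[OF A]
  have 0: "0 \<in> {r. t + 1 * r \<in> J}" using t by simp
  have "\<forall>\<^sub>F r in at 0. r \<in> {r. t + 1 * r \<in> J}" using D(1) 0 by (rule eventually_at_in_open')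
  then have "\<forall>\<^sub>F r in at 0. ?c r \<in> S" by eventually_elim (use D(6) X in blast)
  then show ?thesis unfolding tangent_vectors_def using D(8)[OF 0] by (auto intro!: exI[of _ ?c])
qed

section \<open>Intersection curves as trajectories\<close>

lemma antiderivative_open_interval:
  fixes h :: "real \<Rightarrow> real"
  assumes J: "open J" "is_interval J" "0 \<in> J" and h: "continuous_on J h"
  shows "\<exists>F. \<forall>t\<in>J. (F has_real_derivative h t) (at t)"
proof -
  define F where "F = (\<lambda>t. if 0 \<le> t then integral {0..t} h else - integral {t..0} h)"
  have "(F has_real_derivative h t) (at t)" if t: "t \<in> J" for t
  proof -
    obtain d1 where d1: "d1 > 0" "ball 0 d1 \<subseteq> J" using J by (meson open_contains_ball)
    obtain d2 where d2: "d2 > 0" "ball t d2 \<subseteq> J" using J(1) t by (meson open_contains_ball)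
    define d where "d = min d1 d2 / 2"
    have d: "d > 0" "d < d1" "d < d2" using d1 d2 by (auto simp: d_def)
    define a b where "a = min 0 t - d" and "b = max 0 t + d"
    have ab: "a < 0" "0 < b" "a < t" "t < b" using d by (auto simp: a_def b_def)
    have mem: "- d \<in> J" "d \<in> J" "t - d \<in> J" "t + d \<in> J"
      using d1 d2 d by (auto simp: dist_real_def subset_iff)
    have "a \<in> J" "b \<in> J" using mem by (auto simp: a_def b_def min_def max_def)
    then have abJ: "{a..b} \<subseteq> J" using J(2) by (metis interval_cbox is_interval_cbox interval_subset_is_interval cbox_interval)
    have ch: "continuous_on {a..b} h" using h abJ continuous_on_subset by blast
    have int: "h integrable_on {c..e}" if "a \<le> c" "e \<le> b" for c e
      using that by (intro integrable_continuous_interval continuous_on_subset[OF ch]) auto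
    have Feq: "F u = integral {a..u} h - integral {a..0} h" if u: "u \<in> {a<..<b}" for u
    proof (cases "0 \<le> u")
      case True
      have "integral {a..0} h + integral {0..u} h = integral {a..u} h"
        using ab u True by (intro Henstock_Kurzweil_Integration.integral_combine int) auto
      then show ?thesis using True by (simp add: F_def)
    next
      case False
      have "integral {a..u} h + integral {u..0} h = integral {a..0} h"
        using ab u False by (intro Henstock_Kurzweil_Integration.integral_combine int) auto
      then show ?thesis using False by (simp add: F_def)
    qed
    have "((\<lambda>u. integral {a..u} h) has_vector_derivative h t) (at t within {a..b})"
      by (rule integral_has_vector_derivative[OF ch]) (use ab in auto)
    then have "((\<lambda>u. integral {a..u} h) has_real_derivative h t) (at t)"
      using at_within_Icc_at[OF ab(3,4)] by (simp add: has_real_derivative_iff_has_vector_derivative)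
    then have "((\<lambda>u. integral {a..u} h - integral {a..0} h) has_real_derivative h t) (at t)"
      by (auto intro!: derivative_eq_intros)
    then show ?thesis
      by (rule has_field_derivative_transform_within_open[of _ _ _ "{a<..<b}"]) (use ab Feq in auto)
  qed
  then show ?thesis by blast
qed

text \<open>Separation of variables for the equation with right-hand side \<open>k\<close>: the
  solution is the inverse of an antiderivative of \<open>1 / k\<close>. That antiderivative is
  strictly increasing, so its image is an open interval on which the solution sweeps out all of
  \<open>J\<close>.\<close>

lemma speed_reparametrization:
  fixes k :: "real \<Rightarrow> real"
  assumes J: "open J" "is_interval J" "0 \<in> J" and k: "continuous_on J k" "\<And>t. t \<in> J \<Longrightarrow> 0 < k t"
  shows "\<exists>I \<phi>. open I \<and> is_interval I \<and> \<phi> ` I = J \<and> (\<forall>s\<in>I. (\<phi> has_real_derivative k (\<phi> s)) (at s))"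
proof -
  have "continuous_on J (\<lambda>t. inverse (k t))" using k(2) by (intro continuous_intros k(1)) (metis less_irrefl)
  then obtain F where F: "\<And>t. t \<in> J \<Longrightarrow> (F has_real_derivative inverse (k t)) (at t)"
    using antiderivative_open_interval[OF J] by blast
  have cF: "continuous_on J F" using F by (auto intro!: continuous_at_imp_continuous_on DERIV_isCont)
  have mono: "F t < F t'" if "t \<in> J" "t' \<in> J" "t < t'" for t t'
  proof (rule DERIV_pos_imp_increasing[OF that(3)])
    fix x assume "t \<le> x" "x \<le> t'"
    then have "x \<in> J" using J(2) that by (metis mem_is_interval_1_I)
    then show "\<exists>y. (F has_real_derivative y) (at x) \<and> 0 < y" using F k(2) by (meson positive_imp_inverse_positive)
  qed
  have inj: "inj_on F J" using mono by (metis inj_onI less_irrefl linorder_neqE_linordered_idom)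
  define \<phi> where "\<phi> = inv_into J F"
  have \<phi>F: "\<phi> (F t) = t" if "t \<in> J" for t using inj that by (simp add: \<phi>_def)
  have "open (F ` J)" by (rule invariance_of_domain[OF cF J(1) inj])
  moreover have "is_interval (F ` J)"
    using connected_continuous_image[OF cF] J(2) by (simp add: is_interval_connected_1)
  moreover have "\<phi> ` F ` J = J" using \<phi>F by (force simp: image_image)
  moreover have "(\<phi> has_real_derivative k (\<phi> s)) (at s)" if sJ: "s \<in> F ` J" for s
  proof -
    obtain t where t: "t \<in> J" "s = F t" using sJ by blast
    have "(\<phi> has_derivative (\<lambda>h. k t * h)) (at (F t))"
    proof (rule has_derivative_inverse_strong[OF J(1) t(1) cF \<phi>F])
      show "(F has_derivative (\<lambda>h. inverse (k t) * h)) (at t)"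
        using F[OF t(1)] by (simp add: has_field_derivative_def)
      show "(\<lambda>h. inverse (k t) * h) \<circ> (\<lambda>h. k t * h) = id"
        using k(2)[OF t(1)] by (auto simp: fun_eq_iff)
    qed
    then have "(\<phi> has_real_derivative k t) (at (F t))" by (simp add: has_field_derivative_def)
    then show ?thesis using t \<phi>F by simp
  qed
  ultimately show ?thesis by blast
qed

lemma orthogonal_unit_parallel:
  fixes \<sigma> a b :: "real^3"
  assumes "norm \<sigma> = 1" "a \<bullet> \<sigma> = 0" "b \<bullet> \<sigma> = 0"
  shows "cross3 a b = (cross3 a b \<bullet> \<sigma>) *\<^sub>R \<sigma>"
proof -
  have "cross3 \<sigma> (cross3 (cross3 a b) \<sigma>) = (\<sigma> \<bullet> \<sigma>) *\<^sub>R cross3 a b - (cross3 a b \<bullet> \<sigma>) *\<^sub>R \<sigma>"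
    by (rule cross3_self_left)
  moreover have "cross3 (cross3 a b) \<sigma> = (a \<bullet> \<sigma>) *\<^sub>R b - (b \<bullet> \<sigma>) *\<^sub>R a"
    using exhaust_3 by (force simp add: cross3_simps)
  ultimately show ?thesis using assms by (simp add: norm_eq_1)
qed

lemma continuous_normal_field:
  assumes "smooth_normal_field A n" shows "continuous_on A n"
proof -
  have "continuous (at x within A) n" if x: "x \<in> A" for x
  proof -
    obtain V w where V: "x \<in> V" "smooth_on V w" "\<forall>y\<in>V \<inter> A. n y = w y"
      using assms x unfolding smooth_normal_field_def by metis
    have oV: "open V" and cw: "continuous_on V w" using V(2) Ck_on.simps(1)[of V w] unfolding smooth_on_def by blast+
    have "continuous_on (A \<inter> V) n"
      by (rule continuous_on_eq[OF continuous_on_subset[OF cw, of "A \<inter> V"]]) (use V(3) in auto)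
    then have "continuous (at x within A \<inter> V) n" using x V(1) by (simp add: continuous_on_eq_continuous_within)
    moreover have "at x within A = at x within (A \<inter> V)"
      by (rule at_within_nhd[OF V(1) oV]) auto
    ultimately show ?thesis by simp
  qed
  then show ?thesis by (simp add: continuous_on_eq_continuous_within)
qed

text \<open>A component is the image of one maximal unit-speed curve with tangent \<sigma>. For a
  unit normal \<open>m\<close> of \<open>M\<close>, the vector \<open>cross3 n m\<close> is a
  multiple of \<sigma>, nonzero by transversality. Choosing the normal for which the factor is
  positive and using the factor as speed turns the curve into a trajectory. The relation
  \<open>R\<close> stands for whichever field the normals of \<open>M\<close> obey.\<close>

lemma intersection_trajectory:
  assumes M: "smooth_surface M" and F: "smooth_surface_family S P" and s: "s \<in> S"
    and n: "smooth_normal_field (P s) n" and tr: "transversal (P s) M"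
    and \<Gamma>: "\<Gamma> \<in> components (P s \<inter> M)"
    and R: "\<And>x m. x \<in> M \<Longrightarrow> unit_normal M x m \<Longrightarrow> R x m"
  shows "\<exists>J \<gamma> N. J \<noteq> {} \<and> \<gamma> ` J = \<Gamma> \<and> oriented_trajectory R n J \<gamma> N \<and> continuous_on J \<gamma> \<and>
    (\<forall>r\<in>J. \<gamma> r \<in> M \<and> unit_normal M (\<gamma> r) (N r))"
proof -
  interpret leaf_space "\<lambda>_ :: real. P s \<inter> M" by (rule slice_leaf_space[OF M F s tr])
  obtain x0 where x0: "x0 \<in> \<Gamma>" using in_components_nonempty[OF \<Gamma>] by blast
  then have "x0 \<in> P s \<inter> M" using in_components_subset[OF \<Gamma>] by blast
  then obtain \<tau> where z: "(0, x0, \<tau>) \<in> states" using state_exists[of x0 0] by blast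
  define J0 y \<sigma> where "J0 = flow_dom 0 (x0, \<tau>)" and "y = (\<lambda>t. fst (flow 0 (x0, \<tau>) t))"
    and "\<sigma> = (\<lambda>t. snd (flow 0 (x0, \<tau>) t))"
  have uc: "unit_curve (P s \<inter> M) J0 y \<sigma>" and 0: "0 \<in> J0"
    unfolding J0_def y_def \<sigma>_def using flow_unit_curve[OF z] by auto
  note D = unit_curveD[OF uc]
  have img: "y ` J0 = \<Gamma>" unfolding J0_def y_def by (rule flow_image_component[OF \<Gamma> z x0])
  have yM: "y t \<in> M" "y t \<in> P s" if "t \<in> J0" for t using D(6)[OF that] by auto
  have nn: "normal_to (P s) (y t) (n (y t))" if "t \<in> J0" for t
    using n yM(2)[OF that] unfolding smooth_normal_field_def by blast
  have n\<sigma>: "n (y t) \<bullet> \<sigma> t = 0" if t: "t \<in> J0" for t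
    using nn[OF t] unit_curve_tangent[OF uc _ t, of "P s"] unfolding normal_to_def by blast
  have m\<sigma>: "m \<bullet> \<sigma> t = 0" if "t \<in> J0" "unit_normal M (y t) m" for t m
    using that(2) unit_curve_tangent[OF uc _ that(1), of M] unfolding unit_normal_def normal_to_def by blast
  define K where "K = (\<lambda>t m. cross3 (n (y t)) m \<bullet> \<sigma> t)"
  have crK: "cross3 (n (y t)) m = K t m *\<^sub>R \<sigma> t" if "t \<in> J0" "unit_normal M (y t) m" for t m
    unfolding K_def using orthogonal_unit_parallel[OF D(7) n\<sigma> m\<sigma>] that by blast
  have Knz: "K t m \<noteq> 0" if "t \<in> J0" "unit_normal M (y t) m" for t m
  proof
    assume "K t m = 0"
    then have "parallel (n (y t)) m" using crK[OF that] by (simp add: parallel_def)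
    then show False using tr nn[OF that(1)] that yM unfolding transversal_def unit_normal_def by blast
  qed
  \<comment> \<open>Of the two opposite unit normals exactly one has a positive factor. This selects
    a continuous normal along the whole curve even if \<open>M\<close> is not orientable.\<close>
  define N where "N = (\<lambda>t. THE m. unit_normal M (y t) m \<and> 0 < K t m)"
  have loc: "\<exists>U. open U \<and> t \<in> U \<and> U \<subseteq> J0 \<and> continuous_on U N \<and>
      (\<forall>r\<in>U. unit_normal M (y r) (N r) \<and> 0 < K r (N r))" if t: "t \<in> J0" for t
  proof -
    obtain V g where g: "y t \<in> V" "defining M V g" using smooth_surface_defining[OF M yM(1)[OF t]] by metis
    have sm: "smooth_on V g" using g(2) by (simp add: defining_def)
    note C1 = smooth_on_C1[OF sm]
    define m where "m = (\<lambda>r. grad g (y r) /\<^sub>R norm (grad g (y r)))"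
    define U where "U = J0 \<inter> y -` V"
    have oU: "open U" unfolding U_def by (rule continuous_open_preimage[OF D(5,1) C1(1)])
    have cg: "continuous_on U (\<lambda>r. grad g (y r))"
      by (rule continuous_on_compose2[OF C1(4) continuous_on_subset[OF D(5)]]) (auto simp: U_def)
    have gnz: "grad g (y r) \<noteq> 0" if "r \<in> U" for r using g(2) that by (auto simp: defining_def U_def)
    have cm: "continuous_on U m" unfolding m_def using gnz by (intro continuous_intros cg) auto
    have un: "unit_normal M (y r) a \<longleftrightarrow> a = m r \<or> a = - m r" if "r \<in> U" for r a
      using unit_normal_iff[OF g(2), of "y r" a] yM(1) that by (auto simp: U_def m_def)
    have cn: "continuous_on U (\<lambda>r. n (y r))"
      by (rule continuous_on_compose2[OF continuous_normal_field[OF n] continuous_on_subset[OF D(5)]])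
         (use yM in \<open>auto simp: U_def\<close>)
    have cK: "continuous_on U (\<lambda>r. K r (m r))"
      unfolding K_def by (intro continuous_intros continuous_on_cross cn cm continuous_on_subset[OF D(4)]) (auto simp: U_def)
    \<comment> \<open>The sign that makes the normalized gradient the selected normal at
      \<open>t\<close>; by continuity of the factor it is the right sign nearby as well.\<close>
    define c where "c = sgn (K t (m t))"
    have Ut: "t \<in> U" using t g(1) by (simp add: U_def)
    have "K t (m t) \<noteq> 0" by (rule Knz[OF t]) (use un[OF Ut] in blast)
    then have c: "c = 1 \<or> c = -1" "c * K t (m t) > 0" by (auto simp: c_def sgn_real_def)
    define U' where "U' = U \<inter> (\<lambda>r. c * K r (m r)) -` {0<..}"
    have oU': "open U'" unfolding U'_def by (intro continuous_open_preimage oU continuous_intros cK)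
    have Kc: "K r (b *\<^sub>R a) = b * K r a" "K r (- a) = - K r a" for b r a
      by (simp_all add: K_def cross_mult_right)
    have KN: "unit_normal M (y r) (c *\<^sub>R m r)" "0 < K r (c *\<^sub>R m r)" if r: "r \<in> U'" for r
    proof -
      have "r \<in> U" "0 < c * K r (m r)" using r by (auto simp: U'_def)
      moreover have "c *\<^sub>R m r = m r \<or> c *\<^sub>R m r = - m r" using c(1) by auto
      ultimately show "unit_normal M (y r) (c *\<^sub>R m r)" "0 < K r (c *\<^sub>R m r)"
        using un[of r "c *\<^sub>R m r"] by (simp_all add: Kc)
    qed
    have NU: "N r = c *\<^sub>R m r" if r: "r \<in> U'" for r
      unfolding N_def
    proof (rule the_equality[where P = "\<lambda>m. unit_normal M (y r) m \<and> 0 < K r m", OF conjI[OF KN[OF r]]])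
      fix a assume a: "unit_normal M (y r) a \<and> 0 < K r a"
      have "r \<in> U" using r by (simp add: U'_def)
      then have "a = m r \<or> a = - m r" using un[of r a] a by blast
      then have "a = c *\<^sub>R m r \<or> a = - (c *\<^sub>R m r)" using c(1) by auto
      then show "a = c *\<^sub>R m r" using a KN(2)[OF r] by (auto simp: Kc)
    qed
    have "continuous_on U' (\<lambda>r. c *\<^sub>R m r)"
      by (intro continuous_intros continuous_on_subset[OF cm]) (auto simp: U'_def)
    then have "continuous_on U' N" using NU by (simp cong: continuous_on_cong)
    moreover have "t \<in> U'" "U' \<subseteq> J0" using Ut c(2) by (auto simp: U'_def U_def)
    moreover have "unit_normal M (y r) (N r) \<and> 0 < K r (N r)" if "r \<in> U'" for r
      unfolding NU[OF that] using KN[OF that] by blast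
    ultimately show ?thesis using oU' by blast
  qed
  have N: "unit_normal M (y t) (N t)" "0 < K t (N t)" if "t \<in> J0" for t using loc[OF that] by blast+
  have cN: "continuous_on J0 N"
  proof (intro continuous_at_imp_continuous_on ballI)
    fix t assume "t \<in> J0"
    then obtain U where "open U" "t \<in> U" "continuous_on U N" using loc by blast
    then show "isCont N t" using continuous_on_eq_continuous_at by blast
  qed
  have cK: "continuous_on J0 (\<lambda>t. K t (N t))" unfolding K_def
    by (intro continuous_intros continuous_on_cross cN D(4) continuous_on_compose2[OF continuous_normal_field[OF n] D(5)])
       (use yM in auto)
  obtain I \<phi> where I: "open I" "is_interval I" "\<phi> ` I = J0"
     "\<forall>r\<in>I. (\<phi> has_real_derivative K (\<phi> r) (N (\<phi> r))) (at r)"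
    using speed_reparametrization[OF D(1,2) 0 cK N(2)] by blast
  have c\<phi>: "continuous_on I \<phi>" using I(4) by (auto intro!: continuous_at_imp_continuous_on DERIV_isCont)
  have \<phi>J: "\<phi> r \<in> J0" if "r \<in> I" for r using I(3) that by blast
  have "oriented_trajectory R n I (y \<circ> \<phi>) (N \<circ> \<phi>)"
    unfolding oriented_trajectory_def
  proof (intro conjI ballI I(1,2))
    show "continuous_on I (N \<circ> \<phi>)" using continuous_on_compose[OF c\<phi>] cN I(3) by simp
    fix r assume r: "r \<in> I"
    show "R ((y \<circ> \<phi>) r) ((N \<circ> \<phi>) r)" using R yM(1) N(1) \<phi>J[OF r] by simp
    have "(\<phi> has_vector_derivative K (\<phi> r) (N (\<phi> r))) (at r)"
      using I(4) r by (simp add: has_real_derivative_iff_has_vector_derivative)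
    from vector_diff_chain_at[OF this D(8)[OF \<phi>J[OF r]]]
    show "((y \<circ> \<phi>) has_vector_derivative cross3 (n ((y \<circ> \<phi>) r)) ((N \<circ> \<phi>) r)) (at r)"
      using crK[OF \<phi>J[OF r] N(1)[OF \<phi>J[OF r]]] by simp
  qed
  moreover have "continuous_on I (y \<circ> \<phi>)" using continuous_on_compose[OF c\<phi>] D(5) I(3) by simp
  moreover have "(y \<circ> \<phi>) ` I = \<Gamma>" unfolding image_comp[symmetric] I(3) by (rule img)
  moreover have "I \<noteq> {}" using I(3) 0 by blast
  moreover have "\<forall>r\<in>I. (y \<circ> \<phi>) r \<in> M \<and> unit_normal M ((y \<circ> \<phi>) r) ((N \<circ> \<phi>) r)"
    using yM(1) N(1) \<phi>J by simp
  ultimately show ?thesis by blast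
qed

section \<open>Helicity along the trajectories\<close>

lemma smooth_on_vector:
  assumes "smooth_on V w" shows "open V" "continuous_on V w" "\<And>x. x \<in> V \<Longrightarrow> w differentiable (at x)"
proof -
  have "Ck_on 0 V w" "Ck_on (Suc 0) V w" "open V" using assms unfolding smooth_on_def by blast+
  then show "open V" "continuous_on V w" "\<And>x. x \<in> V \<Longrightarrow> w differentiable (at x)" by auto
qed

lemma xi_parallel:
  assumes "x \<in> simple_spectrum_set v D t0 T"
  shows "is_xi1 v D t0 T x a \<Longrightarrow> is_xi1 v D t0 T x b \<Longrightarrow> parallel a b"
    "is_xi3 v D t0 T x a \<Longrightarrow> is_xi3 v D t0 T x b \<Longrightarrow> parallel a b"
proof -
  obtain l1 l2 l3 e1 e2 e3 where e: "eframe v D t0 T x l1 l2 l3 e1 e2 e3" using eframe_exists[OF assms] by blast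
  show "is_xi1 v D t0 T x a \<Longrightarrow> is_xi1 v D t0 T x b \<Longrightarrow> parallel a b"
    "is_xi3 v D t0 T x a \<Longrightarrow> is_xi3 v D t0 T x b \<Longrightarrow> parallel a b"
    unfolding eframe_is_xi[OF e] by (auto simp: parallel_def)
qed

lemma defining_unit_normal:
  assumes "defining M V g" "x \<in> M" "x \<in> V"
  shows "unit_normal M x (grad g x /\<^sub>R norm (grad g x))"
  using unit_normal_iff[OF assms] by blast

lemma parallel_trans:
  assumes "parallel a b" "parallel b c" "b \<noteq> 0" shows "parallel a c"
  using parallelD[OF assms(1,3)] assms(2) by (metis cross_mult_left parallel_def scaleR_zero_right)

lemma helicity_selection:
  assumes M: "smooth_surface M" "p \<in> M" and w: "smooth_on V w" "p \<in> V"
    and par: "\<And>x m. x \<in> M \<inter> V \<Longrightarrow> unit_normal M x m \<Longrightarrow> parallel (w x) m"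
  shows "helicity w p = 0"
proof -
  obtain U g where g: "p \<in> U" "defining M U g" using smooth_surface_defining[OF M] by metis
  show ?thesis
  proof (rule helicity_normal_field[OF g(2) M(2) g(1) smooth_on_vector(3)[OF w] smooth_on_vector(1)[OF w(1)] w(2)])
    fix x assume x: "x \<in> M \<inter> V \<inter> U"
    then have nz: "grad g x \<noteq> 0" using g(2) by (simp add: defining_def)
    let ?m = "grad g x /\<^sub>R norm (grad g x)"
    have 1: "parallel (w x) ?m" using par defining_unit_normal[OF g(2)] x by blast
    have 2: "parallel ?m (grad g x)" by (simp add: parallel_def cross_mult_left)
    have "?m \<noteq> 0" using nz by simp
    then show "parallel (w x) (grad g x)" by (rule parallel_trans[OF 1 2])
  qed
qed

text \<open>Both coefficients in \<open>n_pm\<close> are positive, so the inner products with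
  \<open>e1\<close> and \<open>e3\<close> do not vanish, and their signs recover how
  \<open>m\<close> is expressed in the given orientations.\<close>

lemma n_pm_decompose:
  assumes x: "x \<in> simple_spectrum_set v D t0 T" and m: "is_n_pm v D t0 T x m"
    and e: "is_xi1 v D t0 T x e1" "is_xi3 v D t0 T x e3"
  shows "m \<bullet> e1 \<noteq> 0" "m \<bullet> e3 \<noteq> 0"
    "m = sgn (m \<bullet> e1) *\<^sub>R n_pm v D t0 T (sgn (m \<bullet> e1) * sgn (m \<bullet> e3)) x e1 e3"
proof -
  obtain l1 l2 l3 f1 f2 f3 where f: "eframe v D t0 T x l1 l2 l3 f1 f2 f3" using eframe_exists[OF x] by blast
  then have ef: "eigenframe (flow_gradient v D t0 T x) l1 l2 l3 f1 f2 f3"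
    and lam: "lambda1 v D t0 T x = l1" "lambda3 v D t0 T x = l3" by (simp_all add: eframe_def)
  define a c where "a = sqrt (sqrt l1 / (sqrt l1 + sqrt l3))" and "c = sqrt (sqrt l3 / (sqrt l1 + sqrt l3))"
  have "0 < l1" "0 < l3" using ef by (auto simp: eigenframe_def)
  then have ac: "0 < a" "0 < c" by (simp_all add: a_def c_def add_pos_pos)
  obtain \<epsilon> h1 h3 where h: "\<epsilon> = 1 \<or> \<epsilon> = -1" "is_xi1 v D t0 T x h1" "is_xi3 v D t0 T x h3" "m = n_pm v D t0 T \<epsilon> x h1 h3"
    using m unfolding is_n_pm_def by blast
  have form: "n_pm v D t0 T \<epsilon> x h1 h3 = a *\<^sub>R h1 + \<epsilon> *\<^sub>R (c *\<^sub>R h3)" for \<epsilon> h1 h3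
    by (simp add: n_pm_def lam a_def c_def Let_def)
  have sg: "h1 = e1 \<or> h1 = - e1" "h3 = e3 \<or> h3 = - e3" using h(2,3) e unfolding eframe_is_xi[OF f] by auto
  have on: "e1 \<bullet> e1 = 1" "e3 \<bullet> e3 = 1" "e1 \<bullet> e3 = 0" "e3 \<bullet> e1 = 0"
    using e ef unfolding eframe_is_xi[OF f] eigenframe_def by (auto simp: inner_commute)
  have "m = a *\<^sub>R e1 + c *\<^sub>R e3 \<or> m = a *\<^sub>R e1 - c *\<^sub>R e3 \<or> m = - (a *\<^sub>R e1) + c *\<^sub>R e3 \<or> m = - (a *\<^sub>R e1) - c *\<^sub>R e3"
    using h(1,4) sg unfolding form by auto
  then show "m \<bullet> e1 \<noteq> 0" "m \<bullet> e3 \<noteq> 0"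
    "m = sgn (m \<bullet> e1) *\<^sub>R n_pm v D t0 T (sgn (m \<bullet> e1) * sgn (m \<bullet> e3)) x e1 e3"
    using ac unfolding form by (auto simp: inner_add_left inner_diff_left on)
qed

lemma continuous_sgn_constant:
  fixes f :: "'a::topological_space \<Rightarrow> real"
  assumes "connected J" "continuous_on J f" "\<And>t. t \<in> J \<Longrightarrow> f t \<noteq> 0" "t \<in> J" "t' \<in> J"
  shows "sgn (f t) = sgn (f t')"
proof (rule ccontr)
  assume ne: "sgn (f t) \<noteq> sgn (f t')"
  have c: "connected (f ` J)" using assms(1,2) connected_continuous_image by blast
  have "f t < 0 \<and> 0 < f t' \<or> f t' < 0 \<and> 0 < f t"
    using ne assms(3)[OF assms(4)] assms(3)[OF assms(5)] by (auto simp: sgn_real_def split: if_splits)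
  moreover have "is_interval (f ` J)" using c by (simp add: is_interval_connected_1)
  ultimately have "0 \<in> f ` J"
    using mem_is_interval_1_I[of "f ` J" "f t" "f t'" 0] mem_is_interval_1_I[of "f ` J" "f t'" "f t" 0] assms(4,5)
    by (auto intro: less_imp_le)
  then show False using assms(3) by auto
qed

text \<open>The repelling and attracting cases differ only in the relation \<open>R\<close>. Since
  its values at a point are parallel, any smooth selection is normal to \<open>M\<close> along
  \<open>M\<close>, which is the hypothesis of the Frobenius argument.\<close>

lemma hyperbolic_trajectories:
  assumes M: "smooth_surface M" "M \<subseteq> U" and F: "smooth_surface_family S P"
    and n: "\<And>s. s \<in> S \<Longrightarrow> smooth_normal_field (P s) (n s)"
    and R: "\<And>x m. x \<in> M \<Longrightarrow> unit_normal M x m \<Longrightarrow> R x m"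
    and par: "\<And>x a b. x \<in> U \<Longrightarrow> R x a \<Longrightarrow> R x b \<Longrightarrow> parallel a b"
  shows "\<forall>s1\<in>S. transversal (P s1) M \<longrightarrow> (\<forall>\<Gamma>\<in>components (P s1 \<inter> M). \<exists>J \<gamma> N.
      \<gamma> ` J = \<Gamma> \<and> oriented_trajectory R (n s1) J \<gamma> N \<and>
      (\<forall>s2\<in>J. \<forall>V w. \<gamma> s2 \<in> V \<longrightarrow> V \<subseteq> U \<longrightarrow> smooth_selection R V w \<longrightarrow> helicity w (\<gamma> s2) = 0))"
proof (intro ballI impI)
  fix s1 \<Gamma> assume s1: "s1 \<in> S" "transversal (P s1) M" "\<Gamma> \<in> components (P s1 \<inter> M)"
  obtain J \<gamma> N where J: "\<gamma> ` J = \<Gamma>" "oriented_trajectory R (n s1) J \<gamma> N" "\<forall>r\<in>J. \<gamma> r \<in> M \<and> unit_normal M (\<gamma> r) (N r)"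
    using intersection_trajectory[OF M(1) F s1(1) n[OF s1(1)] s1(2,3), of R] R by blast
  have "helicity w (\<gamma> s2) = 0"
    if "s2 \<in> J" "\<gamma> s2 \<in> V" "V \<subseteq> U" "smooth_selection R V w" for s2 V w
  proof (rule helicity_selection[OF M(1)])
    show "\<gamma> s2 \<in> M" "\<gamma> s2 \<in> V" using J(3) that by auto
    show "smooth_on V w" using that(4) by (simp add: smooth_selection_def)
    fix x m assume "x \<in> M \<inter> V" "unit_normal M x m"
    then show "parallel (w x) m" using par[of x "w x" m] R that(3,4) by (auto simp: smooth_selection_def)
  qed
  then show "\<exists>J \<gamma> N. \<gamma> ` J = \<Gamma> \<and> oriented_trajectory R (n s1) J \<gamma> N \<and>
      (\<forall>s2\<in>J. \<forall>V w. \<gamma> s2 \<in> V \<longrightarrow> V \<subseteq> U \<longrightarrow> smooth_selection R V w \<longrightarrow> helicity w (\<gamma> s2) = 0)"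
    using J(1,2) by blast
qed

lemma sgn_nonzero_cases: "(a :: real) \<noteq> 0 \<Longrightarrow> sgn a \<in> {1, -1}"
  by (auto simp: sgn_real_def)

text \<open>Relative to fixed selections \<open>w1\<close> and \<open>w3\<close>, the normal of
  \<open>M\<close> could be of either type. The type is locally constant along \<open>M\<close>
  because the inner products with both eigenvectors are continuous and do not vanish. Near
  \<open>p\<close> it is therefore the type \<epsilon> found at \<open>p\<close>, and the field is
  normal to \<open>M\<close> there.\<close>

lemma helicity_shear_selection:
  assumes M: "smooth_surface M" "p \<in> M" and N: "\<And>x m. x \<in> M \<Longrightarrow> unit_normal M x m \<Longrightarrow> is_n_pm v D t0 T x m"
    and V: "V \<subseteq> simple_spectrum_set v D t0 T" "p \<in> V"
    and w: "smooth_selection (is_xi1 v D t0 T) V w1" "smooth_selection (is_xi3 v D t0 T) V w3"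
    and sm: "smooth_on V (\<lambda>x. n_pm v D t0 T \<epsilon> x (w1 x) (w3 x))"
    and m: "unit_normal M p m" "\<epsilon> = sgn (m \<bullet> w1 p) * sgn (m \<bullet> w3 p)"
  shows "helicity (\<lambda>x. n_pm v D t0 T \<epsilon> x (w1 x) (w3 x)) p = 0"
proof -
  let ?W = "\<lambda>x. n_pm v D t0 T \<epsilon> x (w1 x) (w3 x)"
  obtain U g where g: "p \<in> U" "defining M U g" using smooth_surface_defining[OF M] by metis
  have smg: "smooth_on U g" using g(2) by (simp add: defining_def)
  note C1 = smooth_on_C1[OF smg]
  define k where "k = (\<lambda>x. grad g x /\<^sub>R norm (grad g x))"
  have nz: "grad g x \<noteq> 0" if "x \<in> U" for x using g(2) that by (simp add: defining_def)
  have ck: "continuous_on U k" unfolding k_def using nz by (intro continuous_intros C1(4)) auto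
  have un: "unit_normal M x a \<longleftrightarrow> a = k x \<or> a = - k x" if "x \<in> M" "x \<in> U" for x a
    using unit_normal_iff[OF g(2) that] by (simp add: k_def)
  have xi: "is_xi1 v D t0 T x (w1 x)" "is_xi3 v D t0 T x (w3 x)" if "x \<in> V" for x
    using w that by (auto simp: smooth_selection_def)
  have cw: "continuous_on V w1" "continuous_on V w3" "open V"
    using w smooth_on_vector by (auto simp: smooth_selection_def)
  have dec: "a \<bullet> w1 x \<noteq> 0" "a \<bullet> w3 x \<noteq> 0"
    "a = sgn (a \<bullet> w1 x) *\<^sub>R n_pm v D t0 T (sgn (a \<bullet> w1 x) * sgn (a \<bullet> w3 x)) x (w1 x) (w3 x)"
    if "x \<in> M" "x \<in> V" "unit_normal M x a" for x a
    using n_pm_decompose[OF _ N[OF that(1,3)] xi[OF that(2)]] V(1) that(2) by auto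
  \<comment> \<open>The product of the two inner products is unchanged when the normal is reversed,
    so its sign at \<open>p\<close> may be computed from \<open>m\<close> as well as from the
    normalized gradient \<open>k p\<close>.\<close>
  define f where "f = (\<lambda>x. \<epsilon> * ((k x \<bullet> w1 x) * (k x \<bullet> w3 x)))"
  have cf: "continuous_on (U \<inter> V) f"
    unfolding f_def by (intro continuous_intros continuous_on_subset[OF ck] continuous_on_subset[OF cw(1)] continuous_on_subset[OF cw(2)]) auto
  define O' where "O' = (U \<inter> V) \<inter> f -` {0<..}"
  have oO: "open O'" unfolding O'_def
    by (rule continuous_open_preimage[OF cf]) (use C1(1) cw(3) in auto)
  have "f p > 0"
  proof -
    have "m = k p \<or> m = - k p" using un[OF M(2) g(1)] m(1) by simp
    then have "(k p \<bullet> w1 p) * (k p \<bullet> w3 p) = (m \<bullet> w1 p) * (m \<bullet> w3 p)" by auto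
    moreover have "\<epsilon> = sgn ((m \<bullet> w1 p) * (m \<bullet> w3 p))" using m(2) by (simp add: sgn_mult)
    moreover have "(m \<bullet> w1 p) * (m \<bullet> w3 p) \<noteq> 0" using dec(1,2)[OF M(2) V(2) m(1)] by simp
    ultimately have "f p = \<bar>(m \<bullet> w1 p) * (m \<bullet> w3 p)\<bar>" "(m \<bullet> w1 p) * (m \<bullet> w3 p) \<noteq> 0"
      unfolding f_def by (metis abs_sgn mult.commute)+
    then show ?thesis by simp
  qed
  then have pO: "p \<in> O'" using g(1) V(2) by (simp add: O'_def)
  show ?thesis
  proof (rule helicity_normal_field[OF g(2) M(2) g(1) smooth_on_vector(3)[OF sm V(2)] oO pO])
    fix x assume "x \<in> M \<inter> O' \<inter> U"
    then have x: "x \<in> M" "x \<in> U" "x \<in> V" "f x > 0" by (auto simp: O'_def)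
    have uk: "unit_normal M x (k x)" using un[OF x(1,2)] by blast
    note d = dec[OF x(1,3) uk]
    have "sgn (k x \<bullet> w1 x) * sgn (k x \<bullet> w3 x) = \<epsilon>"
    proof -
      have "\<epsilon> \<in> {1, -1}" using m(2) sgn_nonzero_cases[OF dec(1)[OF M(2) V(2) m(1)]]
        sgn_nonzero_cases[OF dec(2)[OF M(2) V(2) m(1)]] by auto
      moreover have "sgn \<epsilon> * sgn ((k x \<bullet> w1 x) * (k x \<bullet> w3 x)) = 1"
        using x(4) by (simp add: f_def flip: sgn_mult)
      ultimately show ?thesis by (auto simp: sgn_mult)
    qed
    then have kx: "k x = sgn (k x \<bullet> w1 x) *\<^sub>R ?W x" using d(3) by simp
    have "parallel (?W x) (k x)"
      by (subst kx) (simp add: parallel_def cross_mult_right)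
    then show "parallel (?W x) (grad g x)"
      using nz[OF x(2)] by (auto simp: k_def parallel_def cross_mult_right)
  qed
qed

text \<open>The inner products of \<open>N\<close> with the continuous eigenvectors never vanish
  along the connected curve. Their signs are constant, so one \<epsilon> and one \<delta> serve the
  entire trajectory.\<close>

lemma shear_trajectories:
  assumes M: "smooth_surface M" "M \<subseteq> simple_spectrum_set v D t0 T" and F: "smooth_surface_family S P"
    and n: "\<And>s. s \<in> S \<Longrightarrow> smooth_normal_field (P s) (n s)"
    and N: "\<And>x m. x \<in> M \<Longrightarrow> unit_normal M x m \<Longrightarrow> is_n_pm v D t0 T x m"
  shows "\<forall>s1\<in>S. transversal (P s1) M \<longrightarrow>
         (\<forall>\<Gamma>\<in>components (P s1 \<inter> M). \<exists>J \<gamma> N.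
            \<gamma> ` J = \<Gamma> \<and> oriented_trajectory (is_n_pm v D t0 T) (n s1) J \<gamma> N \<and>
            (\<forall>e1 e3. continuous_on J e1 \<longrightarrow> continuous_on J e3 \<longrightarrow>
               (\<forall>s2\<in>J. is_xi1 v D t0 T (\<gamma> s2) (e1 s2) \<and> is_xi3 v D t0 T (\<gamma> s2) (e3 s2)) \<longrightarrow>
               (\<exists>\<epsilon>\<in>{1, -1}. \<exists>\<delta>\<in>{1, -1}. \<forall>s2\<in>J.
                  N s2 = \<delta> *\<^sub>R n_pm v D t0 T \<epsilon> (\<gamma> s2) (e1 s2) (e3 s2) \<and>
                  (\<forall>V w1 w3. \<gamma> s2 \<in> V \<longrightarrow> V \<subseteq> simple_spectrum_set v D t0 T \<longrightarrow>
                     smooth_selection (is_xi1 v D t0 T) V w1 \<longrightarrow>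
                     smooth_selection (is_xi3 v D t0 T) V w3 \<longrightarrow>
                     smooth_on V (\<lambda>x. n_pm v D t0 T \<epsilon> x (w1 x) (w3 x)) \<longrightarrow>
                     w1 (\<gamma> s2) = e1 s2 \<longrightarrow> w3 (\<gamma> s2) = e3 s2 \<longrightarrow>
                     helicity (\<lambda>x. n_pm v D t0 T \<epsilon> x (w1 x) (w3 x)) (\<gamma> s2) = 0))))"
proof (intro ballI impI)
  fix s1 \<Gamma> assume s1: "s1 \<in> S" "transversal (P s1) M" "\<Gamma> \<in> components (P s1 \<inter> M)"
  obtain J \<gamma> N where J: "J \<noteq> {}" "\<gamma> ` J = \<Gamma>" "oriented_trajectory (is_n_pm v D t0 T) (n s1) J \<gamma> N"
      "\<forall>r\<in>J. \<gamma> r \<in> M \<and> unit_normal M (\<gamma> r) (N r)"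
    using intersection_trajectory[OF M(1) F s1(1) n[OF s1(1)] s1(2,3), of "is_n_pm v D t0 T"] N by blast
  show "\<exists>J \<gamma> N.
            \<gamma> ` J = \<Gamma> \<and> oriented_trajectory (is_n_pm v D t0 T) (n s1) J \<gamma> N \<and>
            (\<forall>e1 e3. continuous_on J e1 \<longrightarrow> continuous_on J e3 \<longrightarrow>
               (\<forall>s2\<in>J. is_xi1 v D t0 T (\<gamma> s2) (e1 s2) \<and> is_xi3 v D t0 T (\<gamma> s2) (e3 s2)) \<longrightarrow>
               (\<exists>\<epsilon>\<in>{1, -1}. \<exists>\<delta>\<in>{1, -1}. \<forall>s2\<in>J.
                  N s2 = \<delta> *\<^sub>R n_pm v D t0 T \<epsilon> (\<gamma> s2) (e1 s2) (e3 s2) \<and>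
                  (\<forall>V w1 w3. \<gamma> s2 \<in> V \<longrightarrow> V \<subseteq> simple_spectrum_set v D t0 T \<longrightarrow>
                     smooth_selection (is_xi1 v D t0 T) V w1 \<longrightarrow>
                     smooth_selection (is_xi3 v D t0 T) V w3 \<longrightarrow>
                     smooth_on V (\<lambda>x. n_pm v D t0 T \<epsilon> x (w1 x) (w3 x)) \<longrightarrow>
                     w1 (\<gamma> s2) = e1 s2 \<longrightarrow> w3 (\<gamma> s2) = e3 s2 \<longrightarrow>
                     helicity (\<lambda>x. n_pm v D t0 T \<epsilon> x (w1 x) (w3 x)) (\<gamma> s2) = 0)))"
  proof (rule exI[of _ J], rule exI[of _ \<gamma>], rule exI[of _ N], intro conjI J(2,3) allI impI)
    fix e1 e3 assume e: "continuous_on J e1" "continuous_on J e3"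
      "\<forall>s2\<in>J. is_xi1 v D t0 T (\<gamma> s2) (e1 s2) \<and> is_xi3 v D t0 T (\<gamma> s2) (e3 s2)"
    have cN: "continuous_on J N" and conn: "connected J"
      using J(3) by (auto simp: oriented_trajectory_def is_interval_connected_1)
    have dec: "N r \<bullet> e1 r \<noteq> 0" "N r \<bullet> e3 r \<noteq> 0"
      "N r = sgn (N r \<bullet> e1 r) *\<^sub>R n_pm v D t0 T (sgn (N r \<bullet> e1 r) * sgn (N r \<bullet> e3 r)) (\<gamma> r) (e1 r) (e3 r)"
      if "r \<in> J" for r
      using n_pm_decompose[of "\<gamma> r" v D t0 T "N r" "e1 r" "e3 r"] J(4) M(2) N e(3) that by blast+
    obtain r0 where r0: "r0 \<in> J" using J(1) by blast
    define \<delta> \<epsilon> where "\<delta> = sgn (N r0 \<bullet> e1 r0)" and "\<epsilon> = sgn (N r0 \<bullet> e1 r0) * sgn (N r0 \<bullet> e3 r0)"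
    have c: "sgn (N r \<bullet> e1 r) = \<delta>" "sgn (N r \<bullet> e1 r) * sgn (N r \<bullet> e3 r) = \<epsilon>" if "r \<in> J" for r
    proof -
      have "sgn (N r \<bullet> e1 r) = sgn (N r0 \<bullet> e1 r0)" "sgn (N r \<bullet> e3 r) = sgn (N r0 \<bullet> e3 r0)"
        by (rule continuous_sgn_constant[OF conn _ _ that r0]; use dec(1,2) in \<open>auto intro!: continuous_intros cN e\<close>)+
      then show "sgn (N r \<bullet> e1 r) = \<delta>" "sgn (N r \<bullet> e1 r) * sgn (N r \<bullet> e3 r) = \<epsilon>" by (simp_all add: \<delta>_def \<epsilon>_def)
    qed
    have pm: "\<delta> \<in> {1,-1}" "\<epsilon> \<in> {1,-1}"
      using sgn_nonzero_cases[OF dec(1)[OF r0]] sgn_nonzero_cases[OF dec(2)[OF r0]] by (auto simp: \<delta>_def \<epsilon>_def)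
    show "\<exists>\<epsilon>\<in>{1, -1}. \<exists>\<delta>\<in>{1, -1}. \<forall>s2\<in>J.
                  N s2 = \<delta> *\<^sub>R n_pm v D t0 T \<epsilon> (\<gamma> s2) (e1 s2) (e3 s2) \<and>
                  (\<forall>V w1 w3. \<gamma> s2 \<in> V \<longrightarrow> V \<subseteq> simple_spectrum_set v D t0 T \<longrightarrow>
                     smooth_selection (is_xi1 v D t0 T) V w1 \<longrightarrow>
                     smooth_selection (is_xi3 v D t0 T) V w3 \<longrightarrow>
                     smooth_on V (\<lambda>x. n_pm v D t0 T \<epsilon> x (w1 x) (w3 x)) \<longrightarrow>
                     w1 (\<gamma> s2) = e1 s2 \<longrightarrow> w3 (\<gamma> s2) = e3 s2 \<longrightarrow>
                     helicity (\<lambda>x. n_pm v D t0 T \<epsilon> x (w1 x) (w3 x)) (\<gamma> s2) = 0)"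
    proof (rule bexI[OF _ pm(2)], rule bexI[OF _ pm(1)], intro ballI conjI allI impI)
      fix r assume r: "r \<in> J"
      show "N r = \<delta> *\<^sub>R n_pm v D t0 T \<epsilon> (\<gamma> r) (e1 r) (e3 r)" using dec(3)[OF r] c[OF r] by metis
      fix V w1 w3
      assume V: "\<gamma> r \<in> V" "V \<subseteq> simple_spectrum_set v D t0 T" "smooth_selection (is_xi1 v D t0 T) V w1"
         "smooth_selection (is_xi3 v D t0 T) V w3" "smooth_on V (\<lambda>x. n_pm v D t0 T \<epsilon> x (w1 x) (w3 x))"
         "w1 (\<gamma> r) = e1 r" "w3 (\<gamma> r) = e3 r"
      have m: "\<gamma> r \<in> M" "unit_normal M (\<gamma> r) (N r)" using J(4) r by auto
      show "helicity (\<lambda>x. n_pm v D t0 T \<epsilon> x (w1 x) (w3 x)) (\<gamma> r) = 0"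
        by (rule helicity_shear_selection[OF M(1) m(1) N V(2,1,3-5) m(2)]) (use c(2)[OF r] V(6,7) in auto)
    qed
  qed
qed

subsection \<open>Compact surfaces are two-sided\<close>

lemma Ck_on_subset: "Ck_on k V f \<Longrightarrow> V' \<subseteq> V \<Longrightarrow> Ck_on k V' f"
  by (induction k arbitrary: f) (auto intro: continuous_on_subset)

lemma smooth_on_subset: "smooth_on V f \<Longrightarrow> V' \<subseteq> V \<Longrightarrow> open V' \<Longrightarrow> smooth_on V' f"
  unfolding smooth_on_def using Ck_on_subset by blast

lemma defining_subset: "defining M V g \<Longrightarrow> V' \<subseteq> V \<Longrightarrow> open V' \<Longrightarrow> defining M V' g"
  unfolding defining_def using smooth_on_subset by (auto; blast)

lemma defining_zero: "defining M V g \<Longrightarrow> y \<in> V \<Longrightarrow> g y = 0 \<longleftrightarrow> y \<in> M"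
  unfolding defining_def by blast

lemma defining_open: "defining M V g \<Longrightarrow> open V"
  unfolding defining_def smooth_on_def by blast

lemma directional_sign:
  assumes def: "defining M V g" "x \<in> V" "x \<in> M" and h: "s * (grad g x \<bullet> h) > 0"
  shows "\<forall>\<^sub>F t in at_right 0. s * g (x + t *\<^sub>R h) > 0"
proof -
  have sm: "smooth_on V g" using def by (simp add: defining_def)
  have 1: "((\<lambda>t. x + t *\<^sub>R h) has_derivative (\<lambda>t. t *\<^sub>R h)) (at (0::real))"
    by (auto intro!: derivative_eq_intros)
  have 2: "(g has_derivative (\<lambda>h. grad g x \<bullet> h)) (at (x + 0 *\<^sub>R h))"
    using smooth_on_C1(2)[OF sm def(2)] by simp
  have "((\<lambda>t. s * g (x + t *\<^sub>R h)) has_derivative (\<lambda>t. s * (grad g x \<bullet> (t *\<^sub>R h)))) (at 0)"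
    using has_derivative_mult_right[OF diff_chain_at[OF 1 2], of s] by (simp add: o_def)
  moreover have "(\<lambda>t. s * (grad g x \<bullet> (t *\<^sub>R h))) = (*) (s * (grad g x \<bullet> h))" by (auto simp: fun_eq_iff)
  ultimately have "((\<lambda>t. s * g (x + t *\<^sub>R h)) has_real_derivative s * (grad g x \<bullet> h)) (at 0)"
    by (simp add: has_field_derivative_def)
  from DERIV_pos_inc_right[OF this h] obtain d where
    d: "d > 0" "\<forall>t>0. t < d \<longrightarrow> s * g (x + 0 *\<^sub>R h) < s * g (x + (0 + t) *\<^sub>R h)" by blast
  have "g x = 0" using defining_zero[OF def(1,2)] def(3) by simp
  then show ?thesis using d unfolding eventually_at_right_field by (intro exI[of _ d]) auto
qed

lemma tendsto_line: "((\<lambda>t. x + t *\<^sub>R h) \<longlongrightarrow> x) (at_right (0::real))" for x h :: "'a::real_normed_vector"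
proof -
  have "((\<lambda>t. x + t *\<^sub>R h) \<longlongrightarrow> x + 0 *\<^sub>R h) (at_right (0::real))" by (intro tendsto_intros)
  then show ?thesis by simp
qed

lemma eventually_line:
  fixes x h :: "'a::real_normed_vector"
  assumes "\<forall>\<^sub>F y in nhds x. Q y" shows "\<forall>\<^sub>F t in at_right (0::real). Q (x + t *\<^sub>R h)"
  using tendsto_line[of x h] assms unfolding filterlim_iff by blast

text \<open>In a chart built from \<open>g\<close> the two sides of the surface are half-balls. The
  other function has no zero on them, hence a constant sign on each. The two signs differ because a
  function with nonzero gradient takes both signs arbitrarily near its zero.\<close>

lemma sgn_compatible:
  assumes def: "defining M V g" "defining M V' g'" and x: "x \<in> M" "x \<in> V" "x \<in> V'"
  shows "\<exists>c\<in>{1,-1}. \<forall>\<^sub>F y in nhds x. sgn (g' y) = c * sgn (g y)"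
proof -
  have oV: "open V" "open V'" using def defining_open by blast+
  have d: "defining M (V \<inter> V') g" "defining M (V \<inter> V') g'"
    using defining_subset[OF def(1) _ open_Int[OF oV]] defining_subset[OF def(2) _ open_Int[OF oV]] by auto
  have xV: "x \<in> V \<inter> V'" using x by blast
  have nz: "grad g x \<noteq> 0" "grad g' x \<noteq> 0" using d xV by (auto simp: defining_def)
  obtain k1 k2 where ind: "grad g x \<bullet> cross3 k1 k2 \<noteq> 0" by (rule frame_exists[OF nz(1)])
  obtain U r G G' where ch: "open U" "x \<in> U" "U \<subseteq> V \<inter> V'" "0 < r"
    "homeomorphism U (ball 0 r) (chart3 g k1 k2 x) G"
    using surface_chart[OF d(1) x(1) xV ind] by metis
  \<comment> \<open>The half-ball on the side where \<open>g\<close> has the sign of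
    \<open>c\<close>; it is convex, hence connected.\<close>
  define B where "B = (\<lambda>c :: real. {z :: real^3. norm z < r \<and> c * z $ 1 > 0})"
  have "B c = ball 0 r \<inter> {z. (c *\<^sub>R axis 1 1) \<bullet> z > 0}" for c
    by (auto simp: B_def cart_eq_inner_axis inner_commute)
  then have "convex (B c)" for c by (simp only:) (intro convex_Int convex_ball convex_halfspace_gt)
  then have conn: "connected (B c)" for c by (rule convex_connected)
  have sm: "smooth_on (V \<inter> V') g'" using d(2) by (simp add: defining_def)
  have Gg: "G z \<in> U" "g (G z) = z $ 1" if "norm z < r" for z
  proof -
    have z: "z \<in> ball 0 r" using that by simp
    then show "G z \<in> U" using ch(5) unfolding homeomorphism_def by blast
    have "chart3 g k1 k2 x (G z) = z" using homeomorphism_apply2[OF ch(5) z] .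
    then show "g (G z) = z $ 1" by (metis chart3_nth(1))
  qed
  have cG: "continuous_on (B c) (\<lambda>z. g' (G z))" for c
  proof (rule continuous_on_compose2[OF smooth_on_C1(3)[OF sm]])
    have "continuous_on (ball 0 r) G" using ch(5) by (simp add: homeomorphism_def)
    then show "continuous_on (B c) G" by (rule continuous_on_subset) (auto simp: B_def)
    show "G ` B c \<subseteq> V \<inter> V'" using Gg(1) ch(3) by (auto simp: B_def)
  qed
  have g'nz: "g' (G z) \<noteq> 0" if "z \<in> B c" for z c
  proof -
    have z: "norm z < r" "z $ 1 \<noteq> 0" using that by (auto simp: B_def)
    have "G z \<in> V \<inter> V'" using Gg(1)[OF z(1)] ch(3) by blast
    then show ?thesis using Gg(2)[OF z(1)] z(2) defining_zero[OF d(1)] defining_zero[OF d(2)] by metis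
  qed
  have const: "sgn (g' (G z)) = sgn (g' (G z'))" if "z \<in> B c" "z' \<in> B c" for z z' c
    by (rule continuous_sgn_constant[OF conn cG g'nz that])
  have yU: "\<exists>z. norm z < r \<and> G z = y \<and> z $ 1 = g y" if "y \<in> U" for y
    using ch(5) that unfolding homeomorphism_def by (intro exI[of _ "chart3 g k1 k2 x y"]) auto
  have evU: "\<forall>\<^sub>F y in nhds x. y \<in> U" using ch(1,2) by (rule eventually_nhds_in_open)
  \<comment> \<open>A short step along the gradient of \<open>g'\<close>, or against it, stays in
    \<open>U\<close> and gives \<open>g'\<close> the prescribed sign.\<close>
  have ex: "\<exists>y\<in>U. s * g' y > 0" if s: "s = 1 \<or> s = -1" for s
  proof -
    have "s * (grad g' x \<bullet> (s *\<^sub>R grad g' x)) > 0" using s nz(2) by auto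
    then have "\<forall>\<^sub>F t in at_right 0. s * g' (x + t *\<^sub>R (s *\<^sub>R grad g' x)) > 0"
      by (rule directional_sign[OF d(2) xV x(1)])
    then have "\<forall>\<^sub>F t in at_right 0. s * g' (x + t *\<^sub>R (s *\<^sub>R grad g' x)) > 0 \<and> x + t *\<^sub>R (s *\<^sub>R grad g' x) \<in> U"
      using eventually_line[OF evU] by (rule eventually_conj)
    then have "\<exists>t. s * g' (x + t *\<^sub>R (s *\<^sub>R grad g' x)) > 0 \<and> x + t *\<^sub>R (s *\<^sub>R grad g' x) \<in> U"
      using eventually_happens trivial_limit_at_right_real by blast
    then show ?thesis by blast
  qed
  define zp where "zp = (\<lambda>c. (c * (r / 2)) *\<^sub>R axis 1 1 :: real^3)"
  have zp: "zp 1 \<in> B 1" "zp (-1) \<in> B (-1)" using ch(4) by (auto simp: zp_def B_def)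
  define c where "c = sgn (g' (G (zp 1)))"
  have c: "c \<in> {1,-1}" unfolding c_def by (rule sgn_nonzero_cases[OF g'nz[OF zp(1)]])
  define c' where "c' = sgn (g' (G (zp (-1))))"
  have c': "c' \<in> {1,-1}" unfolding c'_def by (rule sgn_nonzero_cases[OF g'nz[OF zp(2)]])
  have pos: "sgn (g' y) = c" if "y \<in> U" "g y > 0" for y
  proof -
    obtain z where z: "norm z < r" "G z = y" "z $ 1 = g y" using yU[OF \<open>y \<in> U\<close>] by blast
    then have "z \<in> B 1" using \<open>g y > 0\<close> by (simp add: B_def)
    from const[OF this zp(1)] z(2) show ?thesis by (simp add: c_def)
  qed
  have neg: "sgn (g' y) = c'" if "y \<in> U" "g y < 0" for y
  proof -
    obtain z where z: "norm z < r" "G z = y" "z $ 1 = g y" using yU[OF \<open>y \<in> U\<close>] by blast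
    then have "z \<in> B (-1)" using \<open>g y < 0\<close> by (simp add: B_def)
    from const[OF this zp(2)] z(2) show ?thesis by (simp add: c'_def)
  qed
  have zero: "g' y = 0" if "y \<in> U" "g y = 0" for y
    using that ch(3) defining_zero[OF d(1)] defining_zero[OF d(2)] by blast
  have "c' = - c"
  proof (rule ccontr)
    assume "c' \<noteq> - c"
    then have eq: "c' = c" using c c' by auto
    obtain y where y: "y \<in> U" "- c * g' y > 0" using ex[of "- c"] c by auto
    then have "g' y \<noteq> 0" by auto
    then have "g y \<noteq> 0" using zero y(1) by blast
    then have "sgn (g' y) = c" using pos[OF y(1)] neg[OF y(1)] eq by (metis linorder_neqE_linordered_idom)
    then have "g' y = c * \<bar>g' y\<bar>" by (metis mult_sgn_abs)
    then have "- c * g' y = - (c * c) * \<bar>g' y\<bar>" by (metis minus_mult_left mult.assoc)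
    then show False using y(2) c by auto
  qed
  then have "sgn (g' y) = c * sgn (g y)" if "y \<in> U" for y
    using pos[OF that] neg[OF that] zero[OF that] by (cases "g y" "0::real" rule: linorder_cases) auto
  then have "\<forall>\<^sub>F y in nhds x. sgn (g' y) = c * sgn (g y)" using evU by (auto elim: eventually_mono)
  then show ?thesis using c by blast
qed

text \<open>\<open>F\<close> takes the values \<open>\<plusminus>1\<close> off \<open>M\<close>, is locally constant there and changes sign across \<open>M\<close>.\<close>

definition side_function :: "(real^3) set \<Rightarrow> (real^3 \<Rightarrow> real) \<Rightarrow> real^3 \<Rightarrow> bool" where
  "side_function M F x \<longleftrightarrow>
     (x \<in> M \<and> (\<exists>V g. \<exists>c\<in>{1,-1}. x \<in> V \<and> defining M V g \<and> (\<forall>\<^sub>F y in nhds x. F y = c * sgn (g y)))) \<or>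
     (x \<notin> M \<and> (\<exists>c\<in>{1,-1}. \<forall>\<^sub>F y in nhds x. F y = c))"

lemma side_function_cong:
  assumes "side_function M F x" "\<forall>\<^sub>F y in nhds x. G y = F y"
  shows "side_function M G x"
proof -
  have tr: "\<forall>\<^sub>F y in nhds x. G y = h y" if "\<forall>\<^sub>F y in nhds x. F y = h y" for h
    using that assms(2) by eventually_elim simp
  show ?thesis using assms(1) tr unfolding side_function_def by meson
qed

lemma side_function_scale:
  assumes "side_function M F x" "c \<in> {1,-1}"
  shows "side_function M (\<lambda>y. c * F y) x"
proof -
  have cc: "c * a \<in> {1,-1}" if "a \<in> {1,-1}" for a using that assms(2) by auto
  have tr: "\<forall>\<^sub>F y in nhds x. c * F y = (c * a) * h y" if "\<forall>\<^sub>F y in nhds x. F y = a * h y" for a h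
    using that by eventually_elim simp
  show ?thesis
  proof (cases "x \<in> M")
    case True
    then obtain V g a where "a \<in> {1,-1}" "x \<in> V" "defining M V g" "\<forall>\<^sub>F y in nhds x. F y = a * sgn (g y)"
      using assms(1) unfolding side_function_def by blast
    then show ?thesis using True cc tr unfolding side_function_def by meson
  next
    case False
    then obtain a where a: "a \<in> {1,-1}" "\<forall>\<^sub>F y in nhds x. F y = a" using assms(1) unfolding side_function_def by blast
    have "\<forall>\<^sub>F y in nhds x. c * F y = c * a" using a(2) by eventually_elim simp
    then show ?thesis using False cc[OF a(1)] unfolding side_function_def by blast
  qed
qed

text \<open>Off \<open>M\<close> a constant serves, because the complement of the closed set
  \<open>M\<close> is open. Near a point of \<open>M\<close> the sign of a defining function serves,
  being locally constant off its zero set.\<close>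

lemma side_function_local:
  assumes M: "smooth_surface M" "closed M"
  shows "\<exists>U F. open U \<and> x \<in> U \<and> (\<forall>y\<in>U. side_function M F y)"
proof (cases "x \<in> M")
  case False
  have "side_function M (\<lambda>_. 1) y" if "y \<in> - M" for y
    using that unfolding side_function_def by (auto intro!: bexI[of _ 1])
  then show ?thesis using False M(2) by (intro exI[of _ "- M"] exI[of _ "\<lambda>_. 1"]) auto
next
  case True
  obtain V g where g: "x \<in> V" "defining M V g" using smooth_surface_defining[OF M(1) True] by metis
  have sm: "smooth_on V g" using g(2) by (simp add: defining_def)
  note C1 = smooth_on_C1[OF sm]
  have "side_function M (\<lambda>y. sgn (g y)) y" if y: "y \<in> V" for y
  proof (cases "y \<in> M")
    case True
    have "\<forall>\<^sub>F z in nhds y. sgn (g z) = 1 * sgn (g z)" by simp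
    then show ?thesis unfolding side_function_def using True y g(2) by blast
  next
    case False
    have "g y \<noteq> 0" using False defining_zero[OF g(2) y] by simp
    define c where "c = sgn (g y)"
    have c: "c \<in> {1,-1}" unfolding c_def by (rule sgn_nonzero_cases[OF \<open>g y \<noteq> 0\<close>])
    have "open (V \<inter> (\<lambda>z. c * g z) -` {0<..})"
      by (intro continuous_open_preimage continuous_intros C1(1,3) open_greaterThan)
    moreover have "c * g y > 0" using \<open>g y \<noteq> 0\<close> by (simp add: c_def sgn_real_def)
    ultimately have "\<forall>\<^sub>F z in nhds y. z \<in> V \<inter> (\<lambda>z. c * g z) -` {0<..}"
      using y by (intro eventually_nhds_in_open) auto
    then have "\<forall>\<^sub>F z in nhds y. sgn (g z) = c"
      by eventually_elim (use c in \<open>auto simp: sgn_real_def\<close>)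
    then show ?thesis unfolding side_function_def using False c by blast
  qed
  then show ?thesis using g(1) C1(1) by (intro exI[of _ V] exI[of _ "\<lambda>y. sgn (g y)"]) auto
qed

lemma side_function_compatible:
  assumes "side_function M F x" "side_function M G x"
  shows "\<exists>c\<in>{1,-1}. \<forall>\<^sub>F y in nhds x. F y = c * G y"
proof (cases "x \<in> M")
  case True
  obtain V g a where F: "a \<in> {1,-1}" "x \<in> V" "defining M V g" "\<forall>\<^sub>F y in nhds x. F y = a * sgn (g y)"
    using assms(1) True unfolding side_function_def by blast
  obtain V' g' b where G: "b \<in> {1,-1}" "x \<in> V'" "defining M V' g'" "\<forall>\<^sub>F y in nhds x. G y = b * sgn (g' y)"
    using assms(2) True unfolding side_function_def by blast
  obtain c where c: "c \<in> {1,-1}" "\<forall>\<^sub>F y in nhds x. sgn (g' y) = c * sgn (g y)"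
    using sgn_compatible[OF F(3) G(3) True F(2) G(2)] by blast
  have "\<forall>\<^sub>F y in nhds x. F y = (a * b * c) * G y"
    using F(4) G(4) c(2) by eventually_elim (use F(1) G(1) c(1) in auto)
  moreover have "a * b * c \<in> {1,-1}" using F(1) G(1) c(1) by auto
  ultimately show ?thesis by blast
next
  case False
  obtain a where F: "a \<in> {1,-1}" "\<forall>\<^sub>F y in nhds x. F y = a"
    using assms(1) False unfolding side_function_def by blast
  obtain b where G: "b \<in> {1,-1}" "\<forall>\<^sub>F y in nhds x. G y = b"
    using assms(2) False unfolding side_function_def by blast
  have "\<forall>\<^sub>F y in nhds x. F y = (a * b) * G y"
    using F(2) G(2) by eventually_elim (use F(1) G(1) in auto)
  moreover have "a * b \<in> {1,-1}" using F(1) G(1) by auto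
  ultimately show ?thesis by blast
qed

text \<open>Makes the sign relating two side functions unique: if both signs were possible near a
  point, the functions would vanish there.\<close>

lemma side_function_nonzero:
  assumes "side_function M F x" shows "\<not> (\<forall>\<^sub>F y in nhds x. F y = 0)"
proof
  assume z: "\<forall>\<^sub>F y in nhds x. F y = 0"
  show False
  proof (cases "x \<in> M")
    case True
    obtain V g a where F: "a \<in> {1,-1}" "x \<in> V" "defining M V g" "\<forall>\<^sub>F y in nhds x. F y = a * sgn (g y)"
      using assms(1) True unfolding side_function_def by blast
    have "\<forall>\<^sub>F y in nhds x. g y = 0" using F(4) z by eventually_elim (use F(1) in \<open>auto simp: sgn_zero_iff\<close>)
    then have 1: "\<forall>\<^sub>F t in at_right 0. g (x + t *\<^sub>R grad g x) = 0" by (rule eventually_line)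
    have "grad g x \<bullet> grad g x > 0" using F(2,3) by (auto simp: defining_def)
    then have "\<forall>\<^sub>F t in at_right 0. 1 * g (x + t *\<^sub>R grad g x) > 0"
      by (intro directional_sign[OF F(3,2) True]) simp
    with 1 have "\<forall>\<^sub>F t in at_right (0::real). False" by eventually_elim simp
    then show False using trivial_limit_at_right_real by (simp add: eventually_False)
  next
    case False
    obtain a where F: "a \<in> {1,-1}" "\<forall>\<^sub>F y in nhds x. F y = a"
      using assms(1) False unfolding side_function_def by blast
    have "\<forall>\<^sub>F y in nhds x. False" using F(2) z by eventually_elim (use F(1) in auto)
    then show False by (simp add: eventually_False)
  qed
qed

text \<open>Near each point the two functions agree up to exactly one sign. Having a given sign is
  therefore locally constant on the connected set.\<close>

lemma side_function_unique:
  assumes A: "open A" "connected A" and F: "\<And>y. y \<in> A \<Longrightarrow> side_function M F y"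
    and G: "\<And>y. y \<in> A \<Longrightarrow> side_function M G y"
  shows "\<exists>c\<in>{1,-1}. \<forall>y\<in>A. F y = c * G y"
proof (cases "A = {}")
  case False
  then obtain x0 where x0: "x0 \<in> A" by blast
  obtain c where c: "c \<in> {1,-1}" "\<forall>\<^sub>F y in nhds x0. F y = c * G y"
    using side_function_compatible[OF F[OF x0] G[OF x0]] by blast
  define Q where "Q = (\<lambda>x. \<forall>\<^sub>F y in nhds x. F y = c * G y)"
  have "Q y" if y: "y \<in> A" for y
  proof (rule connected_propagate[where Q = Q, OF A(2) x0 y])
    show "Q x0" using c(2) by (simp add: Q_def)
    fix x assume x: "x \<in> A"
    obtain d where d: "d \<in> {1,-1}" "\<forall>\<^sub>F y in nhds x. F y = d * G y"
      using side_function_compatible[OF F[OF x] G[OF x]] by blast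
    obtain U where U: "open U" "x \<in> U" "\<forall>y\<in>U. F y = d * G y" using d(2) unfolding eventually_nhds by blast
    have U3: "\<forall>\<^sub>F y in nhds z. F y = d * G y" if "z \<in> U" for z
      unfolding eventually_nhds using U that by blast
    have "Q z \<longleftrightarrow> c = d" if z: "z \<in> U" "z \<in> A" for z
    proof
      assume Qz: "Q z"
      show "c = d"
      proof (rule ccontr)
        assume "c \<noteq> d"
        then have "d = - c" using c(1) d(1) by auto
        have "\<forall>\<^sub>F y in nhds z. F y = 0"
          using Qz[unfolded Q_def] U3[OF z(1)] by eventually_elim (simp add: \<open>d = - c\<close>)
        then show False using side_function_nonzero[OF F[OF z(2)]] by blast
      qed
    next
      assume "c = d" then show "Q z" using U3[OF z(1)] unfolding Q_def by simp
    qed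
    then have "\<forall>z\<in>U \<inter> A. Q z = Q x" using U(2) x by blast
    then show "\<exists>U. open U \<and> x \<in> U \<and> (\<forall>z\<in>U \<inter> A. Q z = Q x)" using U(1,2) by blast
  qed
  then have "F y = c * G y" if "y \<in> A" for y using that eventually_nhds_x_imp_x unfolding Q_def by blast
  then show ?thesis using c(1) by blast
qed auto

definition sided :: "(real^3) set \<Rightarrow> (real^3) set \<Rightarrow> bool" where
  "sided M A \<longleftrightarrow> (\<exists>F. \<forall>y\<in>A. side_function M F y)"

text \<open>Side functions on an overlap that is connected agree up to a global sign. Intersections of boxes being
  connected, subdividing a box that contains \<open>M\<close> yields a side function on all of it: a compact
  surface in \<open>\<real>\<^sup>3\<close> is two-sided.\<close>

lemma sided_union:
  assumes A: "open A" "open B" "connected (A \<inter> B)" and s: "sided M A" "sided M B"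
  shows "sided M (A \<union> B)"
proof -
  obtain F G where F: "\<And>y. y \<in> A \<Longrightarrow> side_function M F y" and G: "\<And>y. y \<in> B \<Longrightarrow> side_function M G y"
    using s unfolding sided_def by metis
  have "\<exists>c\<in>{1,-1}. \<forall>y\<in>A \<inter> B. F y = c * G y"
    by (rule side_function_unique[OF _ A(3)]) (use A F G in auto)
  then obtain c where c: "c \<in> {1,-1}" "\<forall>y\<in>A \<inter> B. F y = c * G y" by blast
  define H where "H = (\<lambda>y. if y \<in> A then F y else c * G y)"
  have "side_function M H y" if "y \<in> A \<union> B" for y
  proof (cases "y \<in> A")
    case True
    have "\<forall>\<^sub>F z in nhds y. z \<in> A" using A(1) True by (rule eventually_nhds_in_open)
    then have "\<forall>\<^sub>F z in nhds y. H z = F z" by eventually_elim (simp add: H_def)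
    then show ?thesis by (rule side_function_cong[OF F[OF True]])
  next
    case False
    then have yB: "y \<in> B" using that by blast
    have "\<forall>\<^sub>F z in nhds y. z \<in> B" using A(2) yB by (rule eventually_nhds_in_open)
    then have "\<forall>\<^sub>F z in nhds y. H z = c * G z" by eventually_elim (use c(2) in \<open>auto simp: H_def\<close>)
    then show ?thesis by (rule side_function_cong[OF side_function_scale[OF G[OF yB] c(1)]])
  qed
  then show ?thesis unfolding sided_def by blast
qed

text \<open>Induction on the set of coordinates in which the box may be long, and within it on the
  number of steps of length \<open>\<delta> / 2\<close> by which coordinate \<open>j\<close> exceeds
  \<delta>. Each step splits the box into two overlapping boxes whose intersection is
  convex.\<close>

lemma sided_boxes:
  fixes \<delta> :: real
  assumes \<delta>: "\<delta> > 0"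
    and small: "\<And>a b. box a b \<subseteq> K \<Longrightarrow> (\<forall>i. b $ i - a $ i < \<delta>) \<Longrightarrow> sided M (box a b)"
    and ab: "box a b \<subseteq> K"
  shows "sided M (box a b)"
proof -
  have main: "\<forall>a b. box a b \<subseteq> K \<and> (\<forall>i. i \<notin> I \<longrightarrow> b $ i - a $ i < \<delta>) \<longrightarrow> sided M (box a b)" for I :: "3 set"
  proof (induction I rule: finite_induct[OF finite])
    case 1
    then show ?case using small by simp
  next
    case (2 j I)
    have "sided M (box a b)"
      if "box a b \<subseteq> K" "\<forall>i. i \<notin> insert j I \<longrightarrow> b $ i - a $ i < \<delta>" "b $ j - a $ j < \<delta> + real n * (\<delta> / 2)" for a b n
      using that
    proof (induction n arbitrary: a b)
      case 0
      then have "\<forall>i. i \<notin> I \<longrightarrow> b $ i - a $ i < \<delta>" by (metis add.right_neutral insertE mult_zero_left of_nat_0)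
      then show ?case using 2(3) 0(1) by blast
    next
      case (Suc n)
      show ?case
      proof (cases "b $ j - a $ j < \<delta>")
        case True
        then have "\<forall>i. i \<notin> I \<longrightarrow> b $ i - a $ i < \<delta>" using Suc.prems(2) by (metis insertE)
        then show ?thesis using 2(3) Suc.prems(1) by blast
      next
        case False
        \<comment> \<open>The lower box is shorter by \<open>\<delta> / 2\<close>. The upper one has
          thickness \<open>3 * \<delta> / 4\<close>, below \<delta>, so it is long in fewer
          coordinates. They overlap in a layer of thickness \<open>\<delta> / 4\<close>.\<close>
        define b1 where "b1 = (\<chi> i. if i = j then b $ j - \<delta> / 2 else b $ i)"
        define a2 where "a2 = (\<chi> i. if i = j then b $ j - 3 * \<delta> / 4 else a $ i)"
        have un: "box a b = box a b1 \<union> box a2 b"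
        proof (intro equalityI subsetI)
          fix x assume x: "x \<in> box a b"
          show "x \<in> box a b1 \<union> box a2 b"
          proof (cases "x $ j < b $ j - \<delta> / 2")
            case True then show ?thesis using x by (auto simp: mem_box_cart b1_def)
          next
            case False then show ?thesis using x \<delta> by (auto simp: mem_box_cart a2_def)
          qed
        next
          fix x assume "x \<in> box a b1 \<union> box a2 b"
          then have *: "x \<in> box a b1 \<or> x \<in> box a2 b" by blast
          have "a $ i < x $ i \<and> x $ i < b $ i" for i
          proof (cases "i = j")
            case True
            show ?thesis using * False \<delta> True unfolding mem_box_cart b1_def a2_def
              by (elim disjE) (drule spec[of _ j], simp)+
          next
            case False
            show ?thesis using * False unfolding mem_box_cart b1_def a2_def
              by (elim disjE) (drule spec[of _ i], simp)+
          qed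
          then show "x \<in> box a b" by (simp add: mem_box_cart)
        qed
        have "convex (box a b1 \<inter> box a2 b)" by (intro convex_Int convex_box)
        then have "connected (box a b1 \<inter> box a2 b)" by (rule convex_connected)
        moreover have "sided M (box a b1)"
        proof (rule Suc.IH)
          show "box a b1 \<subseteq> K" using un Suc.prems(1) by blast
          show "\<forall>i. i \<notin> insert j I \<longrightarrow> b1 $ i - a $ i < \<delta>" using Suc.prems(2) by (simp add: b1_def)
          show "b1 $ j - a $ j < \<delta> + real n * (\<delta> / 2)"
          proof -
            have "b1 $ j = b $ j - \<delta> / 2" "real (Suc n) * (\<delta> / 2) = real n * (\<delta> / 2) + \<delta> / 2"
              by (simp_all add: b1_def distrib_right)
            then show ?thesis using Suc.prems(3) by linarith
          qed
        qed
        moreover have "sided M (box a2 b)"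
        proof -
          have "\<forall>i. i \<notin> I \<longrightarrow> b $ i - a2 $ i < \<delta>" using Suc.prems(2) \<delta> by (auto simp: a2_def)
          moreover have "box a2 b \<subseteq> K" using un Suc.prems(1) by blast
          ultimately show ?thesis using 2(3) by blast
        qed
        ultimately show ?thesis unfolding un by (intro sided_union open_box)
      qed
    qed
    note step = this
    show ?case
    proof (intro allI impI)
      fix a b :: "real^3" assume *: "box a b \<subseteq> K \<and> (\<forall>i. i \<notin> insert j I \<longrightarrow> b $ i - a $ i < \<delta>)"
      obtain n where n: "(b $ j - a $ j) / (\<delta> / 2) < real n" using reals_Archimedean2 by blast
      then have "b $ j - a $ j < real n * (\<delta> / 2)" using \<delta> by (simp add: field_simps)
      then show "sided M (box a b)" using step[of a b n] * \<delta> by simp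
    qed
  qed
  show ?thesis using main[of UNIV] ab by simp
qed

text \<open>A Lebesgue number of the cover by neighbourhoods carrying side functions starts the
  subdivision of a box around \<open>M\<close>.\<close>

lemma compact_surface_sided:
  assumes M: "smooth_surface M" "compact M"
  shows "\<exists>F. \<forall>x\<in>M. side_function M F x"
proof -
  have cl: "closed M" using M(2) by (rule compact_imp_closed)
  obtain a where a: "M \<subseteq> box (-a) a" using bounded_subset_box_symmetric[OF compact_imp_bounded[OF M(2)]] by blast
  let ?K = "cbox (-a) a"
  have "\<exists>e>0. \<forall>x\<in>?K. sided M (ball x e)"
  proof (rule compact_uniform_bound[OF compact_cbox])
    fix x
    obtain U F where U: "open U" "x \<in> U" "\<forall>y\<in>U. side_function M F y" using side_function_local[OF M(1) cl] by blast
    obtain e where e: "e > 0" "ball x e \<subseteq> U" using U(1,2) by (meson open_contains_ball)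
    have "sided M (ball y (e / 2))" if "y \<in> ball x (e / 2)" for y
    proof -
      have "ball y (e / 2) \<subseteq> ball x e"
      proof
        fix z assume "z \<in> ball y (e / 2)"
        then show "z \<in> ball x e" using that dist_triangle[of x z y] by simp
      qed
      then show ?thesis unfolding sided_def using U(3) e(2) by blast
    qed
    then show "\<exists>U e. open U \<and> x \<in> U \<and> 0 < e \<and> (\<forall>y\<in>U \<inter> ?K. sided M (ball y e))"
      using e(1) by (intro exI[of _ "ball x (e / 2)"] exI[of _ "e / 2"]) auto
  next
    fix y and e e' :: real assume "sided M (ball y e)" "e' \<le> e"
    then show "sided M (ball y e')" unfolding sided_def using subset_ball by blast
  qed
  then obtain e where e: "e > 0" "\<And>x. x \<in> ?K \<Longrightarrow> sided M (ball x e)" by blast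
  have "sided M (box (-a) a)"
  \<comment> \<open>With all three sides below \<open>e / 3\<close>, the sum of the coordinate
    differences of two points of the box is below \<open>e\<close>, so the box lies in a ball of
    radius \<open>e\<close> about any of its points.\<close>
  proof (rule sided_boxes[of "e / 3" ?K])
    show "e / 3 > 0" using e(1) by simp
    show "box (-a) a \<subseteq> ?K" by (rule box_subset_cbox)
    fix c d :: "real^3" assume cd: "box c d \<subseteq> ?K" "\<forall>i. d $ i - c $ i < e / 3"
    show "sided M (box c d)"
    proof (cases "box c d = {}")
      case True then show ?thesis by (simp add: sided_def)
    next
      case False
      then obtain x where x: "x \<in> box c d" by blast
      have "box c d \<subseteq> ball x e"
      proof
        fix y assume y: "y \<in> box c d"
        have "\<bar>(x - y) $ i\<bar> < e / 3" for i
        proof -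
          have "c $ i < x $ i \<and> x $ i < d $ i" "c $ i < y $ i \<and> y $ i < d $ i" "d $ i - c $ i < e / 3"
            using x y cd(2) by (auto simp: mem_box_cart)
          then show ?thesis unfolding vector_minus_component abs_less_iff by linarith
        qed
        from this[of 1] this[of 2] this[of 3] have "(\<Sum>i\<in>UNIV. \<bar>(x - y) $ i\<bar>) < e" unfolding sum_3 by linarith
        then show "y \<in> ball x e" using norm_le_l1_cart[of "x - y"] by (simp add: dist_norm)
      qed
      moreover have "sided M (ball x e)" using e(2) x cd(1) by blast
      ultimately show ?thesis unfolding sided_def by blast
    qed
  qed
  then show ?thesis unfolding sided_def using a by blast
qed

text \<open>The vector in question is the unit normal pointing to the side where \<open>F\<close> is
  1. Were the two candidates opposite, \<open>F\<close> would have to be both 1 and -1 at points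
  slightly displaced along one of them.\<close>

lemma side_normal_unique:
  assumes 1: "defining M V g" "x \<in> V" "c \<in> {1,-1}" "\<forall>\<^sub>F y in nhds x. F y = c * sgn (g y)"
    and 2: "defining M V' g'" "x \<in> V'" "c' \<in> {1,-1}" "\<forall>\<^sub>F y in nhds x. F y = c' * sgn (g' y)" and x: "x \<in> M"
  shows "c *\<^sub>R (grad g x /\<^sub>R norm (grad g x)) = c' *\<^sub>R (grad g' x /\<^sub>R norm (grad g' x))"
proof -
  let ?u = "grad g x /\<^sub>R norm (grad g x)" and ?u' = "grad g' x /\<^sub>R norm (grad g' x)"
  have nz: "grad g x \<noteq> 0" "grad g' x \<noteq> 0" using 1 2 by (auto simp: defining_def)
  have "?u' = ?u \<or> ?u' = - ?u"
    using defining_unit_normal[OF 2(1) x 2(2)] unit_normal_iff[OF 1(1) x 1(2)] by blast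
  then have cases: "c' *\<^sub>R ?u' = c *\<^sub>R ?u \<or> c' *\<^sub>R ?u' = - (c *\<^sub>R ?u)" using 1(3) 2(3) by auto
  moreover have False if opp: "c' *\<^sub>R ?u' = - (c *\<^sub>R ?u)"
  proof -
    have c2: "c * c = 1" "c' * c' = 1" using 1(3) 2(3) by auto
    let ?a = "c *\<^sub>R ?u"
    have gu: "grad g x \<bullet> ?u > 0" using nz(1) by (simp add: dot_square_norm)
    have "c * (grad g x \<bullet> ?a) = (c * c) * (grad g x \<bullet> ?u)" by (simp only: inner_scaleR_right mult.assoc)
    then have "c * (grad g x \<bullet> ?a) > 0" using gu c2 by (simp only: mult_1)
    then have e1: "\<forall>\<^sub>F t in at_right 0. c * g (x + t *\<^sub>R ?a) > 0" by (rule directional_sign[OF 1(1,2) x])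
    have gu': "grad g' x \<bullet> ?u' > 0" using nz(2) by (simp add: dot_square_norm)
    have "?a = - (c' *\<^sub>R ?u')" using opp by (simp only: minus_minus)
    then have "(- c') * (grad g' x \<bullet> ?a) = (c' * c') * (grad g' x \<bullet> ?u')"
      by (simp only: inner_minus_right inner_scaleR_right mult.assoc minus_mult_minus)
    then have "(- c') * (grad g' x \<bullet> ?a) > 0" using gu' c2 by (simp only: mult_1)
    then have e2: "\<forall>\<^sub>F t in at_right 0. (- c') * g' (x + t *\<^sub>R ?a) > 0" by (rule directional_sign[OF 2(1,2) x])
    have e3: "\<forall>\<^sub>F t in at_right 0. F (x + t *\<^sub>R ?a) = c * sgn (g (x + t *\<^sub>R ?a))"
      "\<forall>\<^sub>F t in at_right 0. F (x + t *\<^sub>R ?a) = c' * sgn (g' (x + t *\<^sub>R ?a))"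
      using eventually_line[OF 1(4)] eventually_line[OF 2(4)] by blast+
    have "\<forall>\<^sub>F t in at_right (0::real). False"
      using e1 e2 e3
    proof eventually_elim
      case (elim t)
      have "c * sgn (g (x + t *\<^sub>R ?a)) = 1" using elim(1) 1(3) by (auto simp: sgn_real_def)
      moreover have "c' * sgn (g' (x + t *\<^sub>R ?a)) = -1" using elim(2) 2(3) by (auto simp: sgn_real_def)
      ultimately show False using elim(3,4) by simp
    qed
    then show False by (simp add: eventually_False trivial_limit_at_right_real)
  qed
  ultimately show ?thesis by metis
qed

subsection \<open>Orienting the leaves of a foliated surface\<close>

text \<open>The sign of \<open>g\<close> that is positive on the later leaves: it co-orients the surfaces \<open>P s\<close> along \<open>M\<close>.\<close>

definition later_positive ::
  "(real^3) set \<Rightarrow> (real \<Rightarrow> (real^3) set) \<Rightarrow> (real \<times> (real^3)) set \<Rightarrow> (real \<times> (real^3) \<Rightarrow> real) \<Rightarrow> real \<Rightarrow> bool" where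
  "later_positive M P V g \<eta> \<longleftrightarrow>
     (\<forall>r r' y. r < r' \<and> (r, y) \<in> V \<and> (r', y) \<in> V \<and> y \<in> M \<inter> P r' \<longrightarrow> 0 < \<eta> * g (r, y))"

lemma family_defining_subset:
  "family_defining S P V g \<Longrightarrow> V' \<subseteq> V \<Longrightarrow> open V' \<Longrightarrow> family_defining S P V' g"
  unfolding family_defining_def using smooth_on_subset by blast

lemma dist_Pair_le: "dist (a, b) (c, d) \<le> dist a c + dist b d"
  unfolding dist_Pair_Pair by (rule sqrt_sum_squares_le_sum) auto

text \<open>Disjointness is asked of parameters less than \<open>p\<close> apart. This holds for
  pairwise disjoint slices with any positive \<open>p\<close>, and for a family of period
  \<open>p\<close>, so the local order of the leaves is treated once for both.\<close>

locale disjoint_slices =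
  fixes M :: "(real^3) set" and S :: "real set" and P :: "real \<Rightarrow> (real^3) set" and p :: real
  assumes M: "smooth_surface M" and F: "smooth_surface_family S P"
    and tr: "\<And>s. s \<in> S \<Longrightarrow> transversal (P s) M"
    and p: "0 < p"
    and disj: "\<And>s r. s \<in> S \<Longrightarrow> r \<in> S \<Longrightarrow> s < r \<Longrightarrow> r < s + p \<Longrightarrow> P s \<inter> P r \<inter> M = {}"
begin

lemma slice_not_parallel:
  assumes "s \<in> S" "x \<in> M" "x \<in> P s" "defining M V1 g1" "x \<in> V1" "family_defining S P V2 g2" "(s, x) \<in> V2"
  shows "\<not> parallel (grad g1 x) (xgrad g2 (s, x))"
  using transversal_grad[OF tr[OF assms(1)] family_member_defining(1)[OF assms(6)] assms(4,3,2)] assms(5,7)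
    family_member_defining(2)[OF assms(6,7)] by simp

lemma family_defining_mem: "family_defining S P V g \<Longrightarrow> (s, x) \<in> V \<Longrightarrow> s \<in> S \<and> (x \<in> P s \<longleftrightarrow> g (s, x) = 0)"
  unfolding family_defining_def by auto

text \<open>On a later leaf the defining function of an earlier slice has no zero, because the
  leaves are disjoint. Its sign is a continuous function of both parameters and the height, and
  triples with increasing parameters form a convex set, so the sign is constant.\<close>

lemma later_positive_exists:
  assumes s0: "s0 \<in> S" and x0: "x0 \<in> M" "x0 \<in> P s0"
  shows "\<exists>V g. \<exists>\<eta>\<in>{1,-1}. (s0, x0) \<in> V \<and> family_defining S P V g \<and> later_positive M P V g \<eta>"
proof -
  obtain V1 g1 where g1: "x0 \<in> V1" "defining M V1 g1" using smooth_surface_defining[OF M x0(1)] by metis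
  obtain V2 g2 where g2: "(s0, x0) \<in> V2" "family_defining S P V2 g2"
    using smooth_surface_family_defining[OF F s0 x0(2)] by metis
  have np: "\<not> parallel (grad g1 x0) (xgrad g2 (s0, x0))"
    by (rule slice_not_parallel[OF s0 x0 g1(2,1) g2(2,1)])
  define \<tau> where "\<tau> = leaf_dir g1 g2 (s0, x0)"
  obtain e W \<psi> where C: "0 < e" "open W" "(s0, x0) \<in> W" "W \<subseteq> V2" "snd ` W \<subseteq> V1"
    "\<forall>z\<in>W. \<tau> \<bullet> leaf_dir g1 g2 z > 0"
    and C1: "\<forall>s w. \<bar>s - s0\<bar> < e \<and> \<bar>w\<bar> < e \<longrightarrow> (s, \<psi> (s, w)) \<in> W \<and> \<psi> (s, w) \<in> M \<inter> P s \<and>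
       \<tau> \<bullet> (\<psi> (s, w) - x0) = w \<and>
       ((\<lambda>w. \<psi> (s, w)) has_vector_derivative
          leaf_dir g1 g2 (s, \<psi> (s, w)) /\<^sub>R (\<tau> \<bullet> leaf_dir g1 g2 (s, \<psi> (s, w)))) (at w)"
    and C2: "\<forall>s x. (s, x) \<in> W \<and> x \<in> M \<inter> P s \<longrightarrow>
       \<bar>s - s0\<bar> < e \<and> \<bar>\<tau> \<bullet> (x - x0)\<bar> < e \<and> \<psi> (s, \<tau> \<bullet> (x - x0)) = x"
    and C3: "continuous_on {z. \<bar>fst z - s0\<bar> < e \<and> \<bar>snd z\<bar> < e} \<psi>"
    using slice_chart[OF g1(2) x0(1) g1(1) g2(2) x0(2) g2(1) np \<tau>_def] by (elim exE conjE) (rule that)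
  have \<psi>0: "\<psi> (s0, 0) = x0" using C2[rule_format, of s0 x0] C(3) x0 by simp
  let ?Q = "{q :: real \<times> real \<times> real. \<bar>fst (snd q) - s0\<bar> < e \<and> \<bar>snd (snd q)\<bar> < e}"
  have oQ: "open ?Q" unfolding Collect_conj_eq by (intro open_Int open_Collect_less continuous_intros)
  let ?G = "\<lambda>q. (fst q, \<psi> (fst (snd q), snd (snd q)))"
  have cG: "continuous_on ?Q ?G"
    by (intro continuous_intros continuous_on_compose2[OF C3]) auto
  have oG: "open (?Q \<inter> ?G -` W)" by (rule continuous_open_preimage[OF cG oQ C(2)])
  have "(s0, s0, 0) \<in> ?Q \<inter> ?G -` W" using C(1,3) \<psi>0 by simp
  then obtain d0 where d0: "d0 > 0" "ball (s0, s0, 0) d0 \<subseteq> ?Q \<inter> ?G -` W" using oG by (meson open_contains_ball)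
  \<comment> \<open>A third of the radius for each of the three variables; half of \<open>p\<close>
    keeps two admissible parameters less than \<open>p\<close> apart, as disjointness
    requires.\<close>
  define d where "d = min (d0 / 3) (p / 2)"
  have d: "d > 0" "3 * d \<le> d0" "2 * d \<le> p" using d0(1) p by (auto simp: d_def)
  have inQ: "(r, r', w) \<in> ?Q \<inter> ?G -` W" if "\<bar>r - s0\<bar> < d" "\<bar>r' - s0\<bar> < d" "\<bar>w\<bar> < d" for r r' w
  proof -
    have "dist (s0, s0, 0) (r, r', w) \<le> dist s0 r + (dist s0 r' + dist 0 w)"
      using dist_Pair_le[of s0 "(s0, 0)" r "(r', w)"] dist_Pair_le[of s0 0 r' w] by linarith
    then have "dist (s0, s0, 0) (r, r', w) \<le> \<bar>r - s0\<bar> + (\<bar>r' - s0\<bar> + \<bar>w\<bar>)"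
      by (simp add: dist_real_def abs_minus_commute)
    also have "\<dots> < d0" using that d(2) by linarith
    finally show ?thesis using d0(2) by auto
  qed
  define C where "C = {q :: real \<times> real \<times> real. \<bar>fst q - s0\<bar> < d \<and> \<bar>fst (snd q) - s0\<bar> < d \<and> \<bar>snd (snd q)\<bar> < d \<and> fst q < fst (snd q)}"
  have "convex C"
  proof (rule convexI)
    fix q q' :: "real \<times> real \<times> real" and u v :: real
    assume q: "q \<in> C" "q' \<in> C" and uv: "0 \<le> u" "0 \<le> v" "u + v = 1"
    have lin: "\<bar>u * a + v * b - c\<bar> < d" if "\<bar>a - c\<bar> < d" "\<bar>b - c\<bar> < d" for a b c
    proof -
      have "a \<in> ball c d" "b \<in> ball c d" using that by (auto simp: dist_real_def abs_minus_commute)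
      then have "u *\<^sub>R a + v *\<^sub>R b \<in> ball c d" by (rule convexD[OF convex_ball]) (use uv in auto)
      then show ?thesis by (simp add: dist_real_def abs_minus_commute)
    qed
    have "u * fst q + v * fst q' < u * fst (snd q) + v * fst (snd q')"
    proof (cases "u = 0")
      case True then show ?thesis using uv q by (simp add: C_def)
    next
      case False
      have "u * fst q < u * fst (snd q)" using False uv(1) q(1) by (simp add: C_def)
      moreover have "v * fst q' \<le> v * fst (snd q')" using uv(2) q(2) by (intro mult_left_mono) (auto simp: C_def)
      ultimately show ?thesis by linarith
    qed
    then show "u *\<^sub>R q + v *\<^sub>R q' \<in> C"
      using q lin[of "fst q" s0 "fst q'"] lin[of "fst (snd q)" s0 "fst (snd q')"] lin[of "snd (snd q)" 0 "snd (snd q')"]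
      by (simp add: C_def)
  qed
  then have conn: "connected C" by (rule convex_connected)
  let ?h = "\<lambda>q. g2 (?G q)"
  have CQ: "C \<subseteq> ?Q \<inter> ?G -` W"
  proof
    fix q assume "q \<in> C"
    then have "\<bar>fst q - s0\<bar> < d" "\<bar>fst (snd q) - s0\<bar> < d" "\<bar>snd (snd q)\<bar> < d" by (auto simp: C_def)
    from inQ[OF this] show "q \<in> ?Q \<inter> ?G -` W" by simp
  qed
  have sm: "smooth_on V2 g2" using g2(2) by (simp add: family_defining_def)
  have ch: "continuous_on C ?h"
    by (rule continuous_on_compose2[OF smooth_on_C1(3)[OF sm] continuous_on_subset[OF cG]]) (use CQ C(4) in blast)+
  have hnz: "?h q \<noteq> 0" if q: "q \<in> C" for q
  proof
    assume h0: "?h q = 0"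
    have GW: "?G q \<in> W" using CQ q by blast
    then have "fst q \<in> S" "\<psi> (fst (snd q), snd (snd q)) \<in> P (fst q)"
      using family_defining_mem[OF g2(2), of "fst q"] C(4) h0 by auto
    moreover have "\<bar>fst (snd q) - s0\<bar> < e \<and> \<bar>snd (snd q)\<bar> < e" using CQ q by blast
    from C1[rule_format, OF this] have "\<psi> (fst (snd q), snd (snd q)) \<in> M \<inter> P (fst (snd q))"
      "(fst (snd q), \<psi> (fst (snd q), snd (snd q))) \<in> W" by auto
    moreover from this have "fst (snd q) \<in> S" using family_defining_mem[OF g2(2)] C(4) by blast
    moreover have "fst q < fst (snd q)" "fst (snd q) < fst q + p" using q d(3) by (auto simp: C_def)
    ultimately show False using disj[of "fst q" "fst (snd q)"] by blast
  qed
  define q0 where "q0 = (s0 - d / 2, s0 + d / 2, 0 :: real)"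
  have q0: "q0 \<in> C" using d(1) by (auto simp: C_def q0_def)
  define \<eta> where "\<eta> = sgn (?h q0)"
  have \<eta>: "\<eta> \<in> {1,-1}" unfolding \<eta>_def by (rule sgn_nonzero_cases[OF hnz[OF q0]])
  have pos: "0 < \<eta> * ?h q" if q: "q \<in> C" for q
  proof -
    have "sgn (?h q) = \<eta>" unfolding \<eta>_def by (rule continuous_sgn_constant[OF conn ch hnz q q0])
    then have "\<eta> * ?h q = \<bar>?h q\<bar>" by (metis abs_sgn mult.commute)
    then show ?thesis using hnz[OF q] by simp
  qed
  define V where "V = W \<inter> {z. \<bar>fst z - s0\<bar> < d \<and> \<bar>\<tau> \<bullet> (snd z - x0)\<bar> < d}"
  have oV: "open V" unfolding V_def Collect_conj_eq by (intro open_Int C(2) open_Collect_less continuous_intros)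
  have fd: "family_defining S P V g2" by (rule family_defining_subset[OF g2(2) _ oV]) (use C(4) in \<open>auto simp: V_def\<close>)
  have "later_positive M P V g2 \<eta>"
    unfolding later_positive_def
  proof (intro allI impI)
    fix r r' y assume a: "r < r' \<and> (r, y) \<in> V \<and> (r', y) \<in> V \<and> y \<in> M \<inter> P r'"
    then have y: "\<psi> (r', \<tau> \<bullet> (y - x0)) = y" using C2 by (auto simp: V_def)
    have "(r, r', \<tau> \<bullet> (y - x0)) \<in> C" using a by (auto simp: C_def V_def)
    from pos[OF this] show "0 < \<eta> * g2 (r, y)" using y by simp
  qed
  then show ?thesis using \<eta> fd C(3) d(1) by (intro exI[of _ V] exI[of _ g2] bexI[of _ \<eta>]) (auto simp: V_def)
qed

text \<open>If the two co-orientations were opposite, the leaves near \<open>x1\<close> would lie, to first order, on both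
  sides of \<open>P s1\<close> at once; the points \<open>y r\<close> of the nearby leaves chosen transversally to the leaf
  direction rule this out.\<close>

lemma later_normal_unique:
  assumes x1: "x1 \<in> M" "x1 \<in> P s1" and q: "\<And>r. P (r + q) = P r"
    and 1: "(s1, x1) \<in> V" "family_defining S P V g" "\<eta> \<in> {1,-1}" "later_positive M P V g \<eta>"
    and 2: "(s1 + q, x1) \<in> V'" "family_defining S P V' g'" "\<eta>' \<in> {1,-1}" "later_positive M P V' g' \<eta>'"
  shows "\<eta> *\<^sub>R (xgrad g (s1, x1) /\<^sub>R norm (xgrad g (s1, x1))) =
    \<eta>' *\<^sub>R (xgrad g' (s1 + q, x1) /\<^sub>R norm (xgrad g' (s1 + q, x1)))"
proof -
  let ?u = "xgrad g (s1, x1) /\<^sub>R norm (xgrad g (s1, x1))" and ?u' = "xgrad g' (s1 + q, x1) /\<^sub>R norm (xgrad g' (s1 + q, x1))"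
  have s1: "s1 \<in> S" using family_defining_mem[OF 1(2,1)] by blast
  have nz: "xgrad g (s1, x1) \<noteq> 0" "xgrad g' (s1 + q, x1) \<noteq> 0" using 1 2 by (auto simp: family_defining_def)
  note D1 = family_member_defining(1)[OF 1(2), of s1] and D2 = family_member_defining(1)[OF 2(2), of "s1 + q"]
  have x1q: "x1 \<in> P (s1 + q)" using x1 q by simp
  have "unit_normal (P s1) x1 ?u'"
    using defining_unit_normal[OF D2 x1q] 2(1) family_member_defining(2)[OF 2(2,1)] q by simp
  moreover have "unit_normal (P s1) x1 a \<longleftrightarrow> a = ?u \<or> a = - ?u" for a
    using unit_normal_iff[OF D1 x1(2)] 1(1) family_member_defining(2)[OF 1(2,1)] by simp
  ultimately have "?u' = ?u \<or> ?u' = - ?u" by blast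
  then have cases: "\<eta>' *\<^sub>R ?u' = \<eta> *\<^sub>R ?u \<or> \<eta>' *\<^sub>R ?u' = - (\<eta> *\<^sub>R ?u)" using 1(3) 2(3) by auto
  moreover have False if opp: "\<eta>' *\<^sub>R ?u' = - (\<eta> *\<^sub>R ?u)"
  proof -
    define a where "a = \<eta> *\<^sub>R ?u"
    obtain V1 g1 where g1: "x1 \<in> V1" "defining M V1 g1" using smooth_surface_defining[OF M x1(1)] by metis
    have np: "\<not> parallel (grad g1 x1) (xgrad g (s1, x1))"
      by (rule slice_not_parallel[OF s1 x1 g1(2,1) 1(2,1)])
    define \<tau> where "\<tau> = leaf_dir g1 g (s1, x1)"
    obtain e W \<psi> where C: "0 < e" "open W" "(s1, x1) \<in> W" "W \<subseteq> V" "snd ` W \<subseteq> V1"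
      "\<forall>z\<in>W. \<tau> \<bullet> leaf_dir g1 g z > 0"
      and C1: "\<forall>s w. \<bar>s - s1\<bar> < e \<and> \<bar>w\<bar> < e \<longrightarrow> (s, \<psi> (s, w)) \<in> W \<and> \<psi> (s, w) \<in> M \<inter> P s \<and>
         \<tau> \<bullet> (\<psi> (s, w) - x1) = w \<and>
         ((\<lambda>w. \<psi> (s, w)) has_vector_derivative
            leaf_dir g1 g (s, \<psi> (s, w)) /\<^sub>R (\<tau> \<bullet> leaf_dir g1 g (s, \<psi> (s, w)))) (at w)"
      and C2: "\<forall>s x. (s, x) \<in> W \<and> x \<in> M \<inter> P s \<longrightarrow>
         \<bar>s - s1\<bar> < e \<and> \<bar>\<tau> \<bullet> (x - x1)\<bar> < e \<and> \<psi> (s, \<tau> \<bullet> (x - x1)) = x"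
      and C3: "continuous_on {z. \<bar>fst z - s1\<bar> < e \<and> \<bar>snd z\<bar> < e} \<psi>"
      using slice_chart[OF g1(2) x1(1) g1(1) 1(2) x1(2) 1(1) np \<tau>_def] by (elim exE conjE) (rule that)
    have \<psi>0: "\<psi> (s1, 0) = x1" using C2[rule_format, of s1 x1] C(3) x1 by simp
    define y where "y = (\<lambda>r. \<psi> (r, 0))"
    have "continuous_on {s1 - e<..<s1 + e} y" unfolding y_def
      by (rule continuous_on_compose2[OF C3]) (use C(1) in \<open>auto intro!: continuous_intros\<close>)
    then have "isCont y s1" using C(1) by (simp add: continuous_on_eq_continuous_at)
    then have ylim: "(y \<longlongrightarrow> x1) (at_right s1)"
      unfolding isCont_def using \<psi>0 by (metis filterlim_at_split y_def)
    have rlim: "((\<lambda>r. r) \<longlongrightarrow> s1) (at_right s1)" by simp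
    have ev_e: "\<forall>\<^sub>F r in at_right s1. s1 < r \<and> r < s1 + min e p"
      unfolding eventually_at_right_field using C(1) p by (intro exI[of _ "s1 + min e p"]) auto
    have y_props: "y r \<in> M" "y r \<in> P r" "(r, y r) \<in> W" "\<tau> \<bullet> (y r - x1) = 0" if "s1 < r" "r < s1 + min e p" for r
      using C1[rule_format, of r 0] that C(1) by (auto simp: y_def)
    \<comment> \<open>The three components are independent, so the norm of \<open>?L h\<close> is at
      least \<open>B * norm h\<close>. For the displacement \<open>y r - x1\<close> all three are
      small: the one normal to \<open>M\<close> because both points lie on \<open>M\<close>, the one
      along \<tau> because it is zero, and the one along \<open>a\<close> because the two sign
      conditions squeeze it from both sides.\<close>
    let ?L = "\<lambda>h. (grad g1 x1 \<bullet> h) *\<^sub>R axis 1 1 + (a \<bullet> h) *\<^sub>R axis 2 1 + (\<tau> \<bullet> h) *\<^sub>R axis 3 1 :: real^3"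
    have linL: "linear ?L" by (rule linearI) (simp_all add: inner_add_right algebra_simps)
    have ind: "grad g1 x1 \<bullet> cross3 a \<tau> \<noteq> 0"
    proof -
      have "grad g1 x1 \<bullet> cross3 a \<tau> = (\<eta> / norm (xgrad g (s1, x1))) * (\<tau> \<bullet> \<tau>)"
        unfolding a_def cross_mult_left inner_scaleR_right
        using cross3_cycle(1)[of "grad g1 x1" "xgrad g (s1, x1)" \<tau>]
        by (simp add: \<tau>_def leaf_dir_def divide_inverse)
      moreover have "\<tau> \<noteq> 0" using np by (simp add: \<tau>_def leaf_dir_def parallel_def)
      ultimately show ?thesis using 1(3) nz(1) by auto
    qed
    have injL: "inj ?L"
      unfolding linear_injective_0[OF linL] using triple_eq_0[OF ind] by (simp add: axis_comb_eq_0)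
    obtain B where B: "B > 0" "\<And>h. B * norm h \<le> norm (?L h)" using linear_inj_bounded_below_pos[OF linL injL] by blast
    have normL: "norm (?L h) \<le> \<bar>grad g1 x1 \<bullet> h\<bar> + \<bar>a \<bullet> h\<bar> + \<bar>\<tau> \<bullet> h\<bar>" for h
      using norm_le_l1_cart[of "?L h"] unfolding sum_3 axis_comb_nth .
    \<comment> \<open>Two components of at most \<open>b * norm h\<close> each add up to half of the
      lower bound, which is impossible for a nonzero displacement.\<close>
    define b where "b = B / 4"
    have b: "b > 0" using B(1) by (simp add: b_def)
    define N N' where "N = norm (xgrad g (s1, x1))" and "N' = norm (xgrad g' (s1 + q, x1))"
    have NN: "N > 0" "N' > 0" using nz by (auto simp: N_def N'_def)
    have est: "\<forall>\<^sub>F r in at_right s1. \<bar>f (y r) - f x1 - v \<bullet> (y r - x1)\<bar> \<le> k * norm (y r - x1)"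
      if f: "(f has_derivative (\<lambda>h. v \<bullet> h)) (at x1)" "k > 0" for f v k
    proof -
      obtain d where d: "d > 0" "\<And>z. norm (z - x1) < d \<Longrightarrow> norm (f z - f x1 - v \<bullet> (z - x1)) \<le> k * norm (z - x1)"
        using f unfolding has_derivative_at_alt by blast
      have "\<forall>\<^sub>F r in at_right s1. dist (y r) x1 < d" using ylim d(1) by (rule tendstoD)
      then show ?thesis by eventually_elim (use d(2) in \<open>auto simp: dist_norm\<close>)
    qed
    have sm1: "smooth_on V1 g1" and smg: "smooth_on V g" and smg': "smooth_on V' g'"
      using g1(2) 1(2) 2(2) by (auto simp: defining_def family_defining_def)
    have E1: "\<forall>\<^sub>F r in at_right s1. \<bar>g1 (y r) - g1 x1 - grad g1 x1 \<bullet> (y r - x1)\<bar> \<le> b * norm (y r - x1)"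
      by (rule est[OF smooth_on_C1(2)[OF sm1 g1(1)] b])
    have E2: "\<forall>\<^sub>F r in at_right s1. \<bar>g (s1, y r) - g (s1, x1) - xgrad g (s1, x1) \<bullet> (y r - x1)\<bar> \<le> (b * N) * norm (y r - x1)"
      by (rule est[OF slice_has_derivative[OF smg 1(1)]]) (use b NN in simp)
    have E3: "\<forall>\<^sub>F r in at_right s1. \<bar>g' (s1 + q, y r) - g' (s1 + q, x1) - xgrad g' (s1 + q, x1) \<bullet> (y r - x1)\<bar> \<le> (b * N') * norm (y r - x1)"
      by (rule est[OF slice_has_derivative[OF smg' 2(1)]]) (use b NN in simp)
    have oV: "open V" "open V'" using smg smg' by (auto simp: smooth_on_def)
    have M1: "\<forall>\<^sub>F r in at_right s1. (s1, y r) \<in> V"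
      by (rule topological_tendstoD[OF _ oV(1) 1(1)]) (intro tendsto_intros ylim)
    have M2: "\<forall>\<^sub>F r in at_right s1. (r, y r) \<in> V"
      by (rule topological_tendstoD[OF _ oV(1) 1(1)]) (intro tendsto_intros ylim rlim)
    have M3: "\<forall>\<^sub>F r in at_right s1. (s1 + q, y r) \<in> V'"
      by (rule topological_tendstoD[OF _ oV(2) 2(1)]) (intro tendsto_intros ylim)
    have M4: "\<forall>\<^sub>F r in at_right s1. (r + q, y r) \<in> V'"
      by (rule topological_tendstoD[OF _ oV(2) 2(1)]) (intro tendsto_intros ylim rlim)
    have "\<forall>\<^sub>F r in at_right s1. False"
      using ev_e E1 E2 E3 M1 M2 M3 M4
    proof eventually_elim
      case (elim r)
      have r: "s1 < r" "r < s1 + min e p" using elim(1) by auto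
      note y = y_props[OF r]
      let ?h = "y r - x1"
      have "r \<in> S" using family_defining_mem[OF 1(2) elim(6)] by blast
      have yne: "?h \<noteq> 0"
      proof
        assume "?h = 0"
        then have "x1 \<in> P s1 \<inter> P r \<inter> M" using x1 y by simp
        then show False using disj[OF s1 \<open>r \<in> S\<close> r(1)] r(2) by auto
      qed
      have z: "g1 (y r) = 0" "g1 x1 = 0" "g (s1, x1) = 0" "g' (s1 + q, x1) = 0"
      proof -
        have "y r \<in> V1" using y(3) C(5) by force
        then show "g1 (y r) = 0" using defining_zero[OF g1(2)] y(1) by simp
        show "g1 x1 = 0" using defining_zero[OF g1(2,1)] x1(1) by simp
        show "g (s1, x1) = 0" using family_defining_mem[OF 1(2,1)] x1(2) by simp
        show "g' (s1 + q, x1) = 0" using family_defining_mem[OF 2(2,1)] x1q by simp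
      qed
      have p1: "0 < \<eta> * g (s1, y r)" using 1(4) r(1) elim(5,6) y(1,2) unfolding later_positive_def by blast
      have p2: "0 < \<eta>' * g' (s1 + q, y r)"
        using 2(4)[unfolded later_positive_def, rule_format, of "s1 + q" "r + q" "y r"] r(1) elim(7,8) y(1,2) q by simp
      have ah: "a \<bullet> ?h = \<eta> * (xgrad g (s1, x1) \<bullet> ?h) / N" by (simp add: a_def N_def divide_inverse mult.commute mult.left_commute)
      have ah': "- (a \<bullet> ?h) = \<eta>' * (xgrad g' (s1 + q, x1) \<bullet> ?h) / N'"
      proof -
        have "- (a \<bullet> ?h) = (\<eta>' *\<^sub>R ?u') \<bullet> ?h" unfolding opp a_def by simp
        then show ?thesis by (simp add: N'_def divide_inverse mult.commute mult.left_commute)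
      qed
      have "- (b * N * norm ?h) \<le> \<eta> * (xgrad g (s1, x1) \<bullet> ?h)"
        using elim(3) p1 1(3) unfolding z by auto
      then have l1: "- (b * norm ?h) \<le> a \<bullet> ?h" unfolding ah using NN(1) by (simp add: field_simps)
      have "- (b * N' * norm ?h) \<le> \<eta>' * (xgrad g' (s1 + q, x1) \<bullet> ?h)"
        using elim(4) p2 2(3) unfolding z by auto
      then have l2: "- (b * norm ?h) \<le> - (a \<bullet> ?h)" unfolding ah' using NN(2) by (simp add: field_simps)
      have l3: "\<bar>grad g1 x1 \<bullet> ?h\<bar> \<le> b * norm ?h" using elim(2) unfolding z by simp
      have "B * norm ?h \<le> b * norm ?h + b * norm ?h + 0"
        using order_trans[OF B(2)[of ?h] normL[of ?h]] l1 l2 l3 y(4) by linarith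
      then have "B * norm ?h \<le> (B / 2) * norm ?h" by (simp add: b_def)
      then show False using yne B(1) by simp
    qed
    then show False by (simp add: eventually_False trivial_limit_at_right_real)
  qed
  ultimately show ?thesis by metis
qed

text \<open>The unit vector along the cross product of the normal of \<open>M\<close> towards the
  positive side of \<open>G\<close> and the normal of the slice towards later leaves. The defining
  functions and signs are quantified existentially because the two normals do not depend on
  them.\<close>

definition leaf_orientation :: "(real^3 \<Rightarrow> real) \<Rightarrow> real \<Rightarrow> real^3 \<Rightarrow> real^3 \<Rightarrow> bool" where
  "leaf_orientation G s x \<tau> \<longleftrightarrow> (\<exists>V1 g1 V2 g2. \<exists>c\<in>{1,-1}. \<exists>\<eta>\<in>{1,-1}.
     x \<in> V1 \<and> defining M V1 g1 \<and> (\<forall>\<^sub>F y in nhds x. G y = c * sgn (g1 y)) \<and>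
     (s, x) \<in> V2 \<and> family_defining S P V2 g2 \<and> later_positive M P V2 g2 \<eta> \<and>
     \<tau> = sgn (cross3 (c *\<^sub>R (grad g1 x /\<^sub>R norm (grad g1 x))) (\<eta> *\<^sub>R (xgrad g2 (s, x) /\<^sub>R norm (xgrad g2 (s, x))))))"

context
  fixes G :: "real^3 \<Rightarrow> real"
  assumes G: "\<And>x. x \<in> M \<Longrightarrow> side_function M G x"
begin

text \<open>With \<open>q = 0\<close> this is uniqueness at one parameter. A period \<open>q\<close>
  compares the orientations that one leaf receives under two parameters, as needed when a periodic
  family closes up.\<close>

lemma leaf_orientation_unique:
  assumes x: "x \<in> M" "x \<in> P s" and q: "\<And>r. P (r + q) = P r"
    and "leaf_orientation G s x \<tau>" "leaf_orientation G (s + q) x \<tau>'"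
  shows "\<tau> = \<tau>'"
proof -
  obtain V1 g1 V2 g2 c \<eta> where 1: "c \<in> {1,-1}" "\<eta> \<in> {1,-1}" "x \<in> V1" "defining M V1 g1" "\<forall>\<^sub>F y in nhds x. G y = c * sgn (g1 y)"
     "(s, x) \<in> V2" "family_defining S P V2 g2" "later_positive M P V2 g2 \<eta>"
     "\<tau> = sgn (cross3 (c *\<^sub>R (grad g1 x /\<^sub>R norm (grad g1 x))) (\<eta> *\<^sub>R (xgrad g2 (s, x) /\<^sub>R norm (xgrad g2 (s, x)))))"
    using assms(4) unfolding leaf_orientation_def by (elim exE bexE conjE) (rule that)
  obtain U1 h1 U2 h2 d \<theta> where 2: "d \<in> {1,-1}" "\<theta> \<in> {1,-1}" "x \<in> U1" "defining M U1 h1" "\<forall>\<^sub>F y in nhds x. G y = d * sgn (h1 y)"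
     "(s + q, x) \<in> U2" "family_defining S P U2 h2" "later_positive M P U2 h2 \<theta>"
     "\<tau>' = sgn (cross3 (d *\<^sub>R (grad h1 x /\<^sub>R norm (grad h1 x))) (\<theta> *\<^sub>R (xgrad h2 (s + q, x) /\<^sub>R norm (xgrad h2 (s + q, x)))))"
    using assms(5) unfolding leaf_orientation_def by (elim exE bexE conjE) (rule that)
  show ?thesis
    unfolding 1(9) 2(9) side_normal_unique[OF 1(4,3,1,5) 2(4,3,1,5) x(1)]
      later_normal_unique[OF x q 1(6,7,2,8) 2(6,7,2,8)] ..
qed

lemma leaf_orientation_exists:
  assumes s: "s \<in> S" and x: "x \<in> M" "x \<in> P s"
  shows "\<exists>W f. open W \<and> (s, x) \<in> W \<and> continuous_on W f \<and>
    (\<forall>r y. (r, y) \<in> W \<longrightarrow> y \<in> M \<inter> P r \<longrightarrow> leaf_orientation G r y (f (r, y)))"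
proof -
  obtain V1 g1 c where 1: "c \<in> {1,-1}" "x \<in> V1" "defining M V1 g1" "\<forall>\<^sub>F y in nhds x. G y = c * sgn (g1 y)"
    using G[OF x(1)] x(1) unfolding side_function_def by blast
  obtain V2 g2 \<eta> where 2: "\<eta> \<in> {1,-1}" "(s, x) \<in> V2" "family_defining S P V2 g2" "later_positive M P V2 g2 \<eta>"
    using later_positive_exists[OF s x] by blast
  have sm: "smooth_on V1 g1" "smooth_on V2 g2" using 1 2 by (auto simp: defining_def family_defining_def)
  obtain U where U: "open U" "x \<in> U" "\<forall>y\<in>U. G y = c * sgn (g1 y)" using 1(4) unfolding eventually_nhds by blast
  let ?a = "\<lambda>z. c *\<^sub>R (grad g1 (snd z) /\<^sub>R norm (grad g1 (snd z)))" and ?b = "\<lambda>z. \<eta> *\<^sub>R (xgrad g2 z /\<^sub>R norm (xgrad g2 z))"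
  define W0 where "W0 = V2 \<inter> snd -` (V1 \<inter> U)"
  have oW0: "open W0" unfolding W0_def using smooth_on_C1(1)[OF sm(1)] smooth_on_C1(1)[OF sm(2)] U(1)
    by (intro open_Int open_vimage_snd)
  have ca: "continuous_on W0 ?a"
    by (intro continuous_intros continuous_on_compose2[OF smooth_on_C1(4)[OF sm(1)]])
       (use 1(3) in \<open>auto simp: W0_def defining_def\<close>)
  have cb: "continuous_on W0 ?b"
    by (intro continuous_intros continuous_on_subset[OF continuous_on_xgrad[OF sm(2)]])
       (use 2(3) in \<open>auto simp: W0_def family_defining_def\<close>)
  define f where "f = (\<lambda>z. sgn (cross3 (?a z) (?b z)))"
  have cab: "continuous_on W0 (\<lambda>z. cross3 (?a z) (?b z))" by (intro continuous_on_cross ca cb)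
  define W where "W = W0 \<inter> (\<lambda>z. cross3 (?a z) (?b z)) -` (- {0})"
  have oW: "open W" unfolding W_def by (rule continuous_open_preimage[OF cab oW0]) auto
  have "continuous_on W f" unfolding f_def sgn_div_norm
    by (intro continuous_intros continuous_on_subset[OF cab]) (auto simp: W_def)
  moreover have "(s, x) \<in> W"
  proof -
    have "\<not> parallel (grad g1 x) (xgrad g2 (s, x))" by (rule slice_not_parallel[OF s x 1(3,2) 2(3,2)])
    then have "cross3 (?a (s, x)) (?b (s, x)) \<noteq> 0"
      using 1(1) 2(1) by (auto simp: parallel_def cross_mult_left cross_mult_right)
    then show ?thesis using 1(2) 2(2) U(2) by (auto simp: W_def W0_def)
  qed
  moreover have "leaf_orientation G r y (f (r, y))" if "(r, y) \<in> W" for r y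
  proof -
    have y: "(r, y) \<in> V2" "y \<in> V1" "y \<in> U" using that by (auto simp: W_def W0_def)
    have "\<forall>\<^sub>F z in nhds y. G z = c * sgn (g1 z)" unfolding eventually_nhds using U y(3) by blast
    then show ?thesis unfolding leaf_orientation_def f_def
      using 1(1,3) 2(1,3,4) y by (intro exI[of _ V1] exI[of _ g1] exI[of _ V2] exI[of _ g2] bexI[of _ c] bexI[of _ \<eta>]) auto
  qed
  ultimately show ?thesis using oW by blast
qed

end

end

section \<open>Oriented closed leaves\<close>

locale closed_slices = disjoint_slices +
  assumes compact_slice: "s \<in> S \<Longrightarrow> compact (M \<inter> P s)" and connected_slice: "s \<in> S \<Longrightarrow> connected (M \<inter> P s)"
    and slice_nonempty: "s \<in> S \<Longrightarrow> M \<inter> P s \<noteq> {}"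
    and slices_cover: "M \<subseteq> (\<Union>s\<in>S. P s)"
begin

text \<open>Empty outside \<open>S\<close>, so that the leaf space is defined for all real
  parameters.\<close>

definition leaf :: "real \<Rightarrow> (real^3) set" where
  "leaf = (\<lambda>s. if s \<in> S then M \<inter> P s else {})"

lemma leaf_eq: "s \<in> S \<Longrightarrow> leaf s = M \<inter> P s"
  by (simp add: leaf_def)

sublocale circle_leaves leaf
proof
  fix x s assume "x \<in> leaf s"
  then have x: "s \<in> S" "x \<in> M" "x \<in> P s" by (auto simp: leaf_def split: if_splits)
  show "\<exists>\<epsilon> W \<beta> T a. leaf_box leaf s x \<epsilon> W \<beta> T a"
    unfolding leaf_def by (rule slice_box_exists[OF M F x(1) tr[OF x(1)] x(2,3)])
qed (auto simp: leaf_def compact_slice connected_slice)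

definition orientation :: "(real^3 \<Rightarrow> real) \<Rightarrow> real \<Rightarrow> real^3 \<Rightarrow> real^3" where
  "orientation G s x = (THE \<tau>. leaf_orientation G s x \<tau>)"

context
  fixes G :: "real^3 \<Rightarrow> real"
  assumes G: "\<And>x. x \<in> M \<Longrightarrow> side_function M G x"
begin

lemma leaf_orientation_state:
  assumes x: "s \<in> S" "x \<in> M" "x \<in> P s" and \<tau>: "leaf_orientation G s x \<tau>"
  shows "(s, x, \<tau>) \<in> states"
proof -
  obtain V1 g1 V2 g2 c \<eta> where 1: "c \<in> {1,-1}" "\<eta> \<in> {1,-1}" "x \<in> V1" "defining M V1 g1" "\<forall>\<^sub>F y in nhds x. G y = c * sgn (g1 y)"
     "(s, x) \<in> V2" "family_defining S P V2 g2" "later_positive M P V2 g2 \<eta>"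
     "\<tau> = sgn (cross3 (c *\<^sub>R (grad g1 x /\<^sub>R norm (grad g1 x))) (\<eta> *\<^sub>R (xgrad g2 (s, x) /\<^sub>R norm (xgrad g2 (s, x)))))"
    using \<tau> unfolding leaf_orientation_def by (elim exE bexE conjE) (rule that)
  obtain \<epsilon> W \<beta> T a where B: "leaf_box leaf s x \<epsilon> W \<beta> T a"
    and T: "\<forall>r u. \<bar>r - s\<bar> < \<epsilon> \<and> \<bar>u\<bar> < \<epsilon> \<longrightarrow> leaf_dir g1 g2 (r, \<beta> r u) \<noteq> 0 \<and>
        T r u = leaf_dir g1 g2 (r, \<beta> r u) /\<^sub>R norm (leaf_dir g1 g2 (r, \<beta> r u))"
    using leaf_box_of_slice[OF 1(4) x(2) 1(3) 1(7) x(3) 1(6) slice_not_parallel[OF x 1(4,3,7,6)]]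
    unfolding leaf_def[symmetric] by (elim exE conjE) (rule that)
  note BD = leaf_boxD[OF B]
  have xl: "x \<in> leaf s" using x by (simp add: leaf_eq)
  have "\<beta> s 0 = x" using BD(12)[OF BD(3) xl] BD(4) by simp
  then have T0: "T s 0 = sgn (leaf_dir g1 g2 (s, x))" using T[rule_format, of s 0] BD(1) by (simp add: sgn_div_norm)
  have nz: "grad g1 x \<noteq> 0" "xgrad g2 (s, x) \<noteq> 0" using 1 by (auto simp: defining_def family_defining_def)
  have "\<tau> = (c * \<eta>) *\<^sub>R T s (a s x)"
    unfolding 1(9) BD(4) T0 leaf_dir_def snd_conv cross_mult_left cross_mult_right
    using 1(1,2) nz by (auto simp: sgn_scaleR)
  moreover have "c * \<eta> \<in> {1, -1}" using 1(1,2) by auto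
  ultimately show ?thesis using flow_in_box(1)[OF B BD(3) xl] by metis
qed

lemma orientation_eqI:
  assumes "x \<in> leaf s" "leaf_orientation G s x \<tau>"
  shows "orientation G s x = \<tau>"
  unfolding orientation_def
proof (rule the_equality[where P = "leaf_orientation G s x", OF assms(2)])
  have x: "x \<in> M" "x \<in> P s" using assms(1) by (auto simp: leaf_def split: if_splits)
  show "\<rho> = \<tau>" if "leaf_orientation G s x \<rho>" for \<rho>
    using leaf_orientation_unique[OF G x, of 0 \<tau> \<rho>] assms(2) that by simp
qed

lemma leaf_orientation_orientation:
  assumes "x \<in> leaf s"
  shows "leaf_orientation G s x (orientation G s x)"
proof -
  have x: "s \<in> S" "x \<in> M" "x \<in> P s" using assms by (auto simp: leaf_def split: if_splits)
  then obtain \<tau> where "leaf_orientation G s x \<tau>" using leaf_orientation_exists[OF G x] by blast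
  then show ?thesis using orientation_eqI[OF assms] by simp
qed

lemma orientation_state:
  assumes "x \<in> leaf s"
  shows "(s, x, orientation G s x) \<in> states"
proof -
  have x: "s \<in> S" "x \<in> M" "x \<in> P s" using assms by (auto simp: leaf_def split: if_splits)
  show ?thesis by (rule leaf_orientation_state[OF x leaf_orientation_orientation[OF assms]])
qed

lemma orientation_continuous:
  "continuous_on {z. snd z \<in> leaf (fst z)} (\<lambda>z. orientation G (fst z) (snd z))"
  unfolding continuous_on_eq_continuous_within
proof
  let ?A = "{z. snd z \<in> leaf (fst z)}" and ?o = "\<lambda>z. orientation G (fst z) (snd z)"
  fix z assume "z \<in> ?A"
  then have z: "fst z \<in> S" "snd z \<in> M" "snd z \<in> P (fst z)" "z \<in> ?A" by (auto simp: leaf_def split: if_splits)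
  then obtain W f where W: "open W" "z \<in> W" "continuous_on W f"
    "\<forall>r y. (r, y) \<in> W \<longrightarrow> y \<in> M \<inter> P r \<longrightarrow> leaf_orientation G r y (f (r, y))"
    using leaf_orientation_exists[OF G z(1-3)] by auto
  have eq: "f w = ?o w" if "w \<in> ?A" "w \<in> W" for w
  proof -
    have "snd w \<in> M \<inter> P (fst w)" using that(1) by (auto simp: leaf_def split: if_splits)
    then have "leaf_orientation G (fst w) (snd w) (f w)" using W(4)[rule_format, of "fst w" "snd w"] that(2) by simp
    then show ?thesis using orientation_eqI[of "snd w" "fst w"] that(1) by simp
  qed
  have "continuous (at z within ?A) f"
    using W(1-3) by (meson continuous_at_imp_continuous_within continuous_on_eq_continuous_at)
  then show "continuous (at z within ?A) ?o"
    by (rule continuous_transform_within_openin[where S = "?A \<inter> W"])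
       (use W(1,2) z(4) eq in \<open>auto simp: openin_open_Int\<close>)
qed

text \<open>A continuous path of states keeps its sign relative to the orientation.\<close>

lemma orientation_preserved:
  assumes I: "connected I" "i \<in> I" "j \<in> I" and c: "continuous_on I q" "continuous_on I z"
    and st: "\<And>i. i \<in> I \<Longrightarrow> (q i, z i) \<in> states" and i: "snd (z i) = orientation G (q i) (fst (z i))"
  shows "snd (z j) = orientation G (q j) (fst (z j))"
proof -
  have lf: "fst (z k) \<in> leaf (q k)" if "k \<in> I" for k using state_space[of "q k" "fst (z k)" "snd (z k)"] st[OF that] by simp
  let ?o = "\<lambda>k. orientation G (q k) (fst (z k))" and ?a = "\<lambda>k. snd (z k) \<bullet> orientation G (q k) (fst (z k))"
  have unit: "norm (?o k) = 1" if "k \<in> I" for k using state_norm[OF orientation_state[OF lf[OF that]]] .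
  have alt: "snd (z k) = ?o k \<or> snd (z k) = - ?o k" if "k \<in> I" for k
    using state_same_point[OF orientation_state[OF lf[OF that]], of "snd (z k)"] st[OF that] by simp
  have oo: "?o k \<bullet> ?o k = 1" if "k \<in> I" for k using unit[OF that] by (simp add: dot_square_norm)
  have "continuous_on I (\<lambda>k. (\<lambda>w. orientation G (fst w) (snd w)) (q k, fst (z k)))"
    by (rule continuous_on_compose2[OF orientation_continuous]) (use lf in \<open>auto intro!: continuous_intros c\<close>)
  then have "continuous_on I ?a" by (intro continuous_intros c) simp
  then have "sgn (?a j) = sgn (?a i)"
    using alt oo by (intro continuous_sgn_constant[OF I(1) _ _ I(3,2)]) fastforce+
  then show ?thesis using alt[OF I(3)] oo[OF I(2)] oo[OF I(3)] i by auto
qed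

end

end

subsection \<open>Cylinders and tori\<close>

text \<open>The arctangent reduces to a bounded open interval, which is a ball in the line and hence
  homeomorphic to it.\<close>

lemma homeomorphic_open_interval:
  fixes S :: "real set"
  assumes "open S" "is_interval S" "S \<noteq> {}"
  shows "S homeomorphic (UNIV :: real set)"
proof -
  let ?R = "arctan ` S"
  have "homeomorphism S ?R arctan tan"
  proof (rule homeomorphismI)
    show "continuous_on S arctan" by (intro continuous_intros)
    show "continuous_on ?R tan"
    proof (intro continuous_at_imp_continuous_on ballI)
      fix y assume "y \<in> ?R"
      then have "cos y \<noteq> 0" using cos_arctan_not_zero by auto
      then show "isCont tan y" by simp
    qed
  qed (auto simp: tan_arctan)
  then have "S homeomorphic ?R" unfolding homeomorphic_def by blast
  also have "?R homeomorphic (UNIV :: real set)"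
  proof -
    have eq: "?R = {- (pi/2)<..<pi/2} \<inter> tan -` S"
    proof (intro equalityI subsetI)
      fix y assume "y \<in> {- (pi/2)<..<pi/2} \<inter> tan -` S"
      then show "y \<in> ?R" using arctan_tan[of y] by (intro image_eqI[of _ _ "tan y"]) auto
    qed (use arctan_bounded in \<open>auto simp: tan_arctan\<close>)
    have "continuous_on {- (pi/2)<..<pi/2} (tan :: real \<Rightarrow> real)"
    proof (intro continuous_at_imp_continuous_on ballI)
      fix y :: real assume "y \<in> {- (pi/2)<..<pi/2}"
      then have "cos y \<noteq> 0" using cos_gt_zero_pi[of y] by auto
      then show "isCont tan y" by simp
    qed
    then have op: "open ?R" unfolding eq using assms(1) by (intro continuous_open_preimage) auto
    have "connected ?R"
      using assms(2) by (intro connected_continuous_image continuous_intros) (simp add: is_interval_connected)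
    then have conv: "convex ?R" by (simp add: connected_convex_1)
    have "bounded ?R" by (rule bounded_subset[of "{- (pi/2)<..<pi/2}"]) (auto simp: eq)
    then have "compact (closure ?R)" "connected (closure ?R)"
      using \<open>connected ?R\<close> by (auto intro: connected_imp_connected_closure)
    then obtain a b where ab: "closure ?R = {a..b}" using connected_compact_interval_1 by blast
    have "?R = interior (closure ?R)" using convex_interior_closure[OF conv] op by (simp add: interior_open)
    then have R: "?R = {a<..<b}" unfolding ab by simp
    then have "a < b" using assms(3) by (metis greaterThanLessThan_empty image_is_empty leI)
    then have "{a<..<b} = ball ((a + b) / 2) ((b - a) / 2)" by (auto simp: dist_real_def field_simps abs_if split: if_splits)
    then show ?thesis unfolding R using homeomorphic_ball_UNIV[of "(b - a) / 2" "(a + b) / 2"] \<open>a < b\<close> by simp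
  qed
  finally show ?thesis .
qed

lemma homeomorphic_Times:
  assumes "A homeomorphic B" "C homeomorphic D"
  shows "(A \<times> C) homeomorphic (B \<times> D)"
proof -
  obtain f f' g g' where f: "homeomorphism A B f f'" and g: "homeomorphism C D g g'"
    using assms unfolding homeomorphic_def by blast
  have "homeomorphism (A \<times> C) (B \<times> D) (\<lambda>z. (f (fst z), g (snd z))) (\<lambda>z. (f' (fst z), g' (snd z)))"
    unfolding homeomorphism_def
  proof (intro conjI ballI)
    have im: "(\<lambda>z. (a (fst z), b (snd z))) ` (X \<times> Y) = a ` X \<times> b ` Y" for X Y and a :: "'x \<Rightarrow> 'y" and b :: "'z \<Rightarrow> 'w"
      by force
    show "(\<lambda>z. (f (fst z), g (snd z))) ` (A \<times> C) = B \<times> D" "(\<lambda>z. (f' (fst z), g' (snd z))) ` (B \<times> D) = A \<times> C"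
      unfolding im homeomorphism_image1[OF f] homeomorphism_image1[OF g]
        homeomorphism_image2[OF f] homeomorphism_image2[OF g] by (rule refl)+
    show "continuous_on (A \<times> C) (\<lambda>z. (f (fst z), g (snd z)))"
      by (intro continuous_on_Pair continuous_on_compose2[OF homeomorphism_cont1[OF f] continuous_on_fst]
          continuous_on_compose2[OF homeomorphism_cont1[OF g] continuous_on_snd] continuous_on_id) auto
    show "continuous_on (B \<times> D) (\<lambda>z. (f' (fst z), g' (snd z)))"
      by (intro continuous_on_Pair continuous_on_compose2[OF homeomorphism_cont2[OF f] continuous_on_fst]
          continuous_on_compose2[OF homeomorphism_cont2[OF g] continuous_on_snd] continuous_on_id) auto
  qed (use homeomorphism_apply1[OF f] homeomorphism_apply1[OF g] homeomorphism_apply2[OF f] homeomorphism_apply2[OF g] in auto)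
  then show ?thesis unfolding homeomorphic_def by blast
qed

text \<open>Both images are homeomorphic to the graph \<open>{(f x, q x). x \<in> K}\<close>.\<close>

lemma compact_fibres_homeomorphic:
  fixes f :: "'a::topological_space \<Rightarrow> 'b::t2_space" and q :: "'a \<Rightarrow> 'c::t2_space"
  assumes K: "compact K" and f: "continuous_on K f" and q: "continuous_on K q"
    and eq: "\<And>x y. x \<in> K \<Longrightarrow> y \<in> K \<Longrightarrow> f x = f y \<longleftrightarrow> q x = q y"
  shows "(f ` K) homeomorphic (q ` K)"
proof -
  let ?G = "(\<lambda>x. (f x, q x)) ` K"
  have G: "compact ?G" using K f q by (intro compact_continuous_image continuous_intros)
  have "?G homeomorphic (f ` K)"
    by (rule homeomorphic_compact[OF G continuous_on_fst[OF continuous_on_id]]) (use eq in \<open>auto simp: inj_on_def image_image\<close>)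
  moreover have "?G homeomorphic (q ` K)"
    by (rule homeomorphic_compact[OF G continuous_on_snd[OF continuous_on_id]]) (use eq in \<open>auto simp: inj_on_def image_image\<close>)
  ultimately show ?thesis by (metis homeomorphic_sym homeomorphic_trans)
qed

text \<open>A continuous map from a compact set to a Hausdorff space is closed onto its image, hence
  a quotient map.\<close>

lemma factor_continuous_compact:
  fixes q :: "'a::topological_space \<Rightarrow> 'c::t2_space"
  assumes K: "compact K" and f: "continuous_on K f" and q: "continuous_on K q"
    and h: "\<And>x. x \<in> K \<Longrightarrow> h (q x) = f x"
  shows "continuous_on (q ` K) h"
  unfolding continuous_closedin_preimage_eq
proof (intro allI impI)
  fix C :: "'b set" assume C: "closed C"
  obtain D where D: "closed D" "K \<inter> f -` C = K \<inter> D"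
    using continuous_closedin_preimage[OF f C] by (auto simp: closedin_closed)
  have "compact (q ` (K \<inter> D))"
    using D(1) K by (intro compact_continuous_image continuous_on_subset[OF q]) (auto intro: compact_Int_closed)
  moreover have "q ` K \<inter> h -` C = q ` (K \<inter> D)" unfolding D(2)[symmetric] using h by auto
  ultimately show "closedin (top_of_set (q ` K)) (q ` K \<inter> h -` C)"
    by (metis Int_lower1 closed_subset compact_imp_closed)
qed

lemma factor_continuous_open:
  assumes f: "continuous_on D f" and q: "\<And>N. open N \<Longrightarrow> openin (top_of_set (q ` D)) (q ` (D \<inter> N))"
    and h: "\<And>x. x \<in> D \<Longrightarrow> h (q x) = f x"
  shows "continuous_on (q ` D) h"
  unfolding continuous_openin_preimage_eq
proof (intro allI impI)
  fix C :: "'b set" assume C: "open C"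
  obtain N where N: "open N" "D \<inter> f -` C = D \<inter> N"
    using continuous_openin_preimage_gen[OF f C] by (auto simp: openin_open)
  have "q ` D \<inter> h -` C = q ` (D \<inter> N)" unfolding N(2)[symmetric] using h by auto
  then show "openin (top_of_set (q ` D)) (q ` D \<inter> h -` C)" using q[OF N(1)] by simp
qed

text \<open>Invariance of domain on a surface: a chart flattens \<open>M\<close> to a piece of a
  plane, whose dimension equals that of the domain of \<open>f\<close>.\<close>

lemma surface_open_map:
  fixes f :: "'a::euclidean_space \<Rightarrow> real^3"
  assumes M: "smooth_surface M" and dim: "DIM('a) = 2"
    and U: "open U" "continuous_on U f" "inj_on f U" "f ` U \<subseteq> M"
  shows "openin (top_of_set M) (f ` U)"
proof (subst openin_subopen, rule ballI)
  fix p assume "p \<in> f ` U"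
  then obtain x where x: "x \<in> U" "p = f x" by blast
  have pM: "p \<in> M" using x U(4) by blast
  obtain V g where g: "p \<in> V" "defining M V g" using smooth_surface_defining[OF M pM] by metis
  have nz: "grad g p \<noteq> 0" using g by (simp add: defining_def)
  obtain k1 k2 where k: "grad g p \<bullet> cross3 k1 k2 \<noteq> 0" using frame_exists[OF nz] by blast
  obtain W r G where W: "open W" "p \<in> W" "W \<subseteq> V" "homeomorphism W (ball 0 r) (chart3 g k1 k2 p) G"
    using surface_chart[OF g(2) pM g(1) k] by blast
  let ?c = "chart3 g k1 k2 p"
  define N where "N = U \<inter> f -` W"
  have oN: "open N" unfolding N_def by (rule continuous_open_preimage[OF U(2,1) W(1)])
  have fN: "continuous_on N f" "inj_on f N" "f ` N \<subseteq> W" "f ` N \<subseteq> M"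
    using U(2-4) by (auto simp: N_def intro: continuous_on_subset inj_on_subset)
  let ?H = "{z :: real^3. axis 1 1 \<bullet> z = 0}"
  have ax: "axis 1 1 \<bullet> z = z $ 1" for z :: "real^3" by (simp add: inner_axis inner_commute)
  have zero: "g y = 0 \<longleftrightarrow> y \<in> M" if "y \<in> W" for y using g(2) that W(3) unfolding defining_def by blast
  have inv: "openin (top_of_set ?H) ((?c \<circ> f) ` N)"
  proof (rule invariance_of_domain_subspaces[of UNIV])
    show "dim ?H \<le> dim (UNIV :: 'a set)" using dim_special_hyperplane[of "axis 1 1 :: real^3"] dim by (simp add: axis_in_Basis_iff)
    show "continuous_on N (?c \<circ> f)"
      by (intro continuous_on_compose fN(1) continuous_on_subset[OF homeomorphism_cont1[OF W(4)] fN(3)])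
    have "g (f x) = 0" if "x \<in> N" for x using zero[of "f x"] fN(3,4) that by blast
    then show "?c \<circ> f \<in> N \<rightarrow> ?H" by (auto simp: ax)
    have "inj_on ?c W" using homeomorphism_apply1[OF W(4)] by (rule inj_on_inverseI)
    then show "inj_on (?c \<circ> f) N" by (intro comp_inj_on fN(2)) (use fN(3) inj_on_subset in blast)
  qed (use oN subspace_hyperplane in auto)
  then obtain Q where Q: "open Q" "(?c \<circ> f) ` N = ?H \<inter> Q" by (auto simp: openin_open)
  have "open (W \<inter> ?c -` Q)" by (rule continuous_open_preimage[OF homeomorphism_cont1[OF W(4)] W(1) Q(1)])
  moreover have "f ` N = M \<inter> (W \<inter> ?c -` Q)"
  proof (intro equalityI subsetI)
    fix y assume "y \<in> f ` N"
    then show "y \<in> M \<inter> (W \<inter> ?c -` Q)" using fN(3,4) Q(2) by auto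
  next
    fix y assume y: "y \<in> M \<inter> (W \<inter> ?c -` Q)"
    then have "?c y \<in> ?H \<inter> Q" using zero[of y] by (simp add: ax)
    then have "?c y \<in> (?c \<circ> f) ` N" unfolding Q(2) .
    then obtain z where z: "z \<in> N" "?c (f z) = ?c y" by (rule imageE) (simp add: o_def)
    have "f z \<in> W" "y \<in> W" using z(1) y fN(3) by blast+
    then have "f z = y" using homeomorphism_apply1[OF W(4), of "f z"] homeomorphism_apply1[OF W(4), of y] unfolding z(2) by argo
    then show "y \<in> f ` N" using z(1) by blast
  qed
  ultimately have "openin (top_of_set M) (f ` N)" by (simp add: openin_open_Int)
  moreover have "p \<in> f ` N" "f ` N \<subseteq> f ` U" using x W(2) by (auto simp: N_def)
  ultimately show "\<exists>T. openin (top_of_set M) T \<and> p \<in> T \<and> T \<subseteq> f ` U" by blast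
qed

section \<open>Models of the torus and the cylinder\<close>

lemma cis_2pi_eq_iff: "cis (2 * pi * t) = cis (2 * pi * t') \<longleftrightarrow> t - t' \<in> \<int>"
proof -
  have "cis (2 * pi * t) = cis (2 * pi * t') \<longleftrightarrow> (\<exists>n::int. t = t' + of_int n)"
  proof -
    have "\<i> * complex_of_real (2 * pi * t) = \<i> * complex_of_real (2 * pi * t') + of_int (2 * n) * pi * \<i> \<longleftrightarrow> t = t' + of_int n" for n
    proof -
      have "\<i> * complex_of_real (2 * pi * t') + of_int (2 * n) * pi * \<i> = \<i> * complex_of_real (2 * pi * (t' + of_int n))"
        by (simp add: algebra_simps)
      then have "\<i> * complex_of_real (2 * pi * t) = \<i> * complex_of_real (2 * pi * t') + of_int (2 * n) * pi * \<i> \<longleftrightarrow>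
        complex_of_real (2 * pi * t) = complex_of_real (2 * pi * (t' + of_int n))" by simp
      then show ?thesis unfolding of_real_eq_iff by simp
    qed
    then show ?thesis unfolding cis_conv_exp exp_eq by simp
  qed
  also have "\<dots> \<longleftrightarrow> t - t' \<in> \<int>" by (auto simp: Ints_def algebra_simps)
  finally show ?thesis .
qed

lemma cis_2pi_image: "(\<lambda>t. cis (2 * pi * t)) ` {0..1} = sphere 0 1"
proof (intro equalityI subsetI)
  fix z :: complex assume z: "z \<in> sphere 0 1"
  then have "cis (Arg z) = z" by (subst cis_Arg) (auto simp: sgn_div_norm)
  define t where "t = Arg z / (2 * pi)"
  have "cis (2 * pi * frac t) = cis (2 * pi * t)" unfolding cis_2pi_eq_iff by (simp add: frac_def)
  also have "\<dots> = z" using \<open>cis (Arg z) = z\<close> by (simp add: t_def)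
  finally show "z \<in> (\<lambda>t. cis (2 * pi * t)) ` {0..1}"
    using frac_ge_0[of t] frac_lt_1[of t] by (intro image_eqI[of _ _ "frac t"]) auto
qed auto

lemma continuous_on_cis_2pi [continuous_intros]:
  "continuous_on A g \<Longrightarrow> continuous_on A (\<lambda>x. cis (2 * pi * g x))"
  unfolding cis_conv_exp by (intro continuous_intros)

lemma circle_homeomorphic: "sphere (0::complex) 1 homeomorphic sphere (0::real^2) 1"
  by (rule homeomorphic_spheres_gen) auto

text \<open>On the compact rectangle, \<open>f\<close> and the pair of exponential maps identify
  exactly the same points.\<close>

lemma torus_homeomorphic:
  fixes f :: "real \<times> real \<Rightarrow> 'a::t2_space"
  assumes p: "0 < p" and f: "continuous_on ({0..1} \<times> {0..p}) f" "f ` ({0..1} \<times> {0..p}) = M"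
    and eq: "\<And>t s t' s'. t \<in> {0..1} \<Longrightarrow> t' \<in> {0..1} \<Longrightarrow> s \<in> {0..p} \<Longrightarrow> s' \<in> {0..p} \<Longrightarrow>
      f (t, s) = f (t', s') \<longleftrightarrow> t - t' \<in> \<int> \<and> (s - s') / p \<in> \<int>"
  shows "M homeomorphic (sphere (0::real^2) 1 \<times> sphere (0::real^2) 1)"
proof -
  let ?K = "{0..1 :: real} \<times> {0..p}" and ?q = "\<lambda>z :: real \<times> real. (cis (2 * pi * fst z), cis (2 * pi * (snd z / p)))"
  have "(f ` ?K) homeomorphic (?q ` ?K)"
  proof (rule compact_fibres_homeomorphic)
    show "continuous_on ?K ?q" using p by (intro continuous_intros) auto
    fix x y assume "x \<in> ?K" "y \<in> ?K"
    then show "f x = f y \<longleftrightarrow> ?q x = ?q y"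
      using eq[of "fst x" "fst y" "snd x" "snd y"] by (simp add: cis_2pi_eq_iff diff_divide_distrib mem_Times_iff del: times_divide_eq_right)
  qed (use f(1) in \<open>auto intro: compact_Times\<close>)
  moreover have "?q ` ?K = sphere 0 1 \<times> sphere 0 1"
  proof -
    have "(\<lambda>s. s / p) ` {0..p} = {0..1}"
    proof (intro equalityI subsetI)
      fix u assume "u \<in> {0..1 :: real}"
      then show "u \<in> (\<lambda>s. s / p) ` {0..p}" using p by (intro image_eqI[of _ _ "u * p"]) (auto simp: mult_le_cancel_right1)
    qed (use p in auto)
    then have "(\<lambda>s. cis (2 * pi * (s / p))) ` {0..p} = (\<lambda>u. cis (2 * pi * u)) ` {0..1}"
      using image_image[of "\<lambda>u. cis (2 * pi * u)" "\<lambda>s. s / p" "{0..p}"] by simp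
    moreover have "?q ` ?K = ((\<lambda>t. cis (2 * pi * t)) ` {0..1}) \<times> ((\<lambda>s. cis (2 * pi * (s / p))) ` {0..p})"
      by (force simp: image_iff)
    ultimately show ?thesis unfolding cis_2pi_image by simp
  qed
  ultimately have "M homeomorphic (sphere (0::complex) 1 \<times> sphere (0::complex) 1)" using f(2) by simp
  then show ?thesis using homeomorphic_Times[OF circle_homeomorphic circle_homeomorphic] homeomorphic_trans by blast
qed

text \<open>The parameter interval is open, so compactness does not give both directions at once.
  The map from \<open>M\<close> to the cylinder is continuous because \<open>f\<close> is open onto
  \<open>M\<close>; the map back is continuous because over each compact parameter interval the
  covering of the cylinder is a quotient map.\<close>

lemma cylinder_homeomorphic:
  fixes f :: "real \<times> real \<Rightarrow> real^3"
  assumes M: "smooth_surface M" and S: "open S" "is_interval S" "S \<noteq> {}"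
    and f: "continuous_on (UNIV \<times> S) f" "f ` (UNIV \<times> S) = M"
    and eq: "\<And>t s t' s'. s \<in> S \<Longrightarrow> s' \<in> S \<Longrightarrow> f (t, s) = f (t', s') \<longleftrightarrow> s = s' \<and> t - t' \<in> \<int>"
  shows "M homeomorphic (sphere (0::real^2) 1 \<times> (UNIV :: real set))"
proof -
  let ?D = "UNIV \<times> S" and ?q = "\<lambda>z :: real \<times> real. (cis (2 * pi * fst z), snd z)"
  have eqq: "f x = f y \<longleftrightarrow> ?q x = ?q y" if "x \<in> ?D" "y \<in> ?D" for x y
    using eq[of "snd x" "snd y" "fst x" "fst y"] that by (auto simp: cis_2pi_eq_iff)
  have q_img: "?q ` ({0..1} \<times> A) = sphere 0 1 \<times> A" for A
  proof -
    have "?q ` ({0..1} \<times> A) = ((\<lambda>t. cis (2 * pi * t)) ` {0..1}) \<times> A" by (force simp: image_iff)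
    then show ?thesis unfolding cis_2pi_image .
  qed
  have qD: "?q ` ?D = sphere 0 1 \<times> S"
  proof
    have "sphere 0 1 \<times> S \<subseteq> ?q ` ?D" unfolding q_img[symmetric] by auto
    then show "sphere 0 1 \<times> S \<subseteq> ?q ` ?D" .
  qed auto
  define k where "k = (\<lambda>y. ?q (inv_into ?D f y))"
  define h where "h = (\<lambda>z. f (inv_into ?D ?q z))"
  have k: "k (f x) = ?q x" if "x \<in> ?D" for x
    unfolding k_def using eqq[of "inv_into ?D f (f x)" x] that by (simp add: f_inv_into_f inv_into_into del: mem_Times_iff)
  have h: "h (?q x) = f x" if "x \<in> ?D" for x
    unfolding h_def using eqq[of "inv_into ?D ?q (?q x)" x] that f_inv_into_f[of "?q x" ?q ?D] inv_into_into[of "?q x" ?q ?D] by blast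
  have ck: "continuous_on M k"
  proof -
    have op: "openin (top_of_set (f ` ?D)) (f ` (?D \<inter> N))" if N: "open N" for N
    proof (subst openin_subopen, rule ballI)
      fix y assume "y \<in> f ` (?D \<inter> N)"
      then obtain t0 s0 where ts: "(t0, s0) \<in> ?D \<inter> N" "y = f (t0, s0)" by blast
      \<comment> \<open>In a window of width 1 two angles differing by an integer coincide, so
        \<open>f\<close> is injective there.\<close>
      let ?U = "({t0 - 1/2<..<t0 + 1/2} \<times> S) \<inter> N"
      have "openin (top_of_set M) (f ` ?U)"
      proof (rule surface_open_map[OF M])
        show "open ?U" using N S(1) by (intro open_Int open_Times) auto
        show "inj_on f ?U"
        proof (rule inj_onI)
          fix a b assume ab: "a \<in> ?U" "b \<in> ?U" "f a = f b"
          then have 1: "snd a = snd b" "fst a - fst b \<in> \<int>" using eq[of "snd a" "snd b" "fst a" "fst b"] by auto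
          then obtain n where n: "fst a - fst b = of_int n" by (auto elim: Ints_cases)
          moreover have "\<bar>fst a - fst b\<bar> < 1" using ab(1,2) by auto
          ultimately have "n = 0" by simp
          then show "a = b" using n 1 by (simp add: prod_eq_iff)
        qed
        show "continuous_on ?U f" by (rule continuous_on_subset[OF f(1)]) auto
        show "f ` ?U \<subseteq> M" using f(2) by auto
      qed simp
      then show "\<exists>T. openin (top_of_set (f ` ?D)) T \<and> y \<in> T \<and> T \<subseteq> f ` (?D \<inter> N)"
        unfolding f(2) using ts by (intro exI[of _ "f ` ?U"]) auto
    qed
    have "continuous_on (f ` ?D) k"
    proof (rule factor_continuous_open)
      show "continuous_on ?D ?q" by (intro continuous_intros)
    qed (fact op k)+
    then show ?thesis unfolding f(2) .
  qed
  have ch: "continuous_on (sphere 0 1 \<times> S) h"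
    unfolding continuous_on_eq_continuous_within
  proof
    fix z assume z: "z \<in> sphere (0::complex) 1 \<times> S"
    then obtain e where e: "e > 0" "cball (snd z) e \<subseteq> S" using S(1) by (auto simp: open_contains_cball)
    let ?I = "cball (snd z) e"
    have "continuous_on (?q ` ({0..1} \<times> ?I)) h"
    proof (rule factor_continuous_compact)
      show "continuous_on ({0..1} \<times> ?I) f" by (rule continuous_on_subset[OF f(1)]) (use e in auto)
      show "continuous_on ({0..1} \<times> ?I) ?q" by (intro continuous_intros)
      show "h (?q x) = f x" if "x \<in> {0..1} \<times> ?I" for x using h[of x] that e(2) by auto
    qed (auto intro: compact_Times)
    then have c: "continuous_on (sphere 0 1 \<times> ?I) h" unfolding q_img .
    have "continuous (at z within (sphere 0 1 \<times> ?I)) h"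
      using c z e(1) unfolding continuous_on_eq_continuous_within by auto
    moreover have "at z within (sphere 0 1 \<times> ?I) = at z within (sphere 0 1 \<times> S)"
    proof (rule at_within_nhd[of z "UNIV \<times> ball (snd z) e"])
      show "sphere 0 1 \<times> ?I \<inter> UNIV \<times> ball (snd z) e - {z} = sphere 0 1 \<times> S \<inter> UNIV \<times> ball (snd z) e - {z}"
        using e(2) by auto
    qed (use e(1) in \<open>auto intro: open_Times simp: mem_Times_iff\<close>)
    ultimately show "continuous (at z within (sphere 0 1 \<times> S)) h" by simp
  qed
  have "homeomorphism M (sphere 0 1 \<times> S) k h"
  proof (rule homeomorphismI[OF ck ch])
    have "k ` M = ?q ` ?D" unfolding f(2)[symmetric] image_image using k by (rule image_cong[OF refl])
    then show "k ` M \<subseteq> sphere 0 1 \<times> S" unfolding qD by blast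
    show "h ` (sphere 0 1 \<times> S) \<subseteq> M" using h unfolding qD[symmetric] f(2)[symmetric] by force
    show "h (k y) = y" if "y \<in> M" for y
    proof -
      obtain x where x: "x \<in> ?D" "y = f x" using \<open>y \<in> M\<close> f(2) by blast
      show ?thesis unfolding x(2) k[OF x(1)] h[OF x(1)] ..
    qed
    show "k (h z) = z" if "z \<in> sphere 0 1 \<times> S" for z
    proof -
      have "z \<in> ?q ` ?D" using that qD by blast
      then obtain x where x: "x \<in> ?D" "z = ?q x" by blast
      show ?thesis unfolding x(2) h[OF x(1)] k[OF x(1)] ..
    qed
  qed
  then have "M homeomorphic (sphere (0::complex) 1 \<times> S)" unfolding homeomorphic_def by blast
  then show ?thesis using homeomorphic_Times[OF circle_homeomorphic homeomorphic_open_interval[OF S]] homeomorphic_trans by blast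
qed

section \<open>Topology of the foliated surface\<close>

context closed_slices
begin

lemma parameter_interval: "open S" "is_interval S" "S \<noteq> {}"
  using F unfolding smooth_surface_family_def by auto

lemma leaf_nonempty: "s \<in> S \<Longrightarrow> leaf s \<noteq> {}"
  using slice_nonempty leaf_eq by simp

lemma leaf_state_exists:
  assumes "s \<in> S" shows "\<exists>z. (s, z) \<in> states"
proof -
  obtain x where "x \<in> leaf s" using leaf_nonempty[OF assms] by blast
  then show ?thesis using state_exists by blast
qed

text \<open>The parameter interval is exhausted by compact intervals, and a section on each is
  extended to the next. The limit is well defined because each extension leaves the old values
  unchanged.\<close>

lemma global_section: "\<exists>\<sigma>. state_section S \<sigma>"
proof -
  obtain h g where hom: "homeomorphism (UNIV :: real set) S h g"
    using homeomorphic_open_interval[OF parameter_interval] homeomorphic_sym unfolding homeomorphic_def by blast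
  have hg: "h (g s) = s" if "s \<in> S" for s using homeomorphism_apply2[OF hom that] .
  have hS: "h u \<in> S" for u using homeomorphism_image1[OF hom] by blast
  define I where "I = (\<lambda>n. h ` {- real n..real n})"
  have "\<exists>a b. I n = {a..b}" for n
  proof -
    have "continuous_on {- real n..real n} h" using homeomorphism_cont1[OF hom] continuous_on_subset by blast
    then have "connected (I n) \<and> compact (I n)"
      unfolding I_def by (intro conjI connected_continuous_image compact_continuous_image) auto
    then show ?thesis unfolding connected_compact_interval_1 .
  qed
  then obtain a b where ab: "\<And>n. I n = {a n..b n}" by metis
  have "h 0 \<in> I n" for n unfolding I_def by (intro imageI) auto
  then have le: "a n \<le> b n" for n unfolding ab by (metis atLeastAtMost_iff order_trans)
  have mono: "I n \<subseteq> I m" if "n \<le> m" for n m unfolding I_def using that by (intro image_mono) auto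
  have IS: "I n \<subseteq> S" for n unfolding I_def using hS by blast
  have ne: "leaf s \<noteq> {}" if "s \<in> {a n..b n}" for s n using that IS[of n] leaf_nonempty unfolding ab by blast
  have "\<exists>f. \<forall>n. state_section {a n..b n} (f n) \<and> (\<forall>s\<in>{a n..b n}. f (Suc n) s = f n s)"
  proof (rule dependent_nat_choice)
    have "a 0 \<in> S" using IS[of 0] le[of 0] unfolding ab by auto
    then obtain z where "(a 0, z) \<in> states" using leaf_state_exists by blast
    then show "\<exists>\<sigma>. state_section {a 0..b 0} \<sigma>"
      using section_exists[of "a 0" "b 0" "a 0" z] ne[of _ 0] le[of 0] by auto
  next
    fix \<sigma> n assume \<sigma>: "state_section {a n..b n} \<sigma>"
    have "a (Suc n) \<le> a n" "b n \<le> b (Suc n)" using mono[of n "Suc n"] le[of n] unfolding ab by auto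
    then show "\<exists>\<rho>. state_section {a (Suc n)..b (Suc n)} \<rho> \<and> (\<forall>s\<in>{a n..b n}. \<rho> s = \<sigma> s)"
      by (intro section_extend[OF ne \<sigma>]) (use le[of n] in auto)
  qed
  then obtain f where f: "\<And>n. state_section (I n) (f n)" "\<And>n s. s \<in> I n \<Longrightarrow> f (Suc n) s = f n s"
    unfolding ab by blast
  have agree: "f m s = f n s" if "n \<le> m" "s \<in> I n" for n m s
    using that(1)
  proof (induction rule: dec_induct)
    case (step k)
    then show ?case using f(2)[of s k] mono[of n k] that(2) by auto
  qed simp
  define \<nu> where "\<nu> = (\<lambda>s. nat \<lceil>\<bar>g s\<bar>\<rceil>)"
  have \<nu>: "s \<in> I (\<nu> s)" if "s \<in> S" for s
  proof -
    have "g s \<in> {- real (\<nu> s)..real (\<nu> s)}" unfolding \<nu>_def by (simp add: abs_le_iff[symmetric] minus_le_iff) linarith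
    then have "h (g s) \<in> I (\<nu> s)" unfolding I_def by (rule imageI)
    then show ?thesis using hg[OF that] by simp
  qed
  define \<sigma> where "\<sigma> = (\<lambda>s. f (\<nu> s) s)"
  have \<sigma>: "\<sigma> s = f n s" if "s \<in> I n" for s n
  proof -
    have "f (max n (\<nu> s)) s = f n s" "f (max n (\<nu> s)) s = f (\<nu> s) s"
      using agree that \<nu>[of s] IS[of n] by auto
    then show ?thesis by (simp add: \<sigma>_def)
  qed
  have "isCont \<sigma> s" if s: "s \<in> S" for s
  proof -
    \<comment> \<open>The next index is needed: \<open>s\<close> may be an endpoint of the interval
      with index \<open>\<nu> s\<close>, whereas the following one is a neighbourhood of it.\<close>
    let ?N = "S \<inter> g -` {- real (Suc (\<nu> s))<..<real (Suc (\<nu> s))}"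
    have oN: "open ?N"
      by (rule continuous_open_preimage[OF homeomorphism_cont2[OF hom] parameter_interval(1)]) simp
    have NI: "?N \<subseteq> I (Suc (\<nu> s))"
    proof
      fix r assume r: "r \<in> ?N"
      then have "h (g r) \<in> I (Suc (\<nu> s))" unfolding I_def by (intro imageI) auto
      then show "r \<in> I (Suc (\<nu> s))" using hg r by simp
    qed
    have "continuous_on ?N (f (Suc (\<nu> s)))"
      using f(1) NI unfolding state_section_def by (blast intro: continuous_on_subset)
    then have "continuous_on ?N \<sigma>" using \<sigma> NI by (metis (no_types, lifting) continuous_on_cong subsetD)
    moreover have "s \<in> ?N" using s unfolding \<nu>_def by (simp add: abs_less_iff[symmetric] minus_less_iff) linarith
    ultimately show ?thesis using oN by (simp add: continuous_on_eq_continuous_at)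
  qed
  moreover have "(s, \<sigma> s) \<in> states" if "s \<in> S" for s using f(1) \<sigma>[OF \<nu>[OF that]] \<nu>[OF that] unfolding state_section_def by auto
  ultimately have "state_section S \<sigma>" unfolding state_section_def by (blast intro: continuous_at_imp_continuous_on)
  then show ?thesis by blast
qed

lemma disjoint_leaves_cylinder:
  assumes dis: "\<And>s r. s \<in> S \<Longrightarrow> r \<in> S \<Longrightarrow> s \<noteq> r \<Longrightarrow> P s \<inter> P r \<inter> M = {}"
  shows "M homeomorphic (sphere (0::real^2) 1 \<times> (UNIV :: real set))"
proof -
  obtain \<sigma> where \<sigma>: "state_section S \<sigma>" using global_section by blast
  note L = leaf_parametrization[OF \<sigma>]
  let ?f = "\<lambda>q. fst (flow (snd q) (\<sigma> (snd q)) (fst q * period (snd q)))"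
  have leaf: "?f (t, s) \<in> M \<inter> P s" if "s \<in> S" for t s using L(2)[OF that] leaf_eq[OF that] by blast
  show ?thesis
  proof (rule cylinder_homeomorphic[OF M parameter_interval L(1)])
    show "?f ` (UNIV \<times> S) = M"
    proof (intro equalityI subsetI)
      fix x assume "x \<in> M"
      then obtain s where s: "s \<in> S" "x \<in> M \<inter> P s" using slices_cover by blast
      then obtain t where "x = ?f (t, s)" using L(2)[OF s(1)] leaf_eq[OF s(1)] by blast
      then show "x \<in> ?f ` (UNIV \<times> S)" using s(1) by blast
    qed (use leaf in auto)
    fix t s t' s' assume s: "s \<in> S" "s' \<in> S"
    have "s = s'" if "?f (t, s) = ?f (t', s')" using leaf[OF s(1), of t] leaf[OF s(2), of t'] dis[OF s] that by auto
    then show "?f (t, s) = ?f (t', s') \<longleftrightarrow> s = s' \<and> t - t' \<in> \<int>" using L(3)[OF s(1), of t t'] by blast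
  qed
qed

lemma periodic_leaves_torus:
  assumes S: "S = UNIV" and per: "\<And>s. P (s + p) = P s"
    and meet: "\<And>s r. P s \<inter> P r \<inter> M \<noteq> {} \<Longrightarrow> \<exists>k::int. r = s + of_int k * p"
  shows "M homeomorphic (sphere (0::real^2) 1 \<times> sphere (0::real^2) 1)"
proof -
  let ?I = "{0..p}"
  have perk: "P (s + of_int k * p) = P s" for s and k :: int
  proof (induction k arbitrary: s rule: int_induct[of _ 0])
    case (step1 i)
    have "P (s + of_int (i + 1) * p) = P ((s + of_int i * p) + p)" by (simp add: algebra_simps)
    then show ?case using per step1 by simp
  next
    case (step2 i)
    have "P (s + of_int (i - 1) * p) = P (s + of_int (i - 1) * p + p)" using per by simp
    also have "\<dots> = P (s + of_int i * p)" by (simp add: algebra_simps)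
    finally show ?case using step2 by simp
  qed simp
  have inS: "s \<in> S" for s using S by simp
  have leaf_per: "leaf (s + p) = leaf s" for s using per by (simp add: leaf_eq[OF inS])
  have flow_per: "flow p z t = flow 0 z t" "(p, z) \<in> states \<longleftrightarrow> (0, z) \<in> states" for z t
    unfolding flow_def states_def using leaf_per[of 0] by simp_all
  have period_per: "period p = period 0" unfolding period_def using flow_per by simp
  have cover: "\<exists>s\<in>?I. x \<in> leaf s" if "x \<in> M" for x
  proof -
    obtain s where s: "x \<in> P s" using slices_cover \<open>x \<in> M\<close> by blast
    define s' where "s' = s + of_int (- \<lfloor>s / p\<rfloor>) * p"
    have "s' = frac (s / p) * p" using p by (simp add: s'_def frac_def algebra_simps)
    then have "s' \<in> ?I" using p frac_ge_0[of "s / p"] frac_lt_1[of "s / p"] by (auto simp: mult_le_cancel_right2)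
    moreover have "x \<in> leaf s'" using s that perk[of s "- \<lfloor>s / p\<rfloor>"] by (simp add: leaf_eq[OF inS] s'_def)
    ultimately show ?thesis by blast
  qed
  have param: "(\<lambda>q. fst (flow (snd q) (\<sigma> (snd q)) (fst q * period (snd q)))) ` ({0..1} \<times> ?I) = M"
    "continuous_on ({0..1} \<times> ?I) (\<lambda>q. fst (flow (snd q) (\<sigma> (snd q)) (fst q * period (snd q))))"
    if \<sigma>: "state_section ?I \<sigma>" for \<sigma>
  proof -
    note L = leaf_parametrization[OF \<sigma>]
    let ?f = "\<lambda>q. fst (flow (snd q) (\<sigma> (snd q)) (fst q * period (snd q)))"
    show "continuous_on ({0..1} \<times> ?I) ?f" by (rule continuous_on_subset[OF L(1)]) auto
    show "?f ` ({0..1} \<times> ?I) = M"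
    proof (intro equalityI subsetI)
      fix x assume "x \<in> ?f ` ({0..1} \<times> ?I)"
      then obtain t s where "s \<in> ?I" "x = ?f (t, s)" by blast
      then show "x \<in> M" using L(2)[of s] leaf_eq[OF inS] by blast
    next
      fix x assume "x \<in> M"
      then obtain s where s: "s \<in> ?I" "x \<in> leaf s" using cover by blast
      then obtain t where "x = ?f (t, s)" using L(2)[OF s(1)] by blast
      then have "x = ?f (frac t, s)" using L(3)[OF s(1), of t "frac t"] by (simp add: frac_def)
      moreover have "(frac t, s) \<in> {0..1} \<times> ?I" using s(1) frac_ge_0[of t] frac_lt_1[of t] by auto
      ultimately show "x \<in> ?f ` ({0..1} \<times> ?I)" by (rule image_eqI)
    qed
  qed
  have ex: "\<exists>\<sigma>. state_section ?I \<sigma> \<and> \<sigma> 0 = z" if "(0, z) \<in> states" for z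
    by (rule section_exists) (use that p leaf_nonempty[OF inS] in auto)
  \<comment> \<open>A preliminary section, with no condition at its ends, exhibits \<open>M\<close>
    as the image of a compact rectangle. Compactness provides the side function from which the
    leaves are oriented.\<close>
  obtain z where "(0, z) \<in> states" using leaf_state_exists[OF inS] by blast
  then obtain \<sigma>0 where "state_section ?I \<sigma>0" using ex by blast
  note P0 = param[OF this]
  have "compact ({0..1 :: real} \<times> ?I)" by (intro compact_Times) auto
  then have "compact M" by (rule compact_continuous_image[OF P0(2), unfolded P0(1)])
  then obtain G where G: "\<And>x. x \<in> M \<Longrightarrow> side_function M G x" using compact_surface_sided[OF M] by blast
  obtain x0 where x0: "x0 \<in> leaf 0" using leaf_nonempty[OF inS] by blast
  have z0: "(0, x0, orientation G 0 x0) \<in> states" using G x0 by (rule orientation_state)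
  obtain \<sigma> where \<sigma>: "state_section ?I \<sigma>" "\<sigma> 0 = (x0, orientation G 0 x0)"
    using ex[OF z0] by (elim exE conjE) (rule that)
  have st: "(s, \<sigma> s) \<in> states" if "s \<in> ?I" for s using \<sigma>(1) that unfolding state_section_def by blast
  have in0: "0 \<in> ?I" "p \<in> ?I" using p by auto
  define y where "y = fst (\<sigma> p)"
  have y: "y \<in> leaf p" "y \<in> leaf 0" using state_space[of p y "snd (\<sigma> p)"] st[OF in0(2)] leaf_per[of 0] by (auto simp: y_def)
  have yM: "y \<in> M" "y \<in> P 0" using y(2) leaf_eq[OF inS] by auto
  have "snd (\<sigma> p) = orientation G p y" unfolding y_def
    by (rule orientation_preserved[where q = "\<lambda>s. s", OF G _ in0])
       (use \<sigma> st in \<open>auto simp: state_section_def\<close>)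
  \<comment> \<open>The parameters 0 and \<open>p\<close> give the same slice, and later leaves are
    the same leaves for both.\<close>
  also have "orientation G p y = orientation G 0 y"
    using leaf_orientation_unique[OF G yM per, of "orientation G 0 y" "orientation G p y"]
      leaf_orientation_orientation[OF G y(1)] leaf_orientation_orientation[OF G y(2)] by simp
  finally have \<sigma>p: "\<sigma> p = (y, orientation G 0 y)" by (simp add: y_def prod_eq_iff)
  \<comment> \<open>The time from the initial point to the end point along their common leaf. Both
    states carry the orientation of that leaf, so the flow reaches the end state itself and not its
    reversal.\<close>
  obtain b where b: "fst (flow 0 (\<sigma> 0) b) = y" using flow_transitive[OF st[OF in0(1)] y(2)] by blast
  have "snd (flow 0 (\<sigma> 0) b) = orientation G 0 (fst (flow 0 (\<sigma> 0) b))"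
  proof (rule orientation_preserved[OF G, of UNIV 0 b "\<lambda>_. 0" "\<lambda>t. flow 0 (\<sigma> 0) t"])
    show "continuous_on UNIV (\<lambda>t. flow 0 (\<sigma> 0) t)"
      using continuous_on_flow[of UNIV "\<lambda>_. \<sigma> 0" "\<lambda>t. t" "\<lambda>_. 0"] st[OF in0(1)] by simp
  qed (use flow_state[OF st[OF in0(1)]] flow_0[OF st[OF in0(1)]] \<sigma>(2) in auto)
  then have closing: "flow 0 (\<sigma> 0) b = \<sigma> p" unfolding \<sigma>p using b by (simp add: prod_eq_iff)
  \<comment> \<open>The time shift is 0 at the start and \<open>- b\<close> at the end of the
    period, where it cancels the gap between the two states.\<close>
  define \<rho> where "\<rho> = (\<lambda>s. flow s (\<sigma> s) (- (b * s / p)))"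
  have \<rho>: "state_section ?I \<rho>"
    using \<sigma>(1) p st flow_state unfolding state_section_def \<rho>_def
    by (auto intro!: continuous_on_flow continuous_intros)
  have "\<rho> p = flow 0 (flow 0 (\<sigma> 0) b) (- b)" unfolding \<rho>_def closing using p flow_per(1) by simp
  then have \<rho>p: "\<rho> p = \<rho> 0" unfolding flow_add[OF st[OF in0(1)]] by (simp add: \<rho>_def)
  let ?f = "\<lambda>q. fst (flow (snd q) (\<rho> (snd q)) (fst q * period (snd q)))"
  note L = leaf_parametrization[OF \<rho>] and Pa = param[OF \<rho>]
  have fp: "?f (t, p) = ?f (t, 0)" for t using \<rho>p flow_per(1) period_per by simp
  show ?thesis
  proof (rule torus_homeomorphic[OF p Pa(2,1)])
    fix t s t' s' :: real assume s: "s \<in> ?I" "s' \<in> ?I"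
    show "?f (t, s) = ?f (t', s') \<longleftrightarrow> t - t' \<in> \<int> \<and> (s - s') / p \<in> \<int>"
    proof (cases "(s - s') / p \<in> \<int>")
      case True
      then obtain n where n: "s - s' = of_int n * p" using p by (auto simp: field_simps elim!: Ints_cases)
      have "\<bar>of_int n * p\<bar> \<le> p" using s unfolding n[symmetric] by auto
      then have "\<bar>of_int n :: real\<bar> \<le> 1" using p by (simp add: abs_mult)
      then have "n = 0 \<or> n = 1 \<or> n = -1" by linarith
      then have "s = s' \<or> s = p \<and> s' = 0 \<or> s = 0 \<and> s' = p" using n s by auto
      then have "?f (t, s) = ?f (t, s') " using fp[of t] by auto
      then show ?thesis using L(3)[OF s(2), of t t'] True by simp
    next
      case False
      have "?f (t, s) \<noteq> ?f (t', s')"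
      proof
        assume *: "?f (t, s) = ?f (t', s')"
        have "?f (t, s) \<in> M \<inter> P s" "?f (t', s') \<in> M \<inter> P s'"
          using L(2)[OF s(1)] L(2)[OF s(2)] leaf_eq[OF inS] by blast+
        then have "P s' \<inter> P s \<inter> M \<noteq> {}" using * by auto
        then obtain k :: int where "s = s' + of_int k * p" using meet by blast
        then show False using False p by simp
      qed
      then show ?thesis using False by simp
    qed
  qed
qed

end

section \<open>From closed orbits to the elliptic barrier\<close>

lemma closed_orbit_range:
  assumes "closed_orbit X n \<gamma>"
  shows "compact (range \<gamma>)" "connected (range \<gamma>)"
proof -
  obtain p where p: "p > 0" "\<And>s. \<gamma> (s + p) = \<gamma> s" using assms unfolding closed_orbit_def by blast
  obtain N where "\<And>s. (\<gamma> has_vector_derivative cross3 (n (\<gamma> s)) (N s)) (at s)"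
    using assms unfolding closed_orbit_def oriented_trajectory_def by blast
  then have c: "continuous_on UNIV \<gamma>"
    by (intro continuous_at_imp_continuous_on ballI) (rule has_vector_derivative_continuous)
  interpret \<gamma>: periodic_fun_simple \<gamma> p by unfold_locales (rule p(2))
  have "range \<gamma> = \<gamma> ` {0..p}"
  proof (intro equalityI subsetI)
    fix x assume "x \<in> range \<gamma>"
    then obtain s where s: "x = \<gamma> s" by blast
    have "\<gamma> (frac (s / p) * p) = \<gamma> (s - of_int \<lfloor>s / p\<rfloor> * p)" using p(1) by (simp add: frac_def algebra_simps)
    also have "\<dots> = x" unfolding s by (rule \<gamma>.minus_of_int)
    finally have "x = \<gamma> (frac (s / p) * p)" ..
    moreover have "frac (s / p) * p \<in> {0..p}"
      using p(1) frac_ge_0[of "s / p"] frac_lt_1[of "s / p"] by (auto simp: mult_le_cancel_right2)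
    ultimately show "x \<in> \<gamma> ` {0..p}" by (rule image_eqI)
  qed auto
  then show "compact (range \<gamma>)" using c by (metis compact_Icc compact_continuous_image continuous_on_subset top_greatest)
  show "connected (range \<gamma>)" using c connected_continuous_image connected_UNIV by blast
qed

text \<open>Each slice is the image of a closed orbit, hence compact, connected and nonempty. The
  two forms of \<open>slices\<close> lead to the cylinder and to the torus.\<close>

lemma closed_orbit_slices_topology:
  assumes M: "smooth_surface M" and F: "smooth_surface_family S P"
    and tr: "\<And>s. s \<in> S \<Longrightarrow> transversal (P s) M" and sl: "slices S P M"
    and cl: "\<And>s. s \<in> S \<Longrightarrow> \<exists>\<gamma>. closed_orbit X (n s) \<gamma> \<and> range \<gamma> = P s \<inter> M"
  shows "M homeomorphic (sphere (0::real^2) 1 \<times> (UNIV :: real set)) \<or>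
      M homeomorphic (sphere (0::real^2) 1 \<times> sphere (0::real^2) 1)"
proof -
  have slice: "compact (M \<inter> P s)" "connected (M \<inter> P s)" "M \<inter> P s \<noteq> {}" if s: "s \<in> S" for s
  proof -
    obtain \<gamma> where "closed_orbit X (n s) \<gamma>" "range \<gamma> = P s \<inter> M" using cl[OF s] by blast
    then show "compact (M \<inter> P s)" "connected (M \<inter> P s)" "M \<inter> P s \<noteq> {}"
      using closed_orbit_range by (metis Int_commute, metis Int_commute, metis Int_commute UNIV_not_empty image_is_empty)
  qed
  have cov: "M \<subseteq> (\<Union>s\<in>S. P s)" using sl unfolding slices_def by blast
  have cases: "(\<forall>s\<in>S. \<forall>r\<in>S. s \<noteq> r \<longrightarrow> P s \<inter> P r \<inter> M = {}) \<or>
      (S = UNIV \<and> (\<exists>p>0. (\<forall>s. P (s + p) = P s) \<and>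
         (\<forall>s r. P s \<inter> P r \<inter> M \<noteq> {} \<longrightarrow> (\<exists>k::int. r = s + of_int k * p))))"
    using sl unfolding slices_def by blast
  then show ?thesis
  proof (elim disjE conjE exE)
    assume dis: "\<forall>s\<in>S. \<forall>r\<in>S. s \<noteq> r \<longrightarrow> P s \<inter> P r \<inter> M = {}"
    \<comment> \<open>Any positive number can stand for the distance \<open>p\<close>, since all
      slices are disjoint on \<open>M\<close>.\<close>
    interpret closed_slices M S P 1
      using M F tr slice cov dis by unfold_locales auto
    show ?thesis using disjoint_leaves_cylinder dis by blast
  next
    fix p :: real assume S: "S = UNIV" and p: "0 < p" and per: "\<forall>s. P (s + p) = P s"
      and meet: "\<forall>s r. P s \<inter> P r \<inter> M \<noteq> {} \<longrightarrow> (\<exists>k::int. r = s + of_int k * p)"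
    \<comment> \<open>Slices that meet on \<open>M\<close> have parameters differing by an integer
      multiple of \<open>p\<close>, and no integer lies strictly between 0 and 1.\<close>
    have dis: "P s \<inter> P r \<inter> M = {}" if "s < r" "r < s + p" for s r
    proof (rule ccontr)
      assume "P s \<inter> P r \<inter> M \<noteq> {}"
      then obtain k :: int where k: "r = s + of_int k * p" using meet by blast
      have "0 < of_int k * p" "of_int k * p < 1 * p" using that k by auto
      then have "0 < (of_int k :: real)" "(of_int k :: real) < 1" using p by (auto simp: zero_less_mult_iff mult_less_cancel_right_pos)
      then show False by simp
    qed
    interpret closed_slices M S P p
      using M F tr slice cov dis p by unfold_locales auto
    show ?thesis using periodic_leaves_torus[OF S] per meet by blast
  qed
qed

theorem theorem3:
  fixes v :: "real^3 \<Rightarrow> real \<Rightarrow> real^3"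
    and D :: "(real^3) set"
    and t0 T :: real
    and M :: "real \<Rightarrow> (real^3) set"
    and S :: "real set"
    and P :: "real \<Rightarrow> (real^3) set"
    and n :: "real \<Rightarrow> real^3 \<Rightarrow> real^3"
  assumes "compact D" and "T > 0" and "smooth_velocity v D t0 T"
    and "material_surface v D t0 T M"
    and "M t0 \<subseteq> simple_spectrum_set v D t0 T"
    and "smooth_surface_family S P"
    and "\<And>s. s \<in> S \<Longrightarrow> smooth_normal_field (P s) (n s)"
  shows
    "(repelling_LCS v D t0 T M \<longrightarrow>
       (\<forall>s1\<in>S. transversal (P s1) (M t0) \<longrightarrow>
         (\<forall>\<Gamma>\<in>components (P s1 \<inter> M t0). \<exists>J \<gamma> N.
            \<gamma> ` J = \<Gamma> \<and> oriented_trajectory (is_xi3 v D t0 T) (n s1) J \<gamma> N \<and>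
            (\<forall>s2\<in>J. \<forall>V w. \<gamma> s2 \<in> V \<longrightarrow> V \<subseteq> simple_spectrum_set v D t0 T \<longrightarrow>
               smooth_selection (is_xi3 v D t0 T) V w \<longrightarrow> helicity w (\<gamma> s2) = 0)))) \<and>
    (attracting_LCS v D t0 T M \<longrightarrow>
       (\<forall>s1\<in>S. transversal (P s1) (M t0) \<longrightarrow>
         (\<forall>\<Gamma>\<in>components (P s1 \<inter> M t0). \<exists>J \<gamma> N.
            \<gamma> ` J = \<Gamma> \<and> oriented_trajectory (is_xi1 v D t0 T) (n s1) J \<gamma> N \<and>
            (\<forall>s2\<in>J. \<forall>V w. \<gamma> s2 \<in> V \<longrightarrow> V \<subseteq> simple_spectrum_set v D t0 T \<longrightarrow>
               smooth_selection (is_xi1 v D t0 T) V w \<longrightarrow> helicity w (\<gamma> s2) = 0)))) \<and>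
    (shear_LCS v D t0 T M \<longrightarrow>
      ((\<forall>s1\<in>S. transversal (P s1) (M t0) \<longrightarrow>
         (\<forall>\<Gamma>\<in>components (P s1 \<inter> M t0). \<exists>J \<gamma> N.
            \<gamma> ` J = \<Gamma> \<and> oriented_trajectory (is_n_pm v D t0 T) (n s1) J \<gamma> N \<and>
            (\<forall>e1 e3. continuous_on J e1 \<longrightarrow> continuous_on J e3 \<longrightarrow>
               (\<forall>s2\<in>J. is_xi1 v D t0 T (\<gamma> s2) (e1 s2) \<and> is_xi3 v D t0 T (\<gamma> s2) (e3 s2)) \<longrightarrow>
               (\<exists>\<epsilon>\<in>{1, -1}. \<exists>\<delta>\<in>{1, -1}. \<forall>s2\<in>J.
                  N s2 = \<delta> *\<^sub>R n_pm v D t0 T \<epsilon> (\<gamma> s2) (e1 s2) (e3 s2) \<and>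
                  (\<forall>V w1 w3. \<gamma> s2 \<in> V \<longrightarrow> V \<subseteq> simple_spectrum_set v D t0 T \<longrightarrow>
                     smooth_selection (is_xi1 v D t0 T) V w1 \<longrightarrow>
                     smooth_selection (is_xi3 v D t0 T) V w3 \<longrightarrow>
                     smooth_on V (\<lambda>x. n_pm v D t0 T \<epsilon> x (w1 x) (w3 x)) \<longrightarrow>
                     w1 (\<gamma> s2) = e1 s2 \<longrightarrow> w3 (\<gamma> s2) = e3 s2 \<longrightarrow>
                     helicity (\<lambda>x. n_pm v D t0 T \<epsilon> x (w1 x) (w3 x)) (\<gamma> s2) = 0))))) \<and>
       ((\<forall>s1\<in>S. transversal (P s1) (M t0)) \<longrightarrow> slices S P (M t0) \<longrightarrow>
         (\<forall>s1\<in>S. \<exists>\<gamma>. closed_orbit (is_n_pm v D t0 T) (n s1) \<gamma> \<and> range \<gamma> = P s1 \<inter> M t0) \<longrightarrow>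
         elliptic_barrier v D t0 T M)))"
proof (intro conjI impI, goal_cases)
  have sm: "smooth_surface (M t0)" using assms(4) by (simp add: material_surface_def)
  note sub = assms(5) and F = assms(6) and n = assms(7)
  {
    case 1
    have R: "is_xi3 v D t0 T x m" if "x \<in> M t0" "unit_normal (M t0) x m" for x m
      using repelling_normal[OF 1 that] sub that(1) by blast
    show ?case by (rule hyperbolic_trajectories[OF sm sub F n R xi_parallel(2)])
  next
    case 2
    have R: "is_xi1 v D t0 T x m" if "x \<in> M t0" "unit_normal (M t0) x m" for x m
      using attracting_normal[OF 2 that] sub that(1) by blast
    show ?case by (rule hyperbolic_trajectories[OF sm sub F n R xi_parallel(1)])
  next
    case 3
    have R: "is_n_pm v D t0 T x m" if "x \<in> M t0" "unit_normal (M t0) x m" for x m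
      using shear_normal[OF 3 that] sub that(1) by blast
    show ?case by (rule shear_trajectories[OF sm sub F n R])
  next
    case 4
    have "M t0 homeomorphic (sphere (0::real^2) 1 \<times> (UNIV :: real set)) \<or>
        M t0 homeomorphic (sphere (0::real^2) 1 \<times> sphere (0::real^2) 1)"
      by (rule closed_orbit_slices_topology[OF sm F]) (use 4(2-4) in blast)+
    then show ?case using 4(1) by (simp add: elliptic_barrier_def)
  }
qed

end
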